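(* Let $\mathcal G=\{G(x)\}_{x\in I}$ be a Gaussian process on an interval $I\subset\mathbb R$ with mean $m(x)=\mathbb E[G(x)]$ and covariance kernel $r(x,y)=\operatorname{Cov}[G(x),G(y)]$, such that $r(x,x)=1$ for every $x\in I$, and assume: (G1) $\mathcal G$ has $C^1$-paths, $m\in C^1(I)$ and $r\in C^2(I^2)$; (G2) for all distinct $x,y\in I$, the random vector $(G(x),G(y),G'(x),G'(y))$ is nondegenerate; (G3) for every $x\in I$, $(G(x),G'(x))$ is a nondegenerate Gaussian vector. For $x\ne y$ in $I$ define $$\mu_1=m'(x)+\frac{r(x,y)r_{10}(x,y)}{1-r^2(x,y)}m(x)-\frac{r_{10}(x,y)}{1-r^2(x,y)}m(y),\qquad \sigma_1=\sqrt{r_{11}(x,x)-\frac{r_{10}^2(x,y)}{1-r^2(x,y)}},$$ $$\mu_2=m'(y)+\frac{r(x,y)r_{01}(x,y)}{1-r^2(x,y)}m(y)-\frac{r_{01}(x,y)}{1-r^2(x,y)}m(x),\qquad \sigma_2=\sqrt{r_{11}(y,y)-\frac{r_{01}^2(x,y)}{1-r^2(x,y)}},$$ $$\delta=\frac1{\sigma_1\sigma_2}\left(r_{11}(x,y)+\frac{r(x,y)r_{10}(x,y)r_{01}(x,y)}{1-r^2(x,y)}\right),\qquad \nu_1=\frac{\mu_1}{\sigma_1},\quad \nu_2=\frac{\mu_2}{\sigma_2}.$$ Then the two-point correlation function $\rho_2(x,y)$ of the real roots of $G$ is given, for $x\neq y$, by $$\rho_2(x,y)=\frac{E(x,y)}{\pi^2\sqrt{1-r^2(x,y)}}\left(\sum_{i=1}^5\rho_{2,i}(x,y)\right),$$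 where $$E(x,y)=\exp\left(-\frac{m^2(x)-2r(x,y)m(x)m(y)+m^2(y)}{2(1-r^2(x,y))}\right),$$ $$\rho_{2,1}=\sigma_1\sigma_2\left(\sqrt{1-\delta^2}+\delta\arcsin\delta\right),\qquad \rho_{2,2}=\mu_1\mu_2\arcsin\delta,$$ $$\rho_{2,3}=\sigma_1\sigma_2\sqrt{1-\delta^2}\sum_{j=1}^2\int_0^1\frac{(1-t)\nu_j^2}{\exp(\nu_j^2t^2/(2-2\delta^2))}\,dt+\sqrt{\frac\pi2}\,\sigma_1\sigma_2|\delta|\sum_{j=1}^2\nu_j^2\int_0^1\frac{(1-t)|\nu_jt|}{\exp(\nu_j^2t^2/2)}\operatorname{erf}\left(\frac{|\delta\nu_jt|}{\sqrt{2(1-\delta^2)}}\right)dt,$$ $$\rho_{2,4}=\sqrt{\frac\pi2}\,\mu_1\mu_2\sum_{j=1}^2\int_0^1\frac{(t-1)\nu_j}{\exp(\nu_j^2t^2/2)}\operatorname{erf}\left(\frac{\delta\nu_jt}{\sqrt{2(1-\delta^2)}}\right)dt,$$ $$\rho_{2,5}=\frac{|\mu_1\mu_2\nu_1\nu_2|}{\sqrt{1-\delta^2}}\int_0^1\int_0^1(1-t)(1-s)\exp\left(-\frac{\nu_1^2t^2-2\delta\nu_1\nu_2ts+\nu_2^2s^2}{2(1-\delta^2)}\right)dt\,ds .$$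
   Context: Subscripts on $r$ denote partial derivatives: $r_{j\ell}=\frac{\partial^{j+\ell}r}{\partial x^j\partial y^\ell}$. The error function is $\operatorname{erf}(x)=\frac2{\sqrt\pi}\int_0^xe^{-t^2}dt$. The two-point correlation function $\rho_2$ of the real roots of $G$ is the density (with respect to Lebesgue measure on $I^2$) of the two-point correlation measure: for every compactly supported continuous $f$ on $I^2$, $$\mathbb E\Big[\sum f(\alpha_1,\alpha_2)\Big]=\iint_{I^2}f(x,y)\rho_2(x,y)\,dx\,dy,$$ the sum running over ordered pairs $(\alpha_1,\alpha_2)$ of different zeros of $G$ in $I$. It is given by the Rice formula $\rho_2(x,y)=\mathbb E\big[|G'(x)G'(y)|\,\big|\,G(x)=0,G(y)=0\big]\,p_{(G(x),G(y))}(0,0)$ for $x\neq y$, where $p_{(G(x),G(y))}$ is the joint density of $(G(x),G(y))$. *)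

theory Defs
  imports "HOL-Probability.Probability"
begin

definition erf :: "real \<Rightarrow> real" where
  "erf x = 2 / sqrt pi * (LBINT t=0..ereal x. exp (- (t\<^sup>2)))"

text \<open>
  Derivatives on an interval I are taken within I, so they are one-sided at those endpoints
  that belong to I.
\<close>

definition deriv_on :: "real set \<Rightarrow> (real \<Rightarrow> real) \<Rightarrow> real \<Rightarrow> real" where
  "deriv_on I g x = vector_derivative g (at x within I)"

definition C1_on :: "real set \<Rightarrow> (real \<Rightarrow> real) \<Rightarrow> bool" where
  "C1_on I g \<longleftrightarrow> (\<forall>x\<in>I. g differentiable (at x within I)) \<and> continuous_on I (deriv_on I g)"

definition dx :: "real set \<Rightarrow> (real \<Rightarrow> real \<Rightarrow> real) \<Rightarrow> real \<Rightarrow> real \<Rightarrow> real" where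
  "dx I F = (\<lambda>x y. deriv_on I (\<lambda>s. F s y) x)"

definition dy :: "real set \<Rightarrow> (real \<Rightarrow> real \<Rightarrow> real) \<Rightarrow> real \<Rightarrow> real \<Rightarrow> real" where
  "dy I F = (\<lambda>x y. deriv_on I (\<lambda>t. F x t) y)"

definition partial :: "real set \<Rightarrow> nat \<Rightarrow> nat \<Rightarrow> (real \<Rightarrow> real \<Rightarrow> real) \<Rightarrow> real \<Rightarrow> real \<Rightarrow> real" where
  "partial I j l F = (dx I ^^ j) ((dy I ^^ l) F)"

definition C1_on_square :: "real set \<Rightarrow> (real \<Rightarrow> real \<Rightarrow> real) \<Rightarrow> bool" where
  "C1_on_square I F \<longleftrightarrow>
     (\<forall>x\<in>I. \<forall>y\<in>I. (\<lambda>s. F s y) differentiable (at x within I)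
                 \<and> (\<lambda>t. F x t) differentiable (at y within I)) \<and>
     continuous_on (I \<times> I) (\<lambda>(x, y). dx I F x y) \<and>
     continuous_on (I \<times> I) (\<lambda>(x, y). dy I F x y)"

definition C2_on_square :: "real set \<Rightarrow> (real \<Rightarrow> real \<Rightarrow> real) \<Rightarrow> bool" where
  "C2_on_square I F \<longleftrightarrow>
     C1_on_square I F \<and> C1_on_square I (dx I F) \<and> C1_on_square I (dy I F)"

text \<open>Almost surely constant variables count as Gaussian, with variance zero.\<close>

definition gaussian_variable :: "'w measure \<Rightarrow> ('w \<Rightarrow> real) \<Rightarrow> bool" where
  "gaussian_variable M X \<longleftrightarrow> X \<in> borel_measurable M \<and>
     (\<exists>\<mu> \<sigma>. (0 < \<sigma> \<and> distributed M lborel X (normal_density \<mu> \<sigma>)) \<or> (AE \<omega> in M. X \<omega> = \<mu>))"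

definition gaussian_process :: "'w measure \<Rightarrow> real set \<Rightarrow> (real \<Rightarrow> 'w \<Rightarrow> real) \<Rightarrow> bool" where
  "gaussian_process M I G \<longleftrightarrow>
     (\<forall>S c. finite S \<and> S \<subseteq> I \<longrightarrow> gaussian_variable M (\<lambda>\<omega>. \<Sum>s\<in>S. c s * G s \<omega>))"

definition gaussian_vector :: "'w measure \<Rightarrow> ('w \<Rightarrow> 'v::euclidean_space) \<Rightarrow> bool" where
  "gaussian_vector M X \<longleftrightarrow> (\<forall>c. gaussian_variable M (\<lambda>\<omega>. c \<bullet> X \<omega>))"

text \<open>
  The variance of \<open>c \<bullet> X\<close> is the value at \<open>c\<close> of the quadratic form of the covariance matrix
  of \<open>X\<close>, so this says that the covariance matrix is positive definite.
\<close>

definition nondegenerate :: "'w measure \<Rightarrow> ('w \<Rightarrow> 'v::euclidean_space) \<Rightarrow> bool" where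
  "nondegenerate M X \<longleftrightarrow> (\<forall>c. c \<noteq> 0 \<longrightarrow> 0 < prob_space.variance M (\<lambda>\<omega>. c \<bullet> X \<omega>))"

definition path_deriv :: "real set \<Rightarrow> (real \<Rightarrow> 'w \<Rightarrow> real) \<Rightarrow> real \<Rightarrow> 'w \<Rightarrow> real" where
  "path_deriv I G x \<omega> = deriv_on I (\<lambda>t. G t \<omega>) x"

text \<open>
  Point values of densities, and conditioning on events of probability zero, always refer to
  the continuous versions of the densities, which are unique if they exist.
\<close>

definition cont_density :: "'w measure \<Rightarrow> ('w \<Rightarrow> 'v::euclidean_space) \<Rightarrow> 'v \<Rightarrow> real" where
  "cont_density M X = (THE p. continuous_on UNIV p \<and> (\<forall>z. 0 \<le> p z) \<and>
                              distributed M lborel X (\<lambda>z. ennreal (p z)))"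

definition cond_expectation_at ::
  "'w measure \<Rightarrow> ('u::euclidean_space \<Rightarrow> real) \<Rightarrow> ('w \<Rightarrow> 'u) \<Rightarrow> ('w \<Rightarrow> 'v::euclidean_space) \<Rightarrow> 'v \<Rightarrow> real"
where
  "cond_expectation_at M h Y X z =
     (\<integral>y. h y * (cont_density M (\<lambda>\<omega>. (X \<omega>, Y \<omega>)) (z, y) / cont_density M X z) \<partial>lborel)"

definition zero_pairs :: "real set \<Rightarrow> (real \<Rightarrow> 'w \<Rightarrow> real) \<Rightarrow> 'w \<Rightarrow> (real \<times> real) set" where
  "zero_pairs I G \<omega> = {(a, b). a \<in> I \<and> b \<in> I \<and> a \<noteq> b \<and> G a \<omega> = 0 \<and> G b \<omega> = 0}"

definition test_function :: "real set \<Rightarrow> (real \<times> real \<Rightarrow> real) \<Rightarrow> bool" where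
  "test_function I f \<longleftrightarrow> continuous_on (I \<times> I) f \<and>
     (\<exists>K. compact K \<and> K \<subseteq> I \<times> I \<and> (\<forall>z \<in> I \<times> I - K. f z = 0))"

text \<open>
  A correlation measure of a process with C1 paths and C2 covariance can have infinite mass near
  the diagonal. The defining identity is therefore required in [0,\<open>\<infinity>\<close>] for all nonnegative test
  functions, and between real numbers for all test functions whose integral against the density
  converges absolutely.
\<close>

definition two_point_density ::
  "'w measure \<Rightarrow> real set \<Rightarrow> (real \<Rightarrow> 'w \<Rightarrow> real) \<Rightarrow> (real \<Rightarrow> real \<Rightarrow> real) \<Rightarrow> bool" where
  "two_point_density M I G \<rho> \<longleftrightarrow>
     (\<lambda>(x, y). \<rho> x y) \<in> borel_measurable (lebesgue_on (I \<times> I)) \<and>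
     (AE (x, y) in lebesgue_on (I \<times> I). 0 \<le> \<rho> x y) \<and>
     (\<forall>f. test_function I f \<and> (\<forall>z \<in> I \<times> I. 0 \<le> f z) \<longrightarrow>
        (\<integral>\<^sup>+\<omega>. (\<integral>\<^sup>+z. ennreal (f z) \<partial>count_space (zero_pairs I G \<omega>)) \<partial>M) =
        (\<integral>\<^sup>+(x, y). ennreal (f (x, y) * \<rho> x y) \<partial>lebesgue_on (I \<times> I))) \<and>
     (\<forall>f. test_function I f \<and> integrable (lebesgue_on (I \<times> I)) (\<lambda>(x, y). f (x, y) * \<rho> x y) \<longrightarrow>
        (AE \<omega> in M. f summable_on zero_pairs I G \<omega>) \<and>
        integrable M (\<lambda>\<omega>. \<Sum>\<^sub>\<infinity>z\<in>zero_pairs I G \<omega>. f z) \<and>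
        (\<integral>\<omega>. (\<Sum>\<^sub>\<infinity>z\<in>zero_pairs I G \<omega>. f z) \<partial>M) =
        (\<integral>(x, y). f (x, y) * \<rho> x y \<partial>lebesgue_on (I \<times> I)))"

definition rice_density ::
  "'w measure \<Rightarrow> real set \<Rightarrow> (real \<Rightarrow> 'w \<Rightarrow> real) \<Rightarrow> real \<Rightarrow> real \<Rightarrow> real" where
  "rice_density M I G x y =
     cond_expectation_at M (\<lambda>(u, v). \<bar>u * v\<bar>)
       (\<lambda>\<omega>. (path_deriv I G x \<omega>, path_deriv I G y \<omega>)) (\<lambda>\<omega>. (G x \<omega>, G y \<omega>)) (0, 0)
     * cont_density M (\<lambda>\<omega>. (G x \<omega>, G y \<omega>)) (0, 0)"

text \<open>
  The density of the correlation measure is determined only almost everywhere; the Rice formula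
  selects its values off the diagonal. The values on the diagonal remain arbitrary.
\<close>

definition two_point_correlation_function ::
  "'w measure \<Rightarrow> real set \<Rightarrow> (real \<Rightarrow> 'w \<Rightarrow> real) \<Rightarrow> (real \<Rightarrow> real \<Rightarrow> real) \<Rightarrow> bool" where
  "two_point_correlation_function M I G \<rho> \<longleftrightarrow>
     two_point_density M I G \<rho> \<and> (\<forall>x\<in>I. \<forall>y\<in>I. x \<noteq> y \<longrightarrow> \<rho> x y = rice_density M I G x y)"

end

theory Submission
  imports Defs
begin

text \<open>
  For distinct x and y the vector (G(x), G(y), G'(x), G'(y)) is Gaussian as a limit of difference
  quotients, and a Cholesky factorisation makes it a triangular image of independent standard
  normals. After rescaling the first two coordinates by h, the probability that the path changes
  sign on both [x, x + h] and [y, y + h] is h^2 times an integral that converges to the Rice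
  density, locally uniformly off the diagonal. For a test function vanishing near the diagonal,
  the sum of these probabilities over a dyadic grid is a Riemann sum for the integral against the
  Rice density. By Bulinskaya's argument almost every path has only simple zeros, so the
  corresponding sums of sign changes converge to the sum over pairs of zeros from below, and
  Fatou's lemma exchanges limit and expectation. Monotone convergence extends the identity to all
  nonnegative test functions.

  In the closed form, |a + x| is expanded as |x| + a sgn x plus a remainder whose second derivative
  is a measure on the segment between 0 and -a. The products of these three terms for the two
  coordinates give the five summands.
\<close>

section \<open>Laws determined by their characteristic functions\<close>

text \<open>The sum over pairs of zeros may have infinite expectation, and no integrable majorant
  for it is available in advance. So it is never dominated: an inequality that holds for every path
  and every grid bounds its expectation from below, Fatou's lemma from above, and dominated
  convergence is used only for explicit densities and bounded functions. Near the diagonal the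
  vector of values and derivatives degenerates and the bounds on its density break down, which
  forces the restriction to test functions that vanish there. Difference quotients are taken with
  the mesh as step, because a sign change on [s, s + h] is then exactly a condition on G(s) and the
  quotient. It forces G(s) to be of order h; after division by h, the admissible values for a given
  slope u form an interval of length |u|, and the product of two such lengths is the absolute value
  in the Rice formula. The factor pi / 2 in front of the expectations in the closed form is the
  normalisation 1 / (2 pi sqrt(1 - r^2)) of the bivariate normal density divided by the prefactor 1
  / (pi^2 sqrt(1 - r^2)) of the statement.\<close>

definition char_determines :: "('a::euclidean_space \<Rightarrow> real) \<Rightarrow> 'a measure \<Rightarrow> bool" where
  "char_determines \<psi> \<nu> \<longleftrightarrow> (\<forall>N. prob_space N \<and> sets N = sets borel \<and>
     (\<forall>b. (\<integral>x. cis (b \<bullet> x) \<partial>N) = of_real (\<psi> b)) \<longrightarrow> N = \<nu>)"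

lemma cis_inner_measurable [measurable]:
  "X \<in> borel_measurable M \<Longrightarrow> (\<lambda>z. cis (b \<bullet> X z)) \<in> borel_measurable M"
  for X :: "'w \<Rightarrow> 'a::euclidean_space"
  unfolding cis_conv_exp by measurable

text \<open>At \<open>a = 0\<close> the hypothesis shows that \<open>w\<close> has total mass
  \<open>K\<close>. Hence \<open>w / K\<close> is a probability density, and under it
  \<open>X\<close> has characteristic function \<open>\<psi>\<close> and therefore law
  \<open>\<nu>\<close>.\<close>

lemma char_determines_weighted:
  fixes X :: "'w \<Rightarrow> 'a::euclidean_space"
  assumes det: "char_determines \<psi> \<nu>" and psi0: "\<psi> 0 = 1"
    and X[measurable]: "X \<in> borel_measurable N"
    and w: "integrable N w" "\<And>z. z \<in> space N \<Longrightarrow> 0 \<le> w z"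
    and K: "0 < K"
    and char: "\<And>a. (\<integral>z. w z *\<^sub>R cis (a \<bullet> X z) \<partial>N) = of_real (K * \<psi> a)"
    and A[measurable]: "A \<in> sets borel"
  shows "(\<integral>z. w z * indicator A (X z) \<partial>N) = K * measure \<nu> A"
proof -
  have [measurable]: "w \<in> borel_measurable N" using w by auto
  have "of_real (\<integral>z. w z \<partial>N) = (of_real K :: complex)"
    using char[of 0] psi0 by (simp add: scaleR_conv_of_real)
  then have Ew: "(\<integral>z. w z \<partial>N) = K" using of_real_eq_iff by blast
  define D where "D = density N (\<lambda>z. ennreal (w z / K))"
  have nnw: "AE z in N. 0 \<le> w z / K" using w K by (auto intro!: AE_I2)
  have emD: "emeasure D (space D) = 1"
  proof -
    have "emeasure D (space D) = (\<integral>\<^sup>+z. ennreal (w z / K) \<partial>N)"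
      unfolding D_def by (subst emeasure_density) (auto intro!: nn_integral_cong)
    also have "\<dots> = ennreal (\<integral>z. w z / K \<partial>N)"
      using w nnw by (intro nn_integral_eq_integral) auto
    finally show ?thesis using Ew K by simp
  qed
  interpret D: prob_space D using emD by (intro prob_spaceI) auto
  have XD[measurable]: "X \<in> borel_measurable D" unfolding D_def by simp
  have "distr D borel X = \<nu>"
  proof -
    have "(\<integral>x. cis (b \<bullet> x) \<partial>distr D borel X) = of_real (\<psi> b)" for b
    proof -
      have "(\<integral>x. cis (b \<bullet> x) \<partial>distr D borel X) = (\<integral>z. cis (b \<bullet> X z) \<partial>D)"
        by (subst integral_distr) auto
      also have "\<dots> = (\<integral>z. (w z / K) *\<^sub>R cis (b \<bullet> X z) \<partial>N)"
        unfolding D_def using nnw by (subst integral_density) auto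
      also have "\<dots> = (\<integral>z. (1 / K) *\<^sub>R (w z *\<^sub>R cis (b \<bullet> X z)) \<partial>N)"
        by (intro Bochner_Integration.integral_cong) auto
      also have "\<dots> = (1/K) *\<^sub>R (\<integral>z. w z *\<^sub>R cis (b \<bullet> X z) \<partial>N)"
        by (rule integral_scaleR_right)
      also have "\<dots> = of_real (\<psi> b)" using K char[of b] by (simp add: scaleR_conv_of_real)
      finally show ?thesis .
    qed
    then show ?thesis using det D.prob_space_distr[OF XD] unfolding char_determines_def
      by (auto simp: D.prob_space_distr)
  qed
  then have "measure \<nu> A = measure D (X -` A \<inter> space D)"
    using measure_distr[OF XD A] by simp
  also have "\<dots> = (\<integral>z. indicator (X -` A \<inter> space D) z \<partial>D)"
    by simp
  also have "\<dots> = (\<integral>z. indicator A (X z) \<partial>D)"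
    by (intro Bochner_Integration.integral_cong) (auto simp: indicator_def)
  also have "\<dots> = (\<integral>z. (w z / K) *\<^sub>R indicator A (X z) \<partial>N)"
    unfolding D_def using nnw by (subst integral_density) auto
  also have "\<dots> = (\<integral>z. (w z * indicator A (X z)) / K \<partial>N)"
    by (intro Bochner_Integration.integral_cong) auto
  also have "\<dots> = (\<integral>z. w z * indicator A (X z) \<partial>N) / K" by simp
  finally show ?thesis using K by simp
qed

text \<open>
  Weighting the law by the functions 1 + cos and 1 + sin of the second coordinate
  leaves characteristic functions of the first coordinate only.
\<close>

lemma char_determines_pair:
  fixes \<psi>1 :: "'a::euclidean_space \<Rightarrow> real" and \<psi>2 :: "'b::euclidean_space \<Rightarrow> real"
  assumes det1: "char_determines \<psi>1 \<nu>1" and det2: "char_determines \<psi>2 \<nu>2"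
    and p1: "prob_space \<nu>1" "sets \<nu>1 = sets borel" and p2: "prob_space \<nu>2" "sets \<nu>2 = sets borel"
    and z1: "\<psi>1 0 = 1" and z2: "\<psi>2 0 = 1"
    and pos: "\<And>b. 0 < \<psi>2 b" and even: "\<And>b. \<psi>2 (- b) = \<psi>2 b"
  shows "char_determines (\<lambda>z. \<psi>1 (fst z) * \<psi>2 (snd z)) (\<nu>1 \<Otimes>\<^sub>M \<nu>2)"
  unfolding char_determines_def
proof (intro allI impI, elim conjE)
  fix N :: "('a \<times> 'b) measure"
  assume N: "prob_space N" and sN[simp, measurable_cong]: "sets N = sets borel"
    and char0: "\<forall>b. (\<integral>x. cis (b \<bullet> x) \<partial>N) = of_real (\<psi>1 (fst b) * \<psi>2 (snd b))"
  interpret prob_space N by fact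
  interpret v1: prob_space \<nu>1 by fact
  interpret v2: prob_space \<nu>2 by fact
  have sp: "space N = UNIV" using sets_eq_imp_space_eq[OF sN] by simp
  have [measurable]: "fst \<in> borel_measurable N" "snd \<in> borel_measurable N"
    by (simp_all add: measurable_cong_sets[OF sN refl] borel_prod[symmetric])
  have char: "(\<integral>z. cis (a \<bullet> fst z + b \<bullet> snd z) \<partial>N) = of_real (\<psi>1 a * \<psi>2 b)" for a b
    using char0[rule_format, of "(a,b)"] by (simp add: inner_prod_def)
  have cis_meas[measurable]: "(\<lambda>z. cis (a \<bullet> fst z + b \<bullet> snd z)) \<in> borel_measurable N" for a b
    unfolding cis_conv_exp by measurable
  have cis_int: "integrable N (\<lambda>z. cis (a \<bullet> fst z + b \<bullet> snd z))" for a b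
    by (rule integrable_const_bound[of _ 1]) auto
  have nn: "0 \<le> 1 + cos t" "0 \<le> 1 + sin t" for t :: real
    using cos_ge_minus_one[of t] sin_ge_minus_one[of t] by linarith+
  have cosA: "(\<integral>z. cos (b \<bullet> snd z) * indicator A (fst z) \<partial>N) = \<psi>2 b * measure \<nu>1 A"
   and sinA: "(\<integral>z. sin (b \<bullet> snd z) * indicator A (fst z) \<partial>N) = 0"
    if A[measurable]: "A \<in> sets borel" for A b
  proof -
    have i1: "integrable N (\<lambda>z. indicator A (fst z) :: real)"
      by (rule integrable_const_bound[of _ 1]) (auto simp: indicator_def)
    have i2: "integrable N (\<lambda>z. cos (b \<bullet> snd z) * indicator A (fst z))"
      by (rule integrable_const_bound[of _ 1]) (auto simp: indicator_def)
    have i3: "integrable N (\<lambda>z. sin (b \<bullet> snd z) * indicator A (fst z))"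
      by (rule integrable_const_bound[of _ 1]) (auto simp: indicator_def)
    have ic: "integrable N (\<lambda>z. cos (b \<bullet> snd z))" "integrable N (\<lambda>z. sin (b \<bullet> snd z))"
      by (rule integrable_const_bound[of _ 1]; auto)+
    have e1: "(\<integral>z. (1 + cos (b \<bullet> snd z)) *\<^sub>R cis (a \<bullet> fst z) \<partial>N) = of_real ((1 + \<psi>2 b) * \<psi>1 a)" for a
    proof -
      have "(1 + cos (b \<bullet> snd z)) *\<^sub>R cis (a \<bullet> fst z) = cis (a \<bullet> fst z + 0 \<bullet> snd z)
        + (1/2) *\<^sub>R (cis (a \<bullet> fst z + b \<bullet> snd z) + cis (a \<bullet> fst z + (-b) \<bullet> snd z))" for z
        by (simp add: complex_eq_iff cos_add sin_add cos_diff sin_diff field_simps)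
      then have "(\<integral>z. (1 + cos (b \<bullet> snd z)) *\<^sub>R cis (a \<bullet> fst z) \<partial>N) =
        (\<integral>z. cis (a \<bullet> fst z + 0 \<bullet> snd z) + (1/2) *\<^sub>R (cis (a \<bullet> fst z + b \<bullet> snd z) + cis (a \<bullet> fst z + (-b) \<bullet> snd z)) \<partial>N)"
        by simp
      also have "\<dots> = (\<integral>z. cis (a \<bullet> fst z + 0 \<bullet> snd z) \<partial>N) + (1/2) *\<^sub>R ((\<integral>z. cis (a \<bullet> fst z + b \<bullet> snd z) \<partial>N) + (\<integral>z. cis (a \<bullet> fst z + (-b) \<bullet> snd z) \<partial>N))"
        by (simp add: cis_int Bochner_Integration.integral_add Bochner_Integration.integrable_add
           del: inner_zero_left inner_minus_left)
      also have "\<dots> = of_real ((1 + \<psi>2 b) * \<psi>1 a)"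
        unfolding char by (simp add: z2 even scaleR_conv_of_real algebra_simps)
      finally show ?thesis .
    qed
    \<comment> \<open>The frequencies \<open>b\<close> and \<open>- b\<close> enter with opposite
      signs, so evenness of \<open>\<psi>2\<close> cancels them. This makes the sine integral over
      \<open>A\<close> vanish.\<close>
    have e2: "(\<integral>z. (1 + sin (b \<bullet> snd z)) *\<^sub>R cis (a \<bullet> fst z) \<partial>N) = of_real (1 * \<psi>1 a)" for a
    proof -
      have "(1 + sin (b \<bullet> snd z)) *\<^sub>R cis (a \<bullet> fst z) = cis (a \<bullet> fst z + 0 \<bullet> snd z)
        + (- \<i> / 2) * (cis (a \<bullet> fst z + b \<bullet> snd z) - cis (a \<bullet> fst z + (-b) \<bullet> snd z))" for z
        by (simp add: complex_eq_iff cos_add sin_add cos_diff sin_diff field_simps)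
      then have "(\<integral>z. (1 + sin (b \<bullet> snd z)) *\<^sub>R cis (a \<bullet> fst z) \<partial>N) =
        (\<integral>z. cis (a \<bullet> fst z + 0 \<bullet> snd z) + (- \<i> / 2) * (cis (a \<bullet> fst z + b \<bullet> snd z) - cis (a \<bullet> fst z + (-b) \<bullet> snd z)) \<partial>N)"
        by simp
      also have "\<dots> = (\<integral>z. cis (a \<bullet> fst z + 0 \<bullet> snd z) \<partial>N) + (- \<i> / 2) * ((\<integral>z. cis (a \<bullet> fst z + b \<bullet> snd z) \<partial>N) - (\<integral>z. cis (a \<bullet> fst z + (-b) \<bullet> snd z) \<partial>N))"
        by (simp add: cis_int Bochner_Integration.integral_add Bochner_Integration.integral_diff
           Bochner_Integration.integrable_diff del: inner_zero_left inner_minus_left)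
      also have "\<dots> = of_real (1 * \<psi>1 a)"
        unfolding char by (simp add: z2 even)
      finally show ?thesis .
    qed
    have e0: "(\<integral>z. 1 *\<^sub>R cis (a \<bullet> fst z) \<partial>N) = of_real (1 * \<psi>1 a)" for a
      using char[of a 0] z2 by simp
    have c0: "(\<integral>z. 1 * indicator A (fst z) \<partial>N) = 1 * measure \<nu>1 A"
      by (rule char_determines_weighted[OF det1 z1 _ _ _ _ e0 A]) auto
    have c1: "(\<integral>z. (1 + cos (b \<bullet> snd z)) * indicator A (fst z) \<partial>N) = (1 + \<psi>2 b) * measure \<nu>1 A"
      by (rule char_determines_weighted[OF det1 z1 _ _ _ _ e1 A])
         (use nn pos in \<open>auto intro!: Bochner_Integration.integrable_add ic add_pos_pos\<close>)
    have c2: "(\<integral>z. (1 + sin (b \<bullet> snd z)) * indicator A (fst z) \<partial>N) = 1 * measure \<nu>1 A"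
      by (rule char_determines_weighted[OF det1 z1 _ _ _ _ e2 A])
         (use nn pos in \<open>auto intro!: Bochner_Integration.integrable_add ic add_pos_pos\<close>)
    show "(\<integral>z. cos (b \<bullet> snd z) * indicator A (fst z) \<partial>N) = \<psi>2 b * measure \<nu>1 A"
      using c0 c1 i1 i2 by (simp add: distrib_right)
    show "(\<integral>z. sin (b \<bullet> snd z) * indicator A (fst z) \<partial>N) = 0"
      using c0 c2 i1 i3 by (simp add: distrib_right)
  qed
  have prod: "emeasure \<nu>1 A * emeasure \<nu>2 B = emeasure N (A \<times> B)"
    if A[measurable]: "A \<in> sets borel" and B[measurable]: "B \<in> sets borel" for A B
  proof -
    have i1: "integrable N (\<lambda>z. indicator A (fst z) :: real)"
      by (rule integrable_const_bound[of _ 1]) (auto simp: indicator_def)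
    have iAc: "integrable N (\<lambda>z. indicator A (fst z) *\<^sub>R cis (b \<bullet> snd z))" for b
      by (rule integrable_const_bound[of _ 1]) (auto simp: indicator_def)
    have m: "(\<integral>z. indicator A (fst z) *\<^sub>R cis (b \<bullet> snd z) \<partial>N) = of_real (measure \<nu>1 A * \<psi>2 b)" for b
    proof (rule complex_eqI)
      show "Re (\<integral>z. indicator A (fst z) *\<^sub>R cis (b \<bullet> snd z) \<partial>N) = Re (of_real (measure \<nu>1 A * \<psi>2 b))"
        using cosA[OF A, of b] by (subst integral_Re[symmetric, OF iAc]) (simp add: mult.commute)
      show "Im (\<integral>z. indicator A (fst z) *\<^sub>R cis (b \<bullet> snd z) \<partial>N) = Im (of_real (measure \<nu>1 A * \<psi>2 b))"
        using sinA[OF A, of b] by (subst integral_Im[symmetric, OF iAc]) (simp add: mult.commute)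
    qed
    have mA: "(\<integral>z. indicator A (fst z) \<partial>N) = measure \<nu>1 A"
      using cosA[OF A, of 0] z2 by simp
    have meq: "(\<integral>z. indicator A (fst z) * indicator B (snd z) \<partial>N) = measure \<nu>1 A * measure \<nu>2 B"
    \<comment> \<open>The weight is now the indicator of \<open>A\<close>, and its integral
      \<open>measure \<nu>1 A\<close> takes the place of \<open>K\<close>, which has to be positive.
      Null sets are treated directly.\<close>
    proof (cases "measure \<nu>1 A = 0")
      case True
      have "(\<integral>z. indicator A (fst z) * indicator B (snd z) \<partial>N) \<le> (\<integral>z. (indicator A (fst z) :: real) \<partial>N)"
        by (rule Bochner_Integration.integral_mono[OF _ i1], rule integrable_const_bound[of _ 1]) (auto simp: indicator_def)
      then show ?thesis using True mA
        by (simp add: order_antisym Bochner_Integration.integral_nonneg)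
    next
      case False
      then show ?thesis
        by (intro char_determines_weighted[OF det2 z2 _ i1 _ _ m B]) (auto simp: zero_less_measure_iff)
    qed
    have "emeasure N (A \<times> B) = ennreal (measure N (A \<times> B))" by (rule emeasure_eq_measure)
    also have "measure N (A \<times> B) = (\<integral>z. indicator (A \<times> B) z \<partial>N)" by (simp add: sp)
    also have "\<dots> = (\<integral>z. indicator A (fst z) * indicator B (snd z) \<partial>N)"
      by (intro Bochner_Integration.integral_cong) (auto simp: indicator_def)
    finally show ?thesis unfolding meq by (simp add: v1.emeasure_eq_measure v2.emeasure_eq_measure ennreal_mult)
  qed
  have "sets (\<nu>1 \<Otimes>\<^sub>M \<nu>2) = sets (borel \<Otimes>\<^sub>M borel :: ('a \<times> 'b) measure)"
    by (rule sets_pair_measure_cong[OF p1(2) p2(2)])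
  then have "sets (\<nu>1 \<Otimes>\<^sub>M \<nu>2) = sets N" by (simp only: borel_prod sN)
  then show "N = \<nu>1 \<Otimes>\<^sub>M \<nu>2"
    using p1 p2 prod
    by (intro pair_measure_eqI[symmetric] v1.sigma_finite_measure_axioms v2.sigma_finite_measure_axioms) auto
qed

lemma char_determines_std_normal:
  "char_determines (\<lambda>a::real. exp (- a\<^sup>2 / 2)) std_normal_distribution"
  unfolding char_determines_def
proof (intro allI impI, elim conjE)
  fix N :: "real measure"
  assume N: "prob_space N" and sN: "sets N = sets borel"
    and char: "\<forall>b. (\<integral>x. cis (b \<bullet> x) \<partial>N) = of_real (exp (- b\<^sup>2 / 2))"
  have "real_distribution N"
    using N sN sets_eq_imp_space_eq[OF sN] unfolding real_distribution_def real_distribution_axioms_def by auto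
  moreover have "char N = char std_normal_distribution"
    using char unfolding char_std_normal_distribution by (auto simp: char_def fun_eq_iff cis_conv_exp mult.commute)
  ultimately show "N = std_normal_distribution"
    by (intro Levy_uniqueness) (auto intro: real_dist_normal_dist)
qed

section \<open>Standard normal laws in dimensions one, two and four\<close>

abbreviation \<phi> :: "real \<Rightarrow> real" where "\<phi> \<equiv> std_normal_density"

lemma std_normal_pair_density:
  "std_normal_distribution \<Otimes>\<^sub>M std_normal_distribution = density lborel (\<lambda>(x, y). ennreal (\<phi> x * \<phi> y))"
proof -
  interpret p: prob_space std_normal_distribution by (rule prob_space_normal_density) simp
  show ?thesis
    by (subst pair_measure_density)
       (auto simp: p.sigma_finite_measure_axioms lborel_prod ennreal_mult intro!: density_cong
         sigma_finite_lborel simp: split_beta)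
qed

lemma char_determines_std_normal2:
  "char_determines (\<lambda>a::real\<times>real. exp (- ((fst a)\<^sup>2 + (snd a)\<^sup>2) / 2)) (density lborel (\<lambda>(x, y). ennreal (\<phi> x * \<phi> y)))"
  and prob_std_normal2: "prob_space (density lborel (\<lambda>(x, y). ennreal (\<phi> x * \<phi> y)))"
proof -
  interpret p: prob_space std_normal_distribution by (rule prob_space_normal_density) simp
  interpret pp: pair_prob_space std_normal_distribution std_normal_distribution ..
  show "prob_space (density lborel (\<lambda>(x, y). ennreal (\<phi> x * \<phi> y)))"
    unfolding std_normal_pair_density[symmetric] by (rule pp.prob_space_axioms)
  show "char_determines (\<lambda>a::real\<times>real. exp (- ((fst a)\<^sup>2 + (snd a)\<^sup>2) / 2)) (density lborel (\<lambda>(x, y). ennreal (\<phi> x * \<phi> y)))"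
    unfolding std_normal_pair_density[symmetric]
    using char_determines_pair[OF char_determines_std_normal char_determines_std_normal
      p.prob_space_axioms _ p.prob_space_axioms]
    by (simp add: exp_add[symmetric] field_simps)
qed

definition std4 :: "(real \<times> real) \<times> (real \<times> real) \<Rightarrow> real" where
  "std4 = (\<lambda>((a, b), (c, d)). \<phi> a * \<phi> b * \<phi> c * \<phi> d)"

lemma std4_measurable [measurable]: "std4 \<in> borel_measurable borel"
  unfolding std4_def split_beta
  by (simp add: borel_prod[symmetric])

lemma char_determines_std4:
  "char_determines (\<lambda>a. exp (- ((fst (fst a))\<^sup>2 + (snd (fst a))\<^sup>2 + (fst (snd a))\<^sup>2 + (snd (snd a))\<^sup>2) / 2))
     (density lborel (\<lambda>z. ennreal (std4 z)))"
proof -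
  let ?n = "density lborel (\<lambda>(x, y). ennreal (\<phi> x * \<phi> y))"
  interpret p: prob_space ?n by (rule prob_std_normal2)
  have "?n \<Otimes>\<^sub>M ?n = density lborel (\<lambda>z. ennreal (std4 z))"
    by (subst pair_measure_density)
       (auto simp: p.sigma_finite_measure_axioms lborel_prod std4_def ennreal_mult[symmetric] mult.assoc
         simp: split_beta borel_prod[symmetric] sigma_finite_lborel intro!: density_cong)
  moreover have "(\<lambda>a. exp (- ((fst (fst a))\<^sup>2 + (snd (fst a))\<^sup>2 + (fst (snd a))\<^sup>2 + (snd (snd a))\<^sup>2) / 2)) =
    (\<lambda>a::(real \<times> real) \<times> (real \<times> real). exp (- ((fst (fst a))\<^sup>2 + (snd (fst a))\<^sup>2) / 2) * exp (- ((fst (snd a))\<^sup>2 + (snd (snd a))\<^sup>2) / 2))"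
    by (simp add: exp_add[symmetric] fun_eq_iff) (simp add: field_simps)
  ultimately show ?thesis
    using char_determines_pair[OF char_determines_std_normal2 char_determines_std_normal2 p.prob_space_axioms _ p.prob_space_axioms]
    by simp
qed

section \<open>Gaussian vectors in triangular form\<close>

text \<open>Both alternatives of \<open>gaussian_variable\<close> obey one formula: an almost surely
  constant variable has variance 0, and the exponential factor is then 1. This is what allows a
  characteristic function to be written down before nondegeneracy is known.\<close>

lemma (in prob_space) gaussian_variable_char:
  assumes "gaussian_variable M X"
  shows "integrable M X" "integrable M (\<lambda>\<omega>. (X \<omega>)\<^sup>2)"
    "(\<integral>\<omega>. cis (a * X \<omega>) \<partial>M) = cis (a * expectation X) * of_real (exp (- (a\<^sup>2 * variance X) / 2))"
proof -
  have X[measurable]: "X \<in> borel_measurable M" using assms by (simp add: gaussian_variable_def)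
  have "integrable M X \<and> integrable M (\<lambda>\<omega>. (X \<omega>)\<^sup>2) \<and>
    (\<integral>\<omega>. cis (a * X \<omega>) \<partial>M) = cis (a * expectation X) * of_real (exp (- (a\<^sup>2 * variance X) / 2))"
  proof (cases "\<exists>\<mu> \<sigma>. 0 < \<sigma> \<and> distributed M lborel X (normal_density \<mu> \<sigma>)")
    case True
    then obtain \<mu> \<sigma> where s: "0 < \<sigma>" and D: "distributed M lborel X (normal_density \<mu> \<sigma>)" by auto
    have EX: "expectation X = \<mu>" by (rule normal_distributed_expectation[OF s D])
    have VX: "variance X = \<sigma>\<^sup>2" by (rule normal_distributed_variance[OF s D])
    have i1: "integrable M X"
      using distributed_integrable[OF D, of "\<lambda>x. x"] integrable_normal_moment_nz_1[OF s, of \<mu>] by simp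
    have i2: "integrable M (\<lambda>\<omega>. (X \<omega> - \<mu>)\<^sup>2)"
      using distributed_integrable[OF D, of "\<lambda>x. (x - \<mu>)\<^sup>2"] integrable_normal_moment[OF s, of \<mu> 2] by simp
    have "(\<lambda>\<omega>. (X \<omega>)\<^sup>2) = (\<lambda>\<omega>. (X \<omega> - \<mu>)\<^sup>2 + 2 * \<mu> * X \<omega> - \<mu>\<^sup>2)"
      by (simp add: fun_eq_iff power2_eq_square algebra_simps)
    then have i3: "integrable M (\<lambda>\<omega>. (X \<omega>)\<^sup>2)" using i1 i2 by simp
    have D': "distributed M lborel (\<lambda>\<omega>. (X \<omega> - \<mu>) / \<sigma>) std_normal_density"
      using D normal_standard_normal_convert[OF s] by simp
    have "(\<integral>\<omega>. cis ((a * \<sigma>) * ((X \<omega> - \<mu>) / \<sigma>)) \<partial>M) = (\<integral>x. std_normal_density x *\<^sub>R cis ((a * \<sigma>) * x) \<partial>lborel)"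
    proof -
      have [measurable]: "(\<lambda>x::real. cis (a * \<sigma> * x)) \<in> borel_measurable borel"
        unfolding cis_conv_exp by measurable
      have "(\<integral>\<omega>. cis ((a * \<sigma>) * ((X \<omega> - \<mu>) / \<sigma>)) \<partial>M) = (\<integral>x. cis ((a * \<sigma>) * x) \<partial>distr M lborel (\<lambda>\<omega>. (X \<omega> - \<mu>) / \<sigma>))"
        by (subst integral_distr) auto
      also have "\<dots> = (\<integral>x. cis ((a * \<sigma>) * x) \<partial>density lborel std_normal_density)"
        using D' by (simp add: distributed_def)
      also have "\<dots> = (\<integral>x. std_normal_density x *\<^sub>R cis ((a * \<sigma>) * x) \<partial>lborel)"
        by (subst integral_density) auto
      finally show ?thesis .
    qed
    also have "\<dots> = char std_normal_distribution (a * \<sigma>)"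
      unfolding char_def
      by (subst integral_density) (auto simp: cis_conv_exp)
    also have "\<dots> = of_real (exp (- (a * \<sigma>)\<^sup>2 / 2))" by (simp add: char_std_normal_distribution)
    finally have c: "(\<integral>\<omega>. cis ((a * \<sigma>) * ((X \<omega> - \<mu>) / \<sigma>)) \<partial>M) = of_real (exp (- (a * \<sigma>)\<^sup>2 / 2))" .
    have "(\<integral>\<omega>. cis (a * X \<omega>) \<partial>M) = (\<integral>\<omega>. cis (a * \<mu>) * cis ((a * \<sigma>) * ((X \<omega> - \<mu>) / \<sigma>)) \<partial>M)"
      using s by (intro Bochner_Integration.integral_cong) (auto simp: cis_mult field_simps)
    also have "\<dots> = cis (a * \<mu>) * of_real (exp (- (a * \<sigma>)\<^sup>2 / 2))"
      using c by simp
    finally show ?thesis using i1 i3 EX VX by (simp add: power_mult_distrib)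
  next
    case False
    then obtain \<mu> where ae: "AE \<omega> in M. X \<omega> = \<mu>" using assms by (auto simp: gaussian_variable_def)
    have i1: "integrable M X" using ae by (subst integrable_cong_AE[of _ _ "\<lambda>_. \<mu>"]) auto
    have i2: "integrable M (\<lambda>\<omega>. (X \<omega>)\<^sup>2)" using ae by (subst integrable_cong_AE[of _ _ "\<lambda>_. \<mu>\<^sup>2"]) auto
    have EX: "expectation X = \<mu>" using ae by (subst integral_cong_AE[of _ _ "\<lambda>_. \<mu>"]) (auto simp: prob_space)
    have VX: "variance X = 0" using ae unfolding EX
      by (subst integral_cong_AE[of _ _ "\<lambda>_. 0"]) auto
    have [measurable]: "(\<lambda>\<omega>. cis (a * X \<omega>)) \<in> borel_measurable M"
      unfolding cis_conv_exp by measurable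
    have "(\<integral>\<omega>. cis (a * X \<omega>) \<partial>M) = cis (a * \<mu>)" using ae
      by (subst integral_cong_AE[of _ _ "\<lambda>_. cis (a * \<mu>)"]) (auto simp: prob_space)
    then show ?thesis using i1 i2 EX VX by simp
  qed
  then show "integrable M X" "integrable M (\<lambda>\<omega>. (X \<omega>)\<^sup>2)"
    "(\<integral>\<omega>. cis (a * X \<omega>) \<partial>M) = cis (a * expectation X) * of_real (exp (- (a\<^sup>2 * variance X) / 2))" by auto
qed

text \<open>The coefficient of \<open>z1\<close> in the first coordinate is 1 because the process
  has unit variance.\<close>

definition triangular_map where
  "triangular_map m1 m2 m3 m4 l21 l22 l31 l32 l33 l41 l42 l43 l44 = (\<lambda>((z1, z2), (z3, z4)).
    ((m1 + z1, m2 + l21 * z1 + l22 * z2),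
     (m3 + l31 * z1 + l32 * z2 + l33 * z3, (m4 + l41 * z1 + l42 * z2 + l43 * z3 + l44 * z4 :: real))))"

lemma triangular_map_measurable [measurable]:
  "triangular_map m1 m2 m3 m4 l21 l22 l31 l32 l33 l41 l42 l43 l44 \<in> borel \<rightarrow>\<^sub>M borel"
  unfolding triangular_map_def split_beta by (simp add: borel_prod[symmetric])

lemma tuple4_measurable [measurable]:
  fixes Z1 Z2 Z3 Z4 :: "'w \<Rightarrow> real"
  assumes [measurable]: "Z1 \<in> borel_measurable M" "Z2 \<in> borel_measurable M"
    "Z3 \<in> borel_measurable M" "Z4 \<in> borel_measurable M"
  shows "(\<lambda>\<omega>. ((Z1 \<omega>, Z2 \<omega>), (Z3 \<omega>, Z4 \<omega>))) \<in> borel_measurable M"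
  by (simp add: borel_prod[symmetric])

text \<open>The covariance matrix of the vector is the product of the lower triangular matrix and its transpose.\<close>

definition triangular_gaussian where
  "triangular_gaussian M X1 X2 X3 X4 m1 m2 m3 m4 l21 l22 l31 l32 l33 l41 l42 l43 l44 \<longleftrightarrow>
    X1 \<in> borel_measurable M \<and> X2 \<in> borel_measurable M \<and> X3 \<in> borel_measurable M \<and> X4 \<in> borel_measurable M \<and>
    0 < l22 \<and> 0 < l33 \<and> 0 < (l44::real) \<and>
    (\<forall>c1 c2 c3 c4. (\<integral>\<omega>. cis (c1 * X1 \<omega> + c2 * X2 \<omega> + c3 * X3 \<omega> + c4 * X4 \<omega>) \<partial>M) =
      cis (c1 * m1 + c2 * m2 + c3 * m3 + c4 * m4) *
      of_real (exp (- ((c1 + c2 * l21 + c3 * l31 + c4 * l41)\<^sup>2 + (c2 * l22 + c3 * l32 + c4 * l42)\<^sup>2 +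
         (c3 * l33 + c4 * l43)\<^sup>2 + (c4 * l44)\<^sup>2) / 2)))"

text \<open>Since the diagonal is positive, the triangular system can be solved for variables Z in
  terms of X. Their characteristic function is that of four independent standard normals, so their
  law is \<open>std4\<close> and X is its image under the triangular map.\<close>

lemma (in prob_space) triangular_gaussian_nn_integral:
  assumes tg: "triangular_gaussian M X1 X2 X3 X4 m1 m2 m3 m4 l21 l22 l31 l32 l33 l41 l42 l43 l44"
    and H[measurable]: "H \<in> borel_measurable borel"
  shows "(\<integral>\<^sup>+\<omega>. H ((X1 \<omega>, X2 \<omega>), (X3 \<omega>, X4 \<omega>)) \<partial>M) =
    (\<integral>\<^sup>+z. ennreal (std4 z) * H (triangular_map m1 m2 m3 m4 l21 l22 l31 l32 l33 l41 l42 l43 l44 z) \<partial>lborel)"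
proof -
  have [measurable]: "X1 \<in> borel_measurable M" "X2 \<in> borel_measurable M"
    "X3 \<in> borel_measurable M" "X4 \<in> borel_measurable M"
    and pos: "0 < l22" "0 < l33" "0 < l44"
    and char: "\<And>c1 c2 c3 c4. (\<integral>\<omega>. cis (c1 * X1 \<omega> + c2 * X2 \<omega> + c3 * X3 \<omega> + c4 * X4 \<omega>) \<partial>M) =
      cis (c1 * m1 + c2 * m2 + c3 * m3 + c4 * m4) *
      of_real (exp (- ((c1 + c2 * l21 + c3 * l31 + c4 * l41)\<^sup>2 + (c2 * l22 + c3 * l32 + c4 * l42)\<^sup>2 +
         (c3 * l33 + c4 * l43)\<^sup>2 + (c4 * l44)\<^sup>2) / 2))"
    using tg unfolding triangular_gaussian_def by auto
  define Z1 where "Z1 = (\<lambda>\<omega>. X1 \<omega> - m1)"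
  define Z2 where "Z2 = (\<lambda>\<omega>. (X2 \<omega> - m2 - l21 * Z1 \<omega>) / l22)"
  define Z3 where "Z3 = (\<lambda>\<omega>. (X3 \<omega> - m3 - l31 * Z1 \<omega> - l32 * Z2 \<omega>) / l33)"
  define Z4 where "Z4 = (\<lambda>\<omega>. (X4 \<omega> - m4 - l41 * Z1 \<omega> - l42 * Z2 \<omega> - l43 * Z3 \<omega>) / l44)"
  have [measurable]: "Z1 \<in> borel_measurable M" "Z2 \<in> borel_measurable M"
    "Z3 \<in> borel_measurable M" "Z4 \<in> borel_measurable M"
    unfolding Z4_def Z3_def Z2_def Z1_def by measurable
  let ?Z = "\<lambda>\<omega>. ((Z1 \<omega>, Z2 \<omega>), (Z3 \<omega>, Z4 \<omega>))"
  have X: "X1 \<omega> = m1 + Z1 \<omega>" "X2 \<omega> = m2 + l21 * Z1 \<omega> + l22 * Z2 \<omega>"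
     "X3 \<omega> = m3 + l31 * Z1 \<omega> + l32 * Z2 \<omega> + l33 * Z3 \<omega>"
     "X4 \<omega> = m4 + l41 * Z1 \<omega> + l42 * Z2 \<omega> + l43 * Z3 \<omega> + l44 * Z4 \<omega>" for \<omega>
    using pos by (simp_all add: Z1_def Z2_def Z3_def Z4_def)
  have charZ: "(\<integral>\<omega>. cis (a1 * Z1 \<omega> + a2 * Z2 \<omega> + a3 * Z3 \<omega> + a4 * Z4 \<omega>) \<partial>M) =
    of_real (exp (- (a1\<^sup>2 + a2\<^sup>2 + a3\<^sup>2 + a4\<^sup>2) / 2))" for a1 a2 a3 a4
  proof -
    \<comment> \<open>Back substitution: these coefficients turn the given combination of the Z into
      a combination of the centred X.\<close>
    define c4 where "c4 = a4 / l44"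
    define c3 where "c3 = (a3 - c4 * l43) / l33"
    define c2 where "c2 = (a2 - c3 * l32 - c4 * l42) / l22"
    define c1 where "c1 = a1 - c2 * l21 - c3 * l31 - c4 * l41"
    have a: "a4 = c4 * l44" "a3 = c3 * l33 + c4 * l43" "a2 = c2 * l22 + c3 * l32 + c4 * l42"
      "a1 = c1 + c2 * l21 + c3 * l31 + c4 * l41"
      using pos by (simp_all add: c1_def c2_def c3_def c4_def)
    let ?m = "c1 * m1 + c2 * m2 + c3 * m3 + c4 * m4"
    have "(\<integral>\<omega>. cis (a1 * Z1 \<omega> + a2 * Z2 \<omega> + a3 * Z3 \<omega> + a4 * Z4 \<omega>) \<partial>M) =
      (\<integral>\<omega>. cis (- ?m) * cis (c1 * X1 \<omega> + c2 * X2 \<omega> + c3 * X3 \<omega> + c4 * X4 \<omega>) \<partial>M)"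
      by (intro Bochner_Integration.integral_cong) (auto simp: X a cis_mult algebra_simps intro!: arg_cong[of _ _ cis])
    also have "\<dots> = cis (- ?m) * (\<integral>\<omega>. cis (c1 * X1 \<omega> + c2 * X2 \<omega> + c3 * X3 \<omega> + c4 * X4 \<omega>) \<partial>M)"
      by simp
    also have "\<dots> = of_real (exp (- (a1\<^sup>2 + a2\<^sup>2 + a3\<^sup>2 + a4\<^sup>2) / 2))"
      unfolding char by (simp add: a cis_mult mult.assoc[symmetric])
    finally show ?thesis .
  qed
  have law: "distr M borel ?Z = density lborel (\<lambda>z. ennreal (std4 z))"
  proof -
    have "(\<integral>x. cis (b \<bullet> x) \<partial>distr M borel ?Z) = of_real (exp (- ((fst (fst b))\<^sup>2 + (snd (fst b))\<^sup>2 + (fst (snd b))\<^sup>2 + (snd (snd b))\<^sup>2) / 2))" for b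
    proof -
      have "(\<integral>x. cis (b \<bullet> x) \<partial>distr M borel ?Z) = (\<integral>\<omega>. cis (b \<bullet> ?Z \<omega>) \<partial>M)"
        by (rule integral_distr[OF tuple4_measurable cis_inner_measurable]) auto
      then show ?thesis by (simp add: inner_prod_def charZ add.assoc[symmetric])
    qed
    then show ?thesis
      using char_determines_std4 prob_space_distr[of ?Z borel] unfolding char_determines_def by auto
  qed
  have "(\<integral>\<^sup>+\<omega>. H ((X1 \<omega>, X2 \<omega>), (X3 \<omega>, X4 \<omega>)) \<partial>M) =
     (\<integral>\<^sup>+\<omega>. H (triangular_map m1 m2 m3 m4 l21 l22 l31 l32 l33 l41 l42 l43 l44 (?Z \<omega>)) \<partial>M)"
    by (simp add: X triangular_map_def)
  also have "\<dots> = (\<integral>\<^sup>+z. H (triangular_map m1 m2 m3 m4 l21 l22 l31 l32 l33 l41 l42 l43 l44 z) \<partial>distr M borel ?Z)"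
    by (subst nn_integral_distr) auto
  also have "\<dots> = (\<integral>\<^sup>+z. ennreal (std4 z) * H (triangular_map m1 m2 m3 m4 l21 l22 l31 l32 l33 l41 l42 l43 l44 z) \<partial>lborel)"
    unfolding law by (subst nn_integral_density) auto
  finally show ?thesis .
qed

text \<open>
  The covariance matrix of (X1, X2, X3, X4) has diagonal 1, 1, A, D, and R = Cov(X1, X2),
  p1 = Cov(X1, X3), p2 = Cov(X2, X3), q1 = Cov(X1, X4), q2 = Cov(X2, X4), B = Cov(X3, X4).
  The chol constants are the entries of its Cholesky factor.
\<close>

definition qform :: "real \<Rightarrow> real \<Rightarrow> real \<Rightarrow> real \<Rightarrow> real \<Rightarrow> real \<Rightarrow> real \<Rightarrow> real \<Rightarrow> real \<Rightarrow> real \<Rightarrow> real \<Rightarrow> real \<Rightarrow> real" where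
  "qform R p1 p2 q1 q2 A B D c1 c2 c3 c4 = c1\<^sup>2 + c2\<^sup>2 + 2 * c1 * c2 * R + 2 * c1 * c3 * p1 + 2 * c1 * c4 * q1
     + 2 * c2 * c3 * p2 + 2 * c2 * c4 * q2 + c3\<^sup>2 * A + 2 * c3 * c4 * B + c4\<^sup>2 * D"

definition chol22 :: "real \<Rightarrow> real" where "chol22 R = sqrt (1 - R\<^sup>2)"
definition chol32 :: "real \<Rightarrow> real \<Rightarrow> real \<Rightarrow> real" where "chol32 R p1 p2 = (p2 - R * p1) / chol22 R"
definition chol33 :: "real \<Rightarrow> real \<Rightarrow> real \<Rightarrow> real \<Rightarrow> real" where "chol33 R p1 p2 A = sqrt (A - p1\<^sup>2 - (chol32 R p1 p2)\<^sup>2)"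
definition chol43 :: "real \<Rightarrow> real \<Rightarrow> real \<Rightarrow> real \<Rightarrow> real \<Rightarrow> real \<Rightarrow> real \<Rightarrow> real" where
  "chol43 R p1 p2 q1 q2 A B = (B - p1 * q1 - chol32 R p1 p2 * chol32 R q1 q2) / chol33 R p1 p2 A"
definition chol44 :: "real \<Rightarrow> real \<Rightarrow> real \<Rightarrow> real \<Rightarrow> real \<Rightarrow> real \<Rightarrow> real \<Rightarrow> real \<Rightarrow> real" where
  "chol44 R p1 p2 q1 q2 A B D = sqrt (D - q1\<^sup>2 - (chol32 R q1 q2)\<^sup>2 - (chol43 R p1 p2 q1 q2 A B)\<^sup>2)"

text \<open>The assumptions keep every pivot positive, so that \<open>chol22\<close>,
  \<open>chol33\<close> and \<open>chol44\<close> square back to the pivots and the divisors in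
  \<open>chol32\<close> and \<open>chol43\<close> are nonzero.\<close>

lemma cholesky_identity:
  assumes "0 < 1 - R\<^sup>2" "0 < A - p1\<^sup>2 - (chol32 R p1 p2)\<^sup>2"
    "0 < D - q1\<^sup>2 - (chol32 R q1 q2)\<^sup>2 - (chol43 R p1 p2 q1 q2 A B)\<^sup>2"
  shows "qform R p1 p2 q1 q2 A B D c1 c2 c3 c4 =
    (c1 + c2 * R + c3 * p1 + c4 * q1)\<^sup>2 + (c2 * chol22 R + c3 * chol32 R p1 p2 + c4 * chol32 R q1 q2)\<^sup>2 +
    (c3 * chol33 R p1 p2 A + c4 * chol43 R p1 p2 q1 q2 A B)\<^sup>2 + (c4 * chol44 R p1 p2 q1 q2 A B D)\<^sup>2"
proof -
  define l2 l32 l42 l33 l43 l44 where "l2 = chol22 R" "l32 = chol32 R p1 p2" "l42 = chol32 R q1 q2"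
    "l33 = chol33 R p1 p2 A" "l43 = chol43 R p1 p2 q1 q2 A B" "l44 = chol44 R p1 p2 q1 q2 A B D"
  note d = this
  have "0 < l2" "0 < l33" using assms by (auto simp: d chol22_def chol33_def)
  have "1 - R\<^sup>2 = l2\<^sup>2" using assms unfolding d chol22_def by simp
  then have e1: "1 = R\<^sup>2 + l2\<^sup>2" by simp
  have e2: "p2 = R * p1 + l32 * l2" "q2 = R * q1 + l42 * l2"
    using \<open>0 < l2\<close> unfolding d chol32_def by auto
  have "A - p1\<^sup>2 - l32\<^sup>2 = l33\<^sup>2" using assms unfolding d chol33_def by simp
  then have e3: "A = p1\<^sup>2 + l32\<^sup>2 + l33\<^sup>2" by simp
  have e4: "B = p1 * q1 + l32 * l42 + l43 * l33"
    using \<open>0 < l33\<close> unfolding d chol43_def by auto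
  have "D - q1\<^sup>2 - l42\<^sup>2 - l43\<^sup>2 = l44\<^sup>2" using assms unfolding d chol44_def by simp
  then have e5: "D = q1\<^sup>2 + l42\<^sup>2 + l43\<^sup>2 + l44\<^sup>2" by simp
  have e6: "c2\<^sup>2 = c2\<^sup>2 * R\<^sup>2 + c2\<^sup>2 * l2\<^sup>2" using e1 by (metis distrib_left mult.right_neutral)
  have "qform R p1 p2 q1 q2 A B D c1 c2 c3 c4 = (c1 + c2 * R + c3 * p1 + c4 * q1)\<^sup>2 + (c2 * l2 + c3 * l32 + c4 * l42)\<^sup>2 +
    (c3 * l33 + c4 * l43)\<^sup>2 + (c4 * l44)\<^sup>2"
    unfolding qform_def e2 e3 e4 e5
    by (subst e6) (simp add: power2_eq_square algebra_simps)
  then show ?thesis unfolding d .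
qed

text \<open>Each pivot is the value of the form at a nonzero vector chosen to annihilate the squares
  that belong to the earlier pivots.\<close>

lemma cholesky_pos:
  assumes pos: "\<And>c1 c2 c3 c4. (c1, c2, c3, c4) \<noteq> (0, 0, 0, 0) \<Longrightarrow> 0 < qform R p1 p2 q1 q2 A B D c1 c2 c3 c4"
  shows "0 < 1 - R\<^sup>2" "0 < A - p1\<^sup>2 - (chol32 R p1 p2)\<^sup>2"
    "0 < D - q1\<^sup>2 - (chol32 R q1 q2)\<^sup>2 - (chol43 R p1 p2 q1 q2 A B)\<^sup>2"
proof -
  show 1: "0 < 1 - R\<^sup>2" using pos[of "-R" 1 0 0] by (simp add: qform_def power2_eq_square)
  define l2 l32 l42 where "l2 = chol22 R" "l32 = chol32 R p1 p2" "l42 = chol32 R q1 q2"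
  note d = this
  have l2: "0 < l2" using 1 unfolding d chol22_def by simp
  have "1 - R\<^sup>2 = l2\<^sup>2" using 1 unfolding d chol22_def by simp
  then have e1: "1 = R\<^sup>2 + l2\<^sup>2" by simp
  have e2: "p2 = R * p1 + l32 * l2" "q2 = R * q1 + l42 * l2"
    using \<open>0 < l2\<close> unfolding d chol32_def by auto
  have q: "qform R p1 p2 q1 q2 A B D c1 c2 c3 c4 = (c1 + c2 * R + c3 * p1 + c4 * q1)\<^sup>2 + (c2 * l2 + c3 * l32 + c4 * l42)\<^sup>2
     + c3\<^sup>2 * (A - p1\<^sup>2 - l32\<^sup>2) + 2 * c3 * c4 * (B - p1 * q1 - l32 * l42) + c4\<^sup>2 * (D - q1\<^sup>2 - l42\<^sup>2)" for c1 c2 c3 c4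
  proof -
    have e6: "c2\<^sup>2 = c2\<^sup>2 * R\<^sup>2 + c2\<^sup>2 * l2\<^sup>2" using e1 by (metis distrib_left mult.right_neutral)
    show ?thesis unfolding qform_def e2
      by (subst e6) (simp add: power2_eq_square algebra_simps)
  qed
  define P where "P = (\<lambda>c3 c4. c3\<^sup>2 * (A - p1\<^sup>2 - l32\<^sup>2) + 2 * c3 * c4 * (B - p1 * q1 - l32 * l42) + c4\<^sup>2 * (D - q1\<^sup>2 - l42\<^sup>2))"
  have P: "0 < P c3 c4" if "(c3, c4) \<noteq> (0, 0)" for c3 c4
  proof -
    \<comment> \<open>This \<open>c2\<close> makes the second square vanish and the first argument
      chosen below makes the first square vanish, so that only \<open>P\<close> remains of the
      form.\<close>
    define c2 where "c2 = - (c3 * l32 + c4 * l42) / l2"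
    have "c2 * l2 + c3 * l32 + c4 * l42 = 0" using l2 by (simp add: c2_def)
    then show ?thesis using pos[of "- (c2 * R + c3 * p1 + c4 * q1)" c2 c3 c4] that
      unfolding q P_def by auto
  qed
  show 2: "0 < A - p1\<^sup>2 - (chol32 R p1 p2)\<^sup>2" using P[of 1 0] by (simp add: P_def d)
  define a b where "a = A - p1\<^sup>2 - l32\<^sup>2" "b = B - p1 * q1 - l32 * l42"
  note ab = this
  have a: "0 < a" using 2 by (simp add: ab d)
  have "(chol43 R p1 p2 q1 q2 A B)\<^sup>2 = b\<^sup>2 / a"
    using a unfolding chol43_def chol33_def d[symmetric] ab[symmetric] by (simp add: power_divide)
  \<comment> \<open>With second argument 1, \<open>P\<close> is minimal at \<open>- b / a\<close>;
    the minimum is the Schur complement, which is the last pivot.\<close>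
  moreover have "0 < P (- b / a) 1" using P[of "- b / a" 1] by simp
  moreover have "P (- b / a) 1 = (D - q1\<^sup>2 - l42\<^sup>2) - b\<^sup>2 / a"
    using a unfolding P_def ab[symmetric] by (simp add: field_simps power2_eq_square)
  ultimately show "0 < D - q1\<^sup>2 - (chol32 R q1 q2)\<^sup>2 - (chol43 R p1 p2 q1 q2 A B)\<^sup>2"
    by (simp add: d)
qed

section \<open>Absolute values and signs of correlated Gaussian variables\<close>

lemma phi_even: "\<phi> (- x) = \<phi> x" by (simp add: std_normal_density_def)

lemma integral_phi: "(\<integral>x. \<phi> x \<partial>lborel) = 1" "integrable lborel \<phi>"
  using integral_std_normal_moment_even[of 0] integrable_std_normal_moment[of 0] by simp_all

lemma integral_phi_abs: "(\<integral>x. \<phi> x * \<bar>x\<bar> \<partial>lborel) = sqrt (2 / pi)" "integrable lborel (\<lambda>x. \<phi> x * \<bar>x\<bar>)"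
  using integral_std_normal_moment_abs_odd[of 0] integrable_std_normal_moment_abs[of 1] by simp_all

lemma integral_phi_sgn: "(\<integral>x. \<phi> x * sgn x \<partial>lborel) = 0"
proof -
  have "(\<integral>x. \<phi> x * sgn x \<partial>lborel) = \<bar>-1\<bar> *\<^sub>R (\<integral>x. \<phi> (0 + (-1) * x) * sgn (0 + (-1) * x) \<partial>lborel)"
    by (rule lborel_integral_real_affine) simp
  then show ?thesis by (simp add: phi_even sgn_minus)
qed

text \<open>This class contains all factors of the expansion of |a + x|, is preserved by
  conditioning (\<open>corr_cond\<close>), and products of two of its members are integrable against
  the normal density.\<close>

definition lin_growth :: "(real \<Rightarrow> real) \<Rightarrow> bool" where
  "lin_growth f \<longleftrightarrow> f \<in> borel_measurable borel \<and> (\<exists>C\<ge>0. \<forall>x. \<bar>f x\<bar> \<le> C * (1 + \<bar>x\<bar>))"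

lemma lin_growth_measurable [measurable_dest]: "lin_growth f \<Longrightarrow> f \<in> borel_measurable borel"
  by (simp add: lin_growth_def)

lemma lin_growth_abs: "lin_growth f \<Longrightarrow> lin_growth (\<lambda>x. \<bar>f x\<bar>)"
  unfolding lin_growth_def by auto

lemma lin_growth_add: "lin_growth f \<Longrightarrow> lin_growth g \<Longrightarrow> lin_growth (\<lambda>x. f x + g x)"
  unfolding lin_growth_def
proof (elim conjE exE, intro conjI)
  fix C D assume a: "0 \<le> C" "\<forall>x. \<bar>f x\<bar> \<le> C * (1 + \<bar>x\<bar>)" "0 \<le> D" "\<forall>x. \<bar>g x\<bar> \<le> D * (1 + \<bar>x\<bar>)"
  have "\<bar>f x + g x\<bar> \<le> (C + D) * (1 + \<bar>x\<bar>)" for x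
    using a(2)[rule_format, of x] a(4)[rule_format, of x] abs_triangle_ineq[of "f x" "g x"] by (simp add: distrib_right)
  then show "\<exists>C\<ge>0. \<forall>x. \<bar>f x + g x\<bar> \<le> C * (1 + \<bar>x\<bar>)" using a by (intro exI[of _ "C + D"]) auto
qed auto

lemma lin_growth_cmult: "lin_growth f \<Longrightarrow> lin_growth (\<lambda>x. c * f x)"
  unfolding lin_growth_def
proof (elim conjE exE, intro conjI)
  fix C assume a: "0 \<le> C" "\<forall>x. \<bar>f x\<bar> \<le> C * (1 + \<bar>x\<bar>)"
  have "\<bar>c * f x\<bar> \<le> (\<bar>c\<bar> * C) * (1 + \<bar>x\<bar>)" for x
    using mult_left_mono[OF a(2)[rule_format, of x], of "\<bar>c\<bar>"] by (simp add: abs_mult mult.assoc)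
  then show "\<exists>C\<ge>0. \<forall>x. \<bar>c * f x\<bar> \<le> C * (1 + \<bar>x\<bar>)" using a by (intro exI[of _ "\<bar>c\<bar> * C"]) auto
qed auto

lemma lin_growth_abs_shift: "lin_growth (\<lambda>x. \<bar>a + x\<bar>)"
proof -
  have "\<bar>a + x\<bar> \<le> (1 + \<bar>a\<bar>) * (1 + \<bar>x\<bar>)" for x
  proof -
    have "0 \<le> \<bar>a\<bar> * \<bar>x\<bar>" by simp
    then show ?thesis using abs_triangle_ineq[of a x] unfolding distrib_left distrib_right by linarith
  qed
  then show ?thesis unfolding lin_growth_def by (auto intro!: exI[of _ "1 + \<bar>a\<bar>"])
qed

lemma lin_growth_sgn: "lin_growth sgn"
  unfolding lin_growth_def by (auto intro!: exI[of _ 1] simp: sgn_if)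

text \<open>The second-order remainder of |x + a| as a formal Taylor expansion in \<open>a\<close>,
  with \<open>sgn\<close> as the derivative of the absolute value.\<close>

definition abs_remainder :: "real \<Rightarrow> real \<Rightarrow> real" where "abs_remainder a x = \<bar>a + x\<bar> - \<bar>x\<bar> - a * sgn x"

lemma lin_growth_abs_remainder: "lin_growth (abs_remainder a)"
proof -
  have "lin_growth (\<lambda>x. \<bar>a + x\<bar> + (-1) * \<bar>0 + x\<bar> + (- a) * sgn x)"
    by (intro lin_growth_add lin_growth_cmult lin_growth_abs_shift lin_growth_sgn)
  then show ?thesis by (simp add: abs_remainder_def[abs_def])
qed

lemma abs_remainder_measurable [measurable]: "abs_remainder a \<in> borel_measurable borel"
  using lin_growth_abs_remainder by (rule lin_growth_measurable)

lemma LBINT01: "(LBINT t=0..1. f t) = (\<integral>t. indicator {0<..<1} t * f t \<partial>lborel)" for f :: "real \<Rightarrow> real"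
  by (simp add: interval_lebesgue_integral_def set_lebesgue_integral_def einterval_def zero_ereal_def one_ereal_def
      greaterThanLessThan_def greaterThan_def lessThan_def Int_def indicator_def)

text \<open>
  The second derivative of the absolute value is twice the Dirac measure at 0, so the remainder
  of its Taylor expansion is supported between 0 and -a.
\<close>

lemma integral_abs_remainder:
  assumes [measurable]: "q \<in> borel_measurable borel"
  shows "(\<integral>x. abs_remainder a x * q x \<partial>lborel) = 2 * a\<^sup>2 * (LBINT t=0..1. (1 - t) * q (- a * t))"
proof (cases "a = 0")
  case False
  have "(\<integral>x. abs_remainder a x * q x \<partial>lborel) = \<bar>-a\<bar> *\<^sub>R (\<integral>t. abs_remainder a (0 + (-a) * t) * q (0 + (-a) * t) \<partial>lborel)"
    using False by (intro lborel_integral_real_affine) simp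
  also have "(\<integral>t. abs_remainder a (0 + (-a) * t) * q (0 + (-a) * t) \<partial>lborel) =
     (\<integral>t. (2 * \<bar>a\<bar>) * (indicator {0<..<1} t * ((1 - t) * q (- a * t))) \<partial>lborel)"
  proof (rule integral_cong_AE)
    have *: "abs_remainder a (- a * t) = \<bar>a\<bar> * (\<bar>1 - t\<bar> - \<bar>t\<bar> + sgn t)" for t
    proof -
      have "\<bar>a + (- a * t)\<bar> = \<bar>a\<bar> * \<bar>1 - t\<bar>" by (simp add: abs_mult[symmetric] right_diff_distrib)
      moreover have "a * sgn (- a * t) = - (\<bar>a\<bar> * sgn t)" by (simp add: sgn_mult abs_sgn algebra_simps)
      ultimately show ?thesis by (simp add: abs_remainder_def abs_mult algebra_simps)
    qed
    have "abs_remainder a (- a * t) = (2 * \<bar>a\<bar>) * (indicator {0<..<1} t * (1 - t))" if "t \<noteq> 0" for t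
      using that unfolding * by (auto simp: indicator_def sgn_if)
    then show "AE t in lborel. abs_remainder a (0 + (-a) * t) * q (0 + (-a) * t) = (2 * \<bar>a\<bar>) * (indicator {0<..<1} t * ((1 - t) * q (- a * t)))"
      using AE_lborel_singleton[of "0::real"] by (auto elim!: eventually_mono)
  qed measurable
  finally show ?thesis unfolding LBINT01 by (simp add: power2_eq_square)
qed (simp add: abs_remainder_def)

text \<open>The mechanism of \<open>integral_abs_remainder\<close> one order lower: the derivative
  of \<open>sgn\<close> is twice the Dirac measure at 0, so the difference is 2 or -2 between 0 and
  \<open>- a\<close> and vanishes outside.\<close>

lemma integral_sgn_shift:
  assumes [measurable]: "q \<in> borel_measurable borel"
  shows "(\<integral>x. (sgn (a + x) - sgn x) * q x \<partial>lborel) = 2 * a * (LBINT t=0..1. q (- a * t))"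
proof (cases "a = 0")
  case False
  have "(\<integral>x. (sgn (a + x) - sgn x) * q x \<partial>lborel) = \<bar>-a\<bar> *\<^sub>R (\<integral>t. (sgn (a + (0 + (-a) * t)) - sgn (0 + (-a) * t)) * q (0 + (-a) * t) \<partial>lborel)"
    using False by (intro lborel_integral_real_affine) simp
  also have "(\<integral>t. (sgn (a + (0 + (-a) * t)) - sgn (0 + (-a) * t)) * q (0 + (-a) * t) \<partial>lborel) =
     (\<integral>t. (2 * sgn a) * (indicator {0<..<1} t * q (- a * t)) \<partial>lborel)"
  proof (rule integral_cong_AE)
    have "sgn (a + (- a * t)) = sgn a * sgn (1 - t)" "sgn (- a * t) = - sgn a * sgn t" for t
      by (simp_all add: sgn_mult[symmetric] sgn_minus right_diff_distrib)
    then have "sgn (a + (- a * t)) - sgn (- a * t) = sgn a * (sgn (1 - t) + sgn t)" for t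
      by (simp add: distrib_left)
    moreover have "sgn (1 - t) + sgn t = 2 * indicator {0<..<1} t" if "t \<noteq> 0" "t \<noteq> 1" for t :: real
      using that by (auto simp: indicator_def sgn_if)
    ultimately have *: "sgn (a + (- a * t)) - sgn (- a * t) = 2 * sgn a * indicator {0<..<1} t" if "t \<noteq> 0" "t \<noteq> 1" for t
      using that by simp
    show "AE t in lborel. (sgn (a + (0 + (-a) * t)) - sgn (0 + (-a) * t)) * q (0 + (-a) * t) = (2 * sgn a) * (indicator {0<..<1} t * q (- a * t))"
      using AE_lborel_singleton[of "0::real"] AE_lborel_singleton[of "1::real"] by eventually_elim (simp add: *[simplified])
  qed measurable
  also have "\<bar>- a\<bar> *\<^sub>R (\<integral>t. (2 * sgn a) * (indicator {0<..<1} t * q (- a * t)) \<partial>lborel) = 2 * (\<bar>a\<bar> * sgn a) * (LBINT t=0..1. q (- a * t))"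
    unfolding LBINT01 by (simp only: integral_mult_right_zero) simp
  finally show ?thesis by (simp add: abs_mult_sgn)
qed simp

section \<open>The error function as a Gaussian integral\<close>

lemma erf_eq: "erf z = 2 / sqrt pi * z * (LBINT u=0..1. exp (- (z\<^sup>2 * u\<^sup>2)))"
proof -
  have "(LBINT t=ereal 0..ereal z. exp (- (t\<^sup>2))) = (LBINT u=ereal 0..ereal 1. z * exp (- ((z * u)\<^sup>2)))"
  proof -
    have "(LBINT u=ereal 0..ereal 1. z *\<^sub>R exp (- ((z * u)\<^sup>2))) = (LBINT t=ereal (z * 0)..ereal (z * 1). exp (- (t\<^sup>2)))"
      by (rule interval_integral_substitution_finite) (auto intro!: derivative_eq_intros continuous_intros)
    then show ?thesis by simp
  qed
  then show ?thesis unfolding erf_def by (simp add: zero_ereal_def one_ereal_def power_mult_distrib)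
qed

lemma erf_minus: "erf (- z) = - erf z" by (simp add: erf_eq)

lemma phi_conv: "\<phi> (c * u) = exp (- ((c / sqrt 2)\<^sup>2 * u\<^sup>2)) / sqrt (2 * pi)"
  by (simp add: std_normal_density_def power_divide power_mult_distrib)

lemma erf_phi: "erf (c / sqrt 2) = 2 * c * (LBINT u=0..1. \<phi> (c * u))"
  unfolding erf_eq phi_conv by (simp add: real_sqrt_mult field_simps)

lemma integral_sgn_phi:
  "(\<integral>w. \<phi> w * sgn (c + w) \<partial>lborel) = erf (c / sqrt 2)"
proof -
  have i: "integrable lborel (\<lambda>w. \<phi> w * sgn w)" "integrable lborel (\<lambda>w. \<phi> w * sgn (c + w))"
    by (rule Bochner_Integration.integrable_bound[OF integral_phi(2)]; auto simp: sgn_if)+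
  have "(\<integral>w. \<phi> w * sgn (c + w) \<partial>lborel) = (\<integral>w. \<phi> w * sgn w \<partial>lborel) + (\<integral>x. (sgn (c + x) - sgn x) * \<phi> x \<partial>lborel)"
    using i by (subst Bochner_Integration.integral_add[symmetric]) (auto simp: algebra_simps)
  also have "\<dots> = 2 * c * (LBINT t=0..1. \<phi> (- c * t))"
    by (simp add: integral_phi_sgn integral_sgn_shift)
  also have "\<dots> = erf (c / sqrt 2)" using phi_even by (simp add: erf_phi)
  finally show ?thesis .
qed

text \<open>As the mean of a sign, \<open>erf\<close> is visibly measurable and bounded by
  1.\<close>

lemma erf_integral: "erf z = (\<integral>w. \<phi> w * sgn (z * sqrt 2 + w) \<partial>lborel)"
  by (simp add: integral_sgn_phi)

lemma erf_measurable [measurable]: "erf \<in> borel_measurable borel"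
  unfolding erf_integral[abs_def] by measurable

lemma erf_bound: "\<bar>erf z\<bar> \<le> 1"
proof -
  have "\<bar>erf z\<bar> \<le> (\<integral>w. \<phi> w \<partial>lborel)"
    unfolding erf_integral real_norm_def[symmetric]
    by (rule Bochner_Integration.integral_norm_bound_integral[OF _ integral_phi(2)], rule Bochner_Integration.integrable_bound[OF integral_phi(2)])
       (auto simp: sgn_if)
  then show ?thesis by (simp add: integral_phi)
qed

lemma bounded_on_unit_integrable:
  fixes f :: "real \<Rightarrow> real"
  assumes [measurable]: "f \<in> borel_measurable borel" and b: "\<And>t. 0 < t \<Longrightarrow> t < 1 \<Longrightarrow> \<bar>f t\<bar> \<le> C"
  shows "integrable lborel (\<lambda>t. indicator {0<..<1} t * f t)"
proof (rule Bochner_Integration.integrable_bound)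
  show "integrable lborel (\<lambda>t::real. indicator {0<..<1} t * C)" by simp
  show "AE t in lborel. norm (indicator {0<..<1} t * f t) \<le> norm (indicator {0<..<1} t * C)"
    using b by (intro AE_I2) (force simp: indicator_def)
qed measurable

lemma LBINT01_lin:
  fixes f g :: "real \<Rightarrow> real"
  assumes "integrable lborel (\<lambda>t. indicator {0<..<1} t * f t)" "integrable lborel (\<lambda>t. indicator {0<..<1} t * g t)"
  shows "(LBINT t=0..1. c * f t + d * g t) = c * (LBINT t=0..1. f t) + d * (LBINT t=0..1. g t)"
proof -
  have e: "indicator {0<..<1} t * (c * f t + d * g t) = c * (indicator {0<..<1} t * f t) + d * (indicator {0<..<1} t * g t)" for t
    by (simp only: distrib_left mult.left_commute)
  show ?thesis unfolding LBINT01 e using assms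
    by (simp only: Bochner_Integration.integral_add integrable_mult_right integral_mult_right_zero)
qed

text \<open>The mean of the folded normal law. Expand |c + w| into |w|, \<open>c * sgn w\<close> and
  the remainder: the sign has mean 0, and the remainder contributes the \<open>erf\<close> term
  together with an integral that can be evaluated explicitly.\<close>

lemma integral_abs_phi:
  "(\<integral>w. \<phi> w * \<bar>c + w\<bar> \<partial>lborel) = 2 * \<phi> c + c * erf (c / sqrt 2)"
proof -
  have i: "integrable lborel (\<lambda>w. \<phi> w * \<bar>w\<bar>)" "integrable lborel (\<lambda>w. \<phi> w * (c * sgn w))"
    using integral_phi_abs by (auto intro!: Bochner_Integration.integrable_bound[OF integrable_mult_right[OF integral_phi(2), of "\<bar>c\<bar>"]] simp: sgn_if abs_mult)
  have "\<bar>abs_remainder c w\<bar> \<le> 2 * \<bar>c\<bar>" for w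
    by (auto simp: abs_remainder_def sgn_if)
  then have i2: "integrable lborel (\<lambda>w. abs_remainder c w * \<phi> w)"
    by (intro Bochner_Integration.integrable_bound[OF integrable_mult_right[OF integral_phi(2), of "2 * \<bar>c\<bar>"]])
       (auto simp: abs_mult intro!: mult_right_mono)
  have "(\<integral>w. \<phi> w * \<bar>c + w\<bar> \<partial>lborel) = (\<integral>w. (\<phi> w * \<bar>w\<bar> + \<phi> w * (c * sgn w)) + abs_remainder c w * \<phi> w \<partial>lborel)"
    by (simp add: abs_remainder_def algebra_simps)
  also have "\<dots> = (\<integral>w. \<phi> w * \<bar>w\<bar> \<partial>lborel) + (\<integral>w. \<phi> w * (c * sgn w) \<partial>lborel) + (\<integral>w. abs_remainder c w * \<phi> w \<partial>lborel)"
    using i i2 by simp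
  also have "(\<integral>w. \<phi> w * (c * sgn w) \<partial>lborel) = c * (\<integral>w. \<phi> w * sgn w \<partial>lborel)"
    by (subst integral_mult_right_zero[symmetric]) (simp add: algebra_simps)
  also have "(\<integral>w. abs_remainder c w * \<phi> w \<partial>lborel) = 2 * c\<^sup>2 * (LBINT t=0..1. (1 - t) * \<phi> (c * t))"
    using phi_even by (simp add: integral_abs_remainder)
  also have "(LBINT t=0..1. (1 - t) * \<phi> (c * t)) = (LBINT t=0..1. \<phi> (c * t)) - (LBINT t=0..1. t * \<phi> (c * t))"
  proof -
    have b: "\<phi> x \<le> 1" for x
    proof -
      have "exp (- x\<^sup>2 / 2) \<le> 1" by simp
      moreover have "1 \<le> sqrt (2 * pi)" using pi_gt3 by simp
      ultimately show ?thesis unfolding std_normal_density_def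
        using order_trans[of "exp (- x\<^sup>2 / 2)" 1 "sqrt (2 * pi)"] by (simp add: divide_le_eq)
    qed
    have "integrable lborel (\<lambda>t. indicator {0<..<1} t * \<phi> (c * t))"
      by (rule bounded_on_unit_integrable[of _ 1]) (auto simp: b)
    moreover have "integrable lborel (\<lambda>t. indicator {0<..<1} t * (t * \<phi> (c * t)))"
      by (rule bounded_on_unit_integrable[of _ 1]) (auto simp: b abs_mult intro!: mult_le_one)
    ultimately show ?thesis unfolding LBINT01
      by (subst Bochner_Integration.integral_diff[symmetric]) (auto simp: algebra_simps)
  qed
  also have "2 * c\<^sup>2 * ((LBINT t=0..1. \<phi> (c * t)) - (LBINT t=0..1. t * \<phi> (c * t))) =
     c * erf (c / sqrt 2) - 2 * (LBINT t=0..1. c\<^sup>2 * t * \<phi> (c * t))"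
    unfolding erf_phi
    by (subst mult.assoc, subst interval_lebesgue_integral_mult_right) (simp add: power2_eq_square algebra_simps)
  \<comment> \<open>The antiderivative is \<open>- \<phi> (c * t)\<close>. Its value at
    \<open>t = 0\<close> later cancels the mean sqrt(2 / pi) of |w|, and only the term
    \<open>2 * \<phi> c\<close> survives.\<close>
  also have "(LBINT t=0..1. c\<^sup>2 * t * \<phi> (c * t)) = \<phi> 0 - \<phi> c"
  proof -
    have "(LBINT t=ereal 0..ereal 1. c\<^sup>2 * t * \<phi> (c * t)) = - \<phi> (c * 1) - (- \<phi> (c * 0))"
    proof (rule interval_integral_FTC_finite)
      show "continuous_on {min 0 1..max 0 1} (\<lambda>t. c\<^sup>2 * t * \<phi> (c * t))"
        unfolding std_normal_density_def by (intro continuous_intros) auto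
      fix t :: real
      obtain K where K: "\<phi> x = K * exp (- x\<^sup>2 / 2)" for x using std_normal_density_def by blast
      show "((\<lambda>a. - \<phi> (c * a)) has_vector_derivative c\<^sup>2 * t * \<phi> (c * t)) (at t within {min 0 1..max 0 1})"
        unfolding K has_real_derivative_iff_has_vector_derivative[symmetric]
        by (auto intro!: derivative_eq_intros simp: power2_eq_square)
    qed
    then show ?thesis by (simp add: zero_ereal_def one_ereal_def)
  qed
  moreover have "sqrt (2 / pi) = 2 * \<phi> 0"
    by (simp add: std_normal_density_def real_sqrt_mult real_sqrt_divide field_simps)
  ultimately show ?thesis by (simp add: integral_phi_sgn integral_phi_abs)
qed

text \<open>
  For standard normal X and Y with correlation delta, the conditional expectation of
  g(Y) given X = x, and the expectation of f(X) g(Y).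
\<close>

definition corr_cond :: "real \<Rightarrow> (real \<Rightarrow> real) \<Rightarrow> real \<Rightarrow> real" where
  "corr_cond \<delta> g x = (\<integral>w. \<phi> w * g (\<delta> * x + sqrt (1 - \<delta>\<^sup>2) * w) \<partial>lborel)"

definition corr_expectation :: "real \<Rightarrow> (real \<Rightarrow> real) \<Rightarrow> (real \<Rightarrow> real) \<Rightarrow> real" where
  "corr_expectation \<delta> f g = (\<integral>x. \<phi> x * f x * corr_cond \<delta> g x \<partial>lborel)"

text \<open>The joint density of two standard normal variables with correlation \<delta>. With
  \<delta> replaced by r(x, y) and evaluated at the two means, it supplies the factor E of the
  closed form.\<close>

definition corr_density :: "real \<Rightarrow> real \<Rightarrow> real \<Rightarrow> real" where
  "corr_density \<delta> x y = exp (- ((x\<^sup>2 - 2 * \<delta> * x * y + y\<^sup>2) / (2 * (1 - \<delta>\<^sup>2)))) / (2 * pi * sqrt (1 - \<delta>\<^sup>2))"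

lemma corr_density_measurable [measurable]:
  "(\<lambda>(x, y). corr_density \<delta> x y) \<in> borel_measurable (borel \<Otimes>\<^sub>M borel)"
  "corr_density \<delta> x \<in> borel_measurable borel"
  unfolding corr_density_def[abs_def] by measurable

lemma corr_density_sym: "corr_density \<delta> x y = corr_density \<delta> y x"
  by (simp add: corr_density_def algebra_simps)

context
  fixes \<delta> :: real
  assumes delta: "\<bar>\<delta>\<bar> < 1"
begin

lemma delta_sq: "0 < 1 - \<delta>\<^sup>2" using delta by (simp add: abs_square_less_1)

lemma sqrt_delta: "0 < sqrt (1 - \<delta>\<^sup>2)" "sqrt (1 - \<delta>\<^sup>2) \<le> 1" "(sqrt (1 - \<delta>\<^sup>2))\<^sup>2 = 1 - \<delta>\<^sup>2"
  using delta_sq by (auto simp: real_sqrt_le_1_iff)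

lemma corr_cond_measurable [measurable]: "lin_growth g \<Longrightarrow> corr_cond \<delta> g \<in> borel_measurable borel"
  using lin_growth_measurable[of g] unfolding corr_cond_def[abs_def] by measurable

lemma corr_cond_integrable:
  assumes g: "lin_growth g"
  shows "integrable lborel (\<lambda>w. \<phi> w * g (\<delta> * x + sqrt (1 - \<delta>\<^sup>2) * w))"
proof -
  have [measurable]: "g \<in> borel_measurable borel" using g by measurable
  obtain C where C: "0 \<le> C" "\<And>x. \<bar>g x\<bar> \<le> C * (1 + \<bar>x\<bar>)" using g by (auto simp: lin_growth_def)
  show ?thesis
  proof (rule Bochner_Integration.integrable_bound)
    show "integrable lborel (\<lambda>w. C * ((1 + \<bar>x\<bar>) * \<phi> w + \<phi> w * \<bar>w\<bar>))"
      using integral_phi integral_phi_abs by simp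
    have "\<bar>g (\<delta> * x + sqrt (1 - \<delta>\<^sup>2) * w)\<bar> \<le> C * (1 + \<bar>x\<bar> + \<bar>w\<bar>)" for w
    proof -
      have "\<bar>\<delta> * x + sqrt (1 - \<delta>\<^sup>2) * w\<bar> \<le> \<bar>\<delta>\<bar> * \<bar>x\<bar> + \<bar>sqrt (1 - \<delta>\<^sup>2)\<bar> * \<bar>w\<bar>"
        by (metis abs_mult abs_triangle_ineq)
      also have "\<dots> \<le> 1 * \<bar>x\<bar> + 1 * \<bar>w\<bar>"
        using delta sqrt_delta by (intro add_mono mult_right_mono) auto
      finally have "1 + \<bar>\<delta> * x + sqrt (1 - \<delta>\<^sup>2) * w\<bar> \<le> 1 + \<bar>x\<bar> + \<bar>w\<bar>" by simp
      from mult_left_mono[OF this C(1)] C(2) show ?thesis by (meson order_trans)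
    qed
    from mult_left_mono[OF this normal_density_nonneg]
    have "\<bar>\<phi> w * g (\<delta> * x + sqrt (1 - \<delta>\<^sup>2) * w)\<bar> \<le> C * ((1 + \<bar>x\<bar>) * \<phi> w + \<phi> w * \<bar>w\<bar>)" for w
      by (simp add: abs_mult algebra_simps)
    moreover have "0 \<le> C * ((1 + \<bar>x\<bar>) * \<phi> w + \<phi> w * \<bar>w\<bar>)" for w using C by simp
    ultimately show "AE w in lborel. norm (\<phi> w * g (\<delta> * x + sqrt (1 - \<delta>\<^sup>2) * w)) \<le> norm (C * ((1 + \<bar>x\<bar>) * \<phi> w + \<phi> w * \<bar>w\<bar>))"
      by (intro AE_I2) (metis abs_of_nonneg real_norm_def)
  qed measurable
qed

text \<open>The argument of \<open>g\<close> is bounded by |x| + |w|, because both coefficients have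
  absolute value at most 1. The factor 2 in the constant comes from the mean sqrt(2 / pi) of |w|,
  which is at most 1.\<close>

lemma corr_cond_growth:
  assumes g: "lin_growth g"
  shows "lin_growth (corr_cond \<delta> g)"
proof -
  have [measurable]: "g \<in> borel_measurable borel" using g by measurable
  obtain C where C: "0 \<le> C" "\<And>x. \<bar>g x\<bar> \<le> C * (1 + \<bar>x\<bar>)" using g by (auto simp: lin_growth_def)
  have "\<bar>corr_cond \<delta> g x\<bar> \<le> (2 * C) * (1 + \<bar>x\<bar>)" for x
  proof -
    have *: "\<bar>g (\<delta> * x + sqrt (1 - \<delta>\<^sup>2) * w)\<bar> \<le> C * (1 + \<bar>x\<bar> + \<bar>w\<bar>)" for w
    proof -
      have "\<bar>\<delta> * x + sqrt (1 - \<delta>\<^sup>2) * w\<bar> \<le> \<bar>\<delta>\<bar> * \<bar>x\<bar> + \<bar>sqrt (1 - \<delta>\<^sup>2)\<bar> * \<bar>w\<bar>"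
        by (metis abs_mult abs_triangle_ineq)
      also have "\<dots> \<le> 1 * \<bar>x\<bar> + 1 * \<bar>w\<bar>"
        using delta sqrt_delta by (intro add_mono mult_right_mono) auto
      finally have "1 + \<bar>\<delta> * x + sqrt (1 - \<delta>\<^sup>2) * w\<bar> \<le> 1 + \<bar>x\<bar> + \<bar>w\<bar>" by simp
      from mult_left_mono[OF this C(1)] C(2) show ?thesis by (meson order_trans)
    qed
    from mult_left_mono[OF this normal_density_nonneg]
    have "norm (\<phi> w * g (\<delta> * x + sqrt (1 - \<delta>\<^sup>2) * w)) \<le> C * ((1 + \<bar>x\<bar>) * \<phi> w + \<phi> w * \<bar>w\<bar>)" for w
      by (simp add: abs_mult algebra_simps)
    then have "norm (corr_cond \<delta> g x) \<le> (\<integral>w. C * ((1 + \<bar>x\<bar>) * \<phi> w + \<phi> w * \<bar>w\<bar>) \<partial>lborel)"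
      unfolding corr_cond_def using integral_phi integral_phi_abs
      by (intro Bochner_Integration.integral_norm_bound_integral corr_cond_integrable g) auto
    also have "\<dots> = C * ((1 + \<bar>x\<bar>) + sqrt (2 / pi))" using integral_phi integral_phi_abs by simp
    also have "\<dots> \<le> C * ((1 + \<bar>x\<bar>) + 1)"
      using C pi_gt3 by (intro mult_left_mono add_left_mono) auto
    also have "\<dots> \<le> (2 * C) * (1 + \<bar>x\<bar>)" using C by (simp add: algebra_simps)
    finally show ?thesis by simp
  qed
  then show ?thesis using C g unfolding lin_growth_def[of "corr_cond \<delta> g"]
    by (auto intro!: exI[of _ "2 * C"])
qed

lemma phi_growth2_integrable:
  assumes f: "lin_growth f" and g: "lin_growth g"
  shows "integrable lborel (\<lambda>x. \<phi> x * f x * g x)"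
proof -
  have [measurable]: "f \<in> borel_measurable borel" "g \<in> borel_measurable borel" using f g by auto
  obtain C where C: "0 \<le> C" "\<And>x. \<bar>f x\<bar> \<le> C * (1 + \<bar>x\<bar>)" using f by (auto simp: lin_growth_def)
  obtain D where D: "0 \<le> D" "\<And>x. \<bar>g x\<bar> \<le> D * (1 + \<bar>x\<bar>)" using g by (auto simp: lin_growth_def)
  show ?thesis
  proof (rule Bochner_Integration.integrable_bound)
    show "integrable lborel (\<lambda>w. (C * D) * (\<phi> w + 2 * (\<phi> w * \<bar>w\<bar>) + \<phi> w * w^2))"
      using integral_phi integral_phi_abs integrable_std_normal_moment[of 2] by simp
    have "\<bar>\<phi> w * f w * g w\<bar> \<le> \<phi> w * ((C * (1 + \<bar>w\<bar>)) * (D * (1 + \<bar>w\<bar>)))" for w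
      using mult_mono[OF C(2)[of w] D(2)[of w]] C(1) by (simp add: abs_mult mult.assoc mult_left_mono)
    also have "\<phi> w * ((C * (1 + \<bar>w\<bar>)) * (D * (1 + \<bar>w\<bar>))) = (C * D) * (\<phi> w + 2 * (\<phi> w * \<bar>w\<bar>) + \<phi> w * w^2)" for w
      by (simp add: algebra_simps power2_eq_square)
    finally show "AE w in lborel. norm (\<phi> w * f w * g w) \<le> norm ((C * D) * (\<phi> w + 2 * (\<phi> w * \<bar>w\<bar>) + \<phi> w * w^2))"
      by (intro AE_I2) (simp, meson abs_ge_self order_trans)
  qed measurable
qed

lemma corr_expectation_add1:
  assumes "lin_growth f" "lin_growth f'" "lin_growth g"
  shows "corr_expectation \<delta> (\<lambda>x. f x + f' x) g = corr_expectation \<delta> f g + corr_expectation \<delta> f' g"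
  using phi_growth2_integrable[OF assms(1) corr_cond_growth[OF assms(3)]]
    phi_growth2_integrable[OF assms(2) corr_cond_growth[OF assms(3)]]
  unfolding corr_expectation_def by (simp add: distrib_left distrib_right)

lemma corr_expectation_cmult1: "corr_expectation \<delta> (\<lambda>x. c * f x) g = c * corr_expectation \<delta> f g"
  unfolding corr_expectation_def by (subst integral_mult_right_zero[symmetric]) (simp add: algebra_simps)

text \<open>Completing the square in \<open>y\<close>: the joint density is the marginal density at
  \<open>x\<close> times the conditional density of a normal variable with mean \<delta> x and
  variance 1 - \<delta>^2.\<close>

lemma corr_density_phi:
  "corr_density \<delta> x y = \<phi> x * (\<phi> ((y - \<delta> * x) / sqrt (1 - \<delta>\<^sup>2)) / sqrt (1 - \<delta>\<^sup>2))"
proof -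
  have "(x\<^sup>2 - 2 * \<delta> * x * y + y\<^sup>2) / (2 * (1 - \<delta>\<^sup>2)) = x\<^sup>2 / 2 + ((y - \<delta> * x) / sqrt (1 - \<delta>\<^sup>2))\<^sup>2 / 2"
  proof -
    have "((y - \<delta> * x) / sqrt (1 - \<delta>\<^sup>2))\<^sup>2 = (y - \<delta> * x)\<^sup>2 / (1 - \<delta>\<^sup>2)"
      using sqrt_delta by (simp add: power_divide)
    then show ?thesis using delta_sq by (simp add: field_simps power2_eq_square)
  qed
  then have "exp (- ((x\<^sup>2 - 2 * \<delta> * x * y + y\<^sup>2) / (2 * (1 - \<delta>\<^sup>2)))) =
     exp (- x\<^sup>2 / 2) * exp (- ((y - \<delta> * x) / sqrt (1 - \<delta>\<^sup>2))\<^sup>2 / 2)"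
    by (simp add: exp_add[symmetric])
  then show ?thesis unfolding corr_density_def std_normal_density_def by (simp add: field_simps)
qed

lemma corr_cond_corr_density:
  assumes g: "lin_growth g"
  shows "integrable lborel (\<lambda>y. corr_density \<delta> x y * g y)"
    "(\<integral>y. corr_density \<delta> x y * g y \<partial>lborel) = \<phi> x * corr_cond \<delta> g x"
proof -
  let ?v = "sqrt (1 - \<delta>\<^sup>2)"
  have e: "corr_density \<delta> x (\<delta> * x + ?v * w) * g (\<delta> * x + ?v * w) =
     (\<phi> x / ?v) * (\<phi> w * g (\<delta> * x + ?v * w))" for w
    using sqrt_delta by (simp add: corr_density_phi)
  have "integrable lborel (\<lambda>w. corr_density \<delta> x (\<delta> * x + ?v * w) * g (\<delta> * x + ?v * w))"
    unfolding e using corr_cond_integrable[OF g] by simp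
  then show "integrable lborel (\<lambda>y. corr_density \<delta> x y * g y)"
    using sqrt_delta lborel_integrable_real_affine_iff[of ?v "\<lambda>y. corr_density \<delta> x y * g y" "\<delta> * x"] by simp
  have "(\<integral>y. corr_density \<delta> x y * g y \<partial>lborel) = \<bar>?v\<bar> *\<^sub>R (\<integral>w. corr_density \<delta> x (\<delta> * x + ?v * w) * g (\<delta> * x + ?v * w) \<partial>lborel)"
    using sqrt_delta by (intro lborel_integral_real_affine) simp
  also have "\<dots> = \<phi> x * corr_cond \<delta> g x"
    unfolding e corr_cond_def using sqrt_delta by simp
  finally show "(\<integral>y. corr_density \<delta> x y * g y \<partial>lborel) = \<phi> x * corr_cond \<delta> g x" .
qed

text \<open>The definition conditions on the first variable and hides the symmetry. Rewritten as a
  double integral against \<open>corr_density\<close>, which is symmetric in its arguments, it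
  becomes an instance of Fubini's theorem.\<close>

lemma corr_expectation_sym:
  assumes f: "lin_growth f" and g: "lin_growth g"
  shows "corr_expectation \<delta> f g = corr_expectation \<delta> g f"
proof -
  have [measurable]: "f \<in> borel_measurable borel" "g \<in> borel_measurable borel" using f g by auto
  have it: "corr_expectation \<delta> f g = (\<integral>x. (\<integral>y. f x * (corr_density \<delta> x y * g y) \<partial>lborel) \<partial>lborel)"
    if "lin_growth f" "lin_growth g" for f g
    unfolding corr_expectation_def using corr_cond_corr_density(2)[OF that(2)] by (simp add: mult.commute mult.left_commute)
  have nn: "0 \<le> corr_density \<delta> x y" for x y using sqrt_delta(1) by (simp add: corr_density_def)
  have "integrable (lborel \<Otimes>\<^sub>M lborel) (\<lambda>(x, y). f x * (corr_density \<delta> x y * g y))"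
  proof (rule lborel_pair.Fubini_integrable)
    show "AE x in lborel. integrable lborel (\<lambda>y. case (x, y) of (x, y) \<Rightarrow> f x * (corr_density \<delta> x y * g y))"
      using corr_cond_corr_density(1)[OF g] by simp
    have "(\<integral>y. norm (case (x, y) of (x, y) \<Rightarrow> f x * (corr_density \<delta> x y * g y)) \<partial>lborel) =
       \<phi> x * \<bar>f x\<bar> * corr_cond \<delta> (\<lambda>x. \<bar>g x\<bar>) x" for x
      using corr_cond_corr_density(2)[OF lin_growth_abs[OF g], of x] nn by (simp add: abs_mult mult.left_commute mult.commute)
    then show "integrable lborel (\<lambda>x. \<integral>y. norm (case (x, y) of (x, y) \<Rightarrow> f x * (corr_density \<delta> x y * g y)) \<partial>lborel)"
      using phi_growth2_integrable[OF lin_growth_abs[OF f] corr_cond_growth[OF lin_growth_abs[OF g]]] by simp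
  qed measurable
  then have "(\<integral>y. (\<integral>x. f x * (corr_density \<delta> x y * g y) \<partial>lborel) \<partial>lborel) = (\<integral>x. (\<integral>y. f x * (corr_density \<delta> x y * g y) \<partial>lborel) \<partial>lborel)"
    by (rule lborel_pair.Fubini_integral)
  then show ?thesis unfolding it[OF f g] it[OF g f]
    by (simp add: mult.commute mult.left_commute corr_density_sym)
qed

text \<open>Given \<open>x\<close>, the second variable is normal with mean \<delta> x and variance
  1 - \<delta>^2, so this is \<open>integral_abs_phi\<close> after rescaling to unit
  variance.\<close>

lemma corr_cond_abs:
  "corr_cond \<delta> (\<lambda>y. \<bar>y\<bar>) x = 2 * sqrt (1 - \<delta>\<^sup>2) * \<phi> (\<delta> / sqrt (1 - \<delta>\<^sup>2) * x) + \<delta> * x * erf (\<delta> * x / sqrt (2 * (1 - \<delta>\<^sup>2)))"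
proof -
  let ?v = "sqrt (1 - \<delta>\<^sup>2)"
  have "\<bar>\<delta> * x + ?v * w\<bar> = ?v * \<bar>\<delta> * x / ?v + w\<bar>" for w
  proof -
    have "\<delta> * x + ?v * w = ?v * (\<delta> * x / ?v + w)" using sqrt_delta(1) by (simp add: distrib_left)
    then show ?thesis using sqrt_delta(1) by (simp only: abs_mult abs_of_pos)
  qed
  then have "corr_cond \<delta> (\<lambda>y. \<bar>y\<bar>) x = (\<integral>w. ?v * (\<phi> w * \<bar>\<delta> * x / ?v + w\<bar>) \<partial>lborel)"
    unfolding corr_cond_def by (simp add: mult.left_commute)
  also have "\<dots> = ?v * (2 * \<phi> (\<delta> * x / ?v) + (\<delta> * x / ?v) * erf ((\<delta> * x / ?v) / sqrt 2))"
    by (simp add: integral_abs_phi)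
  also have "(\<delta> * x / ?v) / sqrt 2 = \<delta> * x / sqrt (2 * (1 - \<delta>\<^sup>2))" by (simp only: real_sqrt_mult divide_divide_eq_left mult.commute)
  finally show ?thesis using sqrt_delta(1) by (simp add: distrib_left del: real_sqrt_mult)
qed

lemma corr_cond_sgn: "corr_cond \<delta> sgn x = erf (\<delta> * x / sqrt (2 * (1 - \<delta>\<^sup>2)))"
proof -
  let ?v = "sqrt (1 - \<delta>\<^sup>2)"
  have "sgn (\<delta> * x + ?v * w) = sgn (\<delta> * x / ?v + w)" for w
  proof -
    have "\<delta> * x + ?v * w = ?v * (\<delta> * x / ?v + w)" using sqrt_delta(1) by (simp add: distrib_left)
    then show ?thesis using sqrt_delta(1) by (simp only: sgn_mult) simp
  qed
  then have "corr_cond \<delta> sgn x = erf ((\<delta> * x / ?v) / sqrt 2)" unfolding corr_cond_def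
    by (simp only: integral_sgn_phi)
  then show ?thesis by (simp add: real_sqrt_mult[symmetric] mult.commute)
qed

text \<open>Reflection of \<open>x\<close>: the sign is odd, whereas the conditional mean of the
  absolute value is even. This removes the mixed terms of first order, which is why the closed form
  has no summand linear in one \<nu> alone.\<close>

lemma corr_expectation_sgn_abs: "corr_expectation \<delta> sgn (\<lambda>y. \<bar>y\<bar>) = 0"
proof -
  have ev: "corr_cond \<delta> (\<lambda>y. \<bar>y\<bar>) (- x) = corr_cond \<delta> (\<lambda>y. \<bar>y\<bar>) x" for x
    unfolding corr_cond_abs by (simp add: phi_even erf_minus)
  have "corr_expectation \<delta> sgn (\<lambda>y. \<bar>y\<bar>) = \<bar>-1\<bar> *\<^sub>R (\<integral>x. \<phi> (0 + (-1) * x) * sgn (0 + (-1) * x) * corr_cond \<delta> (\<lambda>y. \<bar>y\<bar>) (0 + (-1) * x) \<partial>lborel)"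
    unfolding corr_expectation_def by (rule lborel_integral_real_affine) simp
  also have "\<dots> = - corr_expectation \<delta> sgn (\<lambda>y. \<bar>y\<bar>)"
    by (simp add: phi_even sgn_minus ev corr_expectation_def)
  finally show ?thesis by simp
qed

text \<open>The product of the two exponentials is a multiple of the normal density with variance 1
  / (1 + c^2), so the integral is one of its absolute moments.\<close>

lemma gauss_moment_abs_odd:
  fixes c :: real
  defines "s \<equiv> 1 / sqrt (1 + c\<^sup>2)"
  shows "(\<integral>x. \<phi> x * \<bar>x\<bar> ^ (2 * k + 1) * exp (- (c\<^sup>2 * x\<^sup>2 / 2)) \<partial>lborel) = 2 ^ k * fact k * sqrt (2 / pi) / (1 + c\<^sup>2) ^ (k + 1)"
proof -
  have p: "0 < 1 + c\<^sup>2" by (simp add: add_pos_nonneg)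
  then have s: "0 < s" "s\<^sup>2 = 1 / (1 + c\<^sup>2)" by (auto simp: s_def power_divide)
  have e: "\<phi> x * exp (- (c\<^sup>2 * x\<^sup>2 / 2)) = s * normal_density 0 s x" for x
  proof -
    have "s * (1 / sqrt (2 * pi * s\<^sup>2)) = 1 / sqrt (2 * pi)" using s(1) by (simp add: real_sqrt_mult)
    then have "s * normal_density 0 s x = 1 / sqrt (2 * pi) * exp (- x\<^sup>2 / (2 * s\<^sup>2))"
      unfolding normal_density_def by (simp only: mult.assoc[symmetric] diff_zero)
    moreover have "exp (- x\<^sup>2 / 2) * exp (- (c\<^sup>2 * x\<^sup>2 / 2)) = exp (- x\<^sup>2 / (2 * s\<^sup>2))"
      using p unfolding s(2) exp_add[symmetric] by (simp add: field_simps)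
    ultimately show ?thesis unfolding std_normal_density_def by (simp only: mult.assoc)
  qed
  have "(\<integral>x. \<phi> x * \<bar>x\<bar> ^ (2 * k + 1) * exp (- (c\<^sup>2 * x\<^sup>2 / 2)) \<partial>lborel) =
    (\<integral>x. s * (normal_density 0 s x * \<bar>x - 0\<bar> ^ (2 * k + 1)) \<partial>lborel)"
    using e by (intro Bochner_Integration.integral_cong) (auto simp: mult.assoc mult.left_commute mult.commute)
  also have "\<dots> = s * (2 ^ k * s ^ (2 * k + 1) * fact k * sqrt (2 / pi))"
    using integral_normal_moment_abs_odd[OF s(1), of 0 k] by simp
  also have "\<dots> = 2 ^ k * fact k * sqrt (2 / pi) * (s\<^sup>2) ^ (k + 1)"
    by (simp add: power_mult[symmetric] algebra_simps power2_eq_square mult_2_right power_add)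
  finally show ?thesis using p by (simp add: s(2) power_divide)
qed

text \<open>The inner integral is \<open>erf\<close> up to a factor. Integrating over
  \<open>x\<close> first leaves a rational function of \<open>u\<close>: the derivative of an
  arctangent for \<open>k = 0\<close>, and the reciprocal of a squared quadratic for
  \<open>k = 1\<close>.\<close>

lemma gauss_erf_Fubini:
  "(\<integral>x. \<phi> x * \<bar>x\<bar> ^ (2 * k + 1) * (LBINT u=0..1. exp (- (c\<^sup>2 * x\<^sup>2 / 2 * u\<^sup>2))) \<partial>lborel) =
   (LBINT u=0..1. 2 ^ k * fact k * sqrt (2 / pi) / (1 + c\<^sup>2 * u\<^sup>2) ^ (k + 1))"
proof -
  let ?g = "\<lambda>x u. \<phi> x * \<bar>x\<bar> ^ (2 * k + 1) * (indicator {0<..<1::real} u * exp (- (c\<^sup>2 * x\<^sup>2 / 2 * u\<^sup>2)))"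
  have i: "integrable lborel (\<lambda>u. indicator {0<..<1::real} u * exp (- (c\<^sup>2 * x\<^sup>2 / 2 * u\<^sup>2)))" for x
    by (rule bounded_on_unit_integrable[of _ 1]) auto
  have b: "(\<integral>u. norm (?g x u) \<partial>lborel) \<le> \<phi> x * \<bar>x\<bar> ^ (2 * k + 1)" for x
  proof -
    have "(\<integral>u. norm (?g x u) \<partial>lborel) \<le> (\<integral>u. \<phi> x * \<bar>x\<bar> ^ (2 * k + 1) * indicator {0<..<1::real} u \<partial>lborel)"
    proof (rule Bochner_Integration.integral_mono)
      show "integrable lborel (\<lambda>u. norm (?g x u))" using i[of x] by (intro integrable_norm integrable_mult_right)
      show "norm (?g x u) \<le> \<phi> x * \<bar>x\<bar> ^ (2 * k + 1) * indicator {0<..<1::real} u" for u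
        by (auto simp: indicator_def abs_mult intro!: mult_left_le)
    qed simp
    then show ?thesis by simp
  qed
  have "integrable (lborel \<Otimes>\<^sub>M lborel) (\<lambda>(x, u). ?g x u)"
  proof (rule lborel_pair.Fubini_integrable)
    show "AE x in lborel. integrable lborel (\<lambda>u. case (x, u) of (x, u) \<Rightarrow> ?g x u)"
      using i by (auto intro!: integrable_mult_right)
    show "integrable lborel (\<lambda>x. \<integral>u. norm (case (x, u) of (x, u) \<Rightarrow> ?g x u) \<partial>lborel)"
    proof (rule Bochner_Integration.integrable_bound[OF integrable_std_normal_moment_abs[of "2 * k + 1"]])
      show "AE x in lborel. norm (\<integral>u. norm (case (x, u) of (x, u) \<Rightarrow> ?g x u) \<partial>lborel) \<le> norm (\<phi> x * \<bar>x\<bar> ^ (2 * k + 1))"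
        using b by (intro AE_I2) (simp add: abs_mult)
    qed measurable
  qed measurable
  then have "(\<integral>u. (\<integral>x. ?g x u \<partial>lborel) \<partial>lborel) = (\<integral>x. (\<integral>u. ?g x u \<partial>lborel) \<partial>lborel)"
    by (rule lborel_pair.Fubini_integral)
  moreover have "(\<integral>u. ?g x u \<partial>lborel) = \<phi> x * \<bar>x\<bar> ^ (2 * k + 1) * (LBINT u=0..1. exp (- (c\<^sup>2 * x\<^sup>2 / 2 * u\<^sup>2)))" for x
    unfolding LBINT01 by (rule integral_mult_right_zero)
  moreover have "(\<integral>x. ?g x u \<partial>lborel) = indicator {0<..<1} u * (2 ^ k * fact k * sqrt (2 / pi) / (1 + c\<^sup>2 * u\<^sup>2) ^ (k + 1))" for u
  proof -
    have "(\<integral>x. ?g x u \<partial>lborel) = (\<integral>x. indicator {0<..<1} u * (\<phi> x * \<bar>x\<bar> ^ (2 * k + 1) * exp (- ((c * u)\<^sup>2 * x\<^sup>2 / 2))) \<partial>lborel)"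
      by (intro Bochner_Integration.integral_cong) (auto simp: power_mult_distrib mult.commute mult.left_commute)
    also have "\<dots> = indicator {0<..<1} u * (2 ^ k * fact k * sqrt (2 / pi) / (1 + (c * u)\<^sup>2) ^ (k + 1))"
      by (subst integral_mult_right_zero, subst gauss_moment_abs_odd) rule
    finally show ?thesis by (simp add: power_mult_distrib)
  qed
  ultimately show ?thesis unfolding LBINT01 by simp
qed

section \<open>Arcsine formulas for centred signs and absolute values\<close>

lemma arctan_delta: "arctan (\<delta> / sqrt (1 - \<delta>\<^sup>2)) = arcsin \<delta>"
  using arcsin_arctan[of \<delta>] delta by (simp add: abs_less_iff)

lemma LBINT_arctan1: "(LBINT u=0..1. \<kappa> / (1 + \<kappa>\<^sup>2 * u\<^sup>2)) = arctan \<kappa>" for \<kappa> :: real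
proof -
  have p: "1 + \<kappa>\<^sup>2 * u\<^sup>2 \<noteq> 0" for u by (metis add_pos_nonneg less_numeral_extra(1,3) mult_nonneg_nonneg zero_le_power2)
  have "(LBINT u=ereal 0..ereal 1. \<kappa> / (1 + \<kappa>\<^sup>2 * u\<^sup>2)) = arctan (\<kappa> * 1) - arctan (\<kappa> * 0)"
  proof (rule interval_integral_FTC_finite)
    show "continuous_on {min 0 1..max 0 1} (\<lambda>u. \<kappa> / (1 + \<kappa>\<^sup>2 * u\<^sup>2))" using p by (intro continuous_intros) auto
    fix u :: real
    show "((\<lambda>u. arctan (\<kappa> * u)) has_vector_derivative \<kappa> / (1 + \<kappa>\<^sup>2 * u\<^sup>2)) (at u within {min 0 1..max 0 1})"
      unfolding has_real_derivative_iff_has_vector_derivative[symmetric]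
      by (auto intro!: derivative_eq_intros simp: power_mult_distrib divide_inverse)
  qed
  then show ?thesis by (simp add: zero_ereal_def one_ereal_def)
qed

lemma LBINT_arctan2: "(LBINT u=0..1. 2 * \<kappa> / (1 + \<kappa>\<^sup>2 * u\<^sup>2)\<^sup>2) = \<kappa> / (1 + \<kappa>\<^sup>2) + arctan \<kappa>" for \<kappa> :: real
proof -
  have pp: "0 < 1 + \<kappa>\<^sup>2 * u\<^sup>2" for u by (simp add: add_pos_nonneg)
  then have p: "1 + \<kappa>\<^sup>2 * u\<^sup>2 \<noteq> 0" for u by (metis less_irrefl)
  have "(LBINT u=ereal 0..ereal 1. 2 * \<kappa> / (1 + \<kappa>\<^sup>2 * u\<^sup>2)\<^sup>2) = (\<kappa> * 1 / (1 + \<kappa>\<^sup>2 * 1\<^sup>2) + arctan (\<kappa> * 1)) - (\<kappa> * 0 / (1 + \<kappa>\<^sup>2 * 0\<^sup>2) + arctan (\<kappa> * 0))"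
  proof (rule interval_integral_FTC_finite)
    show "continuous_on {min 0 1..max 0 1} (\<lambda>u. 2 * \<kappa> / (1 + \<kappa>\<^sup>2 * u\<^sup>2)\<^sup>2)" using p by (intro continuous_intros) auto
    fix u :: real
    \<comment> \<open>Over the common denominator the numerators add up to 2 \<kappa>, since the
      terms in u^2 cancel.\<close>
    have e: "(\<kappa> * (1 + \<kappa>\<^sup>2 * u\<^sup>2) - \<kappa> * u * (\<kappa>\<^sup>2 * (2 * u))) / (1 + \<kappa>\<^sup>2 * u\<^sup>2)\<^sup>2 + \<kappa> / (1 + \<kappa>\<^sup>2 * u\<^sup>2) = 2 * \<kappa> / (1 + \<kappa>\<^sup>2 * u\<^sup>2)\<^sup>2"
    proof -
      have "\<kappa> / (1 + \<kappa>\<^sup>2 * u\<^sup>2) = \<kappa> * (1 + \<kappa>\<^sup>2 * u\<^sup>2) / (1 + \<kappa>\<^sup>2 * u\<^sup>2)\<^sup>2" using p[of u] by (simp add: power2_eq_square)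
      then show ?thesis by (simp add: add_divide_distrib[symmetric] algebra_simps power2_eq_square)
    qed
    show "((\<lambda>u. \<kappa> * u / (1 + \<kappa>\<^sup>2 * u\<^sup>2) + arctan (\<kappa> * u)) has_vector_derivative 2 * \<kappa> / (1 + \<kappa>\<^sup>2 * u\<^sup>2)\<^sup>2) (at u within {min 0 1..max 0 1})"
      unfolding has_real_derivative_iff_has_vector_derivative[symmetric] e[symmetric] using p[of u]
      by (auto intro!: derivative_eq_intros simp: power_mult_distrib) (simp add: power2_eq_square divide_inverse algebra_simps)
  qed
  then show ?thesis by (simp add: zero_ereal_def one_ereal_def)
qed

lemma erf_delta: "erf (\<delta> * x / sqrt (2 * (1 - \<delta>\<^sup>2))) =
  sqrt (2 / pi) * (\<delta> / sqrt (1 - \<delta>\<^sup>2)) * (x * (LBINT u=0..1. exp (- ((\<delta> / sqrt (1 - \<delta>\<^sup>2))\<^sup>2 * x\<^sup>2 / 2 * u\<^sup>2))))"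
proof -
  have e: "\<delta> * x / sqrt (2 * (1 - \<delta>\<^sup>2)) = (\<delta> / sqrt (1 - \<delta>\<^sup>2)) * x / sqrt 2"
    by (simp add: real_sqrt_mult[symmetric] mult.commute)
  have sq: "((\<delta> / sqrt (1 - \<delta>\<^sup>2)) * x / sqrt 2)\<^sup>2 = (\<delta> / sqrt (1 - \<delta>\<^sup>2))\<^sup>2 * x\<^sup>2 / 2"
    by (simp add: power_divide power_mult_distrib)
  have c: "2 / sqrt pi * (y * x / sqrt 2) = sqrt (2 / pi) * y * x" for y
    by (simp add: real_sqrt_divide field_simps)
  show ?thesis unfolding e erf_eq sq c by (simp only: mult.assoc)
qed

text \<open>Sheppard's arcsine law. Here \<kappa> is the tangent of arcsin \<delta>, and the extra
  factor \<open>x\<close> in \<open>erf_delta\<close> turns the sign into an absolute value, as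
  needed for \<open>gauss_erf_Fubini\<close> with \<open>k = 0\<close>.\<close>

lemma corr_expectation_sgn_sgn: "corr_expectation \<delta> sgn sgn = 2 / pi * arcsin \<delta>"
proof -
  define \<kappa> where "\<kappa> = \<delta> / sqrt (1 - \<delta>\<^sup>2)"
  have "corr_expectation \<delta> sgn sgn = (\<integral>x. (sqrt (2 / pi) * \<kappa>) * (\<phi> x * \<bar>x\<bar> ^ (2 * 0 + 1) * (LBINT u=0..1. exp (- (\<kappa>\<^sup>2 * x\<^sup>2 / 2 * u\<^sup>2)))) \<partial>lborel)"
    unfolding corr_expectation_def corr_cond_sgn erf_delta \<kappa>_def[symmetric]
    by (intro Bochner_Integration.integral_cong refl) (simp add: abs_sgn mult.assoc mult.left_commute)
  also have "\<dots> = (sqrt (2 / pi) * \<kappa>) * (LBINT u=0..1. sqrt (2 / pi) / (1 + \<kappa>\<^sup>2 * u\<^sup>2))"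
    by (subst integral_mult_right_zero, subst gauss_erf_Fubini) simp
  also have "\<dots> = (LBINT u=0..1. (2 / pi) * (\<kappa> / (1 + \<kappa>\<^sup>2 * u\<^sup>2)))"
    by (subst interval_lebesgue_integral_mult_right[symmetric]) (simp add: mult_ac)
  also have "\<dots> = 2 / pi * arctan \<kappa>"
    by (subst interval_lebesgue_integral_mult_right) (simp add: LBINT_arctan1)
  finally show ?thesis by (simp add: \<kappa>_def arctan_delta)
qed

text \<open>Up to the factor 2 / pi, the Gaussian term of \<open>corr_cond_abs\<close> contributes
  v^3 and its \<open>erf\<close> term contributes \<delta> (\<delta> v + arcsin \<delta>), with v =
  sqrt(1 - \<delta>^2). The relation v^2 + \<delta>^2 = 1 merges the powers of v.\<close>

lemma corr_expectation_abs_abs: "corr_expectation \<delta> (\<lambda>x. \<bar>x\<bar>) (\<lambda>x. \<bar>x\<bar>) = 2 / pi * (sqrt (1 - \<delta>\<^sup>2) + \<delta> * arcsin \<delta>)"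
proof -
  define v where "v = sqrt (1 - \<delta>\<^sup>2)"
  define \<kappa> where "\<kappa> = \<delta> / v"
  have v: "0 < v" "v\<^sup>2 = 1 - \<delta>\<^sup>2" using sqrt_delta by (auto simp: v_def)
  have k1: "1 + \<kappa>\<^sup>2 = 1 / v\<^sup>2" using v by (simp add: \<kappa>_def power_divide field_simps)
  have gi: "lin_growth (\<lambda>x. \<bar>x\<bar>)" using lin_growth_abs_shift[of 0] by simp
  have kphi: "\<phi> (\<kappa> * x) = exp (- (\<kappa>\<^sup>2 * x\<^sup>2 / 2)) / sqrt (2 * pi)" for x
    by (simp add: std_normal_density_def power_mult_distrib)
  let ?A = "\<lambda>x. (2 * v / sqrt (2 * pi)) * (\<phi> x * \<bar>x\<bar> ^ (2 * 0 + 1) * exp (- (\<kappa>\<^sup>2 * x\<^sup>2 / 2)))"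
  let ?B = "\<lambda>x. (\<delta> * sqrt (2 / pi) * \<kappa>) * (\<phi> x * \<bar>x\<bar> ^ (2 * 1 + 1) * (LBINT u=0..1. exp (- (\<kappa>\<^sup>2 * x\<^sup>2 / 2 * u\<^sup>2))))"
  have AB: "\<phi> x * \<bar>x\<bar> * corr_cond \<delta> (\<lambda>x. \<bar>x\<bar>) x = ?A x + ?B x" for x
    unfolding corr_cond_abs erf_delta v_def[symmetric] \<kappa>_def[symmetric] kphi
    by (simp add: algebra_simps power3_eq_cube)
  have iA: "integrable lborel ?A"
    by (intro integrable_mult_right Bochner_Integration.integrable_bound[OF integral_phi_abs(2)])
       (auto simp: abs_mult intro!: mult_left_le)
  have "integrable lborel (\<lambda>x. (\<phi> x * \<bar>x\<bar> * corr_cond \<delta> (\<lambda>x. \<bar>x\<bar>) x) - ?A x)"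
    using phi_growth2_integrable[OF gi corr_cond_growth[OF gi]] iA by (rule Bochner_Integration.integrable_diff)
  then have iB: "integrable lborel ?B" unfolding AB by simp
  have "corr_expectation \<delta> (\<lambda>x. \<bar>x\<bar>) (\<lambda>x. \<bar>x\<bar>) = (\<integral>x. ?A x \<partial>lborel) + (\<integral>x. ?B x \<partial>lborel)"
    unfolding corr_expectation_def AB by (rule Bochner_Integration.integral_add[OF iA iB])
  also have "(\<integral>x. ?A x \<partial>lborel) = (2 * v / sqrt (2 * pi)) * (sqrt (2 / pi) * v\<^sup>2)"
    by (subst integral_mult_right_zero, subst gauss_moment_abs_odd) (simp add: k1)
  also have "\<dots> = 2 / pi * v ^ 3"
    by (simp add: real_sqrt_mult real_sqrt_divide field_simps power2_eq_square power3_eq_cube)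
  also have "(\<integral>x. ?B x \<partial>lborel) = (\<delta> * sqrt (2 / pi) * \<kappa>) * (LBINT u=0..1. 2 * sqrt (2 / pi) / (1 + \<kappa>\<^sup>2 * u\<^sup>2)\<^sup>2)"
    by (subst integral_mult_right_zero, subst gauss_erf_Fubini) (simp add: numeral_2_eq_2)
  also have "\<dots> = (LBINT u=0..1. (2 / pi * \<delta>) * (2 * \<kappa> / (1 + \<kappa>\<^sup>2 * u\<^sup>2)\<^sup>2))"
    by (subst interval_lebesgue_integral_mult_right[symmetric])
       (simp add: mult_ac)
  also have "\<dots> = (2 / pi * \<delta>) * (\<kappa> / (1 + \<kappa>\<^sup>2) + arctan \<kappa>)"
    by (subst interval_lebesgue_integral_mult_right) (simp add: LBINT_arctan2)
  also have "arctan \<kappa> = arcsin \<delta>" by (simp add: \<kappa>_def v_def arctan_delta)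
  also have "\<kappa> / (1 + \<kappa>\<^sup>2) = \<delta> * v" unfolding k1 using v(1) by (simp add: \<kappa>_def power2_eq_square)
  also have "2 / pi * v ^ 3 + (2 / pi * \<delta>) * (\<delta> * v + arcsin \<delta>) = 2 / pi * (v * (v\<^sup>2 + \<delta>\<^sup>2) + \<delta> * arcsin \<delta>)"
    by (simp add: power2_eq_square power3_eq_cube algebra_simps add_divide_distrib)
  finally show ?thesis unfolding v(2) by (simp add: v_def)
qed

section \<open>Expectations that involve the remainder\<close>

lemma corr_expectation_abs_remainder:
  assumes g: "lin_growth g"
  shows "corr_expectation \<delta> (abs_remainder a) g = 2 * a\<^sup>2 * (LBINT t=0..1. (1 - t) * (\<phi> (a * t) * corr_cond \<delta> g (- a * t)))"
proof -
  note corr_cond_measurable[OF g, measurable]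
  have "corr_expectation \<delta> (abs_remainder a) g = (\<integral>x. abs_remainder a x * (\<phi> x * corr_cond \<delta> g x) \<partial>lborel)"
    unfolding corr_expectation_def by (simp add: mult.assoc mult.left_commute)
  then show ?thesis by (simp add: integral_abs_remainder phi_even)
qed

text \<open>The origin of the constant sqrt(pi / 2) in the third and fourth summands of the closed
  form.\<close>

lemma pi_mult_phi: "pi * \<phi> x = sqrt (pi / 2) / exp (x\<^sup>2 / 2)"
proof -
  have "pi / sqrt (2 * pi) = (sqrt pi * sqrt pi) / (sqrt 2 * sqrt pi)" by (simp add: real_sqrt_mult)
  also have "\<dots> = sqrt (pi / 2)" unfolding real_sqrt_divide by (rule nonzero_mult_divide_mult_cancel_right) simp
  finally have *: "pi / sqrt (2 * pi) = sqrt (pi / 2)" .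
  have "pi * \<phi> x = (pi / sqrt (2 * pi)) * exp (- (x\<^sup>2 / 2))" by (simp add: std_normal_density_def)
  then show ?thesis unfolding * exp_minus by (simp only: divide_inverse)
qed

text \<open>The contribution of one index j to the third summand. The remainder places the first
  variable at \<open>- \<nu> * t\<close>, and the two integrals come from the two terms of
  \<open>corr_cond_abs\<close>. In the first, the exponents combine because 1 + \<delta>^2 / (1 -
  \<delta>^2) = 1 / (1 - \<delta>^2).\<close>

lemma corr_expectation_abs_remainder_abs:
  "pi / 2 * corr_expectation \<delta> (abs_remainder \<nu>) (\<lambda>y. \<bar>y\<bar>) =
    sqrt (1 - \<delta>\<^sup>2) * (LBINT t=0..1. (1 - t) * \<nu>\<^sup>2 / exp (\<nu>\<^sup>2 * t\<^sup>2 / (2 - 2 * \<delta>\<^sup>2))) +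
    sqrt (pi / 2) * \<bar>\<delta>\<bar> * (\<nu>\<^sup>2 * (LBINT t=0..1. (1 - t) * \<bar>\<nu> * t\<bar> / exp (\<nu>\<^sup>2 * t\<^sup>2 / 2) * erf (\<bar>\<delta> * \<nu> * t\<bar> / sqrt (2 * (1 - \<delta>\<^sup>2)))))"
proof -
  define v where "v = sqrt (1 - \<delta>\<^sup>2)"
  have v: "0 < v" "v\<^sup>2 = 1 - \<delta>\<^sup>2" using sqrt_delta by (auto simp: v_def)
  have gi: "lin_growth (\<lambda>x. \<bar>x\<bar>)" using lin_growth_abs_shift[of 0] by simp
  let ?A = "\<lambda>t. (1 - t) * \<nu>\<^sup>2 / exp (\<nu>\<^sup>2 * t\<^sup>2 / (2 - 2 * \<delta>\<^sup>2))"
  let ?B = "\<lambda>t. (1 - t) * \<bar>\<nu> * t\<bar> / exp (\<nu>\<^sup>2 * t\<^sup>2 / 2) * erf (\<bar>\<delta> * \<nu> * t\<bar> / sqrt (2 * (1 - \<delta>\<^sup>2)))"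
  have pt: "pi * \<nu>\<^sup>2 * ((1 - t) * (\<phi> (\<nu> * t) * corr_cond \<delta> (\<lambda>y. \<bar>y\<bar>) (- \<nu> * t))) = v * ?A t + sqrt (pi / 2) * \<bar>\<delta>\<bar> * \<nu>\<^sup>2 * ?B t" for t
  proof -
    have 1: "pi * \<phi> (\<nu> * t) * (2 * v * \<phi> (\<delta> / v * (- \<nu> * t))) = v / exp (\<nu>\<^sup>2 * t\<^sup>2 / (2 - 2 * \<delta>\<^sup>2))"
    proof -
      have "(\<nu> * t)\<^sup>2 / 2 + (\<delta> / v * (- \<nu> * t))\<^sup>2 / 2 = (\<nu>\<^sup>2 * t\<^sup>2 / 2) * (1 + \<delta>\<^sup>2 / v\<^sup>2)"
        by (simp add: power_divide power_mult_distrib algebra_simps)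
      also have "1 + \<delta>\<^sup>2 / v\<^sup>2 = 1 / v\<^sup>2" using v by (simp add: field_simps)
      finally have e: "(\<nu> * t)\<^sup>2 / 2 + (\<delta> / v * (- \<nu> * t))\<^sup>2 / 2 = \<nu>\<^sup>2 * t\<^sup>2 / (2 - 2 * \<delta>\<^sup>2)"
        unfolding v(2) by (simp add: right_diff_distrib)
      have "pi * \<phi> x * \<phi> y = 1 / (2 * exp (x\<^sup>2 / 2 + y\<^sup>2 / 2))" for x y
      proof -
        have "\<phi> x * \<phi> y = (1 / sqrt (2 * pi) * (1 / sqrt (2 * pi))) * (exp (- (x\<^sup>2 / 2)) * exp (- (y\<^sup>2 / 2)))"
          unfolding std_normal_density_def by (simp only: mult_ac minus_divide_left)
        also have "1 / sqrt (2 * pi) * (1 / sqrt (2 * pi)) = 1 / (2 * pi)"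
          by (simp only: times_divide_times_eq) simp
        also have "exp (- (x\<^sup>2 / 2)) * exp (- (y\<^sup>2 / 2)) = inverse (exp (x\<^sup>2 / 2 + y\<^sup>2 / 2))"
          by (simp only: exp_add exp_minus inverse_mult_distrib)
        finally have "\<phi> x * \<phi> y = 1 / (2 * pi) * inverse (exp (x\<^sup>2 / 2 + y\<^sup>2 / 2))" .
        then show ?thesis by (simp add: field_simps)
      qed
      from this[of "\<nu> * t" "\<delta> / v * (- \<nu> * t)"] have
        "pi * \<phi> (\<nu> * t) * \<phi> (\<delta> / v * (- \<nu> * t)) = 1 / (2 * exp (\<nu>\<^sup>2 * t\<^sup>2 / (2 - 2 * \<delta>\<^sup>2)))"
        by (simp only: e)
      then have "(2 * v) * (pi * \<phi> (\<nu> * t) * \<phi> (\<delta> / v * (- \<nu> * t))) = v / exp (\<nu>\<^sup>2 * t\<^sup>2 / (2 - 2 * \<delta>\<^sup>2))"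
        by simp
      then show ?thesis by (simp only: mult_ac)
    qed
    \<comment> \<open>The map from z to z erf(z / c) is even, which is where the absolute values in
      the integrand come from.\<close>
    have 2: "\<delta> * (- \<nu> * t) * erf (\<delta> * (- \<nu> * t) / sqrt (2 * (1 - \<delta>\<^sup>2))) = \<bar>\<delta>\<bar> * \<bar>\<nu> * t\<bar> * erf (\<bar>\<delta> * \<nu> * t\<bar> / sqrt (2 * (1 - \<delta>\<^sup>2)))"
    proof -
      have "- x * erf (- x / c) = \<bar>x\<bar> * erf (\<bar>x\<bar> / c)" for x c by (cases "0 \<le> x") (auto simp: erf_minus)
      from this[of "\<delta> * \<nu> * t" "sqrt (2 * (1 - \<delta>\<^sup>2))"] show ?thesis by (simp add: abs_mult mult.assoc)
    qed
    have "pi * \<nu>\<^sup>2 * ((1 - t) * (\<phi> (\<nu> * t) * corr_cond \<delta> (\<lambda>y. \<bar>y\<bar>) (- \<nu> * t))) =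
       \<nu>\<^sup>2 * (1 - t) * (pi * \<phi> (\<nu> * t) * (2 * v * \<phi> (\<delta> / v * (- \<nu> * t)))) +
       \<nu>\<^sup>2 * (1 - t) * (pi * \<phi> (\<nu> * t)) * (\<delta> * (- \<nu> * t) * erf (\<delta> * (- \<nu> * t) / sqrt (2 * (1 - \<delta>\<^sup>2))))"
      unfolding corr_cond_abs v_def[symmetric] by (simp only: distrib_left mult.assoc mult.left_commute mult.commute)
    then show ?thesis unfolding 1 2 unfolding pi_mult_phi by (simp add: power_mult_distrib mult.commute mult.left_commute)
  qed
  have iA: "integrable lborel (\<lambda>t. indicator {0<..<1} t * ?A t)"
  proof (rule bounded_on_unit_integrable)
    fix t :: real assume t: "0 < t" "t < 1"
    have "1 \<le> exp (\<nu>\<^sup>2 * t\<^sup>2 / (2 - 2 * \<delta>\<^sup>2))" using delta_sq by simp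
    then have "1 - t \<le> exp (\<nu>\<^sup>2 * t\<^sup>2 / (2 - 2 * \<delta>\<^sup>2))" using t by linarith
    then show "\<bar>?A t\<bar> \<le> \<nu>\<^sup>2" using t by (simp add: abs_mult divide_le_eq mult.commute[of "\<nu>\<^sup>2"] mult_right_mono)
  qed measurable
  have iB: "integrable lborel (\<lambda>t. indicator {0<..<1} t * ?B t)"
  proof (rule bounded_on_unit_integrable)
    fix t :: real assume t: "0 < t" "t < 1"
    have "inverse (exp (\<nu>\<^sup>2 * t\<^sup>2 / 2)) \<le> 1" by (simp add: inverse_le_1_iff)
    then have "(1 - t) * \<bar>\<nu> * t\<bar> * inverse (exp (\<nu>\<^sup>2 * t\<^sup>2 / 2)) * \<bar>erf (\<bar>\<delta> * \<nu> * t\<bar> / sqrt (2 * (1 - \<delta>\<^sup>2)))\<bar> \<le> 1 * \<bar>\<nu>\<bar> * 1 * 1"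
      using t erf_bound by (intro mult_mono) (auto simp: abs_mult mult_left_le)
    moreover have "\<bar>?B t\<bar> = (1 - t) * \<bar>\<nu> * t\<bar> * inverse (exp (\<nu>\<^sup>2 * t\<^sup>2 / 2)) * \<bar>erf (\<bar>\<delta> * \<nu> * t\<bar> / sqrt (2 * (1 - \<delta>\<^sup>2)))\<bar>"
      unfolding divide_inverse[of _ "exp _"] using t by (simp only: abs_mult abs_of_nonneg abs_inverse abs_exp_cancel abs_abs diff_ge_0_iff_ge less_imp_le)
    ultimately show "\<bar>?B t\<bar> \<le> \<bar>\<nu>\<bar>" by simp
  qed measurable
  have "pi / 2 * corr_expectation \<delta> (abs_remainder \<nu>) (\<lambda>y. \<bar>y\<bar>) = (LBINT t=0..1. pi * \<nu>\<^sup>2 * ((1 - t) * (\<phi> (\<nu> * t) * corr_cond \<delta> (\<lambda>y. \<bar>y\<bar>) (- \<nu> * t))))"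
    unfolding corr_expectation_abs_remainder[OF gi] by (subst interval_lebesgue_integral_mult_right) (simp add: mult.assoc)
  also have "\<dots> = v * (LBINT t=0..1. ?A t) + sqrt (pi / 2) * \<bar>\<delta>\<bar> * \<nu>\<^sup>2 * (LBINT t=0..1. ?B t)"
    unfolding pt by (rule LBINT01_lin[OF iA iB])
  finally show ?thesis by (simp add: v_def mult.assoc)
qed

text \<open>The contribution of one index j to the fourth summand. The first variable sits at
  \<open>- \<nu> * t\<close>, and oddness of \<open>erf\<close> turns the weight
  \<open>1 - t\<close> into \<open>t - 1\<close>.\<close>

lemma corr_expectation_abs_remainder_sgn:
  "pi / 2 * corr_expectation \<delta> (abs_remainder \<nu>) sgn =
    sqrt (pi / 2) * \<nu> * (LBINT t=0..1. (t - 1) * \<nu> / exp (\<nu>\<^sup>2 * t\<^sup>2 / 2) * erf (\<delta> * \<nu> * t / sqrt (2 * (1 - \<delta>\<^sup>2))))"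
proof -
  have pt: "pi * \<nu>\<^sup>2 * ((1 - t) * (\<phi> (\<nu> * t) * corr_cond \<delta> sgn (- \<nu> * t))) =
     (sqrt (pi / 2) * \<nu>) * ((t - 1) * \<nu> / exp (\<nu>\<^sup>2 * t\<^sup>2 / 2) * erf (\<delta> * \<nu> * t / sqrt (2 * (1 - \<delta>\<^sup>2))))" for t
  proof -
    have "corr_cond \<delta> sgn (- \<nu> * t) = - erf (\<delta> * \<nu> * t / sqrt (2 * (1 - \<delta>\<^sup>2)))"
      unfolding corr_cond_sgn by (simp add: erf_minus[symmetric] mult.assoc)
    then have "pi * \<nu>\<^sup>2 * ((1 - t) * (\<phi> (\<nu> * t) * corr_cond \<delta> sgn (- \<nu> * t))) =
      \<nu>\<^sup>2 * (t - 1) * (pi * \<phi> (\<nu> * t)) * erf (\<delta> * \<nu> * t / sqrt (2 * (1 - \<delta>\<^sup>2)))"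
      by (simp add: algebra_simps)
    then show ?thesis unfolding pi_mult_phi by (simp add: power_mult_distrib power2_eq_square mult.commute mult.left_commute)
  qed
  have "pi / 2 * corr_expectation \<delta> (abs_remainder \<nu>) sgn = (LBINT t=0..1. pi * \<nu>\<^sup>2 * ((1 - t) * (\<phi> (\<nu> * t) * corr_cond \<delta> sgn (- \<nu> * t))))"
    unfolding corr_expectation_abs_remainder[OF lin_growth_sgn] by (subst interval_lebesgue_integral_mult_right) (simp add: mult.assoc)
  then show ?thesis unfolding pt by (simp only: interval_lebesgue_integral_mult_right)
qed

text \<open>Both remainders localise, so the expectation is an integral of the joint density over
  the points (- a t, - b s) with the two linear weights. The factor pi / 2 cancels the constants 2
  and 2 and the 2 pi of the density.\<close>

lemma corr_expectation_abs_remainder_abs_remainder: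
  "pi / 2 * corr_expectation \<delta> (abs_remainder a) (abs_remainder b) = a\<^sup>2 * b\<^sup>2 / sqrt (1 - \<delta>\<^sup>2) *
     (LBINT s=0..1. (LBINT t=0..1. (1 - t) * (1 - s) *
        exp (- ((a\<^sup>2 * t\<^sup>2 - 2 * \<delta> * a * b * t * s + b\<^sup>2 * s\<^sup>2) / (2 * (1 - \<delta>\<^sup>2))))))"
proof -
  let ?c = "2 * pi * sqrt (1 - \<delta>\<^sup>2)"
  let ?e = "\<lambda>s t. exp (- ((a\<^sup>2 * t\<^sup>2 - 2 * \<delta> * a * b * t * s + b\<^sup>2 * s\<^sup>2) / (2 * (1 - \<delta>\<^sup>2))))"
  have in1: "\<phi> x * corr_cond \<delta> (abs_remainder a) x = 2 * a\<^sup>2 * (LBINT t=0..1. (1 - t) * corr_density \<delta> x (- a * t))" for x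
    unfolding corr_cond_corr_density(2)[OF lin_growth_abs_remainder, symmetric]
    using integral_abs_remainder[of "corr_density \<delta> x" a] by (simp add: mult.commute)
  have cd: "corr_density \<delta> (- b * s) (- a * t) = ?e s t / ?c" for s t
    unfolding corr_density_def by (simp add: power_mult_distrib algebra_simps)
  have "\<phi> (b * s) * corr_cond \<delta> (abs_remainder a) (- b * s) = (2 * a\<^sup>2 / ?c) * (LBINT t=0..1. (1 - t) * ?e s t)" for s
  proof -
    have "\<phi> (b * s) * corr_cond \<delta> (abs_remainder a) (- b * s) = \<phi> (- b * s) * corr_cond \<delta> (abs_remainder a) (- b * s)"
      using phi_even[of "b * s"] by simp
    also have "\<dots> = 2 * a\<^sup>2 * (LBINT t=0..1. (1 / ?c) * ((1 - t) * ?e s t))"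
      unfolding in1 cd by (simp add: mult.commute)
    also have "\<dots> = (2 * a\<^sup>2 / ?c) * (LBINT t=0..1. (1 - t) * ?e s t)"
      by (subst interval_lebesgue_integral_mult_right) simp
    finally show ?thesis .
  qed
  \<comment> \<open>The variable that belongs to \<open>b\<close> is conditioned on, so that its
    parameter \<open>s\<close> becomes the outer integration variable as in the claim; the roles are
    exchanged back by symmetry.\<close>
  then have "corr_expectation \<delta> (abs_remainder b) (abs_remainder a) = 2 * b\<^sup>2 * (LBINT s=0..1. (1 - s) * ((2 * a\<^sup>2 / ?c) * (LBINT t=0..1. (1 - t) * ?e s t)))"
    unfolding corr_expectation_abs_remainder[OF lin_growth_abs_remainder] by simp
  also have "\<dots> = 2 * b\<^sup>2 * (LBINT s=0..1. (2 * a\<^sup>2 / ?c) * (LBINT t=0..1. (1 - t) * (1 - s) * ?e s t))"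
  proof -
    have "(1 - s) * ((2 * a\<^sup>2 / ?c) * (LBINT t=0..1. (1 - t) * ?e s t)) = (2 * a\<^sup>2 / ?c) * (LBINT t=0..1. (1 - t) * (1 - s) * ?e s t)" for s
    proof -
      have "(LBINT t=0..1. (1 - t) * (1 - s) * ?e s t) = (LBINT t=0..1. (1 - s) * ((1 - t) * ?e s t))"
        by (simp only: mult.assoc mult.left_commute)
      also have "\<dots> = (1 - s) * (LBINT t=0..1. (1 - t) * ?e s t)" by (rule interval_lebesgue_integral_mult_right)
      finally show ?thesis by (simp only: mult.assoc mult.left_commute)
    qed
    then show ?thesis by (simp only:)
  qed
  also have "\<dots> = 2 * b\<^sup>2 * ((2 * a\<^sup>2 / ?c) * (LBINT s=0..1. (LBINT t=0..1. (1 - t) * (1 - s) * ?e s t)))"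
    by (subst interval_lebesgue_integral_mult_right) rule
  finally show ?thesis unfolding corr_expectation_sym[OF lin_growth_abs_remainder lin_growth_abs_remainder, of a b] by (simp add: field_simps)
qed

text \<open>Each factor splits into absolute value, multiple of the sign and remainder. Of the nine
  products the two that pair an absolute value with a sign vanish; the other seven are grouped into
  the five summands.\<close>

lemma corr_expectation_abs_shift:
  "corr_expectation \<delta> (\<lambda>x. \<bar>a + x\<bar>) (\<lambda>y. \<bar>b + y\<bar>) =
    corr_expectation \<delta> (\<lambda>x. \<bar>x\<bar>) (\<lambda>x. \<bar>x\<bar>) + a * b * corr_expectation \<delta> sgn sgn + (corr_expectation \<delta> (abs_remainder a) (\<lambda>x. \<bar>x\<bar>) + corr_expectation \<delta> (abs_remainder b) (\<lambda>x. \<bar>x\<bar>))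
    + (b * corr_expectation \<delta> (abs_remainder a) sgn + a * corr_expectation \<delta> (abs_remainder b) sgn) + corr_expectation \<delta> (abs_remainder a) (abs_remainder b)"
proof -
  have g0: "lin_growth (\<lambda>x. \<bar>x\<bar>)" using lin_growth_abs_shift[of 0] by simp
  note g = g0 lin_growth_sgn lin_growth_abs_remainder lin_growth_cmult[OF lin_growth_sgn]
    lin_growth_add[OF lin_growth_cmult[OF lin_growth_sgn] lin_growth_abs_remainder] lin_growth_abs_shift
  have d: "(\<lambda>x. \<bar>c + x\<bar>) = (\<lambda>x. \<bar>x\<bar> + (c * sgn x + abs_remainder c x))" for c by (simp add: abs_remainder_def)
  have e: "corr_expectation \<delta> (\<lambda>x. \<bar>c + x\<bar>) h = corr_expectation \<delta> (\<lambda>x. \<bar>x\<bar>) h + (c * corr_expectation \<delta> sgn h + corr_expectation \<delta> (abs_remainder c) h)"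
    if "lin_growth h" for c h
    unfolding d corr_expectation_add1[OF g(1) g(5) that] corr_expectation_add1[OF g(4) g(3) that] corr_expectation_cmult1 ..
  have s: "corr_expectation \<delta> (\<lambda>x. \<bar>x\<bar>) h = corr_expectation \<delta> h (\<lambda>x. \<bar>x\<bar>)" if "lin_growth h" for h
    by (rule corr_expectation_sym[OF g0 that])
  show ?thesis
    unfolding e[OF lin_growth_abs_shift]
    unfolding corr_expectation_sym[OF g(1) lin_growth_abs_shift] corr_expectation_sym[OF g(2) lin_growth_abs_shift] corr_expectation_sym[OF g(3) lin_growth_abs_shift]
    unfolding e[OF g(1)] e[OF g(2)] e[OF g(3)] corr_expectation_sgn_abs s[OF g(2)]
      corr_expectation_sym[OF g(2) g(3)] s[OF g(3)] corr_expectation_sym[OF g(3) g(3), of b a]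
    by (simp add: algebra_simps corr_expectation_sgn_abs corr_expectation_sym[OF g(2) g(3), of a])
qed

end

section \<open>The limiting probability of a double sign change\<close>

lemma borel_measurable_fst_snd:
  fixes f :: "'w \<Rightarrow> 'a::euclidean_space \<times> 'b::euclidean_space"
  assumes "f \<in> borel_measurable M"
  shows "(\<lambda>x. fst (f x)) \<in> borel_measurable M" "(\<lambda>x. snd (f x)) \<in> borel_measurable M"
  by (intro measurable_compose[OF assms] borel_measurable_continuous_onI continuous_intros)+

lemma nn_integral_lborel_pair:
  fixes f :: "'a::euclidean_space \<times> 'b::euclidean_space \<Rightarrow> ennreal"
  assumes [measurable]: "f \<in> borel_measurable borel"
  shows "(\<integral>\<^sup>+z. f z \<partial>lborel) = (\<integral>\<^sup>+x. \<integral>\<^sup>+y. f (x, y) \<partial>lborel \<partial>lborel)"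
    "(\<integral>\<^sup>+z. f z \<partial>lborel) = (\<integral>\<^sup>+y. \<integral>\<^sup>+x. f (x, y) \<partial>lborel \<partial>lborel)"
proof -
  have f: "f \<in> borel_measurable (lborel \<Otimes>\<^sub>M lborel)" by (simp add: lborel_prod)
  show "(\<integral>\<^sup>+z. f z \<partial>lborel) = (\<integral>\<^sup>+x. \<integral>\<^sup>+y. f (x, y) \<partial>lborel \<partial>lborel)"
    using lborel.nn_integral_fst[OF f] by (simp add: lborel_prod)
  show "(\<integral>\<^sup>+z. f z \<partial>lborel) = (\<integral>\<^sup>+y. \<integral>\<^sup>+x. f (x, y) \<partial>lborel \<partial>lborel)"
    using lborel_pair.nn_integral_snd[of f] f by (simp add: lborel_prod)
qed

lemma AE_lborel_pair:
  fixes P :: "'a::euclidean_space \<times> 'b::euclidean_space \<Rightarrow> bool"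
  assumes "Measurable.pred borel P" and "AE x in lborel. AE y in lborel. P (x, y)"
  shows "AE z in lborel. P z"
proof -
  have "AE z in lborel \<Otimes>\<^sub>M lborel. P z"
  proof (rule lborel_pair.AE_pair_measure)
    show "{z \<in> space (lborel \<Otimes>\<^sub>M lborel). P z} \<in> sets (lborel \<Otimes>\<^sub>M lborel)"
      unfolding lborel_prod using assms(1) by (simp add: pred_def)
  qed (use assms in simp)
  from this[unfolded lborel_prod] show ?thesis .
qed

lemma phi_le_1: "\<phi> x \<le> 1"
proof -
  have "exp (- x\<^sup>2 / 2) \<le> 1" by simp
  moreover have "1 \<le> sqrt (2 * pi)" using pi_gt3 by simp
  ultimately show ?thesis unfolding std_normal_density_def
    using order_trans[of "exp (- x\<^sup>2 / 2)" 1 "sqrt (2 * pi)"] by (simp add: divide_le_eq)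
qed

text \<open>If \<open>a\<close> is G(s) / h and \<open>u\<close> is the difference quotient with
  step h, then \<open>a + u\<close> is G(s + h) / h, so this is a strict sign change between s and s
  + h.\<close>

definition crosses :: "real \<Rightarrow> real \<Rightarrow> bool" where "crosses a u \<longleftrightarrow> a * (a + u) < 0"

lemma crosses_measurable [measurable (raw)]:
  assumes [measurable]: "f \<in> borel_measurable M" "g \<in> borel_measurable M"
  shows "Measurable.pred M (\<lambda>x. crosses (f x) (g x))"
  unfolding crosses_def by measurable

lemma crosses_scale: "0 < h \<Longrightarrow> crosses (h * a) (h * u) \<longleftrightarrow> crosses a u"
proof -
  assume h: "0 < h"
  have "(h * a) * (h * a + h * u) = (h * h) * (a * (a + u))" by (simp add: algebra_simps)
  moreover have "0 < h * h" using h by simp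
  ultimately show ?thesis unfolding crosses_def by (metis mult_less_cancel_left_pos mult_zero_right)
qed

text \<open>Domination of the rescaled integrals rests on this: on the crossing event the unbounded
  variables \<open>a\<close> and \<open>b\<close> are controlled by the slopes.\<close>

lemma crosses_bound: "crosses a u \<Longrightarrow> \<bar>a\<bar> \<le> \<bar>u\<bar>"
  unfolding crosses_def by (auto simp: mult_less_0_iff)

lemma nn_integral_crosses: "(\<integral>\<^sup>+a. indicator {a. crosses a u} a \<partial>lborel) = ennreal \<bar>u\<bar>"
proof -
  have "{a. crosses a u} = {min 0 (- u)<..<max 0 (- u)}"
    unfolding crosses_def by (auto simp: mult_less_0_iff)
  then show ?thesis by (simp add: max_def min_def)
qed

text \<open>The crossing condition is locally constant in the slope away from \<open>a = 0\<close>
  and \<open>a + x = 0\<close>; these exceptions are null sets when the remaining variables are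
  integrated.\<close>

lemma tendsto_crosses:
  assumes "X \<longlonglongrightarrow> x" "a \<noteq> 0" "a + x \<noteq> 0"
  shows "(\<lambda>n. of_bool (crosses a (X n)) :: real) \<longlonglongrightarrow> of_bool (crosses a x)"
proof -
  have l: "(\<lambda>n. a * (a + X n)) \<longlonglongrightarrow> a * (a + x)" using assms(1) by (intro tendsto_intros)
  have "\<forall>\<^sub>F n in sequentially. crosses a (X n) = crosses a x"
  proof (cases "a * (a + x) < 0")
    case True
    then show ?thesis using order_tendstoD(2)[OF l, of 0] unfolding crosses_def by (auto elim: eventually_mono)
  next
    case False
    then have "0 < a * (a + x)" using assms by (meson linorder_neqE_linordered_idom mult_eq_0_iff)
    from order_tendstoD(1)[OF l this] show ?thesis using False unfolding crosses_def by (auto elim: eventually_mono)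
  qed
  then show ?thesis by (intro tendsto_eventually) (auto elim: eventually_mono)
qed

definition double_cross :: "real \<Rightarrow> ((real \<times> real) \<times> (real \<times> real)) set" where
  "double_cross h = {z. crosses (fst (fst z)) (h * fst (snd z)) \<and> crosses (snd (fst z)) (h * snd (snd z))}"

lemma double_cross_sets [measurable]: "double_cross h \<in> sets borel"
proof -
  note [measurable (raw)] = borel_measurable_fst_snd
  have "Measurable.pred borel (\<lambda>z. crosses (fst (fst z)) (h * fst (snd z)) \<and> crosses (snd (fst z)) (h * snd (snd z)))"
    by measurable
  then show ?thesis unfolding double_cross_def by (simp add: pred_def)
qed

text \<open>
  The first two coordinates of the triangular map take the values h a and h b at z1 = h a - m1 and
  z2 = cross_z2; this substitution has Jacobian h^2 / l2.
\<close>

definition cross_z2 :: "real \<Rightarrow> real \<Rightarrow> real \<Rightarrow> real \<Rightarrow> real \<Rightarrow> real \<Rightarrow> real \<Rightarrow> real" where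
  "cross_z2 m1 m2 R l2 h a b = (- m2 - R * (- m1 + h * a)) / l2 + (h / l2) * b"

lemma cross_z2_measurable [measurable (raw)]:
  assumes [measurable]: "f \<in> borel_measurable M" "g \<in> borel_measurable M"
  shows "(\<lambda>x. cross_z2 m1 m2 R l2 h (f x) (g x)) \<in> borel_measurable M"
  unfolding cross_z2_def by measurable

text \<open>The integrand that remains after the factor h^2 of the substitution is split off. It
  contains no division by \<open>h\<close> and is therefore defined at \<open>h = 0\<close>, where
  it describes the limit.\<close>

definition cross_integrand where
  "cross_integrand m1 m2 m3 m4 R l2 l31 l32 l33 l41 l42 l43 l44 h = (\<lambda>((a, b), (z3, z4)).
     \<phi> (- m1 + h * a) * \<phi> (cross_z2 m1 m2 R l2 h a b) / l2 * \<phi> z3 * \<phi> z4 *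
     of_bool (crosses a (m3 + l31 * (- m1 + h * a) + l32 * cross_z2 m1 m2 R l2 h a b + l33 * z3)) *
     of_bool (crosses b (m4 + l41 * (- m1 + h * a) + l42 * cross_z2 m1 m2 R l2 h a b + l43 * z3 + l44 * z4)))"

lemma cross_integrand_measurable [measurable]:
  "cross_integrand m1 m2 m3 m4 R l2 l31 l32 l33 l41 l42 l43 l44 h \<in> borel_measurable borel"
  unfolding cross_integrand_def split_beta by (simp add: borel_prod[symmetric])

text \<open>With \<open>w = (z3, z4)\<close> outermost, the substitution is a pair of affine changes
  on the line: first \<open>z2\<close> with factor \<open>h / l2\<close>, then \<open>z1\<close>
  with factor \<open>h\<close>.\<close>

lemma double_cross_substitution:
  assumes h: "0 < h" and l2: "0 < l2"
  shows "(\<integral>\<^sup>+z. ennreal (std4 z) * indicator (double_cross h) (triangular_map m1 m2 m3 m4 R l2 l31 l32 l33 l41 l42 l43 l44 z) \<partial>lborel) =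
    ennreal (h\<^sup>2) * (\<integral>\<^sup>+z. ennreal (cross_integrand m1 m2 m3 m4 R l2 l31 l32 l33 l41 l42 l43 l44 h z) \<partial>lborel)"
proof -
  let ?T = "triangular_map m1 m2 m3 m4 R l2 l31 l32 l33 l41 l42 l43 l44"
  let ?F = "\<lambda>z. ennreal (std4 z) * indicator (double_cross h) (?T z)"
  let ?U = "cross_integrand m1 m2 m3 m4 R l2 l31 l32 l33 l41 l42 l43 l44 h"
  have F[measurable]: "?F \<in> borel_measurable borel" by measurable
  have T2[measurable]: "(\<lambda>z2. ?F ((z1, z2), w)) \<in> borel_measurable borel" for z1 w
    by (rule measurable_compose[OF _ F]) simp
  have T1[measurable]: "(\<lambda>(z1, b). ?F ((z1, (- m2 - R * z1) / l2 + (h / l2) * b), w)) \<in> borel_measurable (borel \<Otimes>\<^sub>M borel)" for w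
  proof -
    have "(\<lambda>z. ((fst z, (- m2 - R * fst z) / l2 + (h / l2) * snd z), w)) \<in> borel \<Otimes>\<^sub>M borel \<rightarrow>\<^sub>M borel"
      by (intro borel_measurable_Pair) measurable
    from measurable_compose[OF this, of ?F borel] show ?thesis by (simp add: split_beta)
  qed
  have pt: "ennreal (h / l2) * (ennreal h * ?F ((- m1 + h * a, cross_z2 m1 m2 R l2 h a b), w)) = ennreal (h\<^sup>2) * ennreal (?U ((a, b), w))" for a b w
  proof (cases w)
    case (Pair z3 z4)
    let ?z1 = "- m1 + h * a" and ?z2 = "cross_z2 m1 m2 R l2 h a b"
    have "m1 + ?z1 = h * a" by simp
    moreover have "m2 + R * ?z1 + l2 * ?z2 = h * b" using l2 unfolding cross_z2_def by (simp add: field_simps)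
    ultimately have e: "?T ((?z1, ?z2), w) = ((h * a, h * b), (m3 + l31 * ?z1 + l32 * ?z2 + l33 * z3, m4 + l41 * ?z1 + l42 * ?z2 + l43 * z3 + l44 * z4))"
      by (simp add: triangular_map_def Pair)
    have "indicator (double_cross h) (?T ((?z1, ?z2), w)) = ennreal (of_bool (crosses a (m3 + l31 * ?z1 + l32 * ?z2 + l33 * z3)) *
      of_bool (crosses b (m4 + l41 * ?z1 + l42 * ?z2 + l43 * z3 + l44 * z4)))"
      unfolding e double_cross_def by (simp add: crosses_scale[OF h] indicator_def)
    then show ?thesis using h l2
      unfolding cross_integrand_def Pair std4_def
      by (simp add: ennreal_mult[symmetric] power2_eq_square)
  qed
  have "(\<integral>\<^sup>+z. ?F z \<partial>lborel) = (\<integral>\<^sup>+w. \<integral>\<^sup>+y. ?F (y, w) \<partial>lborel \<partial>lborel)"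
    by (rule nn_integral_lborel_pair) measurable
  also have "\<dots> = (\<integral>\<^sup>+w. \<integral>\<^sup>+y. ennreal (h\<^sup>2) * ennreal (?U (y, w)) \<partial>lborel \<partial>lborel)"
  proof (rule nn_integral_cong)
    fix w
    have m: "(\<lambda>y. ?F (y, w)) \<in> borel_measurable borel"
      by (rule measurable_compose[OF _ F]) simp
    have mU: "(\<lambda>y. ennreal (h\<^sup>2) * ennreal (?U (y, w))) \<in> borel_measurable borel"
      using measurable_compose[OF _ cross_integrand_measurable, of "\<lambda>y. (y, w)" borel] by simp
    have "(\<integral>\<^sup>+y. ?F (y, w) \<partial>lborel) = (\<integral>\<^sup>+z1. \<integral>\<^sup>+z2. ?F ((z1, z2), w) \<partial>lborel \<partial>lborel)"
      by (rule nn_integral_lborel_pair(1)[OF m])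
    also have "\<dots> = (\<integral>\<^sup>+z1. ennreal (h / l2) * (\<integral>\<^sup>+b. ?F ((z1, (- m2 - R * z1) / l2 + (h / l2) * b), w) \<partial>lborel) \<partial>lborel)"
    proof (rule nn_integral_cong)
      fix z1
      have "(\<integral>\<^sup>+z2. ?F ((z1, z2), w) \<partial>lborel) = ennreal \<bar>h / l2\<bar> * (\<integral>\<^sup>+b. ?F ((z1, (- m2 - R * z1) / l2 + (h / l2) * b), w) \<partial>lborel)"
        by (rule nn_integral_real_affine[OF T2]) (use h l2 in auto)
      then show "(\<integral>\<^sup>+z2. ?F ((z1, z2), w) \<partial>lborel) = ennreal (h / l2) * (\<integral>\<^sup>+b. ?F ((z1, (- m2 - R * z1) / l2 + (h / l2) * b), w) \<partial>lborel)"
        using h l2 by simp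
    qed
    also have "\<dots> = ennreal (h / l2) * (\<integral>\<^sup>+z1. (\<integral>\<^sup>+b. ?F ((z1, (- m2 - R * z1) / l2 + (h / l2) * b), w) \<partial>lborel) \<partial>lborel)"
      using T1[of w] by (intro nn_integral_cmult) (simp add: split_beta' lborel.borel_measurable_nn_integral)
    also have "(\<integral>\<^sup>+z1. (\<integral>\<^sup>+b. ?F ((z1, (- m2 - R * z1) / l2 + (h / l2) * b), w) \<partial>lborel) \<partial>lborel) =
       ennreal \<bar>h\<bar> * (\<integral>\<^sup>+a. (\<integral>\<^sup>+b. ?F ((- m1 + h * a, (- m2 - R * (- m1 + h * a)) / l2 + (h / l2) * b), w) \<partial>lborel) \<partial>lborel)"
      using T1[of w] h by (intro nn_integral_real_affine) (auto simp: split_beta' intro: lborel.borel_measurable_nn_integral)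
    also have "ennreal (h / l2) * \<dots> = (\<integral>\<^sup>+a. \<integral>\<^sup>+b. ennreal (h\<^sup>2) * ennreal (?U ((a, b), w)) \<partial>lborel \<partial>lborel)"
    proof -
      have c1: "(\<lambda>b. ?F ((- m1 + h * a, cross_z2 m1 m2 R l2 h a b), w)) \<in> borel_measurable borel" for a
        using measurable_compose[OF _ T1[of w], of "\<lambda>b. (- m1 + h * a, b)" borel] by (simp add: cross_z2_def)
      have c2: "(\<lambda>a. \<integral>\<^sup>+b. ?F ((- m1 + h * a, cross_z2 m1 m2 R l2 h a b), w) \<partial>lborel) \<in> borel_measurable borel"
      proof -
        have "(\<lambda>(a, b). ?F ((- m1 + h * a, cross_z2 m1 m2 R l2 h a b), w)) \<in> borel_measurable (borel \<Otimes>\<^sub>M borel)"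
          using measurable_compose[OF _ T1[of w], of "\<lambda>z. (- m1 + h * fst z, snd z)" "borel \<Otimes>\<^sub>M borel"] by (simp add: cross_z2_def split_beta)
        then show ?thesis by (simp add: split_beta' lborel.borel_measurable_nn_integral)
      qed
      have *: "ennreal (h / l2) * (ennreal \<bar>h\<bar> * (\<integral>\<^sup>+a. (\<integral>\<^sup>+b. ?F ((- m1 + h * a, cross_z2 m1 m2 R l2 h a b), w) \<partial>lborel) \<partial>lborel)) =
        (\<integral>\<^sup>+a. \<integral>\<^sup>+b. ennreal (h / l2) * (ennreal h * ?F ((- m1 + h * a, cross_z2 m1 m2 R l2 h a b), w)) \<partial>lborel \<partial>lborel)"
        using h c1 c2 by (simp add: nn_integral_cmult)
      show ?thesis by (rule *[unfolded pt, unfolded cross_z2_def])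
    qed
    also have "\<dots> = (\<integral>\<^sup>+y. ennreal (h\<^sup>2) * ennreal (?U (y, w)) \<partial>lborel)"
      by (rule nn_integral_lborel_pair(1)[OF mU, symmetric])
    finally show "(\<integral>\<^sup>+y. ?F (y, w) \<partial>lborel) = (\<integral>\<^sup>+y. ennreal (h\<^sup>2) * ennreal (?U (y, w)) \<partial>lborel)" .
  qed
  also have "\<dots> = (\<integral>\<^sup>+z. ennreal (h\<^sup>2) * ennreal (?U z) \<partial>lborel)"
    by (rule nn_integral_lborel_pair(2)[symmetric]) measurable
  also have "\<dots> = ennreal (h\<^sup>2) * (\<integral>\<^sup>+z. ennreal (?U z) \<partial>lborel)"
    by (rule nn_integral_cmult) measurable
  finally show ?thesis .
qed

text \<open>The value of \<open>z2\<close> forced by the vanishing of both of the first two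
  coordinates of the triangular map.\<close>

definition cross_z2_0 :: "real \<Rightarrow> real \<Rightarrow> real \<Rightarrow> real \<Rightarrow> real" where
  "cross_z2_0 m1 m2 R l2 = (R * m1 - m2) / l2"

text \<open>The Rice formula in triangular coordinates: the density of the first two coordinates at
  the origin, times the mean absolute product of the last two given that the first two vanish.
  Values in \<open>ennreal\<close> allow limits to be taken before finiteness is
  established.\<close>

definition cross_limit where
  "cross_limit m1 m2 m3 m4 R l2 l31 l32 l33 l41 l42 l43 l44 =
     ennreal (\<phi> m1 * \<phi> (cross_z2_0 m1 m2 R l2) / l2) *
     (\<integral>\<^sup>+w. ennreal (\<phi> (fst w) * \<phi> (snd w) *
        (\<bar>m3 - l31 * m1 + l32 * cross_z2_0 m1 m2 R l2 + l33 * fst w\<bar> *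
         \<bar>m4 - l41 * m1 + l42 * cross_z2_0 m1 m2 R l2 + l43 * fst w + l44 * snd w\<bar>)) \<partial>lborel)"

text \<open>At \<open>h = 0\<close> the variables \<open>a\<close> and \<open>b\<close> no longer
  occur in the Gaussian factors or in the slopes, so integrating them out leaves the lengths of the
  two crossing intervals.\<close>

lemma cross_integrand_0:
  "(\<integral>\<^sup>+z. ennreal (cross_integrand m1 m2 m3 m4 R l2 l31 l32 l33 l41 l42 l43 l44 0 z) \<partial>lborel) =
     cross_limit m1 m2 m3 m4 R l2 l31 l32 l33 l41 l42 l43 l44" if l2: "0 < l2"
proof -
  define \<zeta> where "\<zeta> = cross_z2_0 m1 m2 R l2"
  let ?c = "\<phi> m1 * \<phi> \<zeta> / l2"
  let ?u = "\<lambda>w::real\<times>real. m3 - l31 * m1 + l32 * \<zeta> + l33 * fst w"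
  let ?v = "\<lambda>w. m4 - l41 * m1 + l42 * \<zeta> + l43 * fst w + l44 * snd w"
  let ?U = "cross_integrand m1 m2 m3 m4 R l2 l31 l32 l33 l41 l42 l43 l44 0"
  have z: "cross_z2 m1 m2 R l2 0 a b = \<zeta>" for a b by (simp add: cross_z2_def \<zeta>_def cross_z2_0_def)
  have c: "0 \<le> ?c" using l2 by simp
  have e: "ennreal (?U ((a, b), w)) = ennreal (?c * (\<phi> (fst w) * \<phi> (snd w))) * (indicator {a. crosses a (?u w)} a * indicator {b. crosses b (?v w)} b)" for a b w
    by (cases w) (simp add: cross_integrand_def z phi_even indicator_def mult.assoc)
  have "(\<integral>\<^sup>+z. ennreal (?U z) \<partial>lborel) = (\<integral>\<^sup>+w. \<integral>\<^sup>+y. ennreal (?U (y, w)) \<partial>lborel \<partial>lborel)"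
    by (rule nn_integral_lborel_pair) measurable
  also have "\<dots> = (\<integral>\<^sup>+w. ennreal ?c * ennreal (\<phi> (fst w) * \<phi> (snd w) * (\<bar>?u w\<bar> * \<bar>?v w\<bar>)) \<partial>lborel)"
  proof (rule nn_integral_cong)
    fix w
    have "(\<integral>\<^sup>+y. ennreal (?U (y, w)) \<partial>lborel) = (\<integral>\<^sup>+a. \<integral>\<^sup>+b. ennreal (?U ((a, b), w)) \<partial>lborel \<partial>lborel)"
      using measurable_compose[OF _ cross_integrand_measurable, of "\<lambda>y. (y, w)" borel]
      by (intro nn_integral_lborel_pair(1)) auto
    also have "\<dots> = ennreal (?c * (\<phi> (fst w) * \<phi> (snd w))) * (ennreal \<bar>?u w\<bar> * ennreal \<bar>?v w\<bar>)"
    proof -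
      have "{b. crosses b (?v w)} \<in> sets borel" "{a. crosses a (?u w)} \<in> sets borel" by measurable
      then show ?thesis unfolding e
        by (simp add: nn_integral_cmult nn_integral_multc nn_integral_crosses)
    qed
    finally show "(\<integral>\<^sup>+y. ennreal (?U (y, w)) \<partial>lborel) = ennreal ?c * ennreal (\<phi> (fst w) * \<phi> (snd w) * (\<bar>?u w\<bar> * \<bar>?v w\<bar>))"
      by (simp only: ennreal_mult[OF c] ennreal_mult[symmetric] mult_nonneg_nonneg normal_density_nonneg abs_ge_zero mult.assoc)
  qed
  also have "\<dots> = ennreal ?c * (\<integral>\<^sup>+w. ennreal (\<phi> (fst w) * \<phi> (snd w) * (\<bar>?u w\<bar> * \<bar>?v w\<bar>)) \<partial>lborel)"
    by (rule nn_integral_cmult) (simp add: borel_prod[symmetric])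
  finally show ?thesis by (simp add: cross_limit_def \<zeta>_def)
qed

text \<open>The fourth power arises from the longest product,
  \<open>l32 * (1 / l2) * R * m1\<close>, and the 5 from 1 + 1 + 3 for the constant, the
  \<open>z1\<close> term and the \<open>z2\<close> term. The summand \<open>l34 * y\<close> lets one
  bound serve both slopes. The quantity \<open>s\<close> records how far the substitution has moved
  the first two coordinates.\<close>

lemma cross_argument_bound:
  fixes h a b C :: real
  assumes C: "1 \<le> C" and s: "0 \<le> s" "s = h * \<bar>a\<bar> + h * \<bar>b\<bar>" and h: "0 \<le> h"
    and bd: "\<bar>m1\<bar> \<le> C" "\<bar>m2\<bar> \<le> C" "\<bar>m3\<bar> \<le> C" "\<bar>R\<bar> \<le> C" "1 / l2 \<le> C" "0 < l2"
      "\<bar>l31\<bar> \<le> C" "\<bar>l32\<bar> \<le> C" "\<bar>l33\<bar> \<le> C" "\<bar>l34\<bar> \<le> C"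
  shows "\<bar>m3 + l31 * (- m1 + h * a) + l32 * cross_z2 m1 m2 R l2 h a b + l33 * x + l34 * y\<bar>
     \<le> 5 * C ^ 4 * (1 + s + \<bar>x\<bar> + \<bar>y\<bar>)"
proof -
  have C0: "0 \<le> C" using C by simp
  have pw: "C \<le> C ^ 4" "C\<^sup>2 \<le> C ^ 4" using C power_increasing[of 1 4 C] power_increasing[of 2 4 C] by simp_all
  have z1: "\<bar>- m1 + h * a\<bar> \<le> C * (1 + s)"
  proof -
    have "\<bar>- m1 + h * a\<bar> \<le> C + h * \<bar>a\<bar>" using bd(1) h abs_triangle_ineq[of "-m1" "h * a"] by (simp add: abs_mult)
    also have "h * \<bar>a\<bar> \<le> s" using s h by simp
    also have "s \<le> C * s" using C s(1) by (simp add: mult_le_cancel_right1)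
    finally show ?thesis by (simp add: distrib_left)
  qed
  have z2: "\<bar>cross_z2 m1 m2 R l2 h a b\<bar> \<le> 3 * C ^ 3 * (1 + s)"
  proof -
    have ze: "cross_z2 m1 m2 R l2 h a b = (- m2 - R * (- m1 + h * a) + h * b) * (1 / l2)"
      using bd(6) by (simp add: cross_z2_def field_simps)
    have zb: "\<bar>- m2 - R * (- m1 + h * a) + h * b\<bar> \<le> 3 * C\<^sup>2 * (1 + s)"
    proof -
      have "\<bar>- m2 - R * (- m1 + h * a) + h * b\<bar> \<le> \<bar>m2\<bar> + \<bar>R * (- m1 + h * a)\<bar> + \<bar>h * b\<bar>" by linarith
      moreover have "\<bar>R * (- m1 + h * a)\<bar> \<le> C * (C * (1 + s))"
        unfolding abs_mult by (rule mult_mono[OF bd(4) z1 C0]) simp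
      moreover have "\<bar>h * b\<bar> \<le> s" using s h by (simp add: abs_mult)
      moreover have "s \<le> C\<^sup>2 * s" "C \<le> C\<^sup>2" using mult_right_mono[OF one_le_power[OF C, of 2] s(1)] power_increasing[of 1 2 C] C by simp_all
      ultimately have "\<bar>- m2 - R * (- m1 + h * a) + h * b\<bar> \<le> C\<^sup>2 + C * (C * (1 + s)) + C\<^sup>2 * s"
        using bd(2) by linarith
      also have "\<dots> = C\<^sup>2 + C\<^sup>2 + 2 * (C\<^sup>2 * s)" by (simp add: power2_eq_square algebra_simps)
      also have "\<dots> \<le> 3 * C\<^sup>2 * (1 + s)" using s(1) C0 by (simp add: distrib_left)
      finally show ?thesis .
    qed
    have zc: "\<bar>1 / l2\<bar> \<le> C" using bd(5,6) by simp
    have zd: "0 \<le> 3 * C\<^sup>2 * (1 + s)" using C0 s(1) by simp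
    have "\<bar>cross_z2 m1 m2 R l2 h a b\<bar> \<le> (3 * C\<^sup>2 * (1 + s)) * C"
      unfolding ze abs_mult by (rule mult_mono[OF zb zc zd]) simp
    then show ?thesis by (simp add: power2_eq_square power3_eq_cube algebra_simps)
  qed
  have t1: "\<bar>l31 * (- m1 + h * a)\<bar> \<le> C ^ 4 * (1 + s)"
  proof -
    have "\<bar>l31 * (- m1 + h * a)\<bar> \<le> C * (C * (1 + s))" unfolding abs_mult by (rule mult_mono[OF bd(7) z1 C0]) simp
    also have "\<dots> = C\<^sup>2 * (1 + s)" by (simp add: power2_eq_square)
    also have "\<dots> \<le> C ^ 4 * (1 + s)" using pw s(1) by (intro mult_right_mono) auto
    finally show ?thesis .
  qed
  have t2: "\<bar>l32 * cross_z2 m1 m2 R l2 h a b\<bar> \<le> 3 * (C ^ 4 * (1 + s))"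
  proof -
    have "\<bar>l32 * cross_z2 m1 m2 R l2 h a b\<bar> \<le> C * (3 * C ^ 3 * (1 + s))" unfolding abs_mult by (rule mult_mono[OF bd(8) z2 C0]) simp
    also have "\<dots> = 3 * (C ^ 4 * (1 + s))" by (simp add: power4_eq_xxxx power3_eq_cube)
    finally show ?thesis .
  qed
  have t3: "\<bar>l33 * x\<bar> \<le> C ^ 4 * \<bar>x\<bar>" "\<bar>l34 * y\<bar> \<le> C ^ 4 * \<bar>y\<bar>"
    unfolding abs_mult using order_trans[OF bd(9) pw(1)] order_trans[OF bd(10) pw(1)] by (simp_all add: mult_right_mono)
  have t4: "\<bar>m3\<bar> \<le> C ^ 4" using bd(3) pw by linarith
  have nn: "0 \<le> C ^ 4 * s" "0 \<le> C ^ 4 * \<bar>x\<bar>" "0 \<le> C ^ 4 * \<bar>y\<bar>" using C0 s(1) by auto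
  have "\<bar>m3 + l31 * (- m1 + h * a) + l32 * cross_z2 m1 m2 R l2 h a b + l33 * x + l34 * y\<bar>
    \<le> \<bar>m3\<bar> + \<bar>l31 * (- m1 + h * a)\<bar> + \<bar>l32 * cross_z2 m1 m2 R l2 h a b\<bar> + \<bar>l33 * x\<bar> + \<bar>l34 * y\<bar>" by linarith
  also have "\<dots> \<le> C ^ 4 + C ^ 4 * (1 + s) + 3 * (C ^ 4 * (1 + s)) + C ^ 4 * \<bar>x\<bar> + C ^ 4 * \<bar>y\<bar>"
    using t1 t2 t3 t4 by linarith
  also have "\<dots> \<le> 5 * C ^ 4 * (1 + s + \<bar>x\<bar> + \<bar>y\<bar>)"
    using nn by (simp add: algebra_simps)
  finally show ?thesis .
qed

text \<open>For fixed (z3, z4) this is a Gaussian weight on a square in the other two variables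
  whose side grows linearly, hence whose area grows quadratically; second Gaussian moments make it
  integrable.\<close>

lemma cross_dominator_finite:
  "(\<integral>\<^sup>+z. ennreal (\<phi> (fst (snd z)) * \<phi> (snd (snd z))) *
      (indicator {x. \<bar>x\<bar> \<le> T * (1 + \<bar>fst (snd z)\<bar> + \<bar>snd (snd z)\<bar>)} (fst (fst z)) *
       indicator {x. \<bar>x\<bar> \<le> T * (1 + \<bar>fst (snd z)\<bar> + \<bar>snd (snd z)\<bar>)} (snd (fst z))) \<partial>(lborel :: ((real \<times> real) \<times> (real \<times> real)) measure)) < \<infinity>"
  (is "(\<integral>\<^sup>+z. ?w z \<partial>_) < _") and cross_dominator_measurable:
  "(\<lambda>z. ennreal (\<phi> (fst (snd z)) * \<phi> (snd (snd z))) *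
      (indicator {x. \<bar>x\<bar> \<le> T * (1 + \<bar>fst (snd z)\<bar> + \<bar>snd (snd z)\<bar>)} (fst (fst z)) *
       indicator {x. \<bar>x\<bar> \<le> T * (1 + \<bar>fst (snd z)\<bar> + \<bar>snd (snd z)\<bar>)} (snd (fst z)))) \<in> borel_measurable (borel :: ((real \<times> real) \<times> (real \<times> real)) measure)"
  if T: "0 \<le> T"
proof -
  let ?t = "\<lambda>w::real\<times>real. T * (1 + \<bar>fst w\<bar> + \<bar>snd w\<bar>)"
  have ind: "indicator {x. \<bar>x\<bar> \<le> c} y = (if \<bar>y\<bar> \<le> c then 1 else 0 :: ennreal)" for c y :: real by simp
  note [measurable (raw)] = borel_measurable_fst_snd
  show m: "?w \<in> borel_measurable (borel :: ((real \<times> real) \<times> (real \<times> real)) measure)"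
    unfolding ind by measurable
  have iv: "{x. \<bar>x\<bar> \<le> c} = {-c..c}" for c :: real by auto
  have "(\<integral>\<^sup>+z. ?w z \<partial>lborel) = (\<integral>\<^sup>+w. \<integral>\<^sup>+y. ?w (y, w) \<partial>lborel \<partial>lborel)"
    by (rule nn_integral_lborel_pair(2)[OF m])
  also have "\<dots> = (\<integral>\<^sup>+w. ennreal (\<phi> (fst w) * \<phi> (snd w) * ((2 * ?t w) * (2 * ?t w))) \<partial>lborel)"
  proof (rule nn_integral_cong)
    fix w :: "real \<times> real"
    have "(\<integral>\<^sup>+y. ?w (y, w) \<partial>lborel) = (\<integral>\<^sup>+a. \<integral>\<^sup>+b. ?w ((a, b), w) \<partial>lborel \<partial>lborel)"
      using measurable_compose[OF _ m, of "\<lambda>y. (y, w)" borel]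
      by (intro nn_integral_lborel_pair(1)) auto
    also have "\<dots> = ennreal (\<phi> (fst w) * \<phi> (snd w)) * (ennreal (2 * ?t w) * ennreal (2 * ?t w))"
      unfolding iv using T by (simp add: nn_integral_cmult nn_integral_multc)
    finally show "(\<integral>\<^sup>+y. ?w (y, w) \<partial>lborel) = ennreal (\<phi> (fst w) * \<phi> (snd w) * ((2 * ?t w) * (2 * ?t w)))"
      using T by (simp add: ennreal_mult[symmetric] mult.assoc)
  qed
  also have "\<dots> \<le> (\<integral>\<^sup>+w. ennreal (4 * T\<^sup>2) * (ennreal (\<phi> (fst w) * (1 + \<bar>fst w\<bar>)\<^sup>2) * ennreal (\<phi> (snd w) * (1 + \<bar>snd w\<bar>)\<^sup>2)) \<partial>lborel)"
  proof (intro nn_integral_mono)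
    fix w :: "real \<times> real"
    have "1 + \<bar>fst w\<bar> + \<bar>snd w\<bar> \<le> (1 + \<bar>fst w\<bar>) * (1 + \<bar>snd w\<bar>)" by (simp add: algebra_simps)
    then have "(1 + \<bar>fst w\<bar> + \<bar>snd w\<bar>)\<^sup>2 \<le> ((1 + \<bar>fst w\<bar>) * (1 + \<bar>snd w\<bar>))\<^sup>2" by (intro power_mono) auto
    from mult_left_mono[OF this, of "4 * T\<^sup>2 * (\<phi> (fst w) * \<phi> (snd w))"]
    have *: "4 * T\<^sup>2 * (\<phi> (fst w) * \<phi> (snd w)) * (1 + \<bar>fst w\<bar> + \<bar>snd w\<bar>)\<^sup>2 \<le> 4 * T\<^sup>2 * (\<phi> (fst w) * \<phi> (snd w)) * ((1 + \<bar>fst w\<bar>) * (1 + \<bar>snd w\<bar>))\<^sup>2"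
      by simp
    have "\<phi> (fst w) * \<phi> (snd w) * ((2 * ?t w) * (2 * ?t w)) \<le> 4 * T\<^sup>2 * ((\<phi> (fst w) * (1 + \<bar>fst w\<bar>)\<^sup>2) * (\<phi> (snd w) * (1 + \<bar>snd w\<bar>)\<^sup>2))"
    proof -
      have q: "(2 * (T * x)) * (2 * (T * x)) = 4 * T\<^sup>2 * x\<^sup>2" for x by (simp add: power2_eq_square)
      then have e: "\<phi> (fst w) * \<phi> (snd w) * ((2 * ?t w) * (2 * ?t w)) = 4 * T\<^sup>2 * (\<phi> (fst w) * \<phi> (snd w)) * (1 + \<bar>fst w\<bar> + \<bar>snd w\<bar>)\<^sup>2"
        unfolding q by (simp only: mult_ac)
      have "\<phi> (fst w) * \<phi> (snd w) * ((2 * ?t w) * (2 * ?t w)) \<le> 4 * T\<^sup>2 * (\<phi> (fst w) * \<phi> (snd w)) * ((1 + \<bar>fst w\<bar>) * (1 + \<bar>snd w\<bar>))\<^sup>2"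
        unfolding e using * by simp
      then show ?thesis by (simp only: power_mult_distrib mult_ac)
    qed
    then show "ennreal (\<phi> (fst w) * \<phi> (snd w) * ((2 * ?t w) * (2 * ?t w))) \<le> ennreal (4 * T\<^sup>2) * (ennreal (\<phi> (fst w) * (1 + \<bar>fst w\<bar>)\<^sup>2) * ennreal (\<phi> (snd w) * (1 + \<bar>snd w\<bar>)\<^sup>2))"
      by (simp add: ennreal_mult[symmetric] ennreal_leI)
  qed
  also have "\<dots> = ennreal (4 * T\<^sup>2) * ((\<integral>\<^sup>+x. ennreal (\<phi> x * (1 + \<bar>x\<bar>)\<^sup>2) \<partial>lborel) * (\<integral>\<^sup>+x. ennreal (\<phi> x * (1 + \<bar>x\<bar>)\<^sup>2) \<partial>lborel))"
    by (subst nn_integral_lborel_pair(1)) (simp_all add: borel_prod[symmetric] nn_integral_cmult nn_integral_multc)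
  also have "\<dots> < \<infinity>"
  proof -
    have "integrable lborel (\<lambda>x. \<phi> x * (1 + \<bar>x\<bar>)\<^sup>2)"
    proof -
      have e: "\<phi> x * (1 + \<bar>x\<bar>)\<^sup>2 = \<phi> x + 2 * (\<phi> x * \<bar>x\<bar>) + \<phi> x * x ^ 2" for x
        by (simp add: power2_eq_square algebra_simps)
      show ?thesis unfolding e using integral_phi integral_phi_abs integrable_std_normal_moment[of 2] by simp
    qed
    then have "(\<integral>\<^sup>+x. ennreal (\<phi> x * (1 + \<bar>x\<bar>)\<^sup>2) \<partial>lborel) < \<infinity>"
      by (simp add: nn_integral_eq_integral)
    then show ?thesis by (simp add: ennreal_mult_less_top)
  qed
  finally show "(\<integral>\<^sup>+z. ?w z \<partial>lborel) < \<infinity>" .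
qed

lemma Bseq_tendsto_bound:
  fixes X :: "nat \<Rightarrow> real"
  assumes "X \<longlonglongrightarrow> x"
  shows "\<exists>C. \<forall>n. \<bar>X n\<bar> \<le> C"
  using convergent_imp_Bseq[of X] assms unfolding Bseq_def convergent_def by auto

lemma double_cross_limit:
  fixes m1 m2 m3 m4 R l2 l31 l32 l33 l41 l42 l43 l44 h :: "nat \<Rightarrow> real"
  assumes lim: "m1 \<longlonglongrightarrow> m1'" "m2 \<longlonglongrightarrow> m2'" "m3 \<longlonglongrightarrow> m3'" "m4 \<longlonglongrightarrow> m4'"
    "R \<longlonglongrightarrow> R'" "l2 \<longlonglongrightarrow> l2'" "l31 \<longlonglongrightarrow> l31'" "l32 \<longlonglongrightarrow> l32'" "l33 \<longlonglongrightarrow> l33'"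
    "l41 \<longlonglongrightarrow> l41'" "l42 \<longlonglongrightarrow> l42'" "l43 \<longlonglongrightarrow> l43'" "l44 \<longlonglongrightarrow> l44'" "h \<longlonglongrightarrow> 0"
    and pos: "0 < l2'" "0 < l33'" "0 < l44'" "\<And>n. 0 \<le> h n"
  shows "(\<lambda>n. \<integral>\<^sup>+z. ennreal (cross_integrand (m1 n) (m2 n) (m3 n) (m4 n) (R n) (l2 n) (l31 n) (l32 n) (l33 n) (l41 n) (l42 n) (l43 n) (l44 n) (h n) z) \<partial>lborel)
    \<longlonglongrightarrow> cross_limit m1' m2' m3' m4' R' l2' l31' l32' l33' l41' l42' l43' l44'"
proof -
  let ?u = "\<lambda>n. cross_integrand (m1 n) (m2 n) (m3 n) (m4 n) (R n) (l2 n) (l31 n) (l32 n) (l33 n) (l41 n) (l42 n) (l43 n) (l44 n) (h n)"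
  let ?v = "cross_integrand m1' m2' m3' m4' R' l2' l31' l32' l33' l41' l42' l43' l44' 0"
  have "(\<lambda>n. 1 / l2 n) \<longlonglongrightarrow> 1 / l2'" using lim(6) pos by (intro tendsto_intros) auto
  then obtain C where C1: "1 \<le> C" and
    bd: "\<And>n. \<bar>m1 n\<bar> \<le> C" "\<And>n. \<bar>m2 n\<bar> \<le> C" "\<And>n. \<bar>m3 n\<bar> \<le> C" "\<And>n. \<bar>m4 n\<bar> \<le> C" "\<And>n. \<bar>R n\<bar> \<le> C"
      "\<And>n. \<bar>1 / l2 n\<bar> \<le> C" "\<And>n. \<bar>l31 n\<bar> \<le> C" "\<And>n. \<bar>l32 n\<bar> \<le> C" "\<And>n. \<bar>l33 n\<bar> \<le> C"
      "\<And>n. \<bar>l41 n\<bar> \<le> C" "\<And>n. \<bar>l42 n\<bar> \<le> C" "\<And>n. \<bar>l43 n\<bar> \<le> C" "\<And>n. \<bar>l44 n\<bar> \<le> C"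
  proof -
    assume l: "(\<lambda>n. 1 / l2 n) \<longlonglongrightarrow> 1 / l2'"
    obtain c1 where 1: "\<And>n. \<bar>m1 n\<bar> \<le> c1" using Bseq_tendsto_bound[OF lim(1)] by auto
    obtain c2 where 2: "\<And>n. \<bar>m2 n\<bar> \<le> c2" using Bseq_tendsto_bound[OF lim(2)] by auto
    obtain c3 where 3: "\<And>n. \<bar>m3 n\<bar> \<le> c3" using Bseq_tendsto_bound[OF lim(3)] by auto
    obtain c4 where 4: "\<And>n. \<bar>m4 n\<bar> \<le> c4" using Bseq_tendsto_bound[OF lim(4)] by auto
    obtain c5 where 5: "\<And>n. \<bar>R n\<bar> \<le> c5" using Bseq_tendsto_bound[OF lim(5)] by auto
    obtain c6 where 6: "\<And>n. \<bar>1 / l2 n\<bar> \<le> c6" using Bseq_tendsto_bound[OF l] by auto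
    obtain c7 where 7: "\<And>n. \<bar>l31 n\<bar> \<le> c7" using Bseq_tendsto_bound[OF lim(7)] by auto
    obtain c8 where 8: "\<And>n. \<bar>l32 n\<bar> \<le> c8" using Bseq_tendsto_bound[OF lim(8)] by auto
    obtain c9 where 9: "\<And>n. \<bar>l33 n\<bar> \<le> c9" using Bseq_tendsto_bound[OF lim(9)] by auto
    obtain c10 where 10: "\<And>n. \<bar>l41 n\<bar> \<le> c10" using Bseq_tendsto_bound[OF lim(10)] by auto
    obtain c11 where 11: "\<And>n. \<bar>l42 n\<bar> \<le> c11" using Bseq_tendsto_bound[OF lim(11)] by auto
    obtain c12 where 12: "\<And>n. \<bar>l43 n\<bar> \<le> c12" using Bseq_tendsto_bound[OF lim(12)] by auto
    obtain c13 where 13: "\<And>n. \<bar>l44 n\<bar> \<le> c13" using Bseq_tendsto_bound[OF lim(13)] by auto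
    have nn: "0 \<le> c1" "0 \<le> c2" "0 \<le> c3" "0 \<le> c4" "0 \<le> c5" "0 \<le> c6" "0 \<le> c7" "0 \<le> c8" "0 \<le> c9" "0 \<le> c10" "0 \<le> c11" "0 \<le> c12" "0 \<le> c13"
      by (rule order_trans[OF abs_ge_zero 1[of 0]] order_trans[OF abs_ge_zero 2[of 0]] order_trans[OF abs_ge_zero 3[of 0]]
         order_trans[OF abs_ge_zero 4[of 0]] order_trans[OF abs_ge_zero 5[of 0]] order_trans[OF abs_ge_zero 6[of 0]]
         order_trans[OF abs_ge_zero 7[of 0]] order_trans[OF abs_ge_zero 8[of 0]] order_trans[OF abs_ge_zero 9[of 0]]
         order_trans[OF abs_ge_zero 10[of 0]] order_trans[OF abs_ge_zero 11[of 0]] order_trans[OF abs_ge_zero 12[of 0]]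
         order_trans[OF abs_ge_zero 13[of 0]])+
    define C where "C = 1 + c1 + c2 + c3 + c4 + c5 + c6 + c7 + c8 + c9 + c10 + c11 + c12 + c13"
    have le: "c1 \<le> C" "c2 \<le> C" "c3 \<le> C" "c4 \<le> C" "c5 \<le> C" "c6 \<le> C" "c7 \<le> C" "c8 \<le> C" "c9 \<le> C" "c10 \<le> C" "c11 \<le> C" "c12 \<le> C" "c13 \<le> C" "1 \<le> C"
      using nn unfolding C_def by linarith+
    show ?thesis
      by (rule that[OF le(14)])
         (rule order_trans[OF 1 le(1)] order_trans[OF 2 le(2)] order_trans[OF 3 le(3)] order_trans[OF 4 le(4)]
           order_trans[OF 5 le(5)] order_trans[OF 6 le(6)] order_trans[OF 7 le(7)] order_trans[OF 8 le(8)]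
           order_trans[OF 9 le(9)] order_trans[OF 10 le(10)] order_trans[OF 11 le(11)] order_trans[OF 12 le(12)] order_trans[OF 13 le(13)])+
  qed
  define K where "K = 5 * C ^ 4"
  have K: "0 < K" using C1 by (simp add: K_def)
  \<comment> \<open>The bound on |a| + |b| contains a shift term \<open>2 * K * s\<close> with
    \<open>s = h * (|a| + |b|)\<close>. Once \<open>4 * K * h <= 1\<close>, it is at most half of
    |a| + |b| and can be absorbed; this doubles the constant \<open>2 * K\<close>.\<close>
  define T where "T = 4 * K"
  let ?w = "\<lambda>z. ennreal (\<phi> (fst (snd z)) * \<phi> (snd (snd z))) *
      (indicator {x. \<bar>x\<bar> \<le> T * (1 + \<bar>fst (snd z)\<bar> + \<bar>snd (snd z)\<bar>)} (fst (fst z)) *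
       indicator {x. \<bar>x\<bar> \<le> T * (1 + \<bar>fst (snd z)\<bar> + \<bar>snd (snd z)\<bar>)} (snd (fst z)))"
  have "\<forall>\<^sub>F n in sequentially. 0 < l2 n" using order_tendstoD(1)[OF lim(6) pos(1)] .
  moreover have "\<forall>\<^sub>F n in sequentially. h n < 1 / (4 * K)" using order_tendstoD(2)[OF lim(14), of "1 / (4 * K)"] K by simp
  ultimately have "\<forall>\<^sub>F n in sequentially. 0 < l2 n \<and> h n < 1 / (4 * K)" by (rule eventually_conj)
  then obtain N where N: "\<And>n. N \<le> n \<Longrightarrow> 0 < l2 n \<and> h n < 1 / (4 * K)" by (auto simp: eventually_sequentially)
  have dom: "ennreal (?u n z) \<le> ennreal C * ?w z" if n: "N \<le> n" for n z
  proof -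
    obtain a b z3 z4 where z: "z = ((a, b), (z3, z4))" by (metis prod.collapse)
    define s where "s = h n * \<bar>a\<bar> + h n * \<bar>b\<bar>"
    have hp: "0 \<le> h n" and l2p: "0 < l2 n" using pos(4) N[OF n] by auto
    have s: "0 \<le> s" using hp by (simp add: s_def)
    let ?z1 = "- m1 n + h n * a" and ?z2 = "cross_z2 (m1 n) (m2 n) (R n) (l2 n) (h n) a b"
    let ?x3 = "m3 n + l31 n * ?z1 + l32 n * ?z2 + l33 n * z3"
    let ?x4 = "m4 n + l41 n * ?z1 + l42 n * ?z2 + l43 n * z3 + l44 n * z4"
    have l2C: "1 / l2 n \<le> C" using bd(6)[of n] l2p by simp
    have C0: "0 \<le> C" using C1 by simp
    have x3: "\<bar>?x3\<bar> \<le> K * (1 + s + \<bar>z3\<bar> + \<bar>z4\<bar>)"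
      using cross_argument_bound[where ?l34.0 = 0 and x = z3 and y = z4, OF C1 s s_def hp bd(1)[of n] bd(2)[of n] bd(3)[of n] bd(5)[of n] l2C l2p bd(7)[of n] bd(8)[of n] bd(9)[of n]] C0 unfolding K_def
      by (simp only: mult_zero_left add_0_right abs_zero)
    have x4: "\<bar>?x4\<bar> \<le> K * (1 + s + \<bar>z3\<bar> + \<bar>z4\<bar>)"
      using cross_argument_bound[where x = z3 and y = z4, OF C1 s s_def hp bd(1)[of n] bd(2)[of n] bd(4)[of n] bd(5)[of n] l2C l2p bd(10)[of n] bd(11)[of n] bd(12)[of n] bd(13)[of n]] unfolding K_def .
    show ?thesis
    proof (cases "crosses a ?x3 \<and> crosses b ?x4")
      case True
      have ab: "\<bar>a\<bar> \<le> K * (1 + s + \<bar>z3\<bar> + \<bar>z4\<bar>)" "\<bar>b\<bar> \<le> K * (1 + s + \<bar>z3\<bar> + \<bar>z4\<bar>)"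
        using crosses_bound True x3 x4 by (meson order_trans)+
      have "4 * (K * s) = 4 * K * h n * (\<bar>a\<bar> + \<bar>b\<bar>)" by (simp add: s_def algebra_simps)
      also have "\<dots> \<le> 1 * (\<bar>a\<bar> + \<bar>b\<bar>)"
        using N[OF n] K by (intro mult_right_mono) (auto simp: field_simps)
      finally have Ks: "4 * (K * s) \<le> \<bar>a\<bar> + \<bar>b\<bar>" by simp
      have sum: "\<bar>a\<bar> + \<bar>b\<bar> \<le> 2 * (K * (1 + \<bar>z3\<bar> + \<bar>z4\<bar>)) + 2 * (K * s)"
        using ab by (simp add: algebra_simps)
      have T: "\<bar>a\<bar> + \<bar>b\<bar> \<le> T * (1 + \<bar>z3\<bar> + \<bar>z4\<bar>)"
        unfolding T_def mult.assoc using sum Ks by linarith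
      have "?u n z \<le> C * (\<phi> z3 * \<phi> z4)"
      proof -
        have "\<phi> ?z1 * \<phi> ?z2 \<le> 1 * 1" by (intro mult_mono phi_le_1) auto
        then have "\<phi> ?z1 * \<phi> ?z2 * (1 / l2 n) \<le> 1 * C" using l2C l2p by (intro mult_mono) auto
        from mult_right_mono[OF this, of "\<phi> z3 * \<phi> z4"] show ?thesis
          using True by (simp add: cross_integrand_def z mult.assoc)
      qed
      then have "ennreal (?u n z) \<le> ennreal (C * (\<phi> z3 * \<phi> z4))" by (rule ennreal_leI)
      also have "\<dots> = ennreal C * ?w z" using T C0 by (simp add: z ennreal_mult)
      finally show ?thesis .
    next
      case False
      then have "?u n z = 0" by (auto simp: cross_integrand_def z)
      then show ?thesis by simp
    qed
  qed
  have T0: "0 \<le> T" using K by (simp add: T_def)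
  note wm[measurable] = cross_dominator_measurable[OF T0]
  have pc: "AE z in lborel. (\<lambda>n. ennreal (?u n z)) \<longlonglongrightarrow> ennreal (?v z)"
  proof -
    let ?\<zeta> = "cross_z2_0 m1' m2' R' l2'"
    let ?A = "\<lambda>z3. m3' + l31' * (- m1') + l32' * ?\<zeta> + l33' * z3"
    let ?B = "\<lambda>z3 z4. m4' + l41' * (- m1') + l42' * ?\<zeta> + l43' * z3 + l44' * z4"
    have conv: "(\<lambda>n. ?u n ((a, b), (z3, z4))) \<longlonglongrightarrow> ?v ((a, b), (z3, z4))"
      if "a \<noteq> 0" "b \<noteq> 0" "a + ?A z3 \<noteq> 0" "b + ?B z3 z4 \<noteq> 0" for a b z3 z4
    proof -
      have v: "?v ((a, b), (z3, z4)) = \<phi> (- m1') * \<phi> ?\<zeta> / l2' * \<phi> z3 * \<phi> z4 * of_bool (crosses a (?A z3)) * of_bool (crosses b (?B z3 z4))"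
        by (simp add: cross_integrand_def cross_z2_def cross_z2_0_def)
      have z1: "(\<lambda>n. - m1 n + h n * a) \<longlonglongrightarrow> - m1'"
        using tendsto_add[OF tendsto_minus[OF lim(1)] tendsto_mult_left_zero[OF lim(14), of a]] by simp
      have z2: "(\<lambda>n. cross_z2 (m1 n) (m2 n) (R n) (l2 n) (h n) a b) \<longlonglongrightarrow> ?\<zeta>"
      proof -
        have "(\<lambda>n. (- m2 n - R n * (- m1 n + h n * a)) / l2 n + (h n / l2 n) * b) \<longlonglongrightarrow> (- m2' - R' * (- m1')) / l2' + (0 / l2') * b"
          using lim pos z1 by (intro tendsto_intros) auto
        then show ?thesis unfolding cross_z2_def cross_z2_0_def by simp
      qed
      have ph: "isCont \<phi> x" for x unfolding std_normal_density_def by (intro continuous_intros) auto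
      show ?thesis unfolding v unfolding cross_integrand_def prod.case
        by (intro tendsto_mult tendsto_divide tendsto_const tendsto_crosses isCont_tendsto_compose[OF ph] z1 z2 tendsto_add lim)
           (use pos that in auto)
    qed
    \<comment> \<open>Where \<open>P\<close> holds, both crossing indicators converge. Since
      \<open>l33'\<close> and \<open>l44'\<close> are positive, its last two conditions exclude a
      single value of z3 and, for given z3, a single value of z4.\<close>
    define P where "P = (\<lambda>z. fst (fst z) \<noteq> 0 \<and> snd (fst z) \<noteq> 0 \<and> fst (fst z) + ?A (fst (snd z)) \<noteq> 0 \<and> snd (fst z) + ?B (fst (snd z)) (snd (snd z)) \<noteq> 0)"
    note [measurable (raw)] = borel_measurable_fst_snd
    have mP: "Measurable.pred borel P" unfolding P_def by measurable
    have "AE z in lborel. P z"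
    proof (rule AE_lborel_pair[OF mP])
      have mab: "Measurable.pred borel (\<lambda>y::real\<times>real. fst y \<noteq> 0 \<and> snd y \<noteq> 0)" by measurable
      have ab: "AE y::real\<times>real in lborel. fst y \<noteq> 0 \<and> snd y \<noteq> 0"
      proof (rule AE_lborel_pair[OF mab])
        have "AE a::real in lborel. a \<noteq> 0" "AE b::real in lborel. b \<noteq> 0" by (rule AE_lborel_singleton)+
        then show "AE a::real in lborel. AE b::real in lborel. fst (a, b) \<noteq> 0 \<and> snd (a, b) \<noteq> 0"
          by auto
      qed
      then show "AE y in lborel. AE w in lborel. P (y, w)"
      proof (rule eventually_mono)
        fix y :: "real \<times> real" assume y: "fst y \<noteq> 0 \<and> snd y \<noteq> 0"
        have m: "Measurable.pred borel (\<lambda>w. P (y, w))"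
          using measurable_compose[OF _ mP, of "\<lambda>w. (y, w)" borel] by simp
        show "AE w in lborel. P (y, w)"
        proof (rule AE_lborel_pair[OF m])
          have "AE z3 in lborel. z3 \<noteq> (- fst y - (m3' + l31' * (- m1') + l32' * ?\<zeta>)) / l33'" by (rule AE_lborel_singleton)
          then show "AE z3 in lborel. AE z4 in lborel. P (y, (z3, z4))"
          proof (rule eventually_mono)
            fix z3 :: real assume "z3 \<noteq> (- fst y - (m3' + l31' * (- m1') + l32' * ?\<zeta>)) / l33'"
            then have 1: "fst y + ?A z3 \<noteq> 0" using pos by (auto simp: field_simps)
            have "AE z4 in lborel. z4 \<noteq> (- snd y - (m4' + l41' * (- m1') + l42' * ?\<zeta> + l43' * z3)) / l44'" by (rule AE_lborel_singleton)
            then show "AE z4 in lborel. P (y, (z3, z4))"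
            proof (rule eventually_mono)
              fix z4 :: real assume "z4 \<noteq> (- snd y - (m4' + l41' * (- m1') + l42' * ?\<zeta> + l43' * z3)) / l44'"
              then have 2: "snd y + ?B z3 z4 \<noteq> 0" using pos by (auto simp: field_simps)
              show "P (y, (z3, z4))" using y 1 2 unfolding P_def by simp
            qed
          qed
        qed
      qed
    qed
    then show ?thesis
    proof (rule eventually_mono)
      fix z assume "P z"
      then show "(\<lambda>n. ennreal (?u n z)) \<longlonglongrightarrow> ennreal (?v z)"
        using conv[of "fst (fst z)" "snd (fst z)" "fst (snd z)" "snd (snd z)"] unfolding P_def
        by (intro tendsto_ennrealI) auto
    qed
  qed
  have "(\<lambda>n. \<integral>\<^sup>+z. ennreal (?u (n + N) z) \<partial>lborel) \<longlonglongrightarrow> (\<integral>\<^sup>+z. ennreal (?v z) \<partial>lborel)"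
  proof (rule nn_integral_dominated_convergence[where w="\<lambda>z. ennreal C * ?w z"])
    show "(\<integral>\<^sup>+z. ennreal C * ?w z \<partial>lborel) < \<infinity>"
      using cross_dominator_finite[OF T0] by (subst nn_integral_cmult) (auto simp: ennreal_mult_less_top wm)
    show "AE z in lborel. ennreal (?u (j + N) z) \<le> ennreal C * ?w z" for j
      by (intro AE_I2 dom) simp
    show "AE z in lborel. (\<lambda>i. ennreal (?u (i + N) z)) \<longlonglongrightarrow> ennreal (?v z)"
      using pc by (rule AE_mp) (intro AE_I2 impI LIMSEQ_ignore_initial_segment)
  qed (use wm in measurable)
  then have "(\<lambda>n. \<integral>\<^sup>+z. ennreal (?u n z) \<partial>lborel) \<longlonglongrightarrow> (\<integral>\<^sup>+z. ennreal (?v z) \<partial>lborel)"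
    by (rule LIMSEQ_offset)
  then show ?thesis by (simp only: cross_integrand_0[OF pos(1)])
qed

section \<open>Rice densities of triangular Gaussian vectors\<close>

lemma continuous_AE_eq:
  fixes f g :: "'a::euclidean_space \<Rightarrow> real"
  assumes "continuous_on UNIV f" "continuous_on UNIV g" and ae: "AE x in lborel. f x = g x"
  shows "f = g"
proof (rule ccontr)
  assume "f \<noteq> g"
  then obtain x where x: "f x \<noteq> g x" by auto
  let ?S = "{x. f x \<noteq> g x}"
  have op: "open ?S" using assms(1,2) by (intro open_Collect_neq)
  have "?S \<in> null_sets lborel"
    using ae op AE_iff_null[of lborel "\<lambda>x. f x = g x"] by simp
  then have "negligible ?S"
    by (simp add: negligible_iff_null_sets null_sets_completionI)
  then show False using open_not_negligible[OF op] x by auto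
qed

text \<open>Two densities of one variable agree almost everywhere, and continuous functions that
  agree almost everywhere are equal. Exhibiting one continuous density therefore evaluates the
  description operator in \<open>cont_density\<close>.\<close>

lemma cont_density_eqI:
  fixes X :: "'w \<Rightarrow> 'v::euclidean_space"
  assumes "prob_space M" and p: "continuous_on UNIV p" "\<And>z. 0 \<le> p z" "distributed M lborel X (\<lambda>z. ennreal (p z))"
  shows "cont_density M X = p"
  unfolding cont_density_def
proof (rule the_equality)
  interpret prob_space M by fact
  show "continuous_on UNIV p \<and> (\<forall>z. 0 \<le> p z) \<and> distributed M lborel X (\<lambda>z. ennreal (p z))" using p by auto
  fix q assume q: "continuous_on UNIV q \<and> (\<forall>z. 0 \<le> q z) \<and> distributed M lborel X (\<lambda>z. ennreal (q z))"
  have "AE x in lborel. ennreal (q x) = ennreal (p x)"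
    using q p(3) by (intro distributed_unique[of lborel X]) auto
  then have "AE x in lborel. q x = p x"
    by (rule eventually_mono) (use p(2) q in auto)
  then show "q = p" using q p(1) by (intro continuous_AE_eq) auto
qed

lemma nn_integral_phi_affine:
  assumes [measurable]: "H \<in> borel_measurable borel" and l: "0 < l"
  shows "(\<integral>\<^sup>+z. ennreal (\<phi> z) * H (m + l * z) \<partial>lborel) = (\<integral>\<^sup>+x. ennreal (\<phi> ((x - m) / l) / l) * H x \<partial>lborel)"
proof -
  have "(\<integral>\<^sup>+x. ennreal (\<phi> ((x - m) / l) / l) * H x \<partial>lborel) = \<bar>l\<bar> * (\<integral>\<^sup>+z. ennreal (\<phi> ((m + l * z - m) / l) / l) * H (m + l * z) \<partial>lborel)"
    using l by (intro nn_integral_real_affine) auto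
  also have "\<dots> = (\<integral>\<^sup>+z. ennreal l * (ennreal (\<phi> z / l) * H (m + l * z)) \<partial>lborel)"
    using l by (subst nn_integral_cmult[symmetric]) auto
  also have "\<dots> = (\<integral>\<^sup>+z. ennreal (\<phi> z) * H (m + l * z) \<partial>lborel)"
    using l by (simp add: mult.assoc[symmetric] ennreal_mult[symmetric])
  finally show ?thesis ..
qed

text \<open>The density of the vector (a + l z1, b + c z1 + d z2) for independent standard normal z1
  and z2, as marginal times conditional density.\<close>

definition dens2 :: "real \<Rightarrow> real \<Rightarrow> real \<Rightarrow> real \<Rightarrow> real \<Rightarrow> real \<times> real \<Rightarrow> real" where
  "dens2 a l b c d x = \<phi> ((fst x - a) / l) / l * (\<phi> ((snd x - (b + c * ((fst x - a) / l))) / d) / d)"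

lemma dens2_nonneg: "0 < l \<Longrightarrow> 0 < d \<Longrightarrow> 0 \<le> dens2 a l b c d x"
  by (simp add: dens2_def)

lemma dens2_measurable [measurable]: "dens2 a l b c d \<in> borel_measurable borel"
  unfolding dens2_def[abs_def] by (simp add: borel_prod[symmetric])

lemma nn_integral_dens2:
  assumes H[measurable]: "H \<in> borel_measurable borel" and l: "0 < l" "0 < d"
  shows "(\<integral>\<^sup>+z. ennreal (\<phi> (fst z) * \<phi> (snd z)) * H (a + l * fst z, b + c * fst z + d * snd z) \<partial>lborel) =
    (\<integral>\<^sup>+x. ennreal (dens2 a l b c d x) * H x \<partial>lborel)"
proof -
  have HP: "(\<lambda>z. H (a + l * fst z, b + c * fst z + d * snd z)) \<in> borel_measurable borel"
    by (rule measurable_compose[OF _ H]) (intro borel_measurable_continuous_onI continuous_intros)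
  have Hs: "(\<lambda>y. H (x, y)) \<in> borel_measurable borel" for x
    by (rule measurable_compose[OF _ H]) simp
  have "(\<integral>\<^sup>+z. ennreal (\<phi> (fst z) * \<phi> (snd z)) * H (a + l * fst z, b + c * fst z + d * snd z) \<partial>lborel) =
    (\<integral>\<^sup>+z1. \<integral>\<^sup>+z2. ennreal (\<phi> z1 * \<phi> z2) * H (a + l * z1, b + c * z1 + d * z2) \<partial>lborel \<partial>lborel)"
    using HP by (subst nn_integral_lborel_pair(1)) (auto simp: borel_prod[symmetric])
  also have "\<dots> = (\<integral>\<^sup>+z1. ennreal (\<phi> z1) * (\<integral>\<^sup>+z2. ennreal (\<phi> z2) * H (a + l * z1, (b + c * z1) + d * z2) \<partial>lborel) \<partial>lborel)"
  proof (rule nn_integral_cong)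
    fix z1
    have [measurable]: "(\<lambda>z2. H (a + l * z1, b + c * z1 + d * z2)) \<in> borel_measurable borel"
      by (rule measurable_compose[OF _ H]) simp
    show "(\<integral>\<^sup>+z2. ennreal (\<phi> z1 * \<phi> z2) * H (a + l * z1, b + c * z1 + d * z2) \<partial>lborel) =
      ennreal (\<phi> z1) * (\<integral>\<^sup>+z2. ennreal (\<phi> z2) * H (a + l * z1, (b + c * z1) + d * z2) \<partial>lborel)"
      by (subst nn_integral_cmult[symmetric]) (auto simp: ennreal_mult mult.assoc)
  qed
  also have "\<dots> = (\<integral>\<^sup>+z1. ennreal (\<phi> z1) * (\<integral>\<^sup>+y. ennreal (\<phi> ((y - (b + c * z1)) / d) / d) * H (a + l * z1, y) \<partial>lborel) \<partial>lborel)"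
    using l Hs by (subst nn_integral_phi_affine) auto
  also have "\<dots> = (\<integral>\<^sup>+z1. ennreal (\<phi> z1) * (\<lambda>x. \<integral>\<^sup>+y. ennreal (\<phi> ((y - (b + c * ((x - a) / l))) / d) / d) * H (x, y) \<partial>lborel) (a + l * z1) \<partial>lborel)"
    using l by simp
  also have "\<dots> = (\<integral>\<^sup>+x. ennreal (\<phi> ((x - a) / l) / l) * (\<integral>\<^sup>+y. ennreal (\<phi> ((y - (b + c * ((x - a) / l))) / d) / d) * H (x, y) \<partial>lborel) \<partial>lborel)"
  proof (rule nn_integral_phi_affine[OF _ l(1)])
    have "(\<lambda>(x, y). ennreal (\<phi> ((y - (b + c * ((x - a) / l))) / d) / d) * H (x, y)) \<in> borel_measurable (borel \<Otimes>\<^sub>M borel)"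
      using H by (simp add: borel_prod[symmetric])
    then show "(\<lambda>x. \<integral>\<^sup>+y. ennreal (\<phi> ((y - (b + c * ((x - a) / l))) / d) / d) * H (x, y) \<partial>lborel) \<in> borel_measurable borel"
      by (simp add: split_beta' lborel.borel_measurable_nn_integral)
  qed
  also have "\<dots> = (\<integral>\<^sup>+x. \<integral>\<^sup>+y. ennreal (dens2 a l b c d (x, y)) * H (x, y) \<partial>lborel \<partial>lborel)"
  proof (rule nn_integral_cong)
    fix x
    have [measurable]: "(\<lambda>y. H (x, y)) \<in> borel_measurable borel" by (rule Hs)
    have "ennreal (dens2 a l b c d (x, y)) * H (x, y) = ennreal (\<phi> ((x - a) / l) / l) * (ennreal (\<phi> ((y - (b + c * ((x - a) / l))) / d) / d) * H (x, y))" for y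
      unfolding dens2_def fst_conv snd_conv using l by (subst ennreal_mult) (simp_all add: mult.assoc)
    then show "ennreal (\<phi> ((x - a) / l) / l) * (\<integral>\<^sup>+y. ennreal (\<phi> ((y - (b + c * ((x - a) / l))) / d) / d) * H (x, y) \<partial>lborel) =
      (\<integral>\<^sup>+y. ennreal (dens2 a l b c d (x, y)) * H (x, y) \<partial>lborel)"
      by (simp only:) (rule nn_integral_cmult[symmetric], measurable)
  qed
  also have "\<dots> = (\<integral>\<^sup>+x. ennreal (dens2 a l b c d x) * H x \<partial>lborel)"
    by (rule nn_integral_lborel_pair(1)[symmetric]) measurable
  finally show ?thesis .
qed

lemma nn_integral_phi_phi: "(\<integral>\<^sup>+z. ennreal (\<phi> (fst z) * \<phi> (snd z)) \<partial>lborel) = 1"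
proof -
  have 1: "(\<integral>\<^sup>+x. ennreal (\<phi> x) \<partial>lborel) = 1"
    using integral_phi by (simp add: nn_integral_eq_integral)
  show ?thesis
    by (subst nn_integral_lborel_pair(1)) (simp_all add: borel_prod[symmetric] ennreal_mult nn_integral_cmult 1)
qed

text \<open>The marginal density of the first pair times the conditional density of the second pair.
  In this form conditioning on the first pair only removes the first factor.\<close>

definition dens4 where
  "dens4 m1 m2 m3 m4 R l2 l31 l32 l33 l41 l42 l43 l44 = (\<lambda>(x, y). dens2 m1 1 m2 R l2 x *
     (let z1 = fst x - m1; z2 = (snd x - (m2 + R * z1)) / l2 in
      dens2 (m3 + l31 * z1 + l32 * z2) l33 (m4 + l41 * z1 + l42 * z2) l43 l44 y))"

lemma dens4_measurable [measurable]:
  "dens4 m1 m2 m3 m4 R l2 l31 l32 l33 l41 l42 l43 l44 \<in> borel_measurable borel"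
  unfolding dens4_def dens2_def Let_def split_beta by (simp add: borel_prod[symmetric])

lemma phi_cont: "continuous_on S f \<Longrightarrow> continuous_on S (\<lambda>x. \<phi> (f x))"
  unfolding std_normal_density_def by (intro continuous_intros) auto

lemma dens_cont:
  assumes "0 < l2" "0 < l33" "0 < l44"
  shows "continuous_on UNIV (dens2 m1 1 m2 R l2)"
    "continuous_on UNIV (dens4 m1 m2 m3 m4 R l2 l31 l32 l33 l41 l42 l43 l44)"
  unfolding dens4_def dens2_def[abs_def] Let_def split_beta using assms
  by (intro continuous_intros phi_cont; auto)+

context prob_space
begin

lemma triangular_gaussian_density:
  assumes tg: "triangular_gaussian M X1 X2 X3 X4 m1 m2 m3 m4 l21 l22 l31 l32 l33 l41 l42 l43 l44"
    and H[measurable]: "H \<in> borel_measurable borel"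
  shows "(\<integral>\<^sup>+\<omega>. H ((X1 \<omega>, X2 \<omega>), (X3 \<omega>, X4 \<omega>)) \<partial>M) =
    (\<integral>\<^sup>+z. ennreal (dens4 m1 m2 m3 m4 l21 l22 l31 l32 l33 l41 l42 l43 l44 z) * H z \<partial>lborel)"
proof -
  have pos: "0 < l22" "0 < l33" "0 < l44" using tg by (auto simp: triangular_gaussian_def)
  let ?T = "triangular_map m1 m2 m3 m4 l21 l22 l31 l32 l33 l41 l42 l43 l44"
  define J where "J = (\<lambda>x. \<integral>\<^sup>+y. ennreal (dens2 (m3 + l31 * (fst x - m1) + l32 * ((snd x - (m2 + l21 * (fst x - m1))) / l22)) l33
    (m4 + l41 * (fst x - m1) + l42 * ((snd x - (m2 + l21 * (fst x - m1))) / l22)) l43 l44 y) * H (x, y) \<partial>lborel)"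
  have Jm: "(\<lambda>(x, y). ennreal (dens2 (m3 + l31 * (fst x - m1) + l32 * ((snd x - (m2 + l21 * (fst x - m1))) / l22)) l33
    (m4 + l41 * (fst x - m1) + l42 * ((snd x - (m2 + l21 * (fst x - m1))) / l22)) l43 l44 y) * H (x, y)) \<in> borel_measurable (borel \<Otimes>\<^sub>M borel)"
    unfolding dens2_def using H by (simp add: borel_prod[symmetric])
  have J[measurable]: "J \<in> borel_measurable borel"
    using Jm unfolding J_def by (simp add: split_beta' lborel.borel_measurable_nn_integral)
  have Hs[measurable]: "(\<lambda>y. H (x, y)) \<in> borel_measurable borel" for x
    by (rule measurable_compose[OF _ H]) simp
  have "(\<integral>\<^sup>+\<omega>. H ((X1 \<omega>, X2 \<omega>), (X3 \<omega>, X4 \<omega>)) \<partial>M) = (\<integral>\<^sup>+z. ennreal (std4 z) * H (?T z) \<partial>lborel)"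
    by (rule triangular_gaussian_nn_integral[OF tg H])
  also have "\<dots> = (\<integral>\<^sup>+v. \<integral>\<^sup>+w. ennreal (std4 (v, w)) * H (?T (v, w)) \<partial>lborel \<partial>lborel)"
    by (rule nn_integral_lborel_pair(1)) measurable
  also have "\<dots> = (\<integral>\<^sup>+v. ennreal (\<phi> (fst v) * \<phi> (snd v)) * J (m1 + 1 * fst v, m2 + l21 * fst v + l22 * snd v) \<partial>lborel)"
  proof (rule nn_integral_cong)
    fix v :: "real \<times> real"
    let ?x = "(m1 + 1 * fst v, m2 + l21 * fst v + l22 * snd v)"
    have "(\<integral>\<^sup>+w. ennreal (std4 (v, w)) * H (?T (v, w)) \<partial>lborel) =
      (\<integral>\<^sup>+w. ennreal (\<phi> (fst v) * \<phi> (snd v)) * (ennreal (\<phi> (fst w) * \<phi> (snd w)) *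
         H (?x, ((m3 + l31 * fst v + l32 * snd v) + l33 * fst w, (m4 + l41 * fst v + l42 * snd v) + l43 * fst w + l44 * snd w))) \<partial>lborel)"
      by (intro nn_integral_cong) (simp add: std4_def triangular_map_def split_beta ennreal_mult mult.assoc add.assoc)
    also have "\<dots> = ennreal (\<phi> (fst v) * \<phi> (snd v)) * (\<integral>\<^sup>+w. ennreal (\<phi> (fst w) * \<phi> (snd w)) *
         H (?x, ((m3 + l31 * fst v + l32 * snd v) + l33 * fst w, (m4 + l41 * fst v + l42 * snd v) + l43 * fst w + l44 * snd w)) \<partial>lborel)"
    proof (rule nn_integral_cmult)
      have "(\<lambda>w. (?x, ((m3 + l31 * fst v + l32 * snd v) + l33 * fst w, (m4 + l41 * fst v + l42 * snd v) + l43 * fst w + l44 * snd w))) \<in> borel_measurable borel"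
        by (intro borel_measurable_continuous_onI continuous_intros)
      from measurable_compose[OF this H]
      show "(\<lambda>w. ennreal (\<phi> (fst w) * \<phi> (snd w)) * H (?x, ((m3 + l31 * fst v + l32 * snd v) + l33 * fst w, (m4 + l41 * fst v + l42 * snd v) + l43 * fst w + l44 * snd w))) \<in> borel_measurable lborel"
        by (simp add: borel_prod[symmetric])
    qed
    also have "(\<integral>\<^sup>+w. ennreal (\<phi> (fst w) * \<phi> (snd w)) *
         H (?x, ((m3 + l31 * fst v + l32 * snd v) + l33 * fst w, (m4 + l41 * fst v + l42 * snd v) + l43 * fst w + l44 * snd w)) \<partial>lborel) = J ?x"
      using nn_integral_dens2[OF Hs[of ?x] pos(2,3)] pos unfolding J_def by simp
    finally show "(\<integral>\<^sup>+w. ennreal (std4 (v, w)) * H (?T (v, w)) \<partial>lborel) = ennreal (\<phi> (fst v) * \<phi> (snd v)) * J ?x" .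
  qed
  also have "\<dots> = (\<integral>\<^sup>+x. ennreal (dens2 m1 1 m2 l21 l22 x) * J x \<partial>lborel)"
    by (rule nn_integral_dens2[OF J]) (use pos in auto)
  also have "\<dots> = (\<integral>\<^sup>+x. \<integral>\<^sup>+y. ennreal (dens4 m1 m2 m3 m4 l21 l22 l31 l32 l33 l41 l42 l43 l44 (x, y)) * H (x, y) \<partial>lborel \<partial>lborel)"
    unfolding J_def using pos
    by (subst nn_integral_cmult[symmetric])
       (auto simp: dens4_def Let_def ennreal_mult dens2_nonneg mult.assoc)
  also have "\<dots> = (\<integral>\<^sup>+z. ennreal (dens4 m1 m2 m3 m4 l21 l22 l31 l32 l33 l41 l42 l43 l44 z) * H z \<partial>lborel)"
    by (rule nn_integral_lborel_pair(1)[symmetric]) measurable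
  finally show ?thesis .
qed

text \<open>The second claim follows from the first by integrating out the conditional factor of
  \<open>dens4\<close>, whose total mass is 1.\<close>

lemma triangular_gaussian_cont_density:
  assumes tg: "triangular_gaussian M X1 X2 X3 X4 m1 m2 m3 m4 l21 l22 l31 l32 l33 l41 l42 l43 l44"
  shows "cont_density M (\<lambda>\<omega>. ((X1 \<omega>, X2 \<omega>), (X3 \<omega>, X4 \<omega>))) = dens4 m1 m2 m3 m4 l21 l22 l31 l32 l33 l41 l42 l43 l44" (is ?th1)
    and "cont_density M (\<lambda>\<omega>. (X1 \<omega>, X2 \<omega>)) = dens2 m1 1 m2 l21 l22" (is ?th2)
proof -
  have pos: "0 < l22" "0 < l33" "0 < l44" using tg by (auto simp: triangular_gaussian_def)
  have [measurable]: "X1 \<in> borel_measurable M" "X2 \<in> borel_measurable M"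
    "X3 \<in> borel_measurable M" "X4 \<in> borel_measurable M" using tg by (auto simp: triangular_gaussian_def)
  let ?X = "\<lambda>\<omega>. ((X1 \<omega>, X2 \<omega>), (X3 \<omega>, X4 \<omega>))"
  let ?p = "dens4 m1 m2 m3 m4 l21 l22 l31 l32 l33 l41 l42 l43 l44"
  have X: "?X \<in> M \<rightarrow>\<^sub>M lborel" by simp
  have "distr M lborel ?X = density lborel (\<lambda>z. ennreal (?p z))"
  proof (rule measure_eqI)
    fix A assume "A \<in> sets (distr M lborel ?X)"
    then have A[measurable]: "A \<in> sets borel" by simp
    have "emeasure (distr M lborel ?X) A = (\<integral>\<^sup>+\<omega>. indicator A (?X \<omega>) \<partial>M)"
    proof -
      have "emeasure (distr M lborel ?X) A = (\<integral>\<^sup>+x. indicator A x \<partial>distr M lborel ?X)" by simp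
      also have "\<dots> = (\<integral>\<^sup>+\<omega>. indicator A (?X \<omega>) \<partial>M)" by (rule nn_integral_distr[OF X]) simp
      finally show ?thesis .
    qed
    also have "\<dots> = (\<integral>\<^sup>+z. ennreal (?p z) * indicator A z \<partial>lborel)"
      by (rule triangular_gaussian_density[OF tg]) measurable
    also have "\<dots> = emeasure (density lborel (\<lambda>z. ennreal (?p z))) A"
      by (subst emeasure_density) auto
    finally show "emeasure (distr M lborel ?X) A = emeasure (density lborel (\<lambda>z. ennreal (?p z))) A" .
  qed simp
  then have d4: "distributed M lborel ?X (\<lambda>z. ennreal (?p z))" using X by (simp add: distributed_def)
  show ?th1
    using dens_cont(2)[OF pos] pos
    by (intro cont_density_eqI[OF prob_space_axioms _ _ d4]) (auto simp: dens4_def Let_def dens2_nonneg)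
  let ?Y = "\<lambda>\<omega>. (X1 \<omega>, X2 \<omega>)"
  have Y: "?Y \<in> M \<rightarrow>\<^sub>M lborel" by simp
  let ?q = "dens2 m1 1 m2 l21 l22"
  have "distr M lborel ?Y = density lborel (\<lambda>z. ennreal (?q z))"
  proof (rule measure_eqI)
    fix A assume "A \<in> sets (distr M lborel ?Y)"
    then have A[measurable]: "A \<in> sets borel" by simp
    have fm: "(\<lambda>z::(real \<times> real) \<times> (real \<times> real). indicator A (fst z) :: ennreal) \<in> borel_measurable borel"
    proof -
      have f: "(\<lambda>z::(real \<times> real) \<times> (real \<times> real). fst z) \<in> borel \<rightarrow>\<^sub>M borel"
        by (intro borel_measurable_continuous_onI continuous_intros)
      show ?thesis by (rule measurable_compose[OF f borel_measurable_indicator[OF A]])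
    qed
    have "emeasure (distr M lborel ?Y) A = (\<integral>\<^sup>+\<omega>. (\<lambda>z. indicator A (fst z)) (?X \<omega>) \<partial>M)"
    proof -
      have "emeasure (distr M lborel ?Y) A = (\<integral>\<^sup>+x. indicator A x \<partial>distr M lborel ?Y)" by simp
      also have "\<dots> = (\<integral>\<^sup>+\<omega>. indicator A (?Y \<omega>) \<partial>M)" by (rule nn_integral_distr[OF Y]) simp
      finally show ?thesis by simp
    qed
    also have "\<dots> = (\<integral>\<^sup>+z. ennreal (?p z) * indicator A (fst z) \<partial>lborel)"
      by (rule triangular_gaussian_density[OF tg fm])
    also have "\<dots> = (\<integral>\<^sup>+x. \<integral>\<^sup>+y. ennreal (?p (x, y)) * indicator A x \<partial>lborel \<partial>lborel)"
      using fm by (subst nn_integral_lborel_pair(1)) auto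
    also have "\<dots> = (\<integral>\<^sup>+x. ennreal (?q x) * indicator A x \<partial>lborel)"
    proof (rule nn_integral_cong)
      fix x :: "real \<times> real"
      let ?a = "m3 + l31 * (fst x - m1) + l32 * ((snd x - (m2 + l21 * (fst x - m1))) / l22)"
      let ?b = "m4 + l41 * (fst x - m1) + l42 * ((snd x - (m2 + l21 * (fst x - m1))) / l22)"
      have one: "(\<integral>\<^sup>+y. ennreal (dens2 ?a l33 ?b l43 l44 y) \<partial>lborel) = 1"
        using nn_integral_dens2[of "\<lambda>_. 1" l33 l44 ?a ?b l43] pos nn_integral_phi_phi by simp
      have "(\<integral>\<^sup>+y. ennreal (?p (x, y)) * indicator A x \<partial>lborel) = (\<integral>\<^sup>+y. (ennreal (?q x) * indicator A x) * ennreal (dens2 ?a l33 ?b l43 l44 y) \<partial>lborel)"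
        using pos by (intro nn_integral_cong) (simp add: dens4_def Let_def ennreal_mult dens2_nonneg mult_ac)
      also have "\<dots> = (ennreal (?q x) * indicator A x) * (\<integral>\<^sup>+y. ennreal (dens2 ?a l33 ?b l43 l44 y) \<partial>lborel)"
        by (rule nn_integral_cmult) simp
      also have "\<dots> = ennreal (?q x) * indicator A x" unfolding one by simp
      finally show "(\<integral>\<^sup>+y. ennreal (?p (x, y)) * indicator A x \<partial>lborel) = ennreal (?q x) * indicator A x" .
    qed
    also have "\<dots> = emeasure (density lborel (\<lambda>z. ennreal (?q z))) A"
      by (subst emeasure_density) auto
    finally show "emeasure (distr M lborel ?Y) A = emeasure (density lborel (\<lambda>z. ennreal (?q z))) A" .
  qed simp
  then have d2: "distributed M lborel ?Y (\<lambda>z. ennreal (?q z))" using Y by (simp add: distributed_def)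
  show ?th2
    using dens_cont(1)[OF pos] pos
    by (intro cont_density_eqI[OF prob_space_axioms _ _ d2]) (auto simp: dens2_nonneg)
qed

text \<open>The marginal density at the origin is positive and cancels in the conditional density.
  What remains integrates |u v| against a Gaussian density, and returning to standard normal
  variables gives the integral in \<open>cross_limit\<close>.\<close>

lemma triangular_gaussian_rice:
  assumes tg: "triangular_gaussian M X1 X2 X3 X4 m1 m2 m3 m4 l21 l22 l31 l32 l33 l41 l42 l43 l44"
  shows "cond_expectation_at M (\<lambda>(u, v). \<bar>u * v\<bar>) (\<lambda>\<omega>. (X3 \<omega>, X4 \<omega>)) (\<lambda>\<omega>. (X1 \<omega>, X2 \<omega>)) (0, 0)
     * cont_density M (\<lambda>\<omega>. (X1 \<omega>, X2 \<omega>)) (0, 0) =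
    enn2real (cross_limit m1 m2 m3 m4 l21 l22 l31 l32 l33 l41 l42 l43 l44)"
proof -
  have pos: "0 < l22" "0 < l33" "0 < l44" using tg by (auto simp: triangular_gaussian_def)
  define \<zeta> where "\<zeta> = cross_z2_0 m1 m2 l21 l22"
  let ?a = "m3 + l31 * (- m1) + l32 * \<zeta>" and ?b = "m4 + l41 * (- m1) + l42 * \<zeta>"
  let ?q0 = "dens2 m1 1 m2 l21 l22 (0, 0)"
  have q0: "?q0 = \<phi> m1 * \<phi> \<zeta> / l22"
  proof -
    have "(0 - (m2 + l21 * ((0 - m1) / 1))) / l22 = \<zeta>" by (simp add: \<zeta>_def cross_z2_0_def)
    then show ?thesis unfolding dens2_def fst_conv snd_conv by (simp add: phi_even)
  qed
  have q0pos: "0 < ?q0" unfolding q0 using pos by (simp add: normal_density_pos)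
  have r: "dens4 m1 m2 m3 m4 l21 l22 l31 l32 l33 l41 l42 l43 l44 ((0, 0), y) = ?q0 * dens2 ?a l33 ?b l43 l44 y" for y
    by (simp add: dens4_def Let_def \<zeta>_def cross_z2_0_def)
  have "cond_expectation_at M (\<lambda>(u, v). \<bar>u * v\<bar>) (\<lambda>\<omega>. (X3 \<omega>, X4 \<omega>)) (\<lambda>\<omega>. (X1 \<omega>, X2 \<omega>)) (0, 0) =
    (\<integral>y. \<bar>fst y * snd y\<bar> * dens2 ?a l33 ?b l43 l44 y \<partial>lborel)"
    unfolding cond_expectation_at_def triangular_gaussian_cont_density[OF tg] r
    using q0pos by (simp add: split_beta)
  also have "\<dots> = enn2real (\<integral>\<^sup>+y. ennreal (\<bar>fst y * snd y\<bar> * dens2 ?a l33 ?b l43 l44 y) \<partial>lborel)"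
  proof (rule integral_eq_nn_integral)
    note [measurable (raw)] = borel_measurable_fst_snd
    show "(\<lambda>y. \<bar>fst y * snd y\<bar> * dens2 ?a l33 ?b l43 l44 y) \<in> borel_measurable lborel" by measurable
  qed (use pos in \<open>auto simp: dens2_nonneg\<close>)
  also have "(\<integral>\<^sup>+y. ennreal (\<bar>fst y * snd y\<bar> * dens2 ?a l33 ?b l43 l44 y) \<partial>lborel) =
    (\<integral>\<^sup>+y. ennreal (dens2 ?a l33 ?b l43 l44 y) * ennreal \<bar>fst y * snd y\<bar> \<partial>lborel)"
    using pos by (intro nn_integral_cong) (simp add: ennreal_mult dens2_nonneg mult.commute)
  also have "\<dots> = (\<integral>\<^sup>+z. ennreal (\<phi> (fst z) * \<phi> (snd z)) * ennreal \<bar>fst (?a + l33 * fst z, ?b + l43 * fst z + l44 * snd z) * snd (?a + l33 * fst z, ?b + l43 * fst z + l44 * snd z)\<bar> \<partial>lborel)"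
    by (rule nn_integral_dens2[symmetric]) (use pos in \<open>auto simp: borel_prod[symmetric]\<close>)
  also have "\<dots> = (\<integral>\<^sup>+w. ennreal (\<phi> (fst w) * \<phi> (snd w) *
        (\<bar>m3 - l31 * m1 + l32 * \<zeta> + l33 * fst w\<bar> * \<bar>m4 - l41 * m1 + l42 * \<zeta> + l43 * fst w + l44 * snd w\<bar>)) \<partial>lborel)"
    by (intro nn_integral_cong) (simp add: ennreal_mult abs_mult)
  finally show ?thesis
    unfolding cross_limit_def triangular_gaussian_cont_density[OF tg] q0 \<zeta>_def[symmetric]
    using q0pos q0 by (simp add: enn2real_mult)
qed

end

text \<open>Given that the first two coordinates vanish, the third has standard deviation
  \<open>l33\<close>, the fourth has standard deviation \<open>\<sigma>2\<close>, and their
  correlation is \<open>l43 / \<sigma>2\<close>. Dividing by the deviations reduces the mean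
  absolute product to shifted standard normal variables.\<close>

lemma cross_limit_corr_expectation:
  fixes m1 m2 m3 m4 R l31 l32 l33 l41 l42 l43 l44 :: real
  assumes R: "R\<^sup>2 < 1" and l: "0 < l33" "0 < l44"
  defines "\<zeta> \<equiv> cross_z2_0 m1 m2 R (sqrt (1 - R\<^sup>2))"
  defines "\<sigma>2 \<equiv> sqrt (l43\<^sup>2 + l44\<^sup>2)"
  shows "\<bar>l43 / \<sigma>2\<bar> < 1"
    "cross_limit m1 m2 m3 m4 R (sqrt (1 - R\<^sup>2)) l31 l32 l33 l41 l42 l43 l44 =
      ennreal (corr_density R m1 m2 * (l33 * \<sigma>2 * corr_expectation (l43 / \<sigma>2)
        (\<lambda>x. \<bar>(m3 - l31 * m1 + l32 * \<zeta>) / l33 + x\<bar>) (\<lambda>x. \<bar>(m4 - l41 * m1 + l42 * \<zeta>) / \<sigma>2 + x\<bar>)))"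
proof -
  define \<delta> where "\<delta> = l43 / \<sigma>2"
  define v where "v = sqrt (1 - R\<^sup>2)"
  have v: "0 < v" using R by (simp add: v_def)
  have s2: "0 < \<sigma>2" "\<sigma>2\<^sup>2 = l43\<^sup>2 + l44\<^sup>2" using l by (auto simp: \<sigma>2_def add_nonneg_pos)
  have d2: "1 - \<delta>\<^sup>2 = (l44 / \<sigma>2)\<^sup>2"
    using s2 l by (simp add: \<delta>_def power_divide field_simps)
  have "0 < 1 - \<delta>\<^sup>2" unfolding d2 using l s2 by simp
  then show d: "\<bar>l43 / \<sigma>2\<bar> < 1" unfolding \<delta>_def[symmetric] by (simp add: abs_square_less_1)
  have dd: "\<bar>\<delta>\<bar> < 1" using d by (simp add: \<delta>_def)
  have sd: "sqrt (1 - \<delta>\<^sup>2) = l44 / \<sigma>2" unfolding d2 using l s2 by simp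
  let ?m = "m3 - l31 * m1 + l32 * \<zeta>" and ?n = "m4 - l41 * m1 + l42 * \<zeta>"
  let ?f = "\<lambda>x. \<bar>?m / l33 + x\<bar>" and ?g = "\<lambda>x. \<bar>?n / \<sigma>2 + x\<bar>"
  have scale: "\<bar>a + l * x\<bar> = l * \<bar>a / l + x\<bar>" if "0 < l" for a l x :: real
  proof -
    have "a + l * x = l * (a / l + x)" using that by (simp add: distrib_left)
    then show ?thesis using that by (simp only: abs_mult abs_of_pos)
  qed
  have f: "\<bar>?m + l33 * x\<bar> = l33 * ?f x" for x
    by (rule scale[OF l(1)])
  have g: "\<bar>?n + l43 * x + l44 * w\<bar> = \<sigma>2 * ?g (\<delta> * x + sqrt (1 - \<delta>\<^sup>2) * w)" for x w
  proof -
    have e: "?n + l43 * x + l44 * w = ?n + \<sigma>2 * (\<delta> * x + sqrt (1 - \<delta>\<^sup>2) * w)"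
      unfolding sd using s2(1) by (simp add: distrib_left \<delta>_def)
    show ?thesis by (simp only: e scale[OF s2(1)])
  qed
  have gK: "0 \<le> corr_cond \<delta> ?g x" for x unfolding corr_cond_def by (intro Bochner_Integration.integral_nonneg) auto
  have gg: "lin_growth ?g" "lin_growth ?f" by (rule lin_growth_abs_shift)+
  have "(\<integral>\<^sup>+w. ennreal (\<phi> (fst w) * \<phi> (snd w) * (\<bar>?m + l33 * fst w\<bar> * \<bar>?n + l43 * fst w + l44 * snd w\<bar>)) \<partial>lborel) =
    (\<integral>\<^sup>+x. \<integral>\<^sup>+w. ennreal (\<phi> x * \<phi> w * (\<bar>?m + l33 * x\<bar> * \<bar>?n + l43 * x + l44 * w\<bar>)) \<partial>lborel \<partial>lborel)"
    by (subst nn_integral_lborel_pair(1)) (auto simp: borel_prod[symmetric])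
  also have "\<dots> = (\<integral>\<^sup>+x. ennreal (l33 * \<sigma>2) * ennreal (\<phi> x * ?f x * corr_cond \<delta> ?g x) \<partial>lborel)"
  proof (rule nn_integral_cong)
    fix x
    have "(\<integral>\<^sup>+w. ennreal (\<phi> x * \<phi> w * (\<bar>?m + l33 * x\<bar> * \<bar>?n + l43 * x + l44 * w\<bar>)) \<partial>lborel) =
      (\<integral>\<^sup>+w. ennreal (l33 * \<sigma>2 * (\<phi> x * ?f x)) * ennreal (\<phi> w * ?g (\<delta> * x + sqrt (1 - \<delta>\<^sup>2) * w)) \<partial>lborel)"
      unfolding f g using l s2 by (intro nn_integral_cong) (simp add: ennreal_mult[symmetric] mult_ac)
    also have "\<dots> = ennreal (l33 * \<sigma>2 * (\<phi> x * ?f x)) * ennreal (corr_cond \<delta> ?g x)"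
      unfolding corr_cond_def using corr_cond_integrable[OF dd gg(1), of x]
      by (subst nn_integral_cmult, simp, subst nn_integral_eq_integral) auto
    also have "\<dots> = ennreal (l33 * \<sigma>2) * ennreal (\<phi> x * ?f x * corr_cond \<delta> ?g x)"
      using l s2 gK[of x] by (simp add: ennreal_mult[symmetric] mult_ac)
    finally show "(\<integral>\<^sup>+w. ennreal (\<phi> x * \<phi> w * (\<bar>?m + l33 * x\<bar> * \<bar>?n + l43 * x + l44 * w\<bar>)) \<partial>lborel) =
      ennreal (l33 * \<sigma>2) * ennreal (\<phi> x * ?f x * corr_cond \<delta> ?g x)" .
  qed
  also have "\<dots> = ennreal (l33 * \<sigma>2) * ennreal (corr_expectation \<delta> ?f ?g)"
    unfolding corr_expectation_def using phi_growth2_integrable[OF dd gg(2) corr_cond_growth[OF dd gg(1)]] gK corr_cond_measurable[OF dd gg(1)]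
    by (subst nn_integral_cmult, simp, subst nn_integral_eq_integral) auto
  finally have I: "(\<integral>\<^sup>+w. ennreal (\<phi> (fst w) * \<phi> (snd w) * (\<bar>?m + l33 * fst w\<bar> * \<bar>?n + l43 * fst w + l44 * snd w\<bar>)) \<partial>lborel) = ennreal (l33 * \<sigma>2) * ennreal (corr_expectation \<delta> ?f ?g)" .
  have cH: "0 \<le> corr_expectation \<delta> ?f ?g" unfolding corr_expectation_def using gK by (intro Bochner_Integration.integral_nonneg) auto
  have cd: "\<phi> m1 * \<phi> \<zeta> / v = corr_density R m1 m2"
  proof -
    have "(m2 - R * m1) / v = - \<zeta>" by (simp add: \<zeta>_def cross_z2_0_def v_def minus_divide_left)
    then show ?thesis using corr_density_phi[of R m1 m2] R by (simp add: abs_square_less_1 v_def[symmetric] phi_even)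
  qed
  have cd0: "0 \<le> corr_density R m1 m2" unfolding cd[symmetric] using v by simp
  show "cross_limit m1 m2 m3 m4 R (sqrt (1 - R\<^sup>2)) l31 l32 l33 l41 l42 l43 l44 =
      ennreal (corr_density R m1 m2 * (l33 * \<sigma>2 * corr_expectation (l43 / \<sigma>2) ?f ?g))"
    unfolding cross_limit_def v_def[symmetric] \<zeta>_def[folded v_def, symmetric] I cd \<delta>_def[symmetric]
    using l s2 cd0 cH by (simp add: ennreal_mult[symmetric] mult.assoc)
qed

section \<open>Gaussian processes with differentiable paths\<close>

lemma deriv_onI:
  "g differentiable (at x within I) \<Longrightarrow> (g has_real_derivative deriv_on I g x) (at x within I)"
  unfolding deriv_on_def has_real_derivative_iff_has_vector_derivative by (simp add: vector_derivative_works)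

lemma mvt_within:
  fixes g :: "real \<Rightarrow> real"
  assumes I: "is_interval I" "a \<in> I" "b \<in> I"
    and g: "\<And>z. z \<in> I \<Longrightarrow> (g has_real_derivative g' z) (at z within I)"
  shows "\<exists>z\<in>I. \<bar>z - a\<bar> \<le> \<bar>b - a\<bar> \<and> g b - g a = g' z * (b - a)"
proof -
  have *: "\<exists>z\<in>{u<..<v}. g v - g u = g' z * (v - u)" "{u..v} \<subseteq> I" if "u \<in> I" "v \<in> I" "u < v" for u v
  proof -
    show s: "{u..v} \<subseteq> I" using I(1) that by (meson atLeastAtMost_iff is_interval_1 subsetI)
    have "\<exists>z\<in>{u<..<v}. g v - g u = (\<lambda>x. g' z * x) (v - u)"
    proof (rule mvt_simple[OF that(3)])
      fix z assume "u \<le> z" "z \<le> v"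
      then have "(g has_real_derivative g' z) (at z within {u..v})"
        using g s by (meson DERIV_subset atLeastAtMost_iff subsetD)
      then show "(g has_derivative (\<lambda>x. g' z * x)) (at z within {u..v})"
        by (simp add: has_field_derivative_def)
    qed
    then show "\<exists>z\<in>{u<..<v}. g v - g u = g' z * (v - u)" by simp
  qed
  consider "a = b" | "a < b" | "b < a" by linarith
  then show ?thesis
  proof cases
    case 1 then show ?thesis using I by auto
  next
    case 2
    from *[OF I(2,3) 2] obtain z where z: "z \<in> {a<..<b}" "g b - g a = g' z * (b - a)" "{a..b} \<subseteq> I" by auto
    then show ?thesis by (intro bexI[of _ z]) auto
  next
    case 3
    from *[OF I(3,2) 3] obtain z where z: "z \<in> {b<..<a}" "g a - g b = g' z * (a - b)" "{b..a} \<subseteq> I" by auto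
    then show ?thesis by (intro bexI[of _ z]) (auto simp: algebra_simps)
  qed
qed

text \<open>The grid points approach \<open>x\<close> without being fixed, so the definition of the
  derivative at \<open>x\<close> is not enough. Intermediate points that also tend to
  \<open>x\<close>, combined with continuity of the derivative, take its place.\<close>

lemma mvt_within_seq:
  fixes g :: "nat \<Rightarrow> real \<Rightarrow> real"
  assumes I: "is_interval I" "\<And>n. s n \<in> I" "\<And>n. s' n \<in> I" "s \<longlonglongrightarrow> x" "s' \<longlonglongrightarrow> x"
    and g: "\<And>n z. z \<in> I \<Longrightarrow> (g n has_real_derivative g' n z) (at z within I)"
  obtains \<xi> where "\<And>n. \<xi> n \<in> I" "\<xi> \<longlonglongrightarrow> x" "\<And>n. g n (s' n) - g n (s n) = g' n (\<xi> n) * (s' n - s n)"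
proof -
  have "\<forall>n. \<exists>z. z \<in> I \<and> \<bar>z - s n\<bar> \<le> \<bar>s' n - s n\<bar> \<and> g n (s' n) - g n (s n) = g' n z * (s' n - s n)"
    using mvt_within[OF I(1) I(2,3) g] by blast
  then obtain \<xi> where xi: "\<And>n. \<xi> n \<in> I" "\<And>n. \<bar>\<xi> n - s n\<bar> \<le> \<bar>s' n - s n\<bar>"
    "\<And>n. g n (s' n) - g n (s n) = g' n (\<xi> n) * (s' n - s n)" by metis
  have "(\<lambda>n. s' n - s n) \<longlonglongrightarrow> 0" using tendsto_diff[OF I(5,4)] by simp
  then have "(\<lambda>n. \<bar>s' n - s n\<bar>) \<longlonglongrightarrow> 0" by (simp add: tendsto_rabs_zero)
  then have "(\<lambda>n. \<xi> n - s n) \<longlonglongrightarrow> 0"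
    by (rule Lim_null_comparison[rotated]) (simp add: xi)
  from tendsto_add[OF this I(4)] have "\<xi> \<longlonglongrightarrow> x" by simp
  then show ?thesis using that xi by blast
qed

lemma C1_on_diff_quotient:
  assumes I: "is_interval I" "\<And>n. s n \<in> I" "\<And>n. s' n \<in> I" "s \<longlonglongrightarrow> x" "s' \<longlonglongrightarrow> x" "x \<in> I" "\<And>n. s n < s' n"
    and g: "C1_on I g"
  shows "(\<lambda>n. (g (s' n) - g (s n)) / (s' n - s n)) \<longlonglongrightarrow> deriv_on I g x"
proof -
  have d: "(g has_real_derivative deriv_on I g z) (at z within I)" if "z \<in> I" for z
    using g that by (auto simp: C1_on_def intro: deriv_onI)
  obtain \<xi> where xi: "\<And>n. \<xi> n \<in> I" "\<xi> \<longlonglongrightarrow> x" "\<And>n. g (s' n) - g (s n) = deriv_on I g (\<xi> n) * (s' n - s n)"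
    using mvt_within_seq[OF I(1-5), of "\<lambda>_. g" "\<lambda>_. deriv_on I g"] d by metis
  have "(\<lambda>n. deriv_on I g (\<xi> n)) \<longlonglongrightarrow> deriv_on I g x"
    using g xi I(6) by (intro continuous_on_tendsto_compose[of I "deriv_on I g"]) (auto simp: C1_on_def)
  moreover have "(g (s' n) - g (s n)) / (s' n - s n) = deriv_on I g (\<xi> n)" for n
    using xi(3)[of n] I(7)[of n] by simp
  ultimately show ?thesis by simp
qed

lemma C1_on_tendsto:
  assumes "C1_on I g" "x \<in> I" "\<And>n. s n \<in> I" "s \<longlonglongrightarrow> x"
  shows "(\<lambda>n. g (s n)) \<longlonglongrightarrow> g x"
proof -
  have "continuous_on I g"
    using assms(1) unfolding C1_on_def by (auto intro!: differentiable_imp_continuous_on simp: differentiable_on_def)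
  then show ?thesis using assms by (intro continuous_on_tendsto_compose[of I g]) auto
qed

lemma C1_on_square_dx:
  assumes "C1_on_square I F" "x \<in> I" "y \<in> I"
  shows "((\<lambda>s. F s y) has_real_derivative dx I F x y) (at x within I)"
    "((\<lambda>t. F x t) has_real_derivative dy I F x y) (at y within I)"
  using assms unfolding C1_on_square_def dx_def dy_def by (auto intro: deriv_onI)

lemma cont_square_tendsto:
  assumes "continuous_on (I \<times> I) (\<lambda>(x, y). F x y)" "x \<in> I" "y \<in> I" "\<And>n. s n \<in> I" "\<And>n. t n \<in> I" "s \<longlonglongrightarrow> x" "t \<longlonglongrightarrow> y"
  shows "(\<lambda>n. F (s n) (t n)) \<longlonglongrightarrow> (F x y :: real)"
  using continuous_on_tendsto_compose[OF assms(1) tendsto_Pair[OF assms(6,7)]] assms by auto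

lemma C1_on_square_cont:
  assumes "C1_on_square I F"
  shows "continuous_on (I \<times> I) (\<lambda>(x, y). dx I F x y)" "continuous_on (I \<times> I) (\<lambda>(x, y). dy I F x y)"
  using assms by (auto simp: C1_on_square_def)

text \<open>Move the first variable by the mean value theorem, using joint continuity of its partial
  derivative, and then the second variable with the first one fixed.\<close>

lemma C1_on_square_tendsto:
  assumes I: "is_interval I" and F: "C1_on_square I F" and x: "x \<in> I" "y \<in> I"
    and s: "\<And>n. s n \<in> I" "\<And>n. t n \<in> I" "s \<longlonglongrightarrow> x" "t \<longlonglongrightarrow> y"
  shows "(\<lambda>n. F (s n) (t n)) \<longlonglongrightarrow> F x y"
proof -
  obtain \<xi> where xi: "\<And>n. \<xi> n \<in> I" "\<xi> \<longlonglongrightarrow> x" "\<And>n. F (s n) (t n) - F x (t n) = dx I F (\<xi> n) (t n) * (s n - x)"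
    using mvt_within_seq[OF I, of "\<lambda>_. x" s x "\<lambda>n z. F z (t n)" "\<lambda>n z. dx I F z (t n)"] x s
      C1_on_square_dx(1)[OF F] by (metis tendsto_const)
  have "(\<lambda>n. dx I F (\<xi> n) (t n) * (s n - x)) \<longlonglongrightarrow> dx I F x y * (x - x)"
    by (intro tendsto_intros cont_square_tendsto[OF C1_on_square_cont(1)[OF F]] x s xi)
  then have 1: "(\<lambda>n. F (s n) (t n) - F x (t n)) \<longlonglongrightarrow> 0" by (simp add: xi(3))
  have "continuous_on I (\<lambda>t. F x t)"
    unfolding continuous_on_eq_continuous_within
    using C1_on_square_dx(2)[OF F x(1)] by (auto intro: DERIV_continuous)
  then have "(\<lambda>n. F x (t n)) \<longlonglongrightarrow> F x y" using x s by (intro continuous_on_tendsto_compose[of I "\<lambda>t. F x t"]) auto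
  from tendsto_add[OF 1 this] show ?thesis by simp
qed

lemma C1_on_square_diff_quotient:
  assumes I: "is_interval I" and F: "C1_on_square I F" and x: "x \<in> I" "y \<in> I"
    and s: "\<And>n. s n \<in> I" "\<And>n. s' n \<in> I" "s \<longlonglongrightarrow> x" "s' \<longlonglongrightarrow> x" "\<And>n. s n < s' n"
    and t: "\<And>n. t n \<in> I" "t \<longlonglongrightarrow> y"
  shows "(\<lambda>n. (F (s' n) (t n) - F (s n) (t n)) / (s' n - s n)) \<longlonglongrightarrow> dx I F x y"
    "(\<lambda>n. (F (t n) (s' n) - F (t n) (s n)) / (s' n - s n)) \<longlonglongrightarrow> dy I F y x"
proof -
  obtain \<xi> where xi: "\<And>n. \<xi> n \<in> I" "\<xi> \<longlonglongrightarrow> x" "\<And>n. F (s' n) (t n) - F (s n) (t n) = dx I F (\<xi> n) (t n) * (s' n - s n)"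
    by (rule mvt_within_seq[OF I s(1-4), of "\<lambda>n z. F z (t n)" "\<lambda>n z. dx I F z (t n)"],
        erule C1_on_square_dx(1)[OF F _ t(1)], rule that)
  have "(\<lambda>n. dx I F (\<xi> n) (t n)) \<longlonglongrightarrow> dx I F x y"
    by (intro cont_square_tendsto[OF C1_on_square_cont(1)[OF F]] x t xi)
  moreover have "(F (s' n) (t n) - F (s n) (t n)) / (s' n - s n) = dx I F (\<xi> n) (t n)" for n
    using xi(3)[of n] s(5)[of n] by simp
  ultimately show "(\<lambda>n. (F (s' n) (t n) - F (s n) (t n)) / (s' n - s n)) \<longlonglongrightarrow> dx I F x y" by simp
  obtain \<xi> where xi: "\<And>n. \<xi> n \<in> I" "\<xi> \<longlonglongrightarrow> x" "\<And>n. F (t n) (s' n) - F (t n) (s n) = dy I F (t n) (\<xi> n) * (s' n - s n)"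
    by (rule mvt_within_seq[OF I s(1-4), of "\<lambda>n z. F (t n) z" "\<lambda>n z. dy I F (t n) z"],
        erule C1_on_square_dx(2)[OF F t(1)], rule that)
  have "(\<lambda>n. dy I F (t n) (\<xi> n)) \<longlonglongrightarrow> dy I F y x"
    by (intro cont_square_tendsto[OF C1_on_square_cont(2)[OF F]] x t xi)
  moreover have "(F (t n) (s' n) - F (t n) (s n)) / (s' n - s n) = dy I F (t n) (\<xi> n)" for n
    using xi(3)[of n] s(5)[of n] by simp
  ultimately show "(\<lambda>n. (F (t n) (s' n) - F (t n) (s n)) / (s' n - s n)) \<longlonglongrightarrow> dy I F y x" by simp
qed

text \<open>The mean value theorem is applied first in the second variable, to the difference of two
  sections, and then in the first variable to \<open>dy I F\<close>. This order produces the mixed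
  derivative in the form used by \<open>partial I 1 1\<close>.\<close>

lemma C2_on_square_second_difference:
  assumes I: "is_interval I" and F: "C2_on_square I F" and x: "x \<in> I" "y \<in> I"
    and s: "\<And>n. s n \<in> I" "\<And>n. s' n \<in> I" "s \<longlonglongrightarrow> x" "s' \<longlonglongrightarrow> x" "\<And>n. s n < s' n"
    and t: "\<And>n. t n \<in> I" "\<And>n. t' n \<in> I" "t \<longlonglongrightarrow> y" "t' \<longlonglongrightarrow> y" "\<And>n. t n < t' n"
  shows "(\<lambda>n. (F (s' n) (t' n) - F (s' n) (t n) - F (s n) (t' n) + F (s n) (t n)) / ((s' n - s n) * (t' n - t n)))
     \<longlonglongrightarrow> dx I (dy I F) x y"
proof -
  have F1: "C1_on_square I F" and F2: "C1_on_square I (dy I F)" using F by (auto simp: C2_on_square_def)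
  have d: "((\<lambda>\<tau>. F (s' n) \<tau> - F (s n) \<tau>) has_real_derivative dy I F (s' n) z - dy I F (s n) z) (at z within I)"
    if "z \<in> I" for n z
    using that s by (intro DERIV_diff C1_on_square_dx(2)[OF F1]) auto
  obtain \<tau> where tau: "\<And>n. \<tau> n \<in> I" "\<tau> \<longlonglongrightarrow> y" "\<And>n. (F (s' n) (t' n) - F (s n) (t' n)) - (F (s' n) (t n) - F (s n) (t n)) =
      (dy I F (s' n) (\<tau> n) - dy I F (s n) (\<tau> n)) * (t' n - t n)"
    by (rule mvt_within_seq[OF I t(1-4), of "\<lambda>n \<tau>. F (s' n) \<tau> - F (s n) \<tau>" "\<lambda>n z. dy I F (s' n) z - dy I F (s n) z"],
        erule d, rule that)
  obtain \<xi> where xi: "\<And>n. \<xi> n \<in> I" "\<xi> \<longlonglongrightarrow> x" "\<And>n. dy I F (s' n) (\<tau> n) - dy I F (s n) (\<tau> n) = dx I (dy I F) (\<xi> n) (\<tau> n) * (s' n - s n)"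
    by (rule mvt_within_seq[OF I s(1-4), of "\<lambda>n z. dy I F z (\<tau> n)" "\<lambda>n z. dx I (dy I F) z (\<tau> n)"],
        erule C1_on_square_dx(1)[OF F2 _ tau(1)], rule that)
  have "(\<lambda>n. dx I (dy I F) (\<xi> n) (\<tau> n)) \<longlonglongrightarrow> dx I (dy I F) x y"
    by (intro cont_square_tendsto[OF C1_on_square_cont(1)[OF F2]] x tau xi)
  moreover have "(F (s' n) (t' n) - F (s' n) (t n) - F (s n) (t' n) + F (s n) (t n)) / ((s' n - s n) * (t' n - t n)) = dx I (dy I F) (\<xi> n) (\<tau> n)" for n
  proof -
    have "F (s' n) (t' n) - F (s' n) (t n) - F (s n) (t' n) + F (s n) (t n) = dx I (dy I F) (\<xi> n) (\<tau> n) * ((s' n - s n) * (t' n - t n))"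
      using tau(3)[of n] unfolding xi(3) by (simp add: algebra_simps)
    then show ?thesis using s(5)[of n] t(5)[of n] by simp
  qed
  ultimately show ?thesis by simp
qed

section \<open>The joint law of values and derivatives at two points\<close>

locale gauss_proc = prob_space M for M :: "'w measure" +
  fixes I :: "real set" and G :: "real \<Rightarrow> 'w \<Rightarrow> real" and m :: "real \<Rightarrow> real" and r :: "real \<Rightarrow> real \<Rightarrow> real"
  assumes interval: "is_interval I"
    and gp: "gaussian_process M I G"
    and mean: "\<And>x. x \<in> I \<Longrightarrow> m x = (\<integral>\<omega>. G x \<omega> \<partial>M)"
    and cov: "\<And>x y. x \<in> I \<Longrightarrow> y \<in> I \<Longrightarrow> r x y = (\<integral>\<omega>. (G x \<omega> - m x) * (G y \<omega> - m y) \<partial>M)"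
    and unit_variance: "\<And>x. x \<in> I \<Longrightarrow> r x x = 1"
    and paths: "\<And>\<omega>. \<omega> \<in> space M \<Longrightarrow> C1_on I (\<lambda>t. G t \<omega>)"
    and mean_C1: "C1_on I m"
    and cov_C2: "C2_on_square I r"
    and nondeg: "\<And>x y. x \<in> I \<Longrightarrow> y \<in> I \<Longrightarrow> x \<noteq> y \<Longrightarrow>
               nondegenerate M (\<lambda>\<omega>. (G x \<omega>, G y \<omega>, path_deriv I G x \<omega>, path_deriv I G y \<omega>))"
begin

lemma cov_sym: "x \<in> I \<Longrightarrow> y \<in> I \<Longrightarrow> r x y = r y x"
  by (simp only: cov mult.commute)

lemma gaussian_G: assumes "x \<in> I" shows "gaussian_variable M (G x)"
proof -
  have "gaussian_variable M (\<lambda>\<omega>. \<Sum>s\<in>{x}. (\<lambda>_. 1) s * G s \<omega>)"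
    by (rule gp[unfolded gaussian_process_def, rule_format]) (use assms in auto)
  then show ?thesis by simp
qed

lemma G_measurable: "x \<in> I \<Longrightarrow> G x \<in> borel_measurable M"
  using gaussian_G by (auto simp: gaussian_variable_def)

lemma G_integrable: "x \<in> I \<Longrightarrow> integrable M (G x)"
  using gaussian_G by (rule gaussian_variable_char)

lemma G_centered_product_integrable:
  assumes "x \<in> I" "y \<in> I"
  shows "integrable M (\<lambda>\<omega>. (G x \<omega> - m x) * (G y \<omega> - m y))"
proof -
  note [measurable] = G_measurable[OF assms(1)] G_measurable[OF assms(2)]
  have sq: "integrable M (\<lambda>\<omega>. (G x \<omega> - m x)\<^sup>2)" if "x \<in> I" for x
  proof -
    have "(\<lambda>\<omega>. (G x \<omega> - m x)\<^sup>2) = (\<lambda>\<omega>. (G x \<omega>)\<^sup>2 - 2 * m x * G x \<omega> + (m x)\<^sup>2)"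
      by (simp add: power2_eq_square algebra_simps)
    then show ?thesis using G_integrable[OF that] gaussian_variable_char(2)[OF gaussian_G[OF that]] by simp
  qed
  show ?thesis
  proof (rule Bochner_Integration.integrable_bound[OF Bochner_Integration.integrable_add[OF sq[OF assms(1)] sq[OF assms(2)]]])
    have "\<bar>a * b\<bar> \<le> a\<^sup>2 + b\<^sup>2" for a b :: real
    proof -
      have "0 \<le> \<bar>a\<bar> * \<bar>b\<bar>" "2 * (\<bar>a\<bar> * \<bar>b\<bar>) \<le> a\<^sup>2 + b\<^sup>2"
        using sum_squares_bound[of "\<bar>a\<bar>" "\<bar>b\<bar>"] by simp_all
      then show ?thesis unfolding abs_mult by linarith
    qed
    then show "AE \<omega> in M. norm ((G x \<omega> - m x) * (G y \<omega> - m y)) \<le> norm ((G x \<omega> - m x)\<^sup>2 + (G y \<omega> - m y)\<^sup>2)"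
      by (intro AE_I2) simp
  qed measurable
qed

text \<open>Points may be repeated, as happens when \<open>s + h = t\<close>. The coefficients of
  equal points are collected because \<open>gaussian_process\<close> sums over sets.\<close>

lemma lincomb_char:
  fixes n :: nat and c p :: "nat \<Rightarrow> real"
  assumes p: "\<And>i. i < n \<Longrightarrow> p i \<in> I"
  shows "(\<integral>\<omega>. cis (\<Sum>i<n. c i * G (p i) \<omega>) \<partial>M) =
    cis (\<Sum>i<n. c i * m (p i)) * of_real (exp (- (\<Sum>i<n. \<Sum>j<n. c i * c j * r (p i) (p j)) / 2))"
proof -
  let ?X = "\<lambda>\<omega>. \<Sum>i<n. c i * G (p i) \<omega>"
  have "gaussian_variable M (\<lambda>\<omega>. \<Sum>s\<in>p ` {..<n}. (\<Sum>i\<in>{i\<in>{..<n}. p i = s}. c i) * G s \<omega>)"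
    by (rule gp[unfolded gaussian_process_def, rule_format]) (use p in auto)
  also have "(\<lambda>\<omega>. \<Sum>s\<in>p ` {..<n}. (\<Sum>i\<in>{i\<in>{..<n}. p i = s}. c i) * G s \<omega>) = ?X"
  proof
    fix \<omega>
    have "(\<Sum>s\<in>p ` {..<n}. (\<Sum>i\<in>{i\<in>{..<n}. p i = s}. c i) * G s \<omega>) = (\<Sum>s\<in>p ` {..<n}. \<Sum>i\<in>{i\<in>{..<n}. p i = s}. c i * G (p i) \<omega>)"
      by (intro sum.cong refl) (simp add: sum_distrib_right)
    also have "\<dots> = ?X \<omega>" by (rule sum.group) auto
    finally show "(\<Sum>s\<in>p ` {..<n}. (\<Sum>i\<in>{i\<in>{..<n}. p i = s}. c i) * G s \<omega>) = ?X \<omega>" .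
  qed
  finally have gX: "gaussian_variable M ?X" .
  have EX: "expectation ?X = (\<Sum>i<n. c i * m (p i))"
    using p by (subst Bochner_Integration.integral_sum) (auto simp: G_integrable mean)
  have "variance ?X = (\<integral>\<omega>. (\<Sum>i<n. \<Sum>j<n. c i * c j * ((G (p i) \<omega> - m (p i)) * (G (p j) \<omega> - m (p j)))) \<partial>M)"
  proof (intro Bochner_Integration.integral_cong refl)
    fix \<omega>
    have "?X \<omega> - expectation ?X = (\<Sum>i<n. c i * (G (p i) \<omega> - m (p i)))"
      unfolding EX by (simp add: sum_subtractf right_diff_distrib)
    then have "(?X \<omega> - expectation ?X)\<^sup>2 = (\<Sum>i<n. c i * (G (p i) \<omega> - m (p i))) * (\<Sum>i<n. c i * (G (p i) \<omega> - m (p i)))"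
      by (simp only: power2_eq_square)
    also have "\<dots> = (\<Sum>i<n. \<Sum>j<n. c i * c j * ((G (p i) \<omega> - m (p i)) * (G (p j) \<omega> - m (p j))))"
      unfolding sum_product by (intro sum.cong refl) (simp add: mult_ac)
    finally show "(?X \<omega> - expectation ?X)\<^sup>2 = (\<Sum>i<n. \<Sum>j<n. c i * c j * ((G (p i) \<omega> - m (p i)) * (G (p j) \<omega> - m (p j))))" .
  qed
  also have "\<dots> = (\<Sum>i<n. \<Sum>j<n. c i * c j * r (p i) (p j))"
  proof -
    have i: "integrable M (\<lambda>\<omega>. c i * c j * ((G (p i) \<omega> - m (p i)) * (G (p j) \<omega> - m (p j))))" if "i < n" "j < n" for i j
      using G_centered_product_integrable[OF p[OF that(1)] p[OF that(2)]] by (rule integrable_mult_right)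
    have "(\<integral>\<omega>. (\<Sum>i<n. \<Sum>j<n. c i * c j * ((G (p i) \<omega> - m (p i)) * (G (p j) \<omega> - m (p j)))) \<partial>M) =
      (\<Sum>i<n. \<integral>\<omega>. (\<Sum>j<n. c i * c j * ((G (p i) \<omega> - m (p i)) * (G (p j) \<omega> - m (p j)))) \<partial>M)"
      by (rule Bochner_Integration.integral_sum) (rule Bochner_Integration.integrable_sum, rule i, auto)
    also have "\<dots> = (\<Sum>i<n. \<Sum>j<n. \<integral>\<omega>. c i * c j * ((G (p i) \<omega> - m (p i)) * (G (p j) \<omega> - m (p j))) \<partial>M)"
      by (rule sum.cong[OF refl], rule Bochner_Integration.integral_sum) (rule i, auto)
    also have "\<dots> = (\<Sum>i<n. \<Sum>j<n. c i * c j * r (p i) (p j))"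
      by (intro sum.cong refl) (simp only: integral_mult_right_zero cov p lessThan_iff)
    finally show ?thesis .
  qed
  finally have VX: "variance ?X = (\<Sum>i<n. \<Sum>j<n. c i * c j * r (p i) (p j))" .
  show ?thesis using gaussian_variable_char(3)[OF gX, of 1] unfolding EX VX[unfolded EX] by simp
qed

definition diff_quot :: "real \<Rightarrow> real \<Rightarrow> 'w \<Rightarrow> real" where "diff_quot h s \<omega> = (G (s + h) \<omega> - G s \<omega>) / h"

text \<open>The four variables are linear combinations of the process at s, t, s + h and t + h. Unit
  variance replaces the diagonal values of \<open>r\<close> by 1 in the covariances.\<close>

lemma diff_quot_char:
  assumes p: "s \<in> I" "t \<in> I" "s + h \<in> I" "t + h \<in> I" and h: "0 < h"
  shows "(\<integral>\<omega>. cis (c1 * G s \<omega> + c2 * G t \<omega> + c3 * diff_quot h s \<omega> + c4 * diff_quot h t \<omega>) \<partial>M) =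
    cis (c1 * m s + c2 * m t + c3 * ((m (s + h) - m s) / h) + c4 * ((m (t + h) - m t) / h)) *
    of_real (exp (- qform (r s t) ((r s (s + h) - 1) / h) ((r (s + h) t - r s t) / h) ((r s (t + h) - r s t) / h) ((r t (t + h) - 1) / h)
       ((2 - 2 * r s (s + h)) / h\<^sup>2) ((r (s + h) (t + h) - r (s + h) t - r s (t + h) + r s t) / h\<^sup>2) ((2 - 2 * r t (t + h)) / h\<^sup>2) c1 c2 c3 c4 / 2))"
proof -
  define pp where "pp = (\<lambda>i::nat. if i = 0 then s else if i = 1 then t else if i = 2 then s + h else t + h)"
  define cc where "cc = (\<lambda>i::nat. if i = 0 then c1 - c3 / h else if i = 1 then c2 - c4 / h else if i = 2 then c3 / h else c4 / h)"
  have four: "{..<4::nat} = {0, 1, 2, 3}" by auto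
  have "pp i \<in> I" if "i < 4" for i using p by (simp add: pp_def)
  note * = lincomb_char[of 4 pp cc, OF this]
  have 1: "(\<Sum>i<4. cc i * G (pp i) \<omega>) = c1 * G s \<omega> + c2 * G t \<omega> + c3 * diff_quot h s \<omega> + c4 * diff_quot h t \<omega>" for \<omega>
    unfolding four using h by (simp add: pp_def cc_def diff_quot_def) (simp add: field_simps)
  have 2: "(\<Sum>i<4. cc i * m (pp i)) = c1 * m s + c2 * m t + c3 * ((m (s + h) - m s) / h) + c4 * ((m (t + h) - m t) / h)"
    unfolding four using h by (simp add: pp_def cc_def) (simp add: field_simps)
  have sy: "r t s = r s t" "r (s + h) s = r s (s + h)" "r (t + h) t = r t (t + h)" "r t (s + h) = r (s + h) t" "r (t + h) s = r s (t + h)"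
    "r (t + h) (s + h) = r (s + h) (t + h)" "r s s = 1" "r t t = 1" "r (s + h) (s + h) = 1" "r (t + h) (t + h) = 1"
    using p by (auto intro: cov_sym unit_variance)
  \<comment> \<open>Writing 1 / h as an indeterminate turns the identity of quadratic forms below
    into one between polynomials.\<close>
  define k where "k = 1 / h"
  have k: "x / h = x * k" "x / h\<^sup>2 = x * k\<^sup>2" for x by (simp_all add: k_def power_divide)
  have 3: "(\<Sum>i<4. \<Sum>j<4. cc i * cc j * r (pp i) (pp j)) = qform (r s t) ((r s (s + h) - 1) / h) ((r (s + h) t - r s t) / h) ((r s (t + h) - r s t) / h) ((r t (t + h) - 1) / h)
       ((2 - 2 * r s (s + h)) / h\<^sup>2) ((r (s + h) (t + h) - r (s + h) t - r s (t + h) + r s t) / h\<^sup>2) ((2 - 2 * r t (t + h)) / h\<^sup>2) c1 c2 c3 c4"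
    unfolding four k qform_def by (simp add: pp_def cc_def sy k) (simp add: power2_eq_square algebra_simps)
  show ?thesis using * unfolding 1 2 3 .
qed

text \<open>
  A common step h for both points allows the same difference quotients to approximate one-sided
  derivatives at the endpoints of the interval.
\<close>

definition approximating :: "real \<Rightarrow> real \<Rightarrow> (nat \<Rightarrow> real) \<Rightarrow> (nat \<Rightarrow> real) \<Rightarrow> (nat \<Rightarrow> real) \<Rightarrow> bool" where
  "approximating x y s t h \<longleftrightarrow> x \<in> I \<and> y \<in> I \<and> (\<forall>n. s n \<in> I \<and> s n + h n \<in> I \<and> t n \<in> I \<and> t n + h n \<in> I \<and> 0 < h n) \<and>
     s \<longlonglongrightarrow> x \<and> t \<longlonglongrightarrow> y \<and> h \<longlonglongrightarrow> 0"

lemma cov_C1: "C1_on_square I r"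
  using cov_C2 by (auto simp: C2_on_square_def)

lemma approximating_limits:
  assumes a: "approximating x y s t h"
  shows "(\<lambda>n. r (s n) (t n)) \<longlonglongrightarrow> r x y"
    "(\<lambda>n. (r (s n) (s n + h n) - 1) / h n) \<longlonglongrightarrow> 0"
    "(\<lambda>n. (r (s n + h n) (t n) - r (s n) (t n)) / h n) \<longlonglongrightarrow> dx I r x y"
    "(\<lambda>n. (r (s n) (t n + h n) - r (s n) (t n)) / h n) \<longlonglongrightarrow> dy I r x y"
    "(\<lambda>n. (r (t n) (t n + h n) - 1) / h n) \<longlonglongrightarrow> 0"
    "(\<lambda>n. (2 - 2 * r (s n) (s n + h n)) / (h n)\<^sup>2) \<longlonglongrightarrow> dx I (dy I r) x x"
    "(\<lambda>n. (r (s n + h n) (t n + h n) - r (s n + h n) (t n) - r (s n) (t n + h n) + r (s n) (t n)) / (h n)\<^sup>2) \<longlonglongrightarrow> dx I (dy I r) x y"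
    "(\<lambda>n. (2 - 2 * r (t n) (t n + h n)) / (h n)\<^sup>2) \<longlonglongrightarrow> dx I (dy I r) y y"
    "(\<lambda>n. m (s n)) \<longlonglongrightarrow> m x" "(\<lambda>n. m (t n)) \<longlonglongrightarrow> m y"
    "(\<lambda>n. (m (s n + h n) - m (s n)) / h n) \<longlonglongrightarrow> deriv_on I m x"
    "(\<lambda>n. (m (t n + h n) - m (t n)) / h n) \<longlonglongrightarrow> deriv_on I m y"
    "\<omega> \<in> space M \<Longrightarrow> (\<lambda>n. G (s n) \<omega>) \<longlonglongrightarrow> G x \<omega>"
    "\<omega> \<in> space M \<Longrightarrow> (\<lambda>n. G (t n) \<omega>) \<longlonglongrightarrow> G y \<omega>"
    "\<omega> \<in> space M \<Longrightarrow> (\<lambda>n. diff_quot (h n) (s n) \<omega>) \<longlonglongrightarrow> path_deriv I G x \<omega>"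
    "\<omega> \<in> space M \<Longrightarrow> (\<lambda>n. diff_quot (h n) (t n) \<omega>) \<longlonglongrightarrow> path_deriv I G y \<omega>"
proof -
  have x: "x \<in> I" "y \<in> I" and sI: "\<And>n. s n \<in> I" "\<And>n. s n + h n \<in> I" and tI: "\<And>n. t n \<in> I" "\<And>n. t n + h n \<in> I"
    and h: "\<And>n. 0 < h n" "h \<longlonglongrightarrow> 0" and s: "s \<longlonglongrightarrow> x" and t: "t \<longlonglongrightarrow> y"
    using a by (auto simp: approximating_def)
  have s': "(\<lambda>n. s n + h n) \<longlonglongrightarrow> x" using tendsto_add[OF s h(2)] by simp
  have t': "(\<lambda>n. t n + h n) \<longlonglongrightarrow> y" using tendsto_add[OF t h(2)] by simp
  have ls: "\<And>n. s n < s n + h n" and lt: "\<And>n. t n < t n + h n" using h by auto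
  show "(\<lambda>n. r (s n) (t n)) \<longlonglongrightarrow> r x y" by (rule C1_on_square_tendsto[OF interval cov_C1 x sI(1) tI(1) s t])
  show "(\<lambda>n. (r (s n + h n) (t n) - r (s n) (t n)) / h n) \<longlonglongrightarrow> dx I r x y"
    using C1_on_square_diff_quotient(1)[OF interval cov_C1 x sI s s' ls tI(1) t] by simp
  show "(\<lambda>n. (r (s n) (t n + h n) - r (s n) (t n)) / h n) \<longlonglongrightarrow> dy I r x y"
    using C1_on_square_diff_quotient(2)[OF interval cov_C1 x(2,1) tI t t' lt sI(1) s] by simp
  show "(\<lambda>n. (r (s n + h n) (t n + h n) - r (s n + h n) (t n) - r (s n) (t n + h n) + r (s n) (t n)) / (h n)\<^sup>2) \<longlonglongrightarrow> dx I (dy I r) x y"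
    using C2_on_square_second_difference[OF interval cov_C2 x sI s s' ls tI t t' lt] by (simp add: power2_eq_square)
  have sd: "(\<lambda>n. (2 - 2 * r (s n) (s n + h n)) / (h n)\<^sup>2) \<longlonglongrightarrow> dx I (dy I r) x x"
    if x: "x \<in> I" and sI: "\<And>n. s n \<in> I" "\<And>n. s n + h n \<in> I" and s: "s \<longlonglongrightarrow> x" "(\<lambda>n. s n + h n) \<longlonglongrightarrow> x" for s x
  proof -
    have ls: "\<And>n. s n < s n + h n" using h by auto
    have e1: "r (s n + h n) (s n + h n) - r (s n + h n) (s n) - r (s n) (s n + h n) + r (s n) (s n) = 2 - 2 * r (s n) (s n + h n)" for n
      using cov_sym[OF sI(2) sI(1), of n n] sI by (simp add: unit_variance)
    show ?thesis
      using C2_on_square_second_difference[OF interval cov_C2 x x sI s ls sI s ls, unfolded e1] by (simp add: power2_eq_square)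
  qed
  show 6: "(\<lambda>n. (2 - 2 * r (s n) (s n + h n)) / (h n)\<^sup>2) \<longlonglongrightarrow> dx I (dy I r) x x" by (rule sd[OF x(1) sI s s'])
  show 8: "(\<lambda>n. (2 - 2 * r (t n) (t n + h n)) / (h n)\<^sup>2) \<longlonglongrightarrow> dx I (dy I r) y y" by (rule sd[OF x(2) tI t t'])
  \<comment> \<open>By unit variance r(s, s + h) - 1 is minus one half of a second difference, hence
    of order h^2. This makes the value and the derivative of the process at one point
    uncorrelated.\<close>
  have e: "(z - 1) / h n = (- 1 / 2) * h n * ((2 - 2 * z) / (h n)\<^sup>2)" for z n
    using h(1)[of n] by (simp add: field_simps power2_eq_square)
  show "(\<lambda>n. (r (s n) (s n + h n) - 1) / h n) \<longlonglongrightarrow> 0"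
    unfolding e using tendsto_mult[OF tendsto_mult[OF tendsto_const h(2), of "- 1 / 2"] 6] by simp
  show "(\<lambda>n. (r (t n) (t n + h n) - 1) / h n) \<longlonglongrightarrow> 0"
    unfolding e using tendsto_mult[OF tendsto_mult[OF tendsto_const h(2), of "- 1 / 2"] 8] by simp
  show "(\<lambda>n. m (s n)) \<longlonglongrightarrow> m x" "(\<lambda>n. m (t n)) \<longlonglongrightarrow> m y"
    by (rule C1_on_tendsto[OF mean_C1 x(1) sI(1) s] C1_on_tendsto[OF mean_C1 x(2) tI(1) t])+
  show "(\<lambda>n. (m (s n + h n) - m (s n)) / h n) \<longlonglongrightarrow> deriv_on I m x"
    using C1_on_diff_quotient[OF interval sI s s' x(1) ls mean_C1] by simp
  show "(\<lambda>n. (m (t n + h n) - m (t n)) / h n) \<longlonglongrightarrow> deriv_on I m y"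
    using C1_on_diff_quotient[OF interval tI t t' x(2) lt mean_C1] by simp
  {
    assume w: "\<omega> \<in> space M"
    show "(\<lambda>n. G (s n) \<omega>) \<longlonglongrightarrow> G x \<omega>" "(\<lambda>n. G (t n) \<omega>) \<longlonglongrightarrow> G y \<omega>"
      by (rule C1_on_tendsto[OF paths[OF w] x(1) sI(1) s] C1_on_tendsto[OF paths[OF w] x(2) tI(1) t])+
    show "(\<lambda>n. diff_quot (h n) (s n) \<omega>) \<longlonglongrightarrow> path_deriv I G x \<omega>"
      using C1_on_diff_quotient[OF interval sI s s' x(1) ls paths[OF w]] by (simp add: diff_quot_def path_deriv_def)
    show "(\<lambda>n. diff_quot (h n) (t n) \<omega>) \<longlonglongrightarrow> path_deriv I G y \<omega>"
      using C1_on_diff_quotient[OF interval tI t t' x(2) lt paths[OF w]] by (simp add: diff_quot_def path_deriv_def)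
  }
qed

text \<open>Both steps are taken inside the segment between \<open>x\<close> and \<open>y\<close>:
  the smaller point moves to the right, and the larger one is reached from a base point at distance
  \<open>h n\<close> to its left. Steps of length at most |x - y| keep all points in the
  interval.\<close>

lemma approximating_exists:
  assumes x: "x \<in> I" "y \<in> I" "x \<noteq> y"
  obtains s t h where "approximating x y s t h"
proof -
  define h where "h = (\<lambda>n. \<bar>x - y\<bar> * (1 / real (Suc n)))"
  have h: "0 < h n" "h n \<le> \<bar>x - y\<bar>" for n using x by (auto simp: h_def field_simps)
  have h0: "h \<longlonglongrightarrow> 0" unfolding h_def
    using tendsto_mult[OF tendsto_const LIMSEQ_inverse_real_of_nat, of "\<bar>x - y\<bar>"] by (simp add: inverse_eq_divide)
  have mem: "z \<in> I" if "u \<in> I" "v \<in> I" "u \<le> z" "z \<le> v" for u v z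
    using interval that by (meson is_interval_1)
  show ?thesis
  proof (cases "x < y")
    case True
    have "x + h n \<in> I" "y - h n \<in> I" for n
      using x h(1)[of n] h(2)[of n] True by (auto intro!: mem[of x y])
    then have "approximating x y (\<lambda>n. x) (\<lambda>n. y - h n) h"
      unfolding approximating_def using x h h0 tendsto_diff[OF tendsto_const h0, of y] by simp
    then show ?thesis by (rule that)
  next
    case False
    have "x - h n \<in> I" "y + h n \<in> I" for n
      using x h(1)[of n] h(2)[of n] False by (auto intro!: mem[of y x])
    then have "approximating x y (\<lambda>n. x - h n) (\<lambda>n. y) h"
      unfolding approximating_def using x h h0 tendsto_diff[OF tendsto_const h0, of x] by simp
    then show ?thesis by (rule that)
  qed
qed

lemma diff_quot_measurable: "s \<in> I \<Longrightarrow> s + h \<in> I \<Longrightarrow> diff_quot h s \<in> borel_measurable M"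
  using G_measurable[of s] G_measurable[of "s + h"] unfolding diff_quot_def[abs_def] by measurable

text \<open>The second point ensures that the interval contains a sequence along which difference
  quotients can be formed; the derivative is their pointwise limit.\<close>

lemma path_deriv_measurable:
  assumes "x \<in> I" "y \<in> I" "x \<noteq> y"
  shows "path_deriv I G x \<in> borel_measurable M"
proof -
  obtain s t h where a: "approximating x y s t h" using approximating_exists[OF assms] by blast
  show ?thesis
  proof (rule borel_measurable_LIMSEQ_real)
    show "\<omega> \<in> space M \<Longrightarrow> (\<lambda>n. diff_quot (h n) (s n) \<omega>) \<longlonglongrightarrow> path_deriv I G x \<omega>" for \<omega>
      by (rule approximating_limits(15)[OF a])
    show "diff_quot (h n) (s n) \<in> borel_measurable M" for n
      using a by (intro diff_quot_measurable) (auto simp: approximating_def)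
  qed
qed

text \<open>The limit of \<open>diff_quot_char\<close>: the left side converges because
  \<open>cis\<close> is bounded, the right side because the covariances converge. The two entries 0
  are the covariances of the value and the derivative at the same point.\<close>

lemma jet_char:
  assumes xy: "x \<in> I" "y \<in> I" "x \<noteq> y"
  shows "(\<integral>\<omega>. cis (c1 * G x \<omega> + c2 * G y \<omega> + c3 * path_deriv I G x \<omega> + c4 * path_deriv I G y \<omega>) \<partial>M) =
    cis (c1 * m x + c2 * m y + c3 * deriv_on I m x + c4 * deriv_on I m y) *
    of_real (exp (- qform (r x y) 0 (dx I r x y) (dy I r x y) 0 (dx I (dy I r) x x) (dx I (dy I r) x y) (dx I (dy I r) y y) c1 c2 c3 c4 / 2))"
    (is "?L = ?R")
proof -
  obtain s t h where a: "approximating x y s t h" using approximating_exists[OF xy] by blast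
  note l = approximating_limits[OF a]
  have sI: "\<And>n. s n \<in> I" "\<And>n. t n \<in> I" "\<And>n. s n + h n \<in> I" "\<And>n. t n + h n \<in> I" "\<And>n. 0 < h n" using a by (auto simp: approximating_def)
  let ?f = "\<lambda>n \<omega>. cis (c1 * G (s n) \<omega> + c2 * G (t n) \<omega> + c3 * diff_quot (h n) (s n) \<omega> + c4 * diff_quot (h n) (t n) \<omega>)"
  have [measurable]: "G x \<in> borel_measurable M" "G y \<in> borel_measurable M" "path_deriv I G x \<in> borel_measurable M" "path_deriv I G y \<in> borel_measurable M"
    using G_measurable path_deriv_measurable xy by auto
  have [measurable]: "G (s n) \<in> borel_measurable M" "G (t n) \<in> borel_measurable M" "diff_quot (h n) (s n) \<in> borel_measurable M" "diff_quot (h n) (t n) \<in> borel_measurable M" for n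
    using G_measurable diff_quot_measurable sI by auto
  have "(\<lambda>n. \<integral>\<omega>. ?f n \<omega> \<partial>M) \<longlonglongrightarrow> ?L"
  proof (rule integral_dominated_convergence[where w="\<lambda>_. 1"])
    show "AE \<omega> in M. (\<lambda>n. ?f n \<omega>) \<longlonglongrightarrow> cis (c1 * G x \<omega> + c2 * G y \<omega> + c3 * path_deriv I G x \<omega> + c4 * path_deriv I G y \<omega>)"
      by (intro AE_I2 tendsto_intros l(13-16))
    show "(\<lambda>\<omega>. cis (c1 * G x \<omega> + c2 * G y \<omega> + c3 * path_deriv I G x \<omega> + c4 * path_deriv I G y \<omega>)) \<in> borel_measurable M"
      unfolding cis_conv_exp by measurable
    show "?f n \<in> borel_measurable M" for n unfolding cis_conv_exp by measurable
  qed auto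
  moreover have "(\<lambda>n. \<integral>\<omega>. ?f n \<omega> \<partial>M) \<longlonglongrightarrow> ?R"
    unfolding diff_quot_char[OF sI(1) sI(2) sI(3) sI(4) sI(5)] qform_def by (intro tendsto_intros l(1-12)) auto
  ultimately show ?thesis by (rule LIMSEQ_unique)
qed

text \<open>The nonnegative variable 1 - cos(a X) has mean 0, so a X is almost surely a multiple of
  2 pi for each a = 1 / (n + 1) simultaneously. For large n such a multiple has absolute value below
  1 and must be 0.\<close>

lemma AE_const_of_char:
  assumes [measurable]: "X \<in> borel_measurable M" and c: "\<And>a. (\<integral>\<omega>. cis (a * X \<omega>) \<partial>M) = 1"
  shows "AE \<omega> in M. X \<omega> = 0"
proof -
  have "AE \<omega> in M. cos (a * X \<omega>) = 1" for a
  proof -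
    have [measurable]: "(\<lambda>\<omega>. cis (a * X \<omega>)) \<in> borel_measurable M" unfolding cis_conv_exp by measurable
    have ic: "integrable M (\<lambda>\<omega>. cis (a * X \<omega>))" by (rule integrable_const_bound[of _ 1]) auto
    have i: "integrable M (\<lambda>\<omega>. 1 - cos (a * X \<omega>))" by (rule integrable_const_bound[of _ 2]) (auto intro!: AE_I2 order_trans[OF abs_triangle_ineq4])
    have "(\<integral>\<omega>. cos (a * X \<omega>) \<partial>M) = Re (\<integral>\<omega>. cis (a * X \<omega>) \<partial>M)"
      by (subst integral_Re[OF ic, symmetric]) simp
    then have "(\<integral>\<omega>. cos (a * X \<omega>) \<partial>M) = 1" using c by simp
    moreover have "integrable M (\<lambda>\<omega>. cos (a * X \<omega>))" by (rule integrable_const_bound[of _ 1]) auto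
    ultimately have "(\<integral>\<omega>. 1 - cos (a * X \<omega>) \<partial>M) = 0" by (simp add: prob_space)
    then have "AE \<omega> in M. 1 - cos (a * X \<omega>) = 0"
      using i by (subst (asm) integral_nonneg_eq_0_iff_AE) auto
    then show ?thesis by (rule eventually_mono) simp
  qed
  then have "AE \<omega> in M. \<forall>n::nat. cos (1 / real (Suc n) * X \<omega>) = 1"
    unfolding AE_all_countable by blast
  then show ?thesis
  proof (rule eventually_mono)
    fix \<omega> assume a: "\<forall>n::nat. cos (1 / real (Suc n) * X \<omega>) = 1"
    obtain n :: nat where n: "\<bar>X \<omega>\<bar> < real n" using reals_Archimedean2 by blast
    obtain k :: int where k: "1 / real (Suc n) * X \<omega> = of_int k * 2 * pi"
      using a cos_one_2pi_int by (metis mult.assoc)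
    have "\<bar>1 / real (Suc n) * X \<omega>\<bar> < 1" using n by (simp add: abs_mult field_simps)
    then have "\<bar>of_int k\<bar> * (2 * pi) < 1" unfolding k by (simp add: abs_mult)
    moreover have "1 < 2 * pi" using pi_gt3 by simp
    ultimately have "\<bar>real_of_int k\<bar> < 1"
      by (smt (verit, best) mult_less_cancel_left1)
    then have "k = 0" by linarith
    then show "X \<omega> = 0" using k by simp
  qed
qed

text \<open>A negative value would make the modulus of a characteristic function exceed 1. The value
  0 would make the linear combination almost surely constant and so give it variance 0, against the
  nondegeneracy assumption.\<close>

lemma jet_covariance_pos:
  assumes xy: "x \<in> I" "y \<in> I" "x \<noteq> y" and c: "(c1, c2, c3, c4) \<noteq> (0, 0, 0, 0)"
  shows "0 < qform (r x y) 0 (dx I r x y) (dy I r x y) 0 (dx I (dy I r) x x) (dx I (dy I r) x y) (dx I (dy I r) y y) c1 c2 c3 c4"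
    (is "0 < ?q c1 c2 c3 c4")
proof (rule ccontr)
  assume neg: "\<not> 0 < ?q c1 c2 c3 c4"
  define X where "X = (\<lambda>\<omega>. c1 * G x \<omega> + c2 * G y \<omega> + c3 * path_deriv I G x \<omega> + c4 * path_deriv I G y \<omega>)"
  define \<mu> where "\<mu> = c1 * m x + c2 * m y + c3 * deriv_on I m x + c4 * deriv_on I m y"
  have [measurable]: "G x \<in> borel_measurable M" "G y \<in> borel_measurable M" "path_deriv I G x \<in> borel_measurable M" "path_deriv I G y \<in> borel_measurable M"
    using G_measurable path_deriv_measurable xy by auto
  have X[measurable]: "X \<in> borel_measurable M" unfolding X_def by measurable
  have ch: "(\<integral>\<omega>. cis (a * X \<omega>) \<partial>M) = cis (a * \<mu>) * of_real (exp (- (a\<^sup>2 * ?q c1 c2 c3 c4) / 2))" for a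
  proof -
    have "?q (a * c1) (a * c2) (a * c3) (a * c4) = a\<^sup>2 * ?q c1 c2 c3 c4"
      unfolding qform_def by (simp add: power2_eq_square algebra_simps)
    then show ?thesis using jet_char[OF xy, of "a * c1" "a * c2" "a * c3" "a * c4"]
      by (simp add: X_def \<mu>_def distrib_left mult.assoc)
  qed
  have "norm (\<integral>\<omega>. cis (1 * X \<omega>) \<partial>M) \<le> 1"
  proof -
    have [measurable]: "(\<lambda>\<omega>. cis (1 * X \<omega>)) \<in> borel_measurable M" unfolding cis_conv_exp by measurable
    have "norm (\<integral>\<omega>. cis (1 * X \<omega>) \<partial>M) \<le> (\<integral>\<omega>. norm (cis (1 * X \<omega>)) \<partial>M)"
      by (rule integral_norm_bound)
    then show ?thesis by (simp add: prob_space)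
  qed
  then have "exp (- ?q c1 c2 c3 c4 / 2) \<le> 1" unfolding ch by (simp add: norm_mult)
  then have q0: "?q c1 c2 c3 c4 = 0" using neg by simp
  have "AE \<omega> in M. X \<omega> - \<mu> = 0"
  proof (rule AE_const_of_char)
    fix a
    have "(\<integral>\<omega>. cis (a * (X \<omega> - \<mu>)) \<partial>M) = (\<integral>\<omega>. cis (- (a * \<mu>)) * cis (a * X \<omega>) \<partial>M)"
      by (intro Bochner_Integration.integral_cong refl) (simp add: cis_mult algebra_simps)
    also have "\<dots> = cis (- (a * \<mu>)) * (\<integral>\<omega>. cis (a * X \<omega>) \<partial>M)" by (rule integral_mult_right_zero)
    also have "\<dots> = 1" unfolding ch q0 by (simp add: cis_mult)
    finally show "(\<integral>\<omega>. cis (a * (X \<omega> - \<mu>)) \<partial>M) = 1" .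
  qed measurable
  then have ae: "AE \<omega> in M. X \<omega> = \<mu>" by (rule eventually_mono) simp
  have EX: "expectation X = \<mu>" using ae by (subst integral_cong_AE[of _ _ "\<lambda>_. \<mu>"]) (auto simp: prob_space)
  have VX: "variance X = 0" unfolding EX using ae by (subst integral_cong_AE[of _ _ "\<lambda>_. 0"]) auto
  have e: "(c1, c2, c3, c4) \<bullet> (G x \<omega>, G y \<omega>, path_deriv I G x \<omega>, path_deriv I G y \<omega>) = X \<omega>" for \<omega>
    by (simp add: X_def add.assoc)
  have "0 < variance (\<lambda>\<omega>. (c1, c2, c3, c4) \<bullet> (G x \<omega>, G y \<omega>, path_deriv I G x \<omega>, path_deriv I G y \<omega>))"
    using nondeg[OF xy] c unfolding nondegenerate_def zero_prod_def by blast
  then show False using VX by (simp only: e less_irrefl)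
qed

lemma jet_cholesky_pos:
  assumes xy: "x \<in> I" "y \<in> I" "x \<noteq> y"
  shows "0 < 1 - (r x y)\<^sup>2" "0 < dx I (dy I r) x x - 0\<^sup>2 - (chol32 (r x y) 0 (dx I r x y))\<^sup>2"
    "0 < dx I (dy I r) y y - (dy I r x y)\<^sup>2 - (chol32 (r x y) (dy I r x y) 0)\<^sup>2
      - (chol43 (r x y) 0 (dx I r x y) (dy I r x y) 0 (dx I (dy I r) x x) (dx I (dy I r) x y))\<^sup>2"
  using cholesky_pos[OF jet_covariance_pos[OF xy]] by blast+

lemma triangular_gaussian_cholesky:
  assumes "X1 \<in> borel_measurable M" "X2 \<in> borel_measurable M" "X3 \<in> borel_measurable M" "X4 \<in> borel_measurable M"
    and pos: "0 < 1 - R\<^sup>2" "0 < A - p1\<^sup>2 - (chol32 R p1 p2)\<^sup>2"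
      "0 < D - q1\<^sup>2 - (chol32 R q1 q2)\<^sup>2 - (chol43 R p1 p2 q1 q2 A B)\<^sup>2"
    and char: "\<And>c1 c2 c3 c4. (\<integral>\<omega>. cis (c1 * X1 \<omega> + c2 * X2 \<omega> + c3 * X3 \<omega> + c4 * X4 \<omega>) \<partial>M) =
      cis (c1 * m1 + c2 * m2 + c3 * m3 + c4 * m4) * of_real (exp (- qform R p1 p2 q1 q2 A B D c1 c2 c3 c4 / 2))"
  shows "triangular_gaussian M X1 X2 X3 X4 m1 m2 m3 m4 R (chol22 R) p1 (chol32 R p1 p2) (chol33 R p1 p2 A)
     q1 (chol32 R q1 q2) (chol43 R p1 p2 q1 q2 A B) (chol44 R p1 p2 q1 q2 A B D)"
  using assms(1-4) pos char unfolding triangular_gaussian_def cholesky_identity[OF pos]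
  by (auto simp: chol22_def chol33_def chol44_def)

lemma jet_triangular:
  assumes xy: "x \<in> I" "y \<in> I" "x \<noteq> y"
  shows "triangular_gaussian M (G x) (G y) (path_deriv I G x) (path_deriv I G y) (m x) (m y) (deriv_on I m x) (deriv_on I m y)
    (r x y) (chol22 (r x y)) 0 (chol32 (r x y) 0 (dx I r x y)) (chol33 (r x y) 0 (dx I r x y) (dx I (dy I r) x x))
    (dy I r x y) (chol32 (r x y) (dy I r x y) 0) (chol43 (r x y) 0 (dx I r x y) (dy I r x y) 0 (dx I (dy I r) x x) (dx I (dy I r) x y))
    (chol44 (r x y) 0 (dx I r x y) (dy I r x y) 0 (dx I (dy I r) x x) (dx I (dy I r) x y) (dx I (dy I r) y y))"
  by (rule triangular_gaussian_cholesky[OF G_measurable[OF xy(1)] G_measurable[OF xy(2)] path_deriv_measurable[OF xy]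
    path_deriv_measurable[OF xy(2,1) xy(3)[symmetric]] jet_cholesky_pos[OF xy] jet_char[OF xy]])

definition rice_limit :: "real \<Rightarrow> real \<Rightarrow> ennreal" where
  "rice_limit x y = cross_limit (m x) (m y) (deriv_on I m x) (deriv_on I m y)
    (r x y) (chol22 (r x y)) 0 (chol32 (r x y) 0 (dx I r x y)) (chol33 (r x y) 0 (dx I r x y) (dx I (dy I r) x x))
    (dy I r x y) (chol32 (r x y) (dy I r x y) 0) (chol43 (r x y) 0 (dx I r x y) (dy I r x y) 0 (dx I (dy I r) x x) (dx I (dy I r) x y))
    (chol44 (r x y) 0 (dx I r x y) (dy I r x y) 0 (dx I (dy I r) x x) (dx I (dy I r) x y) (dx I (dy I r) y y))"

text \<open>The expression of the limit by \<open>corr_expectation\<close> shows that it is finite,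
  so passing to real numbers loses nothing.\<close>

lemma rice_density_limit:
  assumes xy: "x \<in> I" "y \<in> I" "x \<noteq> y"
  shows "rice_density M I G x y = enn2real (rice_limit x y)" "rice_limit x y = ennreal (rice_density M I G x y)"
proof -
  show 1: "rice_density M I G x y = enn2real (rice_limit x y)"
    unfolding rice_density_def rice_limit_def by (rule triangular_gaussian_rice[OF jet_triangular[OF xy]])
  have pos: "(r x y)\<^sup>2 < 1" "0 < chol33 (r x y) 0 (dx I r x y) (dx I (dy I r) x x)"
    "0 < chol44 (r x y) 0 (dx I r x y) (dy I r x y) 0 (dx I (dy I r) x x) (dx I (dy I r) x y) (dx I (dy I r) y y)"
    using jet_cholesky_pos[OF xy] by (auto simp: chol33_def chol44_def)
  have "rice_limit x y < \<top>"
    unfolding rice_limit_def chol22_def[of "r x y"] cross_limit_corr_expectation(2)[OF pos] by simp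
  then show "rice_limit x y = ennreal (rice_density M I G x y)"
    unfolding 1 by simp
qed

section \<open>Probabilities of double sign changes off the diagonal\<close>

lemma tendsto_ch2: "R \<longlonglongrightarrow> R' \<Longrightarrow> (\<lambda>n. chol22 (R n)) \<longlonglongrightarrow> chol22 R'"
  unfolding chol22_def by (intro tendsto_intros)

lemma tendsto_ch32:
  "0 < 1 - R'\<^sup>2 \<Longrightarrow> R \<longlonglongrightarrow> R' \<Longrightarrow> p1 \<longlonglongrightarrow> p1' \<Longrightarrow> p2 \<longlonglongrightarrow> p2' \<Longrightarrow> (\<lambda>n. chol32 (R n) (p1 n) (p2 n)) \<longlonglongrightarrow> chol32 R' p1' p2'"
  unfolding chol32_def by (intro tendsto_intros tendsto_ch2) (auto simp: chol22_def)

text \<open>Positivity of the pivots is an open condition: it is assumed for the limiting matrix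
  only and holds from some index on for the approximating ones.\<close>

lemma tendsto_cholesky:
  assumes pos: "0 < 1 - R'\<^sup>2" "0 < A' - p1'\<^sup>2 - (chol32 R' p1' p2')\<^sup>2"
      "0 < D' - q1'\<^sup>2 - (chol32 R' q1' q2')\<^sup>2 - (chol43 R' p1' p2' q1' q2' A' B')\<^sup>2"
    and l: "R \<longlonglongrightarrow> R'" "p1 \<longlonglongrightarrow> p1'" "p2 \<longlonglongrightarrow> p2'" "q1 \<longlonglongrightarrow> q1'" "q2 \<longlonglongrightarrow> q2'" "A \<longlonglongrightarrow> A'" "B \<longlonglongrightarrow> B'" "D \<longlonglongrightarrow> D'"
  shows "(\<lambda>n. chol33 (R n) (p1 n) (p2 n) (A n)) \<longlonglongrightarrow> chol33 R' p1' p2' A'"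
    "(\<lambda>n. chol43 (R n) (p1 n) (p2 n) (q1 n) (q2 n) (A n) (B n)) \<longlonglongrightarrow> chol43 R' p1' p2' q1' q2' A' B'"
    "(\<lambda>n. chol44 (R n) (p1 n) (p2 n) (q1 n) (q2 n) (A n) (B n) (D n)) \<longlonglongrightarrow> chol44 R' p1' p2' q1' q2' A' B' D'"
    "\<forall>\<^sub>F n in sequentially. 0 < 1 - (R n)\<^sup>2 \<and> 0 < A n - (p1 n)\<^sup>2 - (chol32 (R n) (p1 n) (p2 n))\<^sup>2 \<and>
      0 < D n - (q1 n)\<^sup>2 - (chol32 (R n) (q1 n) (q2 n))\<^sup>2 - (chol43 (R n) (p1 n) (p2 n) (q1 n) (q2 n) (A n) (B n))\<^sup>2"
proof -
  note c32 = tendsto_ch32[OF pos(1) l(1)]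
  show 33: "(\<lambda>n. chol33 (R n) (p1 n) (p2 n) (A n)) \<longlonglongrightarrow> chol33 R' p1' p2' A'"
    unfolding chol33_def by (intro tendsto_intros c32 l)
  show 43: "(\<lambda>n. chol43 (R n) (p1 n) (p2 n) (q1 n) (q2 n) (A n) (B n)) \<longlonglongrightarrow> chol43 R' p1' p2' q1' q2' A' B'"
    unfolding chol43_def using pos(2) by (intro tendsto_intros c32 33 l) (auto simp: chol33_def)
  show "(\<lambda>n. chol44 (R n) (p1 n) (p2 n) (q1 n) (q2 n) (A n) (B n) (D n)) \<longlonglongrightarrow> chol44 R' p1' p2' q1' q2' A' B' D'"
    unfolding chol44_def by (intro tendsto_intros c32 43 l)
  have "(\<lambda>n. 1 - (R n)\<^sup>2) \<longlonglongrightarrow> 1 - R'\<^sup>2"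
    "(\<lambda>n. A n - (p1 n)\<^sup>2 - (chol32 (R n) (p1 n) (p2 n))\<^sup>2) \<longlonglongrightarrow> A' - p1'\<^sup>2 - (chol32 R' p1' p2')\<^sup>2"
    "(\<lambda>n. D n - (q1 n)\<^sup>2 - (chol32 (R n) (q1 n) (q2 n))\<^sup>2 - (chol43 (R n) (p1 n) (p2 n) (q1 n) (q2 n) (A n) (B n))\<^sup>2)
      \<longlonglongrightarrow> D' - q1'\<^sup>2 - (chol32 R' q1' q2')\<^sup>2 - (chol43 R' p1' p2' q1' q2' A' B')\<^sup>2"
    by (intro tendsto_intros c32 43 l)+
  then show "\<forall>\<^sub>F n in sequentially. 0 < 1 - (R n)\<^sup>2 \<and> 0 < A n - (p1 n)\<^sup>2 - (chol32 (R n) (p1 n) (p2 n))\<^sup>2 \<and>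
      0 < D n - (q1 n)\<^sup>2 - (chol32 (R n) (q1 n) (q2 n))\<^sup>2 - (chol43 (R n) (p1 n) (p2 n) (q1 n) (q2 n) (A n) (B n))\<^sup>2"
    using pos by (intro eventually_conj order_tendstoD)
qed

definition cross_event :: "real \<Rightarrow> real \<Rightarrow> real \<Rightarrow> 'w set" where
  "cross_event s t h = {\<omega> \<in> space M. G s \<omega> * G (s + h) \<omega> < 0 \<and> G t \<omega> * G (t + h) \<omega> < 0}"

text \<open>Base points and step vary together, so convergence along all such sequences is a
  sequential form of locally uniform convergence. It covers both the grid cells around a fixed pair
  and the subsequences in the compactness argument for boundedness.\<close>

lemma cross_event_limit:
  assumes a: "approximating x y s t h" and ne: "x \<noteq> y"
  shows "(\<lambda>n. prob (cross_event (s n) (t n) (h n)) / (h n)\<^sup>2) \<longlonglongrightarrow> rice_density M I G x y"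
proof -
  have xy: "x \<in> I" "y \<in> I" "x \<noteq> y" and sI: "\<And>n. s n \<in> I" "\<And>n. t n \<in> I" "\<And>n. s n + h n \<in> I" "\<And>n. t n + h n \<in> I" "\<And>n. 0 < h n" and h0: "h \<longlonglongrightarrow> 0"
    using a ne by (auto simp: approximating_def)
  note l = approximating_limits[OF a]
  note pos = jet_cholesky_pos[OF xy]
  define R where "R = (\<lambda>n. r (s n) (t n))"
  define p1 where "p1 = (\<lambda>n. (r (s n) (s n + h n) - 1) / h n)"
  define p2 where "p2 = (\<lambda>n. (r (s n + h n) (t n) - r (s n) (t n)) / h n)"
  define q1 where "q1 = (\<lambda>n. (r (s n) (t n + h n) - r (s n) (t n)) / h n)"
  define q2 where "q2 = (\<lambda>n. (r (t n) (t n + h n) - 1) / h n)"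
  define A where "A = (\<lambda>n. (2 - 2 * r (s n) (s n + h n)) / (h n)\<^sup>2)"
  define B where "B = (\<lambda>n. (r (s n + h n) (t n + h n) - r (s n + h n) (t n) - r (s n) (t n + h n) + r (s n) (t n)) / (h n)\<^sup>2)"
  define D where "D = (\<lambda>n. (2 - 2 * r (t n) (t n + h n)) / (h n)\<^sup>2)"
  note defs = R_def p1_def p2_def q1_def q2_def A_def B_def D_def
  note L = l(1-8)[folded defs]
  note T = tendsto_cholesky[OF pos L]
  let ?c = "\<lambda>n. \<integral>\<^sup>+z. ennreal (cross_integrand (m (s n)) (m (t n)) ((m (s n + h n) - m (s n)) / h n) ((m (t n + h n) - m (t n)) / h n)
     (R n) (chol22 (R n)) (p1 n) (chol32 (R n) (p1 n) (p2 n)) (chol33 (R n) (p1 n) (p2 n) (A n))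
     (q1 n) (chol32 (R n) (q1 n) (q2 n)) (chol43 (R n) (p1 n) (p2 n) (q1 n) (q2 n) (A n) (B n)) (chol44 (R n) (p1 n) (p2 n) (q1 n) (q2 n) (A n) (B n) (D n)) (h n) z) \<partial>lborel"
  have "?c \<longlonglongrightarrow> rice_limit x y"
    unfolding rice_limit_def
    by (rule double_cross_limit[OF l(9-12) L(1) tendsto_ch2[OF L(1)] L(2) tendsto_ch32[OF pos(1) L(1) L(2) L(3)] T(1)
        L(4) tendsto_ch32[OF pos(1) L(1) L(4) L(5)] T(2,3) h0])
       (use pos sI(5) in \<open>auto simp: chol22_def chol33_def chol44_def less_imp_le\<close>)
  then have "?c \<longlonglongrightarrow> ennreal (rice_density M I G x y)" unfolding rice_density_limit(2)[OF xy] .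
  moreover have "\<forall>\<^sub>F n in sequentially. ?c n = ennreal (prob (cross_event (s n) (t n) (h n)) / (h n)\<^sup>2)"
    using T(4)
  proof (rule eventually_mono)
    fix n assume "0 < 1 - (R n)\<^sup>2 \<and> 0 < A n - (p1 n)\<^sup>2 - (chol32 (R n) (p1 n) (p2 n))\<^sup>2 \<and>
      0 < D n - (q1 n)\<^sup>2 - (chol32 (R n) (q1 n) (q2 n))\<^sup>2 - (chol43 (R n) (p1 n) (p2 n) (q1 n) (q2 n) (A n) (B n))\<^sup>2"
    then have pn: "0 < 1 - (R n)\<^sup>2" "0 < A n - (p1 n)\<^sup>2 - (chol32 (R n) (p1 n) (p2 n))\<^sup>2"
      "0 < D n - (q1 n)\<^sup>2 - (chol32 (R n) (q1 n) (q2 n))\<^sup>2 - (chol43 (R n) (p1 n) (p2 n) (q1 n) (q2 n) (A n) (B n))\<^sup>2" by auto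
    have meas: "G (s n) \<in> borel_measurable M" "G (t n) \<in> borel_measurable M" "diff_quot (h n) (s n) \<in> borel_measurable M" "diff_quot (h n) (t n) \<in> borel_measurable M"
      "G (s n + h n) \<in> borel_measurable M" "G (t n + h n) \<in> borel_measurable M"
      using G_measurable diff_quot_measurable sI by auto
    note [measurable] = meas
    note tg = triangular_gaussian_cholesky[OF meas(1-4) pn, of "m (s n)" "m (t n)" "(m (s n + h n) - m (s n)) / h n" "(m (t n + h n) - m (t n)) / h n",
      OF diff_quot_char[OF sI(1)[of n] sI(2)[of n] sI(3)[of n] sI(4)[of n] sI(5)[of n], folded defs[THEN fun_cong]]]
    have c2: "0 < chol22 (R n)" using pn by (simp add: chol22_def)
    have ev: "indicator (cross_event (s n) (t n) (h n)) \<omega> = indicator (double_cross (h n)) ((G (s n) \<omega>, G (t n) \<omega>), (diff_quot (h n) (s n) \<omega>, diff_quot (h n) (t n) \<omega>))"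
      if "\<omega> \<in> space M" for \<omega>
    proof -
      have "G u \<omega> + h n * diff_quot (h n) u \<omega> = G (u + h n) \<omega>" for u using sI(5)[of n] by (simp add: diff_quot_def)
      then show ?thesis using that by (auto simp: indicator_def cross_event_def double_cross_def crosses_def)
    qed
    have es: "cross_event (s n) (t n) (h n) \<in> events" unfolding cross_event_def by measurable
    have "ennreal (prob (cross_event (s n) (t n) (h n))) = (\<integral>\<^sup>+\<omega>. indicator (cross_event (s n) (t n) (h n)) \<omega> \<partial>M)"
      using es by (simp add: emeasure_eq_measure)
    also have "\<dots> = (\<integral>\<^sup>+\<omega>. indicator (double_cross (h n)) ((G (s n) \<omega>, G (t n) \<omega>), (diff_quot (h n) (s n) \<omega>, diff_quot (h n) (t n) \<omega>)) \<partial>M)"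
      by (rule nn_integral_cong) (rule ev)
    also have "\<dots> = ennreal ((h n)\<^sup>2) * ?c n"
      using triangular_gaussian_nn_integral[OF tg, of "indicator (double_cross (h n))"] double_cross_substitution[OF sI(5) c2]
      by simp
    finally have P: "ennreal (prob (cross_event (s n) (t n) (h n))) = ennreal ((h n)\<^sup>2) * ?c n" .
    have hh: "0 < (h n)\<^sup>2" using sI(5)[of n] by simp
    have "ennreal (prob (cross_event (s n) (t n) (h n)) / (h n)\<^sup>2) = ennreal (1 / (h n)\<^sup>2) * ennreal (prob (cross_event (s n) (t n) (h n)))"
      using hh by (simp add: ennreal_mult[symmetric])
    also have "\<dots> = (ennreal (1 / (h n)\<^sup>2) * ennreal ((h n)\<^sup>2)) * ?c n" unfolding P by (simp only: mult.assoc)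
    also have "ennreal (1 / (h n)\<^sup>2) * ennreal ((h n)\<^sup>2) = 1" using hh sI(5)[of n] by (simp add: ennreal_mult[symmetric])
    finally show "?c n = ennreal (prob (cross_event (s n) (t n) (h n)) / (h n)\<^sup>2)" by simp
  qed
  ultimately have "(\<lambda>n. ennreal (prob (cross_event (s n) (t n) (h n)) / (h n)\<^sup>2)) \<longlonglongrightarrow> ennreal (rice_density M I G x y)"
    by (rule Lim_transform_eventually)
  moreover have "0 \<le> rice_density M I G x y" unfolding rice_density_limit(1)[OF xy] by simp
  ultimately show ?thesis by (subst (asm) tendsto_ennreal_iff) auto
qed

text \<open>The Rice density is the integral of \<open>cross_integrand\<close> at step 0, so
  continuity is the case \<open>h = 0\<close> of \<open>double_cross_limit\<close>, with parameters
  that converge along the given sequence of points.\<close>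

lemma rice_density_continuous:
  "continuous_on ((I \<times> I) \<inter> {z. fst z \<noteq> snd z}) (\<lambda>(x, y). rice_density M I G x y)"
  unfolding continuous_on_sequentially
proof (intro allI ballI impI, elim conjE)
  fix u :: "nat \<Rightarrow> real \<times> real" and z
  assume z: "z \<in> (I \<times> I) \<inter> {z. fst z \<noteq> snd z}" and u: "\<forall>n. u n \<in> (I \<times> I) \<inter> {z. fst z \<noteq> snd z}" and lim: "u \<longlonglongrightarrow> z"
  obtain x y where zxy: "z = (x, y)" by (cases z)
  have xy: "x \<in> I" "y \<in> I" "x \<noteq> y" using z zxy by auto
  define s t where "s = (\<lambda>n. fst (u n))" and "t = (\<lambda>n. snd (u n))"
  have sI: "s n \<in> I" "t n \<in> I" "s n \<noteq> t n" for n using u[rule_format, of n] by (auto simp: s_def t_def mem_Times_iff)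
  have ls: "s \<longlonglongrightarrow> x" "t \<longlonglongrightarrow> y" using tendsto_fst[OF lim] tendsto_snd[OF lim] by (auto simp: s_def t_def zxy)
  have C2: "C1_on_square I (dy I r)" using cov_C2 by (auto simp: C2_on_square_def)
  note cs = cont_square_tendsto[OF C1_on_square_cont(1)[OF C2]]
  note pos = jet_cholesky_pos[OF xy]
  have mc: "(\<lambda>n. deriv_on I m (v n)) \<longlonglongrightarrow> deriv_on I m w" if "\<And>n. v n \<in> I" "v \<longlonglongrightarrow> w" "w \<in> I" for v w
    using mean_C1 that by (intro continuous_on_tendsto_compose[of I "deriv_on I m"]) (auto simp: C1_on_def)
  note L = C1_on_square_tendsto[OF interval cov_C1 xy(1,2) sI(1,2) ls] tendsto_const[of 0]
    cont_square_tendsto[OF C1_on_square_cont(1)[OF cov_C1] xy(1,2) sI(1,2) ls]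
    cont_square_tendsto[OF C1_on_square_cont(2)[OF cov_C1] xy(1,2) sI(1,2) ls] tendsto_const[of 0]
    cs[OF xy(1,1) sI(1,1) ls(1,1)] cs[OF xy(1,2) sI(1,2) ls(1,2)] cs[OF xy(2,2) sI(2,2) ls(2,2)]
  note T = tendsto_cholesky[OF pos L]
  let ?c = "\<lambda>n. rice_limit (s n) (t n)"
  have c: "?c n = (\<integral>\<^sup>+z. ennreal (cross_integrand (m (s n)) (m (t n)) (deriv_on I m (s n)) (deriv_on I m (t n))
    (r (s n) (t n)) (chol22 (r (s n) (t n))) 0 (chol32 (r (s n) (t n)) 0 (dx I r (s n) (t n))) (chol33 (r (s n) (t n)) 0 (dx I r (s n) (t n)) (dx I (dy I r) (s n) (s n)))
    (dy I r (s n) (t n)) (chol32 (r (s n) (t n)) (dy I r (s n) (t n)) 0) (chol43 (r (s n) (t n)) 0 (dx I r (s n) (t n)) (dy I r (s n) (t n)) 0 (dx I (dy I r) (s n) (s n)) (dx I (dy I r) (s n) (t n)))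
    (chol44 (r (s n) (t n)) 0 (dx I r (s n) (t n)) (dy I r (s n) (t n)) 0 (dx I (dy I r) (s n) (s n)) (dx I (dy I r) (s n) (t n)) (dx I (dy I r) (t n) (t n))) 0 z) \<partial>lborel)" for n
    unfolding rice_limit_def
    by (rule cross_integrand_0[symmetric]) (use jet_cholesky_pos(1)[OF sI[of n]] in \<open>simp add: chol22_def\<close>)
  have "?c \<longlonglongrightarrow> rice_limit x y"
    unfolding c unfolding rice_limit_def
    by (rule double_cross_limit[OF C1_on_tendsto[OF mean_C1 xy(1) sI(1) ls(1)] C1_on_tendsto[OF mean_C1 xy(2) sI(2) ls(2)]
        mc[OF sI(1) ls(1) xy(1)] mc[OF sI(2) ls(2) xy(2)] L(1) tendsto_ch2[OF L(1)] L(2) tendsto_ch32[OF pos(1) L(1) L(2) L(3)] T(1)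
        L(4) tendsto_ch32[OF pos(1) L(1) L(4) L(5)] T(2,3) tendsto_const])
       (use pos in \<open>auto simp: chol22_def chol33_def chol44_def\<close>)
  then have "(\<lambda>n. ennreal (rice_density M I G (s n) (t n))) \<longlonglongrightarrow> ennreal (rice_density M I G x y)"
    unfolding rice_density_limit(2)[OF xy] rice_density_limit(2)[OF sI] .
  moreover have "0 \<le> rice_density M I G x y" "\<And>n. 0 \<le> rice_density M I G (s n) (t n)"
    unfolding rice_density_limit(1)[OF xy] rice_density_limit(1)[OF sI] by auto
  ultimately have "(\<lambda>n. rice_density M I G (s n) (t n)) \<longlonglongrightarrow> rice_density M I G x y"
    by (subst (asm) tendsto_ennreal_iff) auto
  then show "((\<lambda>(x, y). rice_density M I G x y) \<circ> u) \<longlonglongrightarrow> (case z of (x, y) \<Rightarrow> rice_density M I G x y)"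
    by (simp add: zxy s_def t_def o_def split_beta)
qed

end

section \<open>Sums over pairs of points on dyadic grids\<close>

lemma nn_integral_count_space_summable:
  fixes f :: "'a \<Rightarrow> real"
  assumes s: "f summable_on A" and nn: "\<And>z. z \<in> A \<Longrightarrow> 0 \<le> f z"
  shows "(\<integral>\<^sup>+z. ennreal (f z) \<partial>count_space A) = ennreal (infsum f A)"
proof -
  have "(\<lambda>z. norm (f z)) summable_on A" using s summable_on_iff_abs_summable_on_real by blast
  then have a: "Infinite_Set_Sum.abs_summable_on f A" using abs_summable_equivalent by blast
  show ?thesis using nn_integral_conv_infsetsum[OF a nn] infsetsum_infsum[OF a] by simp
qed

lemma nn_integral_count_space_le:
  fixes f :: "'a \<Rightarrow> real"
  assumes nn: "\<And>z. z \<in> A \<Longrightarrow> 0 \<le> f z"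
    and le: "\<And>F. finite F \<Longrightarrow> F \<subseteq> A \<Longrightarrow> ennreal (sum f F) \<le> L"
  shows "(\<integral>\<^sup>+z. ennreal (f z) \<partial>count_space A) \<le> L"
proof (cases "L = \<top>")
  case False
  then obtain l where l: "0 \<le> l" "L = ennreal l" by (cases L) auto
  have "bdd_above (sum f ` {F. F \<subseteq> A \<and> finite F})"
    using le l by (intro bdd_aboveI2[of _ _ l]) auto
  then have s: "f summable_on A" using nn by (intro nonneg_bdd_above_summable_on) auto
  have "(\<integral>\<^sup>+z. ennreal (f z) \<partial>count_space A) = ennreal (infsum f A)"
    by (rule nn_integral_count_space_summable[OF s]) (rule nn)
  also have "\<dots> = (SUP F\<in>{F. finite F \<and> F \<subseteq> A}. ennreal (sum f F))"
    by (rule infsum_nonneg_is_SUPREMUM_ennreal[OF s]) (rule nn)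
  also have "\<dots> \<le> L" using le by (intro SUP_least) auto
  finally show ?thesis .
qed simp

lemma nn_integral_count_space_finite_le:
  fixes f :: "'a \<Rightarrow> real"
  assumes nn: "\<And>z. z \<in> A \<Longrightarrow> 0 \<le> f z" and F: "finite F" "F \<subseteq> A"
  shows "ennreal (sum f F) \<le> (\<integral>\<^sup>+z. ennreal (f z) \<partial>count_space A)"
proof -
  have "ennreal (sum f F) = (\<Sum>z\<in>F. ennreal (f z))" using nn F by (subst sum_ennreal) auto
  also have "\<dots> = (\<integral>\<^sup>+z. ennreal (f z) \<partial>count_space F)" using F by (simp add: nn_integral_count_space_finite)
  also have "\<dots> \<le> (\<integral>\<^sup>+z. ennreal (f z) \<partial>count_space A)"
  proof -
    have *: "(\<integral>\<^sup>+z. h z \<partial>count_space X) = (\<integral>\<^sup>+z. h z * indicator X z \<partial>count_space UNIV)" for h :: "'a \<Rightarrow> ennreal" and X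
      by (simp add: nn_integral_restrict_space[symmetric] restrict_count_space)
    show ?thesis unfolding *[of F] *[of A] using F by (intro nn_integral_mono) (auto simp: indicator_def)
  qed
  finally show ?thesis .
qed

lemma nn_integral_count_space_finiteD:
  fixes f :: "'a \<Rightarrow> real"
  assumes nn: "\<And>z. z \<in> A \<Longrightarrow> 0 \<le> f z" and fin: "(\<integral>\<^sup>+z. ennreal (f z) \<partial>count_space A) < \<top>"
  shows "f summable_on A"
proof -
  obtain l where l: "0 \<le> l" "(\<integral>\<^sup>+z. ennreal (f z) \<partial>count_space A) = ennreal l" using fin by (cases "\<integral>\<^sup>+z. ennreal (f z) \<partial>count_space A") auto
  have "bdd_above (sum f ` {F. F \<subseteq> A \<and> finite F})"
    using nn_integral_count_space_finite_le[of A f] nn l by (intro bdd_aboveI2[of _ _ l]) auto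
  then show ?thesis using nn by (intro nonneg_bdd_above_summable_on) auto
qed

locale grid =
  fixes a b :: real
  assumes ab: "a < b"
begin

definition mesh :: "nat \<Rightarrow> real" where "mesh n = (b - a) / 2 ^ n"
definition pt :: "nat \<Rightarrow> nat \<Rightarrow> real" where "pt n i = a + real i * mesh n"
text \<open>Indices run up to and including \<open>2 ^ n\<close>: the last cell is the single point
  \<open>b\<close>, so that the half-open cells partition the closed interval.\<close>

definition half_cell :: "nat \<Rightarrow> nat \<Rightarrow> real set" where "half_cell n i = {t \<in> {a..b}. pt n i \<le> t \<and> t < pt n (Suc i)}"
definition closed_cell :: "nat \<Rightarrow> nat \<Rightarrow> real set" where "closed_cell n i = {t \<in> {a..b}. pt n i \<le> t \<and> t \<le> pt n (Suc i)}"
definition idx :: "nat \<Rightarrow> real \<Rightarrow> nat" where "idx n t = nat \<lfloor>(t - a) / mesh n\<rfloor>"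

lemma mesh_pos: "0 < mesh n" using ab by (simp add: mesh_def)

lemma mesh_lim: "mesh \<longlonglongrightarrow> 0"
proof -
  have "(\<lambda>n. (b - a) * (1 / 2) ^ n) \<longlonglongrightarrow> (b - a) * 0"
    by (intro tendsto_intros LIMSEQ_power_zero) simp
  moreover have "mesh = (\<lambda>n. (b - a) * (1 / 2) ^ n)" by (simp add: fun_eq_iff mesh_def power_one_over)
  ultimately show ?thesis by (simp only: mult_zero_right)
qed

lemma pt_Suc: "pt n (Suc i) = pt n i + mesh n" by (simp add: pt_def algebra_simps)

lemma pt_last: "pt n (2 ^ n) = b" by (simp add: pt_def mesh_def)

lemma pt_le: "i \<le> 2 ^ n \<Longrightarrow> pt n i \<in> {a..b}"
proof -
  assume i: "i \<le> 2 ^ n"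
  have "real i * mesh n \<le> real (2 ^ n) * mesh n" using i mesh_pos[of n] by (intro mult_right_mono) auto
  then have "pt n i \<le> pt n (2 ^ n)" unfolding pt_def by linarith
  moreover have "a \<le> pt n i" using mesh_pos[of n] by (simp add: pt_def)
  ultimately show ?thesis by (simp add: pt_last)
qed

lemma idx_cell: assumes "t \<in> {a..b}" shows "t \<in> half_cell n (idx n t)" "idx n t \<le> 2 ^ n"
proof -
  have m: "0 < mesh n" by (rule mesh_pos)
  have q0: "0 \<le> (t - a) / mesh n" using assms m by simp
  have i: "real (idx n t) = of_int \<lfloor>(t - a) / mesh n\<rfloor>" using q0 by (simp add: idx_def)
  have "real (idx n t) \<le> (t - a) / mesh n" "(t - a) / mesh n < real (idx n t) + 1"
    unfolding i by linarith+
  then have "real (idx n t) * mesh n \<le> t - a" "t - a < (real (idx n t) + 1) * mesh n"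
    using m by (simp_all add: pos_le_divide_eq pos_divide_less_eq)
  then show "t \<in> half_cell n (idx n t)" using assms by (auto simp: half_cell_def pt_def algebra_simps)
  have "real (idx n t) * mesh n \<le> real (2 ^ n) * mesh n"
    using \<open>real (idx n t) * mesh n \<le> t - a\<close> assms pt_last[of n] unfolding pt_def by auto
  then show "idx n t \<le> 2 ^ n" using m by simp
qed

lemma half_cell_unique: "t \<in> half_cell n i \<Longrightarrow> t \<in> half_cell n j \<Longrightarrow> i = j"
proof -
  have *: "\<not> i < j" if "t \<in> half_cell n i" "t \<in> half_cell n j" for i j
  proof
    assume "i < j"
    then have "real (Suc i) * mesh n \<le> real j * mesh n" using mesh_pos[of n] by (intro mult_right_mono) auto
    then show False using that unfolding half_cell_def pt_def by auto
  qed
  assume "t \<in> half_cell n i" "t \<in> half_cell n j"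
  then show "i = j" using *[of i j] *[of j i] by linarith
qed

lemma half_cell_sub: "half_cell n i \<subseteq> closed_cell n i" "closed_cell n i \<subseteq> {a..b}"
  by (auto simp: half_cell_def closed_cell_def)

lemma closed_cell_compact: "compact (closed_cell n i)"
proof -
  have "closed_cell n i = {a..b} \<inter> {pt n i..pt n (Suc i)}" by (auto simp: closed_cell_def)
  then show ?thesis by simp
qed

lemma closed_cell_ne: "i \<le> 2 ^ n \<Longrightarrow> closed_cell n i \<noteq> {}"
  using pt_le[of i n] mesh_pos[of n] pt_Suc[of n i] by (auto simp: closed_cell_def intro!: exI[of _ "pt n i"])

lemma closed_cell_diam: "u \<in> closed_cell n i \<Longrightarrow> v \<in> closed_cell n i \<Longrightarrow> \<bar>u - v\<bar> \<le> mesh n"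
  by (auto simp: closed_cell_def pt_Suc)

end

text \<open>Since \<open>f\<close> vanishes on the diagonal, the sum over all pairs of zeros equals
  the sum over pairs of different zeros, and full products Z x Z can be used.\<close>

locale grid_fun = grid +
  fixes f :: "real \<times> real \<Rightarrow> real"
  assumes fc: "continuous_on ({a..b} \<times> {a..b}) f"
    and fnn: "\<And>z. z \<in> {a..b} \<times> {a..b} \<Longrightarrow> 0 \<le> f z"
    and fdiag: "\<And>t. t \<in> {a..b} \<Longrightarrow> f (t, t) = 0"
begin

text \<open>
  Taking the minimum of f over the closed cells makes every grid sum a lower bound for the sum over
  pairs of zeros.
\<close>

definition cell_argmin :: "nat \<Rightarrow> nat \<Rightarrow> nat \<Rightarrow> real \<times> real" where
  "cell_argmin n i j = (SOME z. z \<in> closed_cell n i \<times> closed_cell n j \<and> (\<forall>y\<in>closed_cell n i \<times> closed_cell n j. f z \<le> f y))"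

lemma cell_argmin: assumes "i \<le> 2 ^ n" "j \<le> 2 ^ n"
  shows "cell_argmin n i j \<in> closed_cell n i \<times> closed_cell n j" "y \<in> closed_cell n i \<times> closed_cell n j \<Longrightarrow> f (cell_argmin n i j) \<le> f y"
proof -
  have "compact (closed_cell n i \<times> closed_cell n j)" by (intro compact_Times closed_cell_compact)
  moreover have "closed_cell n i \<times> closed_cell n j \<noteq> {}" using closed_cell_ne assms by auto
  moreover have "continuous_on (closed_cell n i \<times> closed_cell n j) f"
    using half_cell_sub(2) by (intro continuous_on_subset[OF fc]) auto
  ultimately have "\<exists>z. z \<in> closed_cell n i \<times> closed_cell n j \<and> (\<forall>y\<in>closed_cell n i \<times> closed_cell n j. f z \<le> f y)"
    using continuous_attains_inf by blast
  from someI_ex[OF this] show "cell_argmin n i j \<in> closed_cell n i \<times> closed_cell n j" "y \<in> closed_cell n i \<times> closed_cell n j \<Longrightarrow> f (cell_argmin n i j) \<le> f y"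
    unfolding cell_argmin_def by blast+
qed

definition cell_min :: "nat \<Rightarrow> nat \<Rightarrow> nat \<Rightarrow> real" where "cell_min n i j = f (cell_argmin n i j)"

lemma cell_min_nonneg: "i \<le> 2 ^ n \<Longrightarrow> j \<le> 2 ^ n \<Longrightarrow> 0 \<le> cell_min n i j"
  unfolding cell_min_def by (rule fnn[OF subsetD[OF Sigma_mono[OF half_cell_sub(2) half_cell_sub(2)] cell_argmin(1)]])

lemma cell_min_tendsto:
  assumes "p \<in> {a..b}" "q \<in> {a..b}"
  shows "(\<lambda>n. cell_min n (idx n p) (idx n q)) \<longlonglongrightarrow> f (p, q)"
proof -
  have w: "cell_argmin n (idx n p) (idx n q) \<in> closed_cell n (idx n p) \<times> closed_cell n (idx n q)" for n
    by (intro cell_argmin idx_cell assms)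
  have c: "(\<lambda>n. u n) \<longlonglongrightarrow> x" if "x \<in> {a..b}" "\<And>n. u n \<in> closed_cell n (idx n x)" for u x
  proof -
    have "\<bar>u n - x\<bar> \<le> mesh n" for n
      by (rule closed_cell_diam[OF that(2) subsetD[OF half_cell_sub(1) idx_cell(1)[OF that(1)]]])
    then have "(\<lambda>n. u n - x) \<longlonglongrightarrow> 0" by (intro Lim_null_comparison[OF _ mesh_lim]) auto
    then show ?thesis by (simp add: LIM_zero_iff)
  qed
  have "(\<lambda>n. fst (cell_argmin n (idx n p) (idx n q))) \<longlonglongrightarrow> p" "(\<lambda>n. snd (cell_argmin n (idx n p) (idx n q))) \<longlonglongrightarrow> q"
    using w assms by (auto intro!: c simp: mem_Times_iff)
  from tendsto_Pair[OF this] have "(\<lambda>n. cell_argmin n (idx n p) (idx n q)) \<longlonglongrightarrow> (p, q)" by simp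
  moreover have "cell_argmin n (idx n p) (idx n q) \<in> {a..b} \<times> {a..b}" for n
    by (rule subsetD[OF Sigma_mono[OF half_cell_sub(2) half_cell_sub(2)] w])
  ultimately show ?thesis unfolding cell_min_def using assms
    by (intro continuous_on_tendsto_compose[OF fc]) auto
qed

definition cell_sum :: "nat \<Rightarrow> real set \<Rightarrow> real" where
  "cell_sum n Z = (\<Sum>i\<le>2^n. \<Sum>j\<le>2^n. cell_min n i j * (of_bool (Z \<inter> half_cell n i \<noteq> {}) * of_bool (Z \<inter> half_cell n j \<noteq> {})))"

lemma cell_sum_alt:
  defines "A n Z \<equiv> {i. i \<le> 2 ^ n \<and> Z \<inter> half_cell n i \<noteq> {}}"
  shows "cell_sum n Z = (\<Sum>(i, j)\<in>A n Z \<times> A n Z. cell_min n i j)"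
proof -
  have "cell_sum n Z = (\<Sum>(i, j)\<in>{..2^n} \<times> {..2^n}. cell_min n i j * (of_bool (Z \<inter> half_cell n i \<noteq> {}) * of_bool (Z \<inter> half_cell n j \<noteq> {})))"
    unfolding cell_sum_def by (rule sum.cartesian_product)
  also have "\<dots> = (\<Sum>(i, j)\<in>A n Z \<times> A n Z. cell_min n i j)"
  proof (rule sum.mono_neutral_cong_right)
    show "\<forall>x\<in>{..2^n} \<times> {..2^n} - A n Z \<times> A n Z. (case x of (i, j) \<Rightarrow> cell_min n i j * (of_bool (Z \<inter> half_cell n i \<noteq> {}) * of_bool (Z \<inter> half_cell n j \<noteq> {}))) = 0"
      by (auto simp: A_def)
    fix x assume "x \<in> A n Z \<times> A n Z"
    then have "Z \<inter> half_cell n (fst x) \<noteq> {}" "Z \<inter> half_cell n (snd x) \<noteq> {}" unfolding A_def by (simp_all add: mem_Times_iff)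
    then show "(case x of (i, j) \<Rightarrow> cell_min n i j * (of_bool (Z \<inter> half_cell n i \<noteq> {}) * of_bool (Z \<inter> half_cell n j \<noteq> {}))) = (case x of (i, j) \<Rightarrow> cell_min n i j)"
      by (simp add: split_beta)
  qed (auto simp: A_def)
  finally show ?thesis .
qed

text \<open>One point of \<open>Z\<close> is chosen in each occupied cell. Half-open cells are
  disjoint, so the choices are distinct, and the minimum over a closed cell bounds the value at the
  chosen pair from below.\<close>

lemma cell_sum_le:
  assumes Z: "Z \<subseteq> {a..b}"
  shows "ennreal (cell_sum n Z) \<le> (\<integral>\<^sup>+z. ennreal (f z) \<partial>count_space (Z \<times> Z))"
proof -
  define A where "A = {i. i \<le> 2 ^ n \<and> Z \<inter> half_cell n i \<noteq> {}}"
  have "\<forall>i\<in>A. \<exists>t. t \<in> Z \<inter> half_cell n i" by (auto simp: A_def)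
  then obtain c where c: "\<And>i. i \<in> A \<Longrightarrow> c i \<in> Z \<and> c i \<in> half_cell n i" by (metis Int_iff)
  have inj: "inj_on c A" using c half_cell_unique by (metis inj_onI)
  have fA: "finite A" by (simp add: A_def)
  have "cell_sum n Z = (\<Sum>(i, j)\<in>A \<times> A. cell_min n i j)" unfolding A_def by (rule cell_sum_alt)
  also have "\<dots> \<le> (\<Sum>(i, j)\<in>A \<times> A. f (c i, c j))"
    using c half_cell_sub(1) unfolding cell_min_def by (intro sum_mono) (force intro!: cell_argmin(2) simp: A_def)
  also have "\<dots> = sum f ((\<lambda>(i, j). (c i, c j)) ` (A \<times> A))"
    by (subst sum.reindex) (use inj in \<open>auto simp: inj_on_def split_beta\<close>)
  finally have "ennreal (cell_sum n Z) \<le> ennreal (sum f ((\<lambda>(i, j). (c i, c j)) ` (A \<times> A)))" by (rule ennreal_leI)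
  also have "\<dots> \<le> (\<integral>\<^sup>+z. ennreal (f z) \<partial>count_space (Z \<times> Z))"
    using Z c fA by (intro nn_integral_count_space_finite_le) (auto intro!: fnn)
  finally show ?thesis .
qed

text \<open>It suffices to treat a finite set of pairs. As soon as the mesh is smaller than the
  least distance between their coordinates, these lie in different cells, and the grid sum contains
  a separate term for each pair.\<close>

lemma cell_sum_liminf:
  assumes Z: "Z \<subseteq> {a..b}"
  shows "(\<integral>\<^sup>+z. ennreal (f z) \<partial>count_space (Z \<times> Z)) \<le> liminf (\<lambda>n. ennreal (cell_sum n Z))"
proof (rule nn_integral_count_space_le)
  show "0 \<le> f z" if "z \<in> Z \<times> Z" for z using that Z by (auto intro!: fnn)
  fix F assume F: "finite F" "F \<subseteq> Z \<times> Z"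
  define P where "P = fst ` F \<union> snd ` F"
  have P: "finite P" "P \<subseteq> Z" "F \<subseteq> P \<times> P" using F by (auto simp: P_def image_iff subset_iff) (metis fst_conv snd_conv)+
  have sep: "\<exists>d>0. \<forall>p\<in>P. \<forall>q\<in>P. p \<noteq> q \<longrightarrow> d \<le> \<bar>p - q\<bar>"
  proof -
    \<comment> \<open>The element 1 keeps the set nonempty when \<open>P\<close> has at most one
      point.\<close>
    let ?S = "insert 1 ((\<lambda>(p, q). \<bar>p - q\<bar>) ` {(p, q) \<in> P \<times> P. p \<noteq> q})"
    have "finite {(p, q) \<in> P \<times> P. p \<noteq> q}" by (rule finite_subset[of _ "P \<times> P"]) (use P(1) in auto)
    then have fS: "finite ?S" by simp
    have "0 < Min ?S" using fS by (subst Min_gr_iff) auto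
    moreover have "Min ?S \<le> \<bar>p - q\<bar>" if "p \<in> P" "q \<in> P" "p \<noteq> q" for p q
      using fS that by (intro Min_le) force+
    ultimately show ?thesis by blast
  qed
  then obtain d where d: "0 < d" "\<And>p q. p \<in> P \<Longrightarrow> q \<in> P \<Longrightarrow> p \<noteq> q \<Longrightarrow> d \<le> \<bar>p - q\<bar>" by blast
  have ev: "\<forall>\<^sub>F n in sequentially. mesh n < d" using order_tendstoD(2)[OF mesh_lim d(1)] .
  have le: "\<forall>\<^sub>F n in sequentially. ennreal (\<Sum>(p, q)\<in>F. cell_min n (idx n p) (idx n q)) \<le> ennreal (cell_sum n Z)"
    using ev
  proof (rule eventually_mono)
    fix n assume n: "mesh n < d"
    have idxA: "idx n p \<in> {i. i \<le> 2 ^ n \<and> Z \<inter> half_cell n i \<noteq> {}}" if "p \<in> P" for p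
    proof -
      have p: "p \<in> Z" "p \<in> {a..b}" using that P(2) Z by blast+
      then have "p \<in> Z \<inter> half_cell n (idx n p)" using idx_cell(1)[OF p(2)] by blast
      then show ?thesis using idx_cell(2)[OF p(2)] by blast
    qed
    have inj: "inj_on (idx n) P"
    proof (rule inj_onI, rule ccontr)
      fix p q assume pq: "p \<in> P" "q \<in> P" "idx n p = idx n q" "p \<noteq> q"
      have "p \<in> closed_cell n (idx n p)" "q \<in> closed_cell n (idx n p)"
        using idx_cell(1)[of p n] idx_cell(1)[of q n] pq P Z half_cell_sub(1) by (auto simp: subset_iff)
      then have "\<bar>p - q\<bar> \<le> mesh n" by (rule closed_cell_diam)
      then show False using d(2)[OF pq(1,2,4)] n by linarith
    qed
    have "(\<Sum>(p, q)\<in>F. cell_min n (idx n p) (idx n q)) = (\<Sum>(i, j)\<in>(\<lambda>(p, q). (idx n p, idx n q)) ` F. cell_min n i j)"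
    proof (subst sum.reindex)
      have "inj_on (\<lambda>(p, q). (idx n p, idx n q)) (P \<times> P)" using inj by (auto simp: inj_on_def)
      then show "inj_on (\<lambda>(p, q). (idx n p, idx n q)) F" using P(3) inj_on_subset by blast
    qed (simp add: split_beta o_def)
    also have "\<dots> \<le> cell_sum n Z"
      unfolding cell_sum_alt using idxA P(3) by (intro sum_mono2) (auto intro: cell_min_nonneg)
    finally show "ennreal (\<Sum>(p, q)\<in>F. cell_min n (idx n p) (idx n q)) \<le> ennreal (cell_sum n Z)" by (rule ennreal_leI)
  qed
  have "(\<lambda>n. \<Sum>z\<in>F. cell_min n (idx n (fst z)) (idx n (snd z))) \<longlonglongrightarrow> (\<Sum>z\<in>F. f (fst z, snd z))"
    using F Z by (intro tendsto_sum cell_min_tendsto) auto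
  then have lim: "(\<lambda>n. ennreal (\<Sum>(p, q)\<in>F. cell_min n (idx n p) (idx n q))) \<longlonglongrightarrow> ennreal (sum f F)"
    by (intro tendsto_ennrealI) (simp add: split_beta)
  have "ennreal (sum f F) = liminf (\<lambda>n. ennreal (\<Sum>(p, q)\<in>F. cell_min n (idx n p) (idx n q)))"
    using lim_imp_Liminf[OF _ lim] by simp
  also have "\<dots> \<le> liminf (\<lambda>n. ennreal (cell_sum n Z))" by (rule Liminf_mono[OF le])
  finally show "ennreal (sum f F) \<le> liminf (\<lambda>n. ennreal (cell_sum n Z))" .
qed

lemma cell_sum_liminf_eq:
  assumes Z: "Z \<subseteq> {a..b}"
  shows "(\<integral>\<^sup>+z. ennreal (f z) \<partial>count_space (Z \<times> Z)) = liminf (\<lambda>n. ennreal (cell_sum n Z))"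
proof (rule antisym[OF cell_sum_liminf[OF Z]])
  have "liminf (\<lambda>n. ennreal (cell_sum n Z)) \<le> liminf (\<lambda>n. \<integral>\<^sup>+z. ennreal (f z) \<partial>count_space (Z \<times> Z))"
    using cell_sum_le[OF Z] by (intro Liminf_mono) auto
  then show "liminf (\<lambda>n. ennreal (cell_sum n Z)) \<le> (\<integral>\<^sup>+z. ennreal (f z) \<partial>count_space (Z \<times> Z))"
    by (simp add: Liminf_const)
qed

text \<open>The indices stop below \<open>2 ^ n\<close>, because a sign change refers to the next
  grid point, which has to lie in the interval.\<close>

definition cell_sign_sum :: "nat \<Rightarrow> (real \<Rightarrow> real) \<Rightarrow> real" where
  "cell_sign_sum n g = (\<Sum>i<2^n. \<Sum>j<2^n. cell_min n i j * of_bool (g (pt n i) * g (pt n i + mesh n) < 0 \<and> g (pt n j) * g (pt n j + mesh n) < 0))"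

end

section \<open>Sign changes and simple zeros on a grid\<close>

context grid
begin

lemma sign_change_zero:
  fixes g :: "real \<Rightarrow> real"
  assumes c: "continuous_on {a..b} g" and i: "i < 2 ^ n" and sc: "g (pt n i) * g (pt n i + mesh n) < 0"
  shows "{t \<in> {a..b}. g t = 0} \<inter> half_cell n i \<noteq> {}"
proof -
  have p: "pt n i \<in> {a..b}" "pt n (Suc i) \<in> {a..b}" using i by (auto simp: Suc_le_eq intro!: pt_le simp del: atLeastAtMost_iff)
  have lt: "pt n i \<le> pt n (Suc i)" using mesh_pos[of n] by (simp add: pt_Suc)
  have cc: "continuous_on {pt n i..pt n (Suc i)} g" using p by (intro continuous_on_subset[OF c]) auto
  have "\<exists>t. pt n i \<le> t \<and> t \<le> pt n (Suc i) \<and> g t = 0"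
  proof (cases "g (pt n i) < 0")
    case True
    then have "0 \<le> g (pt n (Suc i))" using sc unfolding pt_Suc by (simp add: mult_less_0_iff)
    then show ?thesis using True IVT'[of g "pt n i" 0 "pt n (Suc i)"] lt cc by auto
  next
    case False
    then have "g (pt n (Suc i)) \<le> 0" "0 \<le> g (pt n i)" using sc unfolding pt_Suc by (auto simp: mult_less_0_iff)
    then show ?thesis using IVT2'[of g "pt n (Suc i)" 0 "pt n i"] lt cc by auto
  qed
  then obtain t where t: "pt n i \<le> t" "t \<le> pt n (Suc i)" "g t = 0" by blast
  \<comment> \<open>The strict sign change rules out a zero at the right end, so the zero belongs to
    the half-open cell and to no other.\<close>
  moreover have "t \<noteq> pt n (Suc i)" using t(3) sc unfolding pt_Suc by auto
  ultimately have "t \<in> {t \<in> {a..b}. g t = 0} \<inter> half_cell n i" using p by (auto simp: half_cell_def less_le)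
  then show ?thesis by blast
qed

text \<open>By compactness |g| + |g'| has a positive minimum \<open>k\<close>. When the mesh is so
  small that g' varies by less than \<open>k\<close> over it, g' keeps the sign it has at any zero
  in the cell, so g takes opposite signs at the two ends.\<close>

lemma regular_sign_change:
  fixes g g' :: "real \<Rightarrow> real"
  assumes d: "\<And>t. t \<in> {a..b} \<Longrightarrow> (g has_real_derivative g' t) (at t within {a..b})"
    and c': "continuous_on {a..b} g'"
    and reg: "\<And>t. t \<in> {a..b} \<Longrightarrow> \<not> (g t = 0 \<and> g' t = 0)"
    and gridp: "\<And>n i. i \<le> 2 ^ n \<Longrightarrow> g (pt n i) \<noteq> 0"
  shows "\<forall>\<^sub>F n in sequentially. \<forall>i<2^n. {t \<in> {a..b}. g t = 0} \<inter> half_cell n i \<noteq> {} \<longleftrightarrow> g (pt n i) * g (pt n i + mesh n) < 0"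
proof -
  have cg: "continuous_on {a..b} g" using d by (meson DERIV_continuous continuous_on_eq_continuous_within)
  have "compact {a..b}" "{a..b} \<noteq> {}" "continuous_on {a..b} (\<lambda>t. \<bar>g t\<bar> + \<bar>g' t\<bar>)"
    using ab by (auto intro!: continuous_intros cg c')
  then have "\<exists>t0\<in>{a..b}. \<forall>t\<in>{a..b}. \<bar>g t0\<bar> + \<bar>g' t0\<bar> \<le> \<bar>g t\<bar> + \<bar>g' t\<bar>"
    by (rule continuous_attains_inf)
  then obtain t0 where t0: "t0 \<in> {a..b}" "\<And>t. t \<in> {a..b} \<Longrightarrow> \<bar>g t0\<bar> + \<bar>g' t0\<bar> \<le> \<bar>g t\<bar> + \<bar>g' t\<bar>"
    by blast
  define k where "k = \<bar>g t0\<bar> + \<bar>g' t0\<bar>"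
  have k: "0 < k" using reg[OF t0(1)] unfolding k_def by auto
  have "uniformly_continuous_on {a..b} g'" using c' by (intro compact_uniformly_continuous) auto
  then obtain e where e: "0 < e" "\<And>u v. u \<in> {a..b} \<Longrightarrow> v \<in> {a..b} \<Longrightarrow> \<bar>u - v\<bar> < e \<Longrightarrow> \<bar>g' u - g' v\<bar> < k"
    using k unfolding uniformly_continuous_on_def dist_real_def by metis
  have near: "\<exists>z. g u = z * (u - p) \<and> 0 < z * g' p" if p: "p \<in> {a..b}" "g p = 0" and u: "u \<in> {a..b}" "\<bar>u - p\<bar> < e" for p u
  proof -
    obtain z where z: "z \<in> {a..b}" "\<bar>z - p\<bar> \<le> \<bar>u - p\<bar>" "g u - g p = g' z * (u - p)"
      using mvt_within[of "{a..b}" p u g g'] p u d is_interval_cc by blast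
    have "\<bar>g' z - g' p\<bar> < k" using z p u by (intro e) auto
    moreover have "k \<le> \<bar>g' p\<bar>" using t0(2)[OF p(1)] p(2) by (simp add: k_def)
    ultimately have "\<bar>g' z - g' p\<bar> < \<bar>g' p\<bar>" by linarith
    then have "0 < g' z * g' p" by (auto simp: zero_less_mult_iff abs_if split: if_splits)
    then show ?thesis using z(3) p(2) by auto
  qed
  have "\<forall>\<^sub>F n in sequentially. mesh n < e" using order_tendstoD(2)[OF mesh_lim e(1)] .
  then show ?thesis
  proof (rule eventually_mono, intro allI impI iffI)
    fix n i :: nat assume n: "mesh n < e" and i: "i < 2 ^ n"
    { assume "g (pt n i) * g (pt n i + mesh n) < 0"
      then show "{t \<in> {a..b}. g t = 0} \<inter> half_cell n i \<noteq> {}" by (rule sign_change_zero[OF cg i]) }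
    assume "{t \<in> {a..b}. g t = 0} \<inter> half_cell n i \<noteq> {}"
    then obtain p where p: "p \<in> {a..b}" "g p = 0" "p \<in> half_cell n i" by auto
    have pI: "pt n i \<in> {a..b}" "pt n (Suc i) \<in> {a..b}" using i by (auto simp: Suc_le_eq intro!: pt_le simp del: atLeastAtMost_iff)
    have "g (pt n i) \<noteq> 0" using gridp i by simp
    then have l: "pt n i < p" "p < pt n (Suc i)" using p by (auto simp: half_cell_def less_le)
    obtain z where z: "g (pt n i) = z * (pt n i - p)" "0 < z * g' p"
      using near[OF p(1,2) pI(1)] l n by (auto simp: pt_Suc)
    obtain y where y: "g (pt n (Suc i)) = y * (pt n (Suc i) - p)" "0 < y * g' p"
      using near[OF p(1,2) pI(2)] l n by (auto simp: pt_Suc)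
    have "0 < z * y" using z(2) y(2) by (auto simp: zero_less_mult_iff)
    have "g (pt n i) * g (pt n (Suc i)) = (z * y) * ((pt n i - p) * (pt n (Suc i) - p))" by (simp add: z y algebra_simps)
    moreover have "(pt n i - p) * (pt n (Suc i) - p) < 0" using l by (intro mult_neg_pos) auto
    ultimately have "g (pt n i) * g (pt n (Suc i)) < 0" using \<open>0 < z * y\<close> by (simp add: mult_pos_neg)
    then show "g (pt n i) * g (pt n i + mesh n) < 0" by (simp add: pt_Suc)
  qed
qed

end

context grid_fun
begin

lemma regular_cell_sign_sum:
  fixes g g' :: "real \<Rightarrow> real"
  assumes d: "\<And>t. t \<in> {a..b} \<Longrightarrow> (g has_real_derivative g' t) (at t within {a..b})"
    and c': "continuous_on {a..b} g'"
    and reg: "\<And>t. t \<in> {a..b} \<Longrightarrow> \<not> (g t = 0 \<and> g' t = 0)"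
    and gridp: "\<And>n i. i \<le> 2 ^ n \<Longrightarrow> g (pt n i) \<noteq> 0"
  shows "\<forall>\<^sub>F n in sequentially. cell_sum n {t \<in> {a..b}. g t = 0} = cell_sign_sum n g"
  using regular_sign_change[OF assms]
proof (rule eventually_mono)
  fix n assume n: "\<forall>i<2^n. {t \<in> {a..b}. g t = 0} \<inter> half_cell n i \<noteq> {} \<longleftrightarrow> g (pt n i) * g (pt n i + mesh n) < 0"
  let ?Z = "{t \<in> {a..b}. g t = 0}"
  \<comment> \<open>The additional cell of index \<open>2 ^ n\<close> contains no zero, since
    \<open>b\<close> is itself a grid point and \<open>g\<close> does not vanish there.\<close>
  have "half_cell n (2 ^ n) = {b}"
    using ab mesh_pos[of n] pt_last[of n] by (auto simp: half_cell_def pt_Suc)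
  moreover have "g b \<noteq> 0" using gridp[of "2 ^ n" n] by (simp add: pt_last)
  ultimately have last: "?Z \<inter> half_cell n (2 ^ n) = {}" by auto
  have "cell_sum n ?Z = (\<Sum>i<2^n. \<Sum>j<2^n. cell_min n i j * (of_bool (?Z \<inter> half_cell n i \<noteq> {}) * of_bool (?Z \<inter> half_cell n j \<noteq> {})))"
    unfolding cell_sum_def lessThan_Suc_atMost[symmetric] sum.lessThan_Suc using last by simp
  also have "\<dots> = cell_sign_sum n g" unfolding cell_sign_sum_def
    by (intro sum.cong refl) (use n in \<open>auto simp: of_bool_conj[symmetric]\<close>)
  finally show "cell_sum n ?Z = cell_sign_sum n g" .
qed

end

section \<open>Zeros and sign changes of the paths\<close>

context gauss_proc
begin

lemma path_continuous: "\<omega> \<in> space M \<Longrightarrow> continuous_on I (\<lambda>t. G t \<omega>)"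
  using paths unfolding C1_on_def by (auto intro!: differentiable_imp_continuous_on simp: differentiable_on_def)

lemma path_has_derivative:
  assumes "\<omega> \<in> space M" "t \<in> S" "S \<subseteq> I"
  shows "((\<lambda>t. G t \<omega>) has_real_derivative path_deriv I G t \<omega>) (at t within S)"
proof -
  have "((\<lambda>t. G t \<omega>) has_real_derivative deriv_on I (\<lambda>t. G t \<omega>) t) (at t within I)"
    using paths[OF assms(1)] assms unfolding C1_on_def by (intro deriv_onI) auto
  then show ?thesis using assms by (auto simp: path_deriv_def intro: DERIV_subset)
qed

lemma path_deriv_continuous:
  assumes "\<omega> \<in> space M" shows "continuous_on I (\<lambda>t. path_deriv I G t \<omega>)"
  using paths[OF assms] unfolding C1_on_def by (simp add: path_deriv_def[abs_def])

text \<open>By compactness a continuous path has a zero exactly if its absolute value gets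
  arbitrarily small on a countable dense set. The endpoints are included in that set so that it is
  nonempty also when \<open>p = q\<close>.\<close>

lemma zero_in_interval_measurable:
  assumes pq: "p \<le> q" "{p..q} \<subseteq> I"
  shows "{\<omega> \<in> space M. \<exists>t\<in>{p..q}. G t \<omega> = 0} \<in> events"
proof -
  define D where "D = ({p..q} \<inter> \<rat>) \<union> {p, q}"
  have D: "countable D" "D \<subseteq> {p..q}" using pq(1) by (auto simp: D_def countable_rat)
  have [measurable]: "G t \<in> borel_measurable M" if "t \<in> D" for t using that D pq by (intro G_measurable) auto
  have "(\<exists>t\<in>{p..q}. G t \<omega> = 0) \<longleftrightarrow> (\<forall>k::nat. \<exists>t\<in>D. \<bar>G t \<omega>\<bar> < 1 / real (Suc k))" if w: "\<omega> \<in> space M" for \<omega>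
  proof
    have c: "continuous_on {p..q} (\<lambda>t. G t \<omega>)" using path_continuous[OF w] pq(2) by (rule continuous_on_subset)
    {
      assume "\<exists>t\<in>{p..q}. G t \<omega> = 0"
      then obtain t where t: "t \<in> {p..q}" "G t \<omega> = 0" by blast
      show "\<forall>k::nat. \<exists>t\<in>D. \<bar>G t \<omega>\<bar> < 1 / real (Suc k)"
      proof
        fix k :: nat
        have k0: "0 < 1 / real (Suc k)" by simp
        obtain d where d: "0 < d" "\<And>u. u \<in> {p..q} \<Longrightarrow> \<bar>u - t\<bar> < d \<Longrightarrow> \<bar>G u \<omega> - G t \<omega>\<bar> < 1 / real (Suc k)"
          using c t(1) k0 unfolding continuous_on_iff dist_real_def by metis
        show "\<exists>t\<in>D. \<bar>G t \<omega>\<bar> < 1 / real (Suc k)"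
        proof (cases "p = q")
          case True
          then have "t = p" using t by auto
          then show ?thesis using t k0 by (intro bexI[of _ p]) (auto simp: D_def)
        next
          case False
          then have "max p (t - d) < min q (t + d)" using pq(1) t(1) d(1) by auto
          then obtain u where u: "u \<in> \<rat>" "max p (t - d) < u" "u < min q (t + d)" using Rats_dense_in_real by blast
          then have "\<bar>G u \<omega>\<bar> < 1 / real (Suc k)" using d(2)[of u] t(2) by auto
          then show ?thesis using u by (intro bexI[of _ u]) (auto simp: D_def)
        qed
      qed
    }
    {
      assume a: "\<forall>k::nat. \<exists>t\<in>D. \<bar>G t \<omega>\<bar> < 1 / real (Suc k)"
      have "compact {p..q}" "{p..q} \<noteq> {}" "continuous_on {p..q} (\<lambda>t. \<bar>G t \<omega>\<bar>)"
        using pq by (auto intro: continuous_intros c)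
      then have "\<exists>t0\<in>{p..q}. \<forall>t\<in>{p..q}. \<bar>G t0 \<omega>\<bar> \<le> \<bar>G t \<omega>\<bar>" by (rule continuous_attains_inf)
      then obtain t0 where t0: "t0 \<in> {p..q}" "\<And>t. t \<in> {p..q} \<Longrightarrow> \<bar>G t0 \<omega>\<bar> \<le> \<bar>G t \<omega>\<bar>" by blast
      have "G t0 \<omega> = 0"
      proof (rule ccontr)
        assume "G t0 \<omega> \<noteq> 0"
        then obtain k :: nat where k: "1 / real (Suc k) < \<bar>G t0 \<omega>\<bar>"
          using reals_Archimedean[of "\<bar>G t0 \<omega>\<bar>"] by (auto simp: inverse_eq_divide)
        obtain t where "t \<in> D" "\<bar>G t \<omega>\<bar> < 1 / real (Suc k)" using a by blast
        then show False using t0(2)[of t] D k by fastforce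
      qed
      then show "\<exists>t\<in>{p..q}. G t \<omega> = 0" using t0 by blast
    }
  qed
  then have "{\<omega> \<in> space M. \<exists>t\<in>{p..q}. G t \<omega> = 0} = {\<omega> \<in> space M. \<forall>k::nat. \<exists>t\<in>D. \<bar>G t \<omega>\<bar> < 1 / real (Suc k)}" by blast
  also have "\<dots> = (\<Inter>k::nat. \<Union>t\<in>D. {\<omega> \<in> space M. \<bar>G t \<omega>\<bar> < 1 / real (Suc k)})" by (auto simp: INT_iff)
  also have "\<dots> \<in> events"
  proof -
    have "(\<Union>t\<in>D. {\<omega> \<in> space M. \<bar>G t \<omega>\<bar> < 1 / real (Suc k)}) \<in> events" for k
    proof (rule sets.countable_UN'[OF D(1)], rule image_subsetI)
      show "{\<omega> \<in> space M. \<bar>G t \<omega>\<bar> < 1 / real (Suc k)} \<in> events" if "t \<in> D" for t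
        using that by measurable
    qed
    then show ?thesis by (intro sets.countable_INT') auto
  qed
  finally show ?thesis .
qed

text \<open>Unit variance excludes the constant case and fixes \<sigma> = 1. The density is then at
  most 1 / sqrt(2 pi) <= 1 / 2, and the interval has length 2 \<eta>.\<close>

lemma prob_small_value:
  assumes t: "t \<in> I" and e: "0 \<le> \<eta>"
  shows "prob {\<omega> \<in> space M. \<bar>G t \<omega>\<bar> \<le> \<eta>} \<le> \<eta>"
proof -
  note [measurable] = G_measurable[OF t]
  have ex: "expectation (G t) = m t" using mean[OF t] by simp
  have v: "variance (G t) = 1" using cov[OF t t] unit_variance[OF t] unfolding ex by (simp add: power2_eq_square)
  have "\<not> (AE \<omega> in M. G t \<omega> = \<mu>)" for \<mu>
  proof
    assume ae: "AE \<omega> in M. G t \<omega> = \<mu>"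
    have "expectation (G t) = \<mu>" using ae by (subst integral_cong_AE[of _ _ "\<lambda>_. \<mu>"]) (auto simp: prob_space)
    then have "variance (G t) = 0" using ae by (subst integral_cong_AE[of _ _ "\<lambda>_. 0"]) auto
    then show False using v by simp
  qed
  then obtain \<mu> \<sigma> where s: "0 < \<sigma>" and D: "distributed M lborel (G t) (normal_density \<mu> \<sigma>)"
    using gaussian_G[OF t] by (auto simp: gaussian_variable_def)
  have "\<sigma>\<^sup>2 = 1" using normal_distributed_variance[OF s D] v by simp
  then have s1: "\<sigma> = 1" using s by (simp add: power2_eq_1_iff)
  have dens: "normal_density \<mu> 1 x \<le> 1 / 2" for x
  proof -
    have "2 \<le> sqrt (2 * pi)" using pi_gt3 by (intro real_le_rsqrt) simp
    moreover have "exp (- (x - \<mu>)\<^sup>2 / 2) \<le> 1" by simp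
    ultimately have "1 / sqrt (2 * pi) * exp (- (x - \<mu>)\<^sup>2 / 2) \<le> 1 / 2 * 1"
      by (intro mult_mono) (auto simp: field_simps)
    then show ?thesis by (simp add: normal_density_def)
  qed
  have "emeasure M {\<omega> \<in> space M. \<bar>G t \<omega>\<bar> \<le> \<eta>} = emeasure M (G t -` {-\<eta>..\<eta>} \<inter> space M)"
    by (rule arg_cong[where f="emeasure M"]) auto
  also have "\<dots> = (\<integral>\<^sup>+x. ennreal (normal_density \<mu> \<sigma> x) * indicator {-\<eta>..\<eta>} x \<partial>lborel)"
    by (rule distributed_emeasure[OF D]) simp
  also have "\<dots> \<le> (\<integral>\<^sup>+x. ennreal (1 / 2) * indicator {-\<eta>..\<eta>} x \<partial>lborel)"
    using dens s1 by (intro nn_integral_mono mult_right_mono ennreal_leI) auto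
  also have "\<dots> = ennreal (1 / 2) * ennreal (2 * \<eta>)" using e by (simp add: nn_integral_cmult)
  also have "\<dots> = ennreal \<eta>" using e by (subst ennreal_mult[symmetric]) auto
  finally show ?thesis using e by (simp add: emeasure_eq_measure)
qed

end

locale gauss_grid = gauss_proc M I G m r + grid a b
  for M :: "'w measure" and I G m r and a b :: real +
  assumes abI: "{a..b} \<subseteq> I"
begin

definition zset :: "'w \<Rightarrow> real set" where "zset \<omega> = {t \<in> {a..b}. G t \<omega> = 0}"

lemma pt_I: "i \<le> 2 ^ n \<Longrightarrow> pt n i \<in> I" using pt_le abI by blast

text \<open>A zero at a grid point would occupy a cell without a strict sign change across it, so
  grid zeros have to be excluded before sign changes can count zeros.\<close>

lemma AE_grid_nonzero: "AE \<omega> in M. \<forall>n. \<forall>i\<le>2^n. G (pt n i) \<omega> \<noteq> 0"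
proof -
  have "AE \<omega> in M. G t \<omega> \<noteq> 0" if "t \<in> I" for t
  proof -
    note [measurable] = G_measurable[OF that]
    have "prob {\<omega> \<in> space M. \<bar>G t \<omega>\<bar> \<le> 0} \<le> 0" by (rule prob_small_value[OF that]) simp
    then have "prob {\<omega> \<in> space M. G t \<omega> = 0} = 0" by (simp add: measure_le_0_iff)
    then show ?thesis by (subst AE_iff_measurable[OF _ refl]) (auto simp: emeasure_eq_measure)
  qed
  then have "AE \<omega> in M. \<forall>n. \<forall>i\<in>{..2^n}. G (pt n i) \<omega> \<noteq> 0"
    unfolding AE_all_countable using pt_I by (auto intro!: AE_finite_allI)
  then show ?thesis by (rule eventually_mono) auto
qed

text \<open>
  Bulinskaya's argument: a double zero forces one of the grid values to be of smaller order
  than the mesh, and the union bound over the grid controls the probability of this.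
\<close>

lemma AE_no_double_zero: "AE \<omega> in M. \<forall>t\<in>{a..b}. \<not> (G t \<omega> = 0 \<and> path_deriv I G t \<omega> = 0)"
proof -
  define A where "A = (\<lambda>\<eta> n. \<Union>i\<in>{..2^n}. {\<omega> \<in> space M. \<bar>G (pt n i) \<omega>\<bar> \<le> mesh n * \<eta>})"
  \<comment> \<open>The set-theoretic lower limit of the events. A path with a double zero belongs
    to \<open>A \<eta> n\<close> for all large \<open>n\<close>, whatever \<eta> > 0 is, and the
    intersections increase with \<open>N\<close>, so their probabilities converge to that of
    \<open>L \<eta>\<close>.\<close>
  define L where "L = (\<lambda>\<eta>. \<Union>N. \<Inter>n\<in>{N..}. A \<eta> n)"
  have Am: "A \<eta> n \<in> events" for \<eta> n
    unfolding A_def using G_measurable[OF pt_I] by (intro sets.finite_UN) auto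
  have AP: "prob (A \<eta> n) \<le> 2 * (b - a) * \<eta>" if e: "0 \<le> \<eta>" for \<eta> n
  proof -
    have p: "prob {\<omega> \<in> space M. \<bar>G (pt n i) \<omega>\<bar> \<le> mesh n * \<eta>} \<le> mesh n * \<eta>" if "i \<in> {..2^n}" for i
      using that e mesh_pos[of n] by (intro prob_small_value pt_I) auto
    have "prob (A \<eta> n) \<le> (\<Sum>i\<in>{..2^n}. prob {\<omega> \<in> space M. \<bar>G (pt n i) \<omega>\<bar> \<le> mesh n * \<eta>})"
      unfolding A_def using G_measurable[OF pt_I] by (intro finite_measure_subadditive_finite) auto
    also have "\<dots> \<le> (\<Sum>i\<in>{..(2::nat)^n}. mesh n * \<eta>)" by (intro sum_mono p)
    also have "\<dots> = real (Suc (2 ^ n)) * (mesh n * \<eta>)" by simp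
    \<comment> \<open>The \<open>2 ^ n + 1\<close> grid points are at most twice
      \<open>2 ^ n\<close>, which keeps the bound free of \<open>n\<close>.\<close>
    also have "\<dots> \<le> (2 * 2 ^ n) * (mesh n * \<eta>)"
      using e mesh_pos[of n] by (intro mult_right_mono) (auto simp: one_le_power)
    also have "\<dots> = 2 * (b - a) * \<eta>" by (simp add: mesh_def)
    finally show ?thesis .
  qed
  have Lm: "L \<eta> \<in> events" for \<eta>
    unfolding L_def by (intro sets.countable_UN sets.countable_INT') (use Am in auto)
  have LP: "prob (L \<eta>) \<le> 2 * (b - a) * \<eta>" if e: "0 \<le> \<eta>" for \<eta>
  proof -
    have Bm: "(\<Inter>n\<in>{N..}. A \<eta> n) \<in> events" for N using Am by (intro sets.countable_INT') auto
    have "(\<lambda>N. prob (\<Inter>n\<in>{N..}. A \<eta> n)) \<longlonglongrightarrow> prob (L \<eta>)"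
      unfolding L_def using Bm by (intro finite_Lim_measure_incseq) (auto simp: incseq_def)
    moreover have "prob (\<Inter>n\<in>{N..}. A \<eta> n) \<le> 2 * (b - a) * \<eta>" for N
      using finite_measure_mono[of "\<Inter>n\<in>{N..}. A \<eta> n" "A \<eta> N"] Am AP[OF e, of N] by fastforce
    ultimately show ?thesis by (intro LIMSEQ_le_const2) auto
  qed
  define B where "B = (\<Inter>k::nat. L (1 / real (Suc k)))"
  have Bm: "B \<in> events" unfolding B_def by (intro sets.countable_INT') (use Lm in auto)
  have "prob B \<le> 2 * (b - a) * (1 / real (Suc k))" for k
  proof -
    have "prob B \<le> prob (L (1 / real (Suc k)))" unfolding B_def by (intro finite_measure_mono Lm) auto
    also have "\<dots> \<le> 2 * (b - a) * (1 / real (Suc k))" by (rule LP) simp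
    finally show ?thesis .
  qed
  moreover have "(\<lambda>k. 2 * (b - a) * (1 / real (Suc k))) \<longlonglongrightarrow> 2 * (b - a) * 0"
    by (intro tendsto_mult tendsto_const LIMSEQ_Suc lim_1_over_n)
  ultimately have "prob B \<le> 0" by (intro LIMSEQ_le_const[of _ _ "prob B"]) auto
  then have null: "B \<in> null_sets M" using Bm by (auto simp: null_sets_def emeasure_eq_measure measure_le_0_iff)
  show ?thesis
  proof (rule AE_I'[OF null], rule subsetI)
    fix \<omega> assume "\<omega> \<in> {\<omega> \<in> space M. \<not> (\<forall>t\<in>{a..b}. \<not> (G t \<omega> = 0 \<and> path_deriv I G t \<omega> = 0))}"
    then obtain t where w: "\<omega> \<in> space M" and t: "t \<in> {a..b}" "G t \<omega> = 0" "path_deriv I G t \<omega> = 0" by auto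
    have c: "continuous_on {a..b} (\<lambda>t. path_deriv I G t \<omega>)" using path_deriv_continuous[OF w] abI by (rule continuous_on_subset)
    have d: "((\<lambda>t. G t \<omega>) has_real_derivative path_deriv I G u \<omega>) (at u within {a..b})" if "u \<in> {a..b}" for u
      by (rule path_has_derivative[OF w that abI])
    have "\<omega> \<in> L \<eta>" if e: "0 < \<eta>" for \<eta>
    proof -
      have "uniformly_continuous_on {a..b} (\<lambda>t. path_deriv I G t \<omega>)" using c by (intro compact_uniformly_continuous) auto
      then obtain \<delta> where de: "0 < \<delta>" "\<And>u. u \<in> {a..b} \<Longrightarrow> \<bar>u - t\<bar> < \<delta> \<Longrightarrow> \<bar>path_deriv I G u \<omega> - path_deriv I G t \<omega>\<bar> < \<eta>"
        using e t(1) unfolding uniformly_continuous_on_def dist_real_def by metis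
      have "\<forall>\<^sub>F n in sequentially. mesh n < \<delta>" using order_tendstoD(2)[OF mesh_lim de(1)] .
      then obtain N where N: "\<And>n. N \<le> n \<Longrightarrow> mesh n < \<delta>" by (auto simp: eventually_sequentially)
      have "\<omega> \<in> A \<eta> n" if n: "N \<le> n" for n
      proof -
        let ?i = "idx n t"
        have i: "?i \<le> 2 ^ n" "t \<in> half_cell n ?i" using idx_cell[OF t(1)] by auto
        have p: "pt n ?i \<in> {a..b}" by (rule pt_le[OF i(1)])
        have near: "\<bar>pt n ?i - t\<bar> \<le> mesh n" using i(2) by (auto simp: half_cell_def pt_Suc)
        obtain z where z: "z \<in> {a..b}" "\<bar>z - t\<bar> \<le> \<bar>pt n ?i - t\<bar>" "G (pt n ?i) \<omega> - G t \<omega> = path_deriv I G z \<omega> * (pt n ?i - t)"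
          using mvt_within[of "{a..b}" t "pt n ?i" "\<lambda>t. G t \<omega>" "\<lambda>u. path_deriv I G u \<omega>", OF is_interval_cc t(1) p d] by blast
        have "\<bar>path_deriv I G z \<omega>\<bar> < \<eta>" using de(2)[OF z(1)] z(2) near N[OF n] t(3) by simp
        then have "\<bar>path_deriv I G z \<omega>\<bar> * \<bar>pt n ?i - t\<bar> \<le> \<eta> * mesh n" using near e by (intro mult_mono) auto
        then have "\<bar>G (pt n ?i) \<omega>\<bar> \<le> mesh n * \<eta>" using z(3) t(2) by (simp add: abs_mult mult.commute)
        then show ?thesis unfolding A_def using i w by blast
      qed
      then show ?thesis unfolding L_def by blast
    qed
    then show "\<omega> \<in> B" unfolding B_def by simp
  qed
qed

text \<open>The half-open cell is exhausted by the compact intervals from \<open>pt n i\<close> to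
  \<open>q k\<close>; the minimum with \<open>b\<close> in \<open>q\<close> takes care of the last
  cell, which consists of \<open>b\<close> alone.\<close>

lemma zset_cell_measurable:
  assumes i: "i \<le> 2 ^ n"
  shows "{\<omega> \<in> space M. zset \<omega> \<inter> half_cell n i \<noteq> {}} \<in> events"
proof -
  define q where "q = (\<lambda>k::nat. min b (pt n (Suc i) - mesh n / real (Suc k)))"
  have p: "pt n i \<in> {a..b}" by (rule pt_le[OF i])
  have pq: "pt n i \<le> q k" for k
  proof -
    have "mesh n / real (Suc k) \<le> mesh n" using mesh_pos[of n] by (simp add: field_simps)
    then show ?thesis using p by (auto simp: q_def pt_Suc)
  qed
  have sub: "{pt n i..q k} \<subseteq> I" for k using p abI by (auto simp: q_def)
  have "{\<omega> \<in> space M. zset \<omega> \<inter> half_cell n i \<noteq> {}} = (\<Union>k. {\<omega> \<in> space M. \<exists>t\<in>{pt n i..q k}. G t \<omega> = 0})"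
  proof (intro equalityI subsetI)
    fix \<omega> assume "\<omega> \<in> {\<omega> \<in> space M. zset \<omega> \<inter> half_cell n i \<noteq> {}}"
    then obtain t where w: "\<omega> \<in> space M" and t: "t \<in> {a..b}" "G t \<omega> = 0" "pt n i \<le> t" "t < pt n (Suc i)"
      by (auto simp: zset_def half_cell_def)
    have "0 < (pt n (Suc i) - t) / mesh n" using t mesh_pos[of n] by simp
    then obtain k :: nat where "1 / real (Suc k) < (pt n (Suc i) - t) / mesh n"
      using reals_Archimedean by (auto simp: inverse_eq_divide)
    then have "mesh n / real (Suc k) < pt n (Suc i) - t" using mesh_pos[of n] by (simp add: field_simps)
    then have "t \<in> {pt n i..q k}" using t by (auto simp: q_def)
    then show "\<omega> \<in> (\<Union>k. {\<omega> \<in> space M. \<exists>t\<in>{pt n i..q k}. G t \<omega> = 0})" using w t(2) by blast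
  next
    fix \<omega> assume "\<omega> \<in> (\<Union>k. {\<omega> \<in> space M. \<exists>t\<in>{pt n i..q k}. G t \<omega> = 0})"
    then obtain k t where w: "\<omega> \<in> space M" and t: "t \<in> {pt n i..q k}" "G t \<omega> = 0" by blast
    have "0 < mesh n / real (Suc k)" using mesh_pos[of n] by simp
    then have "t \<in> zset \<omega> \<inter> half_cell n i" using t p by (auto simp: zset_def half_cell_def q_def)
    then show "\<omega> \<in> {\<omega> \<in> space M. zset \<omega> \<inter> half_cell n i \<noteq> {}}" using w by blast
  qed
  also have "\<dots> \<in> events" using zero_in_interval_measurable[OF pq sub] by (intro sets.countable_UN) auto
  finally show ?thesis .
qed

end

locale gauss_grid_fun = gauss_grid M I G m r a b + grid_fun a b f
  for M :: "'w measure" and I G m r and a b :: real and f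
begin

definition grid_pair_sum :: "'w \<Rightarrow> ennreal" where
  "grid_pair_sum \<omega> = (\<integral>\<^sup>+z. ennreal (f z) \<partial>count_space (zset \<omega> \<times> zset \<omega>))"

lemma zset_sub: "zset \<omega> \<subseteq> {a..b}" by (auto simp: zset_def)

text \<open>Measurability is obtained from the sums over occupied cells, whose lower limit is the
  pair sum for every path. The sign change sums reach it only almost surely.\<close>

lemma grid_pair_sum_measurable [measurable]: "grid_pair_sum \<in> borel_measurable M"
proof -
  have "(\<lambda>\<omega>. ennreal (cell_sum n (zset \<omega>))) \<in> borel_measurable M" for n
  proof -
    have [measurable]: "Measurable.pred M (\<lambda>\<omega>. zset \<omega> \<inter> half_cell n i \<noteq> {})" if "i \<le> 2 ^ n" for i
      using zset_cell_measurable[OF that] by (simp add: pred_def)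
    have "(\<lambda>\<omega>. of_bool (zset \<omega> \<inter> half_cell n i \<noteq> {}) :: real) \<in> borel_measurable M" if "i \<le> 2 ^ n" for i
      using that by measurable
    then show ?thesis unfolding cell_sum_def
      by (intro measurable_compose[OF _ measurable_ennreal] borel_measurable_sum borel_measurable_times) auto
  qed
  then have "(\<lambda>\<omega>. liminf (\<lambda>n. ennreal (cell_sum n (zset \<omega>)))) \<in> borel_measurable M" by measurable
  then show ?thesis unfolding grid_pair_sum_def[abs_def] cell_sum_liminf_eq[OF zset_sub] .
qed

definition sign_change_sum :: "nat \<Rightarrow> 'w \<Rightarrow> real" where "sign_change_sum n \<omega> = cell_sign_sum n (\<lambda>t. G t \<omega>)"

lemma sign_change_sum_eq: "\<omega> \<in> space M \<Longrightarrow> sign_change_sum n \<omega> = (\<Sum>i<2^n. \<Sum>j<2^n. cell_min n i j * indicator (cross_event (pt n i) (pt n j) (mesh n)) \<omega>)"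
  unfolding sign_change_sum_def cell_sign_sum_def by (intro sum.cong refl) (auto simp: cross_event_def indicator_def)

lemma cross_event_sets: "i < 2 ^ n \<Longrightarrow> j < 2 ^ n \<Longrightarrow> cross_event (pt n i) (pt n j) (mesh n) \<in> events"
proof -
  assume ij: "i < 2 ^ n" "j < 2 ^ n"
  have [measurable]: "G (pt n i) \<in> borel_measurable M" "G (pt n j) \<in> borel_measurable M"
    "G (pt n i + mesh n) \<in> borel_measurable M" "G (pt n j + mesh n) \<in> borel_measurable M"
    using ij pt_I[of i n] pt_I[of j n] pt_I[of "Suc i" n] pt_I[of "Suc j" n] by (auto simp: pt_Suc intro!: G_measurable)
  show ?thesis unfolding cross_event_def by measurable
qed

lemma sign_change_sum_nonneg: "0 \<le> sign_change_sum n \<omega>"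
  unfolding sign_change_sum_def cell_sign_sum_def by (intro sum_nonneg mult_nonneg_nonneg cell_min_nonneg) auto

lemma sign_change_sum_integral:
  "sign_change_sum n \<in> borel_measurable M"
  "(\<integral>\<^sup>+\<omega>. ennreal (sign_change_sum n \<omega>) \<partial>M) = ennreal (\<Sum>i<2^n. \<Sum>j<2^n. cell_min n i j * prob (cross_event (pt n i) (pt n j) (mesh n)))"
proof -
  let ?h = "\<lambda>\<omega>. \<Sum>i<2^n. \<Sum>j<2^n. cell_min n i j * indicator (cross_event (pt n i) (pt n j) (mesh n)) \<omega> :: real"
  have i1: "integrable M (\<lambda>\<omega>. cell_min n i j * indicator (cross_event (pt n i) (pt n j) (mesh n)) \<omega>)" if "i < 2 ^ n" "j < 2 ^ n" for i j
    using cross_event_sets[OF that] by (intro integrable_mult_right integrable_real_indicator) (auto simp: emeasure_eq_measure)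
  have i2: "integrable M (\<lambda>\<omega>. \<Sum>j<2^n. cell_min n i j * indicator (cross_event (pt n i) (pt n j) (mesh n)) \<omega>)" if "i < 2 ^ n" for i
    using that by (intro Bochner_Integration.integrable_sum i1) auto
  have i3: "integrable M ?h" by (intro Bochner_Integration.integrable_sum i2) auto
  have iS: "integrable M (sign_change_sum n)" using i3 by (rule Bochner_Integration.integrable_cong[THEN iffD1, rotated 2]) (auto simp: sign_change_sum_eq)
  then show "sign_change_sum n \<in> borel_measurable M" by auto
  have "(\<integral>\<^sup>+\<omega>. ennreal (sign_change_sum n \<omega>) \<partial>M) = ennreal (\<integral>\<omega>. sign_change_sum n \<omega> \<partial>M)"
    using iS sign_change_sum_nonneg by (intro nn_integral_eq_integral) auto
  also have "(\<integral>\<omega>. sign_change_sum n \<omega> \<partial>M) = (\<integral>\<omega>. ?h \<omega> \<partial>M)"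
    by (rule Bochner_Integration.integral_cong[OF refl]) (rule sign_change_sum_eq)
  also have "\<dots> = (\<Sum>i<2^n. \<integral>\<omega>. (\<Sum>j<2^n. cell_min n i j * indicator (cross_event (pt n i) (pt n j) (mesh n)) \<omega>) \<partial>M)"
    by (rule Bochner_Integration.integral_sum) (rule i2, simp)
  also have "\<dots> = (\<Sum>i<2^n. \<Sum>j<2^n. \<integral>\<omega>. cell_min n i j * indicator (cross_event (pt n i) (pt n j) (mesh n)) \<omega> \<partial>M)"
    by (rule sum.cong[OF refl], rule Bochner_Integration.integral_sum) (rule i1, auto)
  also have "\<dots> = (\<Sum>i<2^n. \<Sum>j<2^n. cell_min n i j * prob (cross_event (pt n i) (pt n j) (mesh n)))"
  proof (intro sum.cong refl)
    fix i j :: nat assume "i \<in> {..<2^n}" "j \<in> {..<2^n}"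
    then have "cross_event (pt n i) (pt n j) (mesh n) \<subseteq> space M" by (auto simp: cross_event_def)
    then show "(\<integral>\<omega>. cell_min n i j * indicator (cross_event (pt n i) (pt n j) (mesh n)) \<omega> \<partial>M) = cell_min n i j * prob (cross_event (pt n i) (pt n j) (mesh n))"
      by (simp add: Int_absorb2)
  qed
  finally show "(\<integral>\<^sup>+\<omega>. ennreal (sign_change_sum n \<omega>) \<partial>M) = ennreal (\<Sum>i<2^n. \<Sum>j<2^n. cell_min n i j * prob (cross_event (pt n i) (pt n j) (mesh n)))" .
qed

lemma sign_change_sum_le_grid_pair_sum: assumes "\<omega> \<in> space M" shows "ennreal (sign_change_sum n \<omega>) \<le> grid_pair_sum \<omega>"
proof -
  have c: "continuous_on {a..b} (\<lambda>t. G t \<omega>)" using path_continuous[OF assms] abI by (rule continuous_on_subset)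
  have "sign_change_sum n \<omega> \<le> (\<Sum>i<2^n. \<Sum>j<2^n. cell_min n i j * (of_bool (zset \<omega> \<inter> half_cell n i \<noteq> {}) * of_bool (zset \<omega> \<inter> half_cell n j \<noteq> {})))"
    unfolding sign_change_sum_def cell_sign_sum_def
  proof (intro sum_mono mult_left_mono)
    fix i j :: nat assume ij: "i \<in> {..<2^n}" "j \<in> {..<2^n}"
    show "0 \<le> cell_min n i j" using ij by (intro cell_min_nonneg) auto
    have "zset \<omega> \<inter> half_cell n k \<noteq> {}" if "k < 2 ^ n" "G (pt n k) \<omega> * G (pt n k + mesh n) \<omega> < 0" for k
      unfolding zset_def by (rule sign_change_zero[OF c that])
    then show "of_bool (G (pt n i) \<omega> * G (pt n i + mesh n) \<omega> < 0 \<and> G (pt n j) \<omega> * G (pt n j + mesh n) \<omega> < 0)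
      \<le> (of_bool (zset \<omega> \<inter> half_cell n i \<noteq> {}) * of_bool (zset \<omega> \<inter> half_cell n j \<noteq> {}) :: real)"
      using ij by (cases "G (pt n i) \<omega> * G (pt n i + mesh n) \<omega> < 0 \<and> G (pt n j) \<omega> * G (pt n j + mesh n) \<omega> < 0") simp_all
  qed
  also have "\<dots> \<le> (\<Sum>i\<le>2^n. \<Sum>j<2^n. cell_min n i j * (of_bool (zset \<omega> \<inter> half_cell n i \<noteq> {}) * of_bool (zset \<omega> \<inter> half_cell n j \<noteq> {})))"
    by (rule sum_mono2) (auto intro!: sum_nonneg mult_nonneg_nonneg cell_min_nonneg)
  also have "\<dots> \<le> cell_sum n (zset \<omega>)" unfolding cell_sum_def
    by (intro sum_mono sum_mono2) (auto intro!: mult_nonneg_nonneg cell_min_nonneg)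
  finally have "ennreal (sign_change_sum n \<omega>) \<le> ennreal (cell_sum n (zset \<omega>))" by (rule ennreal_leI)
  also have "\<dots> \<le> grid_pair_sum \<omega>" unfolding grid_pair_sum_def by (rule cell_sum_le[OF zset_sub])
  finally show ?thesis .
qed

lemma grid_pair_sum_eq_liminf: "AE \<omega> in M. grid_pair_sum \<omega> = liminf (\<lambda>n. ennreal (sign_change_sum n \<omega>))"
  using AE_grid_nonzero AE_no_double_zero AE_space
proof eventually_elim
  fix \<omega> assume nz: "\<forall>n. \<forall>i\<le>2^n. G (pt n i) \<omega> \<noteq> 0" and reg: "\<forall>t\<in>{a..b}. \<not> (G t \<omega> = 0 \<and> path_deriv I G t \<omega> = 0)" and w: "\<omega> \<in> space M"
  have c: "continuous_on {a..b} (\<lambda>t. path_deriv I G t \<omega>)" using path_deriv_continuous[OF w] abI by (rule continuous_on_subset)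
  have "\<forall>\<^sub>F n in sequentially. cell_sum n (zset \<omega>) = sign_change_sum n \<omega>"
    unfolding zset_def sign_change_sum_def
    by (rule regular_cell_sign_sum[OF path_has_derivative[OF w _ abI] c]) (use reg nz in auto)
  then have "liminf (\<lambda>n. ennreal (cell_sum n (zset \<omega>))) = liminf (\<lambda>n. ennreal (sign_change_sum n \<omega>))"
    by (intro Liminf_eq) (auto elim: eventually_mono)
  then show "grid_pair_sum \<omega> = liminf (\<lambda>n. ennreal (sign_change_sum n \<omega>))"
    unfolding grid_pair_sum_def cell_sum_liminf_eq[OF zset_sub] .
qed

lemma grid_pair_sum_integral_limit:
  assumes "(\<lambda>n. \<Sum>i<2^n. \<Sum>j<2^n. cell_min n i j * prob (cross_event (pt n i) (pt n j) (mesh n))) \<longlonglongrightarrow> l"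
  shows "(\<integral>\<^sup>+\<omega>. grid_pair_sum \<omega> \<partial>M) = ennreal l"
proof (rule antisym)
  have lim: "(\<lambda>n. \<integral>\<^sup>+\<omega>. ennreal (sign_change_sum n \<omega>) \<partial>M) \<longlonglongrightarrow> ennreal l"
    unfolding sign_change_sum_integral(2) using assms by (rule tendsto_ennrealI)
  have "(\<integral>\<^sup>+\<omega>. grid_pair_sum \<omega> \<partial>M) = (\<integral>\<^sup>+\<omega>. liminf (\<lambda>n. ennreal (sign_change_sum n \<omega>)) \<partial>M)"
    by (rule nn_integral_cong_AE[OF grid_pair_sum_eq_liminf])
  also have "\<dots> \<le> liminf (\<lambda>n. \<integral>\<^sup>+\<omega>. ennreal (sign_change_sum n \<omega>) \<partial>M)"
    using sign_change_sum_integral(1) by (intro nn_integral_liminf) measurable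
  also have "\<dots> = ennreal l" using lim_imp_Liminf[OF _ lim] by simp
  finally show "(\<integral>\<^sup>+\<omega>. grid_pair_sum \<omega> \<partial>M) \<le> ennreal l" .
  show "ennreal l \<le> (\<integral>\<^sup>+\<omega>. grid_pair_sum \<omega> \<partial>M)"
    by (rule LIMSEQ_le_const2[OF lim]) (use sign_change_sum_le_grid_pair_sum in \<open>auto intro!: nn_integral_mono\<close>)
qed

end

context gauss_proc
begin

text \<open>The value 0 on the diagonal agrees with the limit of the cutoffs, which vanish there,
  and also gives the right density when the interval is a single point.\<close>

definition rho :: "real \<times> real \<Rightarrow> real" where
  "rho z = (if fst z = snd z then 0 else rice_density M I G (fst z) (snd z))"

lemma rho_nonneg: "z \<in> I \<times> I \<Longrightarrow> 0 \<le> rho z"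
  by (auto simp: rho_def rice_density_limit(1) mem_Times_iff)

end

section \<open>Riemann sums for the Rice density\<close>

context gauss_grid_fun
begin

definition cross_rate :: "nat \<Rightarrow> nat \<Rightarrow> nat \<Rightarrow> real" where
  "cross_rate n i j = prob (cross_event (pt n i) (pt n j) (mesh n)) / (mesh n)\<^sup>2"

text \<open>A step function whose integral is exactly the expected sign change sum. Convergence of
  the Riemann sums thereby becomes convergence of integrals.\<close>

definition rice_step :: "nat \<Rightarrow> real \<times> real \<Rightarrow> real" where
  "rice_step n z = (\<Sum>i<2^n. \<Sum>j<2^n. cell_min n i j * cross_rate n i j * indicator ({pt n i..<pt n (Suc i)} \<times> {pt n j..<pt n (Suc j)}) z)"

lemma rice_step_integral:
  "integrable lborel (rice_step n)"
  "(\<integral>z. rice_step n z \<partial>lborel) = (\<Sum>i<2^n. \<Sum>j<2^n. cell_min n i j * prob (cross_event (pt n i) (pt n j) (mesh n)))"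
proof -
  let ?C = "\<lambda>i j. {pt n i..<pt n (Suc i)} \<times> {pt n j..<pt n (Suc j)}"
  have S: "?C i j \<in> sets lborel" for i j unfolding lborel_prod[symmetric] by auto
  have E: "emeasure lborel (?C i j) = ennreal ((mesh n)\<^sup>2)" for i j
  proof -
    have "emeasure lborel (?C i j) = emeasure lborel {pt n i..<pt n (Suc i)} * emeasure lborel {pt n j..<pt n (Suc j)}"
      unfolding lborel_prod[symmetric] by (rule lborel.emeasure_pair_measure_Times) auto
    also have "\<dots> = ennreal ((mesh n)\<^sup>2)"
      using mesh_pos[of n] by (simp add: pt_Suc ennreal_mult[symmetric] power2_eq_square)
    finally show ?thesis .
  qed
  have i1: "integrable lborel (\<lambda>z. cell_min n i j * cross_rate n i j * indicator (?C i j) z)" for i j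
    using S E by (intro integrable_mult_right integrable_real_indicator) auto
  have i2: "integrable lborel (\<lambda>z. \<Sum>j<2^n. cell_min n i j * cross_rate n i j * indicator (?C i j) z)" for i
    by (intro Bochner_Integration.integrable_sum i1)
  show "integrable lborel (rice_step n)" unfolding rice_step_def[abs_def] by (intro Bochner_Integration.integrable_sum i2)
  have m: "measure lborel (?C i j) = (mesh n)\<^sup>2" for i j unfolding measure_def E by simp
  have "(\<integral>z. rice_step n z \<partial>lborel) = (\<Sum>i<2^n. \<integral>z. (\<Sum>j<2^n. cell_min n i j * cross_rate n i j * indicator (?C i j) z) \<partial>lborel)"
    unfolding rice_step_def by (rule Bochner_Integration.integral_sum) (rule i2)
  also have "\<dots> = (\<Sum>i<2^n. \<Sum>j<2^n. \<integral>z. cell_min n i j * cross_rate n i j * indicator (?C i j) z \<partial>lborel)"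
    by (rule sum.cong[OF refl], rule Bochner_Integration.integral_sum) (rule i1)
  also have "\<dots> = (\<Sum>i<2^n. \<Sum>j<2^n. cell_min n i j * prob (cross_event (pt n i) (pt n j) (mesh n)))"
    using mesh_pos[of n] by (intro sum.cong refl) (simp add: m cross_rate_def)
  finally show "(\<integral>z. rice_step n z \<partial>lborel) = (\<Sum>i<2^n. \<Sum>j<2^n. cell_min n i j * prob (cross_event (pt n i) (pt n j) (mesh n)))" .
qed

lemma idx_iff:
  assumes "x \<in> {a..<b}" "i < 2 ^ n"
  shows "x \<in> {pt n i..<pt n (Suc i)} \<longleftrightarrow> i = idx n x"
proof -
  have x: "x \<in> {a..b}" using assms by auto
  have "x \<in> {pt n i..<pt n (Suc i)} \<longleftrightarrow> x \<in> half_cell n i" using x by (auto simp: half_cell_def)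
  also have "\<dots> \<longleftrightarrow> i = idx n x" using idx_cell(1)[OF x] half_cell_unique by blast
  finally show ?thesis .
qed

lemma idx_less:
  assumes "x \<in> {a..<b}" shows "idx n x < 2 ^ n"
proof -
  have x: "x \<in> {a..b}" using assms by auto
  have "pt n (idx n x) \<le> x" using idx_cell(1)[OF x] by (auto simp: half_cell_def)
  then have "idx n x \<noteq> 2 ^ n" using assms pt_last by (metis atLeastLessThan_iff not_less)
  then show ?thesis using idx_cell(2)[OF x, of n] by simp
qed

lemma rice_step_inside:
  assumes "x \<in> {a..<b}" "y \<in> {a..<b}"
  shows "rice_step n (x, y) = cell_min n (idx n x) (idx n y) * cross_rate n (idx n x) (idx n y)"
proof -
  have "rice_step n (x, y) = (\<Sum>i<2^n. \<Sum>j<2^n. (if j = idx n y then (if i = idx n x then cell_min n i j * cross_rate n i j else 0) else 0))"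
    unfolding rice_step_def by (intro sum.cong refl)
      (use idx_iff[OF assms(1)] idx_iff[OF assms(2)] in \<open>auto simp: indicator_def\<close>)
  also have "\<dots> = cell_min n (idx n x) (idx n y) * cross_rate n (idx n x) (idx n y)"
    using idx_less[OF assms(1), of n] idx_less[OF assms(2), of n] by (simp add: sum.delta)
  finally show ?thesis .
qed

lemma rice_step_outside:
  assumes "z \<notin> {a..<b} \<times> {a..<b}"
  shows "rice_step n z = 0"
proof -
  have sub: "{pt n i..<pt n (Suc i)} \<subseteq> {a..<b}" if "i < 2 ^ n" for i
    using pt_le[of i n] pt_le[of "Suc i" n] that by auto
  have "z \<notin> {pt n i..<pt n (Suc i)} \<times> {pt n j..<pt n (Suc j)}" if "i < 2 ^ n" "j < 2 ^ n" for i j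
    using assms sub[OF that(1)] sub[OF that(2)] by (auto simp: mem_Times_iff)
  then show ?thesis unfolding rice_step_def by (intro sum.neutral ballI) auto
qed

lemma rice_step_tendsto:
  assumes xy: "x \<in> {a..<b}" "y \<in> {a..<b}"
  shows "(\<lambda>n. rice_step n (x, y)) \<longlonglongrightarrow> f (x, y) * rho (x, y)"
proof (cases "x = y")
  case True
  \<comment> \<open>No limit of the crossing rates is available on the diagonal. There the minimum
    over the cell is 0, because the cell contains a diagonal point, where \<open>f\<close>
    vanishes.\<close>
  have "cell_min n (idx n y) (idx n y) = 0" for n
  proof -
    have y: "y \<in> {a..b}" using xy by auto
    have i: "idx n y \<le> 2 ^ n" "y \<in> closed_cell n (idx n y)" by (rule idx_cell(2)[OF y], rule subsetD[OF half_cell_sub(1) idx_cell(1)[OF y]])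
    then have "cell_min n (idx n y) (idx n y) \<le> f (y, y)" unfolding cell_min_def by (intro cell_argmin(2)) auto
    then show ?thesis using cell_min_nonneg[OF i(1) i(1)] fdiag[OF y] by simp
  qed
  then show ?thesis using True xy by (simp add: rice_step_inside rho_def)
next
  case False
  have x: "x \<in> {a..b}" "y \<in> {a..b}" using xy by auto
  have lim: "(\<lambda>n. pt n (idx n u)) \<longlonglongrightarrow> u" if "u \<in> {a..b}" for u
  proof -
    have "\<bar>pt n (idx n u) - u\<bar> \<le> mesh n" for n using idx_cell(1)[OF that, of n] by (auto simp: half_cell_def pt_Suc)
    then have "(\<lambda>n. pt n (idx n u) - u) \<longlonglongrightarrow> 0" by (intro Lim_null_comparison[OF _ mesh_lim]) auto
    then show ?thesis by (simp add: LIM_zero_iff)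
  qed
  have "approximating x y (\<lambda>n. pt n (idx n x)) (\<lambda>n. pt n (idx n y)) mesh"
    unfolding approximating_def
  proof (intro conjI allI)
    show "x \<in> I" "y \<in> I" using x abI by blast+
    fix n
    show "pt n (idx n x) \<in> I" "pt n (idx n y) \<in> I" by (intro pt_I idx_cell x)+
    show "pt n (idx n x) + mesh n \<in> I" "pt n (idx n y) + mesh n \<in> I"
      unfolding pt_Suc[symmetric] using idx_less xy by (auto intro!: pt_I simp: Suc_le_eq)
  qed (use mesh_pos mesh_lim lim x in auto)
  from cross_event_limit[OF this False]
  have "(\<lambda>n. cross_rate n (idx n x) (idx n y)) \<longlonglongrightarrow> rho (x, y)" using False by (simp add: cross_rate_def rho_def)
  with cell_min_tendsto[OF x] show ?thesis unfolding rice_step_inside[OF xy] by (rule tendsto_mult)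
qed

text \<open>
  Away from the diagonal the normalised probabilities of a double sign change are eventually
  bounded, since along a subsequence they converge by compactness.
\<close>

lemma cross_rate_bounded:
  assumes e: "0 < \<epsilon>" and f0: "\<And>z. z \<in> {a..b} \<times> {a..b} \<Longrightarrow> \<bar>fst z - snd z\<bar> < \<epsilon> \<Longrightarrow> f z = 0"
  shows "\<exists>C N. \<forall>n\<ge>N. \<forall>i<2^n. \<forall>j<2^n. cell_min n i j \<noteq> 0 \<longrightarrow> cross_rate n i j \<le> C"
proof (rule ccontr)
  assume "\<not> ?thesis"
  then have "\<forall>k::nat. \<exists>n i j. k \<le> n \<and> i < 2 ^ n \<and> j < 2 ^ n \<and> cell_min n i j \<noteq> 0 \<and> real k < cross_rate n i j"
    by (metis not_le)
  then obtain n i j where k: "\<And>k::nat. k \<le> n k" "\<And>k. i k < 2 ^ n k" "\<And>k. j k < 2 ^ n k"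
    "\<And>k. cell_min (n k) (i k) (j k) \<noteq> 0" "\<And>k. real k < cross_rate (n k) (i k) (j k)" by metis
  define p where "p = (\<lambda>k. (pt (n k) (i k), pt (n k) (j k)))"
  have "compact ({a..b} \<times> {a..b})" by (intro compact_Times) auto
  moreover have "p k \<in> {a..b} \<times> {a..b}" for k
    using pt_le[of "i k" "n k"] pt_le[of "j k" "n k"] k(2,3)[of k] by (simp add: p_def)
  ultimately obtain l \<tau> where l: "l \<in> {a..b} \<times> {a..b}" "strict_mono \<tau>" "(p \<circ> \<tau>) \<longlonglongrightarrow> l"
    unfolding compact_eq_seq_compact_metric seq_compact_def by metis
  obtain x y where lxy: "l = (x, y)" by (cases l)
  define s t h where "s = (\<lambda>k. pt (n (\<tau> k)) (i (\<tau> k)))" and "t = (\<lambda>k. pt (n (\<tau> k)) (j (\<tau> k)))"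
    and "h = (\<lambda>k. mesh (n (\<tau> k)))"
  have st: "s \<longlonglongrightarrow> x" "t \<longlonglongrightarrow> y"
    using tendsto_fst[OF l(3)] tendsto_snd[OF l(3)] by (simp_all add: lxy p_def s_def t_def o_def)
  have ge: "k \<le> n (\<tau> k)" for k using k(1)[of "\<tau> k"] seq_suble[OF l(2), of k] by linarith
  have "filterlim (\<lambda>k. n (\<tau> k)) at_top sequentially"
    by (rule filterlim_at_top_mono[OF filterlim_ident]) (simp add: ge)
  then have h0: "h \<longlonglongrightarrow> 0" unfolding h_def by (rule filterlim_compose[OF mesh_lim])
  \<comment> \<open>A nonzero cell minimum means that \<open>f\<close> is nonzero at the minimising
    point, whose coordinates are therefore at least \<epsilon> apart. The lower corners of the two
    cells differ from these coordinates by at most one mesh each.\<close>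
  have sep: "\<epsilon> - 2 * h k \<le> \<bar>s k - t k\<bar>" for k
  proof -
    let ?n = "n (\<tau> k)" and ?i = "i (\<tau> k)" and ?j = "j (\<tau> k)"
    have ij: "?i < 2 ^ ?n" "?j < 2 ^ ?n" using k by auto
    define w where "w = cell_argmin ?n ?i ?j"
    have w: "w \<in> closed_cell ?n ?i \<times> closed_cell ?n ?j" unfolding w_def using ij by (intro cell_argmin) auto
    have "w \<in> {a..b} \<times> {a..b}" by (rule subsetD[OF Sigma_mono[OF half_cell_sub(2) half_cell_sub(2)] w])
    then have "\<epsilon> \<le> \<bar>fst w - snd w\<bar>" using f0[of w] k(4)[of "\<tau> k"] unfolding cell_min_def w_def by force
    moreover have "\<bar>fst w - s k\<bar> \<le> h k" "\<bar>snd w - t k\<bar> \<le> h k"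
      using w by (auto simp: mem_Times_iff closed_cell_def s_def t_def h_def pt_Suc)
    ultimately show ?thesis by linarith
  qed
  have "(\<lambda>k. \<epsilon> - 2 * h k) \<longlonglongrightarrow> \<epsilon> - 2 * 0" "(\<lambda>k. \<bar>s k - t k\<bar>) \<longlonglongrightarrow> \<bar>x - y\<bar>"
    by (intro tendsto_intros h0 st)+
  then have "\<epsilon> - 2 * 0 \<le> \<bar>x - y\<bar>" by (rule LIMSEQ_le) (use sep in blast)
  then have ne: "x \<noteq> y" using e by auto
  have "approximating x y s t h"
    unfolding approximating_def
  proof (intro conjI allI)
    show "x \<in> I" "y \<in> I" using l(1) lxy abI by auto
    fix k
    show "s k \<in> I" "t k \<in> I" "s k + h k \<in> I" "t k + h k \<in> I"
      unfolding s_def t_def h_def pt_Suc[symmetric] by (auto intro!: pt_I simp: Suc_le_eq k less_imp_le)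
  qed (use mesh_pos h0 st in \<open>auto simp: h_def\<close>)
  from cross_event_limit[OF this ne]
  have lim: "(\<lambda>k. cross_rate (n (\<tau> k)) (i (\<tau> k)) (j (\<tau> k))) \<longlonglongrightarrow> rice_density M I G x y" by (simp add: cross_rate_def s_def t_def h_def)
  have "real k \<le> cross_rate (n (\<tau> k)) (i (\<tau> k)) (j (\<tau> k))" for k
    using k(5)[of "\<tau> k"] seq_suble[OF l(2), of k] by linarith
  then have "filterlim (\<lambda>k. cross_rate (n (\<tau> k)) (i (\<tau> k)) (j (\<tau> k))) at_top sequentially"
    by (intro filterlim_at_top_mono[OF filterlim_real_sequentially]) auto
  then show False using lim by (intro not_tendsto_and_filterlim_at_infinity[OF _ lim]) (auto intro: filterlim_at_top_imp_at_infinity)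
qed

lemma grid_pair_sum_integral:
  assumes e: "0 < \<epsilon>" and f0: "\<And>z. z \<in> {a..b} \<times> {a..b} \<Longrightarrow> \<bar>fst z - snd z\<bar> < \<epsilon> \<Longrightarrow> f z = 0"
  shows "(\<integral>\<^sup>+\<omega>. grid_pair_sum \<omega> \<partial>M) = (\<integral>\<^sup>+z. ennreal (f z * rho z) * indicator ({a..b} \<times> {a..b}) z \<partial>lborel)"
proof -
  \<comment> \<open>The step functions live on the half-open square, because their cells omit the
    right endpoint. The missing edges form a null set and are restored at the end.\<close>
  let ?S = "{a..<b} \<times> {a..<b}"
  define F where "F = (\<lambda>z. f z * rho z * indicator ?S z)"
  obtain C N where CN: "\<And>n i j. N \<le> n \<Longrightarrow> i < 2 ^ n \<Longrightarrow> j < 2 ^ n \<Longrightarrow> cell_min n i j \<noteq> 0 \<Longrightarrow> cross_rate n i j \<le> C"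
    using cross_rate_bounded[OF assms] by blast
  have "compact (f ` ({a..b} \<times> {a..b}))" by (intro compact_continuous_image[OF fc] compact_Times) auto
  then have "bounded (f ` ({a..b} \<times> {a..b}))" by (rule compact_imp_bounded)
  then obtain B where B: "0 < B" "\<And>z. z \<in> {a..b} \<times> {a..b} \<Longrightarrow> \<bar>f z\<bar> \<le> B" by (auto simp: bounded_pos)
  have wB: "cell_min n i j \<le> B" if "i \<le> 2 ^ n" "j \<le> 2 ^ n" for n i j
    using B(2)[OF subsetD[OF Sigma_mono[OF half_cell_sub(2) half_cell_sub(2)] cell_argmin(1)[OF that]]] by (simp add: cell_min_def)
  have Vlim: "(\<lambda>n. rice_step n z) \<longlonglongrightarrow> F z" for z
    using rice_step_tendsto[of "fst z" "snd z"] rice_step_outside[of z] by (cases "z \<in> ?S") (auto simp: F_def mem_Times_iff)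
  have Vm: "rice_step n \<in> borel_measurable lborel" for n using rice_step_integral(1) by (rule borel_measurable_integrable)
  have Fm: "F \<in> borel_measurable lborel" by (rule borel_measurable_LIMSEQ_real[OF Vlim Vm])
  have dom: "norm (rice_step (n + N) z) \<le> B * max C 0 * indicator ({a..b} \<times> {a..b}) z" for n z
  proof (cases "z \<in> ?S")
    case True
    obtain x y where z: "z = (x, y)" "x \<in> {a..<b}" "y \<in> {a..<b}" using True by (cases z) auto
    let ?i = "idx (n + N) x" and ?j = "idx (n + N) y"
    have i: "?i < 2 ^ (n + N)" "?j < 2 ^ (n + N)" using idx_less z by auto
    have Q: "0 \<le> cross_rate (n + N) ?i ?j" by (simp add: cross_rate_def)
    have W: "0 \<le> cell_min (n + N) ?i ?j" using i by (intro cell_min_nonneg) auto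
    have "rice_step (n + N) z \<le> B * max C 0"
    proof (cases "cell_min (n + N) ?i ?j = 0")
      case True then show ?thesis unfolding z(1) rice_step_inside[OF z(2,3)] using B(1) by simp
    next
      case False
      have "cross_rate (n + N) ?i ?j \<le> max C 0" using CN[OF _ i False] by simp
      then show ?thesis unfolding z(1) rice_step_inside[OF z(2,3)] using i W Q B(1) by (intro mult_mono wB) auto
    qed
    moreover have "0 \<le> rice_step (n + N) z" unfolding z(1) rice_step_inside[OF z(2,3)] using W Q by simp
    moreover have "z \<in> {a..b} \<times> {a..b}" using z by auto
    ultimately show ?thesis by simp
  next
    case False
    then show ?thesis using B(1) by (simp add: rice_step_outside)
  qed
  have "{a..b} \<times> {a..b} = cbox (a, a) (b, b)" by (simp add: cbox_Pair_eq)
  then have wi: "integrable lborel (\<lambda>z. B * max C 0 * indicator ({a..b} \<times> {a..b}) z)"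
    by (intro integrable_mult_right integrable_real_indicator) (auto simp: emeasure_lborel_cbox_eq)
  have Vlim': "AE z in lborel. (\<lambda>n. rice_step (n + N) z) \<longlonglongrightarrow> F z" using Vlim by (intro AE_I2 LIMSEQ_ignore_initial_segment)
  have dom': "AE z in lborel. norm (rice_step (n + N) z) \<le> B * max C 0 * indicator ({a..b} \<times> {a..b}) z" for n
    by (rule AE_I2) (rule dom)
  have Fi: "integrable lborel F" "(\<lambda>n. \<integral>z. rice_step (n + N) z \<partial>lborel) \<longlonglongrightarrow> (\<integral>z. F z \<partial>lborel)"
    by (rule integrable_dominated_convergence[OF Fm Vm wi Vlim' dom'],
        rule integral_dominated_convergence[OF Fm Vm wi Vlim' dom'])
  have "(\<lambda>n. \<Sum>i<2^n. \<Sum>j<2^n. cell_min n i j * prob (cross_event (pt n i) (pt n j) (mesh n))) \<longlonglongrightarrow> (\<integral>z. F z \<partial>lborel)"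
    using LIMSEQ_offset[OF Fi(2)] unfolding rice_step_integral(2) .
  then have "(\<integral>\<^sup>+\<omega>. grid_pair_sum \<omega> \<partial>M) = ennreal (\<integral>z. F z \<partial>lborel)" by (rule grid_pair_sum_integral_limit)
  also have "\<dots> = (\<integral>\<^sup>+z. ennreal (F z) \<partial>lborel)"
  proof (rule nn_integral_eq_integral[OF Fi(1), symmetric], rule AE_I2)
    fix z
    show "0 \<le> F z"
    proof (cases "z \<in> ?S")
      case True
      then have z: "z \<in> {a..b} \<times> {a..b}" by auto
      then have "z \<in> I \<times> I" using abI by auto
      then show ?thesis using fnn[OF z] rho_nonneg[of z] by (simp add: F_def)
    qed (simp add: F_def)
  qed
  also have "\<dots> = (\<integral>\<^sup>+z. ennreal (f z * rho z) * indicator ({a..b} \<times> {a..b}) z \<partial>lborel)"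
  proof (rule nn_integral_cong_AE)
    have "AE z in lborel. fst z \<noteq> b \<and> snd z \<noteq> b"
    proof (rule AE_lborel_pair)
      show "Measurable.pred borel (\<lambda>z. fst z \<noteq> b \<and> snd z \<noteq> b)" by (simp add: borel_prod[symmetric])
      have ae: "AE u in lborel. u \<noteq> b" by (rule AE_lborel_singleton)
      show "AE x in lborel. AE y in lborel. fst (x, y) \<noteq> b \<and> snd (x, y) \<noteq> b"
        using ae by (rule eventually_mono) (use ae in auto)
    qed
    then show "AE z in lborel. ennreal (F z) = ennreal (f z * rho z) * indicator ({a..b} \<times> {a..b}) z"
    proof (rule eventually_mono)
      fix z :: "real \<times> real" assume "fst z \<noteq> b \<and> snd z \<noteq> b"
      then have "indicator ({a..b} \<times> {a..b}) z = (indicator ?S z :: ennreal)" "indicator ({a..b} \<times> {a..b}) z = (indicator ?S z :: real)"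
        by (auto simp: indicator_def mem_Times_iff)
      then show "ennreal (F z) = ennreal (f z * rho z) * indicator ({a..b} \<times> {a..b}) z"
        by (simp add: F_def indicator_def)
    qed
  qed
  finally show ?thesis .
qed

end

section \<open>The two-point correlation measure\<close>

text \<open>A piecewise linear function of |d| that is 0 up to 1 / (k + 1) and 1 from 2 / (k + 1)
  on. It is continuous in \<open>d\<close> and increases with \<open>k\<close> to the indicator of
  \<open>d\<close> nonzero, so that monotone convergence applies to both sides of the
  identity.\<close>

definition offdiag_cutoff :: "nat \<Rightarrow> real \<Rightarrow> real" where
  "offdiag_cutoff k d = min 1 (max 0 (real (Suc k) * \<bar>d\<bar> - 1))"

lemma offdiag_cutoff_nonneg [simp]: "0 \<le> offdiag_cutoff k d"
  by (simp add: offdiag_cutoff_def)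

lemma offdiag_cutoff_0: "\<bar>d\<bar> < 1 / real (Suc k) \<Longrightarrow> offdiag_cutoff k d = 0"
  by (simp add: offdiag_cutoff_def field_simps)

lemma offdiag_cutoff_mono: "k \<le> l \<Longrightarrow> offdiag_cutoff k d \<le> offdiag_cutoff l d"
proof -
  assume "k \<le> l"
  then have "real (Suc k) * \<bar>d\<bar> \<le> real (Suc l) * \<bar>d\<bar>" by (intro mult_right_mono) auto
  then show ?thesis unfolding offdiag_cutoff_def by (auto simp: min_def max_def)
qed

lemma continuous_on_offdiag_cutoff [continuous_intros]:
  "continuous_on A g \<Longrightarrow> continuous_on A (\<lambda>x. offdiag_cutoff k (g x))"
  unfolding offdiag_cutoff_def by (intro continuous_intros)

lemma SUP_offdiag_cutoff:
  assumes c: "0 \<le> c"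
  shows "(SUP k. ennreal (c * offdiag_cutoff k d)) = (if d = 0 then 0 else ennreal c)"
proof (cases "d = 0")
  case True
  then show ?thesis by (simp add: offdiag_cutoff_0)
next
  case False
  obtain k where k: "2 / \<bar>d\<bar> < real k" using reals_Archimedean2 by blast
  have "offdiag_cutoff k d = 1"
  proof -
    have "2 < real k * \<bar>d\<bar>" using k False by (simp add: pos_divide_less_eq)
    then have "2 \<le> real (Suc k) * \<bar>d\<bar>" by (simp add: algebra_simps)
    then show ?thesis unfolding offdiag_cutoff_def by linarith
  qed
  then have "ennreal c \<le> (SUP k. ennreal (c * offdiag_cutoff k d))" by (intro SUP_upper2[of k]) auto
  moreover have "(SUP k. ennreal (c * offdiag_cutoff k d)) \<le> ennreal c"
    using c by (intro SUP_least ennreal_leI mult_left_le) (auto simp: offdiag_cutoff_def)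
  ultimately show ?thesis using False by (simp add: antisym)
qed

lemma nn_integral_count_space_UNIV:
  "(\<integral>\<^sup>+z. h z \<partial>count_space X) = (\<integral>\<^sup>+z. h z * indicator X z \<partial>count_space UNIV)"
  by (simp add: nn_integral_restrict_space[symmetric] restrict_count_space)

context gauss_proc
begin

lemma I_borel: "I \<times> I \<in> sets borel"
  unfolding borel_prod[symmetric] using real_interval_borel_measurable[OF interval] by simp

lemma rho_measurable: "(\<lambda>z. indicator (I \<times> I) z * rho z) \<in> borel_measurable borel"
proof -
  let ?A = "(I \<times> I) \<inter> {z. fst z \<noteq> snd z}"
  have "{z::real \<times> real. fst z \<noteq> snd z} \<in> sets borel"
    by (intro borel_open open_Collect_neq continuous_intros)
  then have "?A \<in> sets borel" using I_borel by blast
  then have "(\<lambda>z. indicator ?A z *\<^sub>R (\<lambda>(x, y). rice_density M I G x y) z) \<in> borel_measurable borel"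
    by (intro borel_measurable_continuous_on_indicator rice_density_continuous)
  also have "(\<lambda>z. indicator ?A z *\<^sub>R (\<lambda>(x, y). rice_density M I G x y) z) = (\<lambda>z. indicator (I \<times> I) z * rho z)"
    by (auto simp: fun_eq_iff rho_def indicator_def split_beta)
  finally show ?thesis .
qed

definition pair_sum :: "(real \<times> real \<Rightarrow> real) \<Rightarrow> 'w \<Rightarrow> ennreal" where
  "pair_sum f \<omega> = (\<integral>\<^sup>+z. ennreal (f z) \<partial>count_space (zero_pairs I G \<omega>))"

text \<open>The square is spanned by the coordinates of the compact support; the two points
  \<open>p\<close> and \<open>q\<close> are added to it so that \<open>a < b\<close> holds even for
  an empty or one-point support.\<close>

lemma test_function_support:
  assumes f: "test_function I f" and pq: "p \<in> I" "q \<in> I" "p < q"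
  obtains a b where "a < b" "{a..b} \<subseteq> I" "\<And>z. z \<in> I \<times> I \<Longrightarrow> z \<notin> {a..b} \<times> {a..b} \<Longrightarrow> f z = 0"
proof -
  obtain K where K: "compact K" "K \<subseteq> I \<times> I" "\<And>z. z \<in> I \<times> I - K \<Longrightarrow> f z = 0"
    using f by (auto simp: test_function_def)
  define A where "A = fst ` K \<union> snd ` K \<union> {p, q}"
  have cA: "compact A" unfolding A_def
    by (intro compact_Un compact_continuous_image K continuous_intros) auto
  have AI: "A \<subseteq> I" using K(2) pq by (auto simp: A_def)
  have bd: "bdd_below A" "bdd_above A" "closed A" "A \<noteq> {}"
    using compact_imp_bounded[OF cA] compact_imp_closed[OF cA]
    by (auto simp: bounded_imp_bdd_below bounded_imp_bdd_above A_def)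
  have m: "Inf A \<in> I" "Sup A \<in> I" using AI closed_contains_Inf[OF bd(4,1,3)] closed_contains_Sup[OF bd(4,2,3)] by blast+
  have bnd: "Inf A \<le> u" "u \<le> Sup A" if "u \<in> A" for u
    using that bd by (auto intro: cInf_lower cSup_upper)
  have lt: "Inf A < Sup A" using bnd(1)[of p] bnd(2)[of q] pq by (auto simp: A_def)
  have sub: "{Inf A..Sup A} \<subseteq> I" 
  proof
    fix u assume "u \<in> {Inf A..Sup A}"
    then show "u \<in> I" using mem_is_interval_1_I[OF interval m] by simp
  qed
  have "f z = 0" if z: "z \<in> I \<times> I" "z \<notin> {Inf A..Sup A} \<times> {Inf A..Sup A}" for z
  proof (rule K(3))
    have "z \<notin> K"
    proof
      assume "z \<in> K"
      then have "fst z \<in> A" "snd z \<in> A" by (auto simp: A_def)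
      then show False using bnd z(2) by (auto simp: mem_Times_iff)
    qed
    then show "z \<in> I \<times> I - K" using z by simp
  qed
  then show ?thesis using that lt sub by blast
qed

text \<open>For each cutoff the grid argument applies on a compact square. Both sides increase with
  the cutoff, and the identity survives in the limit even if its value is infinite.\<close>

lemma pair_sum_integral:
  assumes f: "test_function I f" and nn: "\<And>z. z \<in> I \<times> I \<Longrightarrow> 0 \<le> f z"
  shows "pair_sum f \<in> borel_measurable M"
    and "(\<integral>\<^sup>+\<omega>. pair_sum f \<omega> \<partial>M) = (\<integral>\<^sup>+z. ennreal (f z * rho z) * indicator (I \<times> I) z \<partial>lborel)"
proof -
  have "pair_sum f \<in> borel_measurable M \<and>
    (\<integral>\<^sup>+\<omega>. pair_sum f \<omega> \<partial>M) = (\<integral>\<^sup>+z. ennreal (f z * rho z) * indicator (I \<times> I) z \<partial>lborel)"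
  \<comment> \<open>An interval with at most one point has no pairs of different zeros, and
    \<open>rho\<close> vanishes on its square.\<close>
  proof (cases "\<exists>p\<in>I. \<exists>q\<in>I. p < q")
    case False
    then have eq: "u = v" if "u \<in> I" "v \<in> I" for u v using that by (metis linorder_neqE)
    have "zero_pairs I G \<omega> = {}" for \<omega> using eq by (auto simp: zero_pairs_def)
    then have p0: "pair_sum f \<omega> = 0" for \<omega> by (simp add: pair_sum_def nn_integral_count_space_finite)
    have r0: "ennreal (f z * rho z) * indicator (I \<times> I) z = 0" for z
      using eq by (cases z) (auto simp: rho_def indicator_def)
    have "pair_sum f = (\<lambda>_. 0)" using p0 by blast
    then show ?thesis unfolding r0 by simp
  next
    case True
    then obtain p q where pq: "p \<in> I" "q \<in> I" "p < q" by blast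
    obtain a b where ab: "a < b" "{a..b} \<subseteq> I" and supp: "\<And>z. z \<in> I \<times> I \<Longrightarrow> z \<notin> {a..b} \<times> {a..b} \<Longrightarrow> f z = 0"
      using test_function_support[OF f pq] by blast
    let ?S = "{a..b} \<times> {a..b}"
    have SI: "?S \<subseteq> I \<times> I" using ab by blast
    define fk where "fk = (\<lambda>k z. f z * offdiag_cutoff k (fst z - snd z))"
    have fkc: "continuous_on ?S (fk k)" for k
      unfolding fk_def using continuous_on_subset[OF _ SI] f by (intro continuous_intros) (auto simp: test_function_def)
    have GF: "gauss_grid_fun M I G m r a b (fk k)" for k
    proof unfold_locales
      show "a < b" "{a..b} \<subseteq> I" by (rule ab)+
      show "continuous_on ?S (fk k)" by (rule fkc)
      show "0 \<le> fk k z" if "z \<in> ?S" for z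
        using nn[OF subsetD[OF SI that]] by (simp add: fk_def)
      show "fk k (t, t) = 0" for t by (simp add: fk_def offdiag_cutoff_0)
    qed
    define Z where "Z = (\<lambda>\<omega>. {t \<in> {a..b}. G t \<omega> = 0})"
    define N where "N = (\<lambda>k \<omega>. \<integral>\<^sup>+z. ennreal (fk k z) \<partial>count_space (Z \<omega> \<times> Z \<omega>))"
    have N_eq: "gauss_grid_fun.grid_pair_sum G a b (fk k) = N k" for k
      unfolding N_def Z_def gauss_grid_fun.grid_pair_sum_def[OF GF, abs_def]
        gauss_grid.zset_def[OF gauss_grid_fun.axioms(1)[OF GF], abs_def] ..
    have N_meas: "N k \<in> borel_measurable M" for k
      using gauss_grid_fun.grid_pair_sum_measurable[OF GF, of k] unfolding N_eq .
    have N_int: "(\<integral>\<^sup>+\<omega>. N k \<omega> \<partial>M) = (\<integral>\<^sup>+z. ennreal (fk k z * rho z) * indicator ?S z \<partial>lborel)" for k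
    proof -
      have "(\<integral>\<^sup>+\<omega>. gauss_grid_fun.grid_pair_sum G a b (fk k) \<omega> \<partial>M) = (\<integral>\<^sup>+z. ennreal (fk k z * rho z) * indicator ?S z \<partial>lborel)"
      proof (rule gauss_grid_fun.grid_pair_sum_integral[OF GF, of "1 / real (Suc k)"])
        show "fk k z = 0" if "\<bar>fst z - snd z\<bar> < 1 / real (Suc k)" for z
          using that by (simp add: fk_def offdiag_cutoff_0)
      qed simp
      then show ?thesis unfolding N_eq .
    qed
    have fk_mono: "fk k z \<le> fk l z" if "k \<le> l" "z \<in> I \<times> I" for k l z
      unfolding fk_def using that by (intro mult_left_mono offdiag_cutoff_mono nn)
    have ZI: "Z \<omega> \<times> Z \<omega> \<subseteq> I \<times> I" for \<omega> using ab by (auto simp: Z_def)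
    have N_mono: "incseq N"
      unfolding N_def by (intro incseq_SucI le_funI nn_integral_mono ennreal_leI fk_mono) (use ZI in auto)
    have sup: "pair_sum f \<omega> = (SUP k. N k \<omega>)" for \<omega>
    proof -
      have "(SUP k. N k \<omega>) = (SUP k. \<integral>\<^sup>+z. ennreal (fk k z) * indicator (Z \<omega> \<times> Z \<omega>) z \<partial>count_space UNIV)"
        unfolding N_def nn_integral_count_space_UNIV[of "Z \<omega> \<times> Z \<omega>"] ..
      also have "\<dots> = (\<integral>\<^sup>+z. (SUP k. ennreal (fk k z) * indicator (Z \<omega> \<times> Z \<omega>) z) \<partial>count_space UNIV)"
      proof (rule nn_integral_monotone_convergence_SUP[symmetric])
        show "incseq (\<lambda>k z. ennreal (fk k z) * indicator (Z \<omega> \<times> Z \<omega>) z)"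
        proof (intro incseq_SucI le_funI)
          fix k z
          show "ennreal (fk k z) * indicator (Z \<omega> \<times> Z \<omega>) z \<le> ennreal (fk (Suc k) z) * indicator (Z \<omega> \<times> Z \<omega>) z"
          proof (cases "z \<in> Z \<omega> \<times> Z \<omega>")
            case True
            then show ?thesis using ZI fk_mono[of k "Suc k" z] by (auto intro: ennreal_leI)
          qed simp
        qed
      qed simp
      also have "\<dots> = (\<integral>\<^sup>+z. ennreal (f z) * indicator (zero_pairs I G \<omega>) z \<partial>count_space UNIV)"
      proof (rule nn_integral_cong)
        fix z :: "real \<times> real"
        show "(SUP k. ennreal (fk k z) * indicator (Z \<omega> \<times> Z \<omega>) z) = ennreal (f z) * indicator (zero_pairs I G \<omega>) z"
        proof (cases "z \<in> Z \<omega> \<times> Z \<omega>")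
          case True
          then have zI: "z \<in> I \<times> I" using ZI by blast
          have "z \<in> zero_pairs I G \<omega> \<longleftrightarrow> fst z \<noteq> snd z"
            using True zI by (auto simp: zero_pairs_def Z_def mem_Times_iff split_beta)
          then show ?thesis using True SUP_offdiag_cutoff[OF nn[OF zI], of "fst z - snd z"] by (simp add: fk_def)
        next
          case False
          have "ennreal (f z) * indicator (zero_pairs I G \<omega>) z = 0"
          proof (cases "z \<in> zero_pairs I G \<omega>")
            case True
            then have "z \<in> I \<times> I" "z \<notin> ?S" using False by (auto simp: zero_pairs_def Z_def)
            then show ?thesis by (simp add: supp)
          qed simp
          then show ?thesis using False by simp
        qed
      qed
      also have "\<dots> = pair_sum f \<omega>" unfolding pair_sum_def nn_integral_count_space_UNIV[of "zero_pairs I G \<omega>"] ..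
      finally show ?thesis by simp
    qed
    have pm: "pair_sum f = (\<lambda>\<omega>. SUP k. N k \<omega>)" using sup by blast
    have meas: "pair_sum f \<in> borel_measurable M" unfolding pm using N_meas by measurable
    have "(\<integral>\<^sup>+\<omega>. pair_sum f \<omega> \<partial>M) = (SUP k. \<integral>\<^sup>+\<omega>. N k \<omega> \<partial>M)"
      unfolding sup by (rule nn_integral_monotone_convergence_SUP[OF N_mono N_meas])
    also have "\<dots> = (SUP k. \<integral>\<^sup>+z. ennreal (fk k z * rho z) * indicator ?S z \<partial>lborel)" unfolding N_int ..
    also have "\<dots> = (\<integral>\<^sup>+z. (SUP k. ennreal (fk k z * rho z) * indicator ?S z) \<partial>lborel)"
    proof (rule nn_integral_monotone_convergence_SUP[symmetric])
      show "incseq (\<lambda>k z. ennreal (fk k z * rho z) * indicator ?S z)"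
      proof (intro incseq_SucI le_funI)
        fix k z
        show "ennreal (fk k z * rho z) * indicator ?S z \<le> ennreal (fk (Suc k) z * rho z) * indicator ?S z"
        proof (cases "z \<in> ?S")
          case True
          then have z: "z \<in> I \<times> I" using SI by blast
          have "fk k z * rho z \<le> fk (Suc k) z * rho z" using z by (intro mult_right_mono fk_mono rho_nonneg) auto
          then show ?thesis using True by (simp add: ennreal_leI)
        qed simp
      qed
      fix k
      have "?S = cbox (a, a) (b, b)" by (simp add: cbox_Pair_eq)
      then have Sb: "?S \<in> sets borel" by simp
      have "(\<lambda>z. indicator ?S z *\<^sub>R fk k z) \<in> borel_measurable borel"
        by (rule borel_measurable_continuous_on_indicator[OF Sb fkc])
      then have "(\<lambda>z. ennreal ((indicator ?S z *\<^sub>R fk k z) * (indicator (I \<times> I) z * rho z))) \<in> borel_measurable borel"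
        using rho_measurable by measurable
      also have "(\<lambda>z. ennreal ((indicator ?S z *\<^sub>R fk k z) * (indicator (I \<times> I) z * rho z))) = (\<lambda>z. ennreal (fk k z * rho z) * indicator ?S z)"
      proof
        fix z
        show "ennreal ((indicator ?S z *\<^sub>R fk k z) * (indicator (I \<times> I) z * rho z)) = ennreal (fk k z * rho z) * indicator ?S z"
        proof (cases "z \<in> ?S")
          case True
          then show ?thesis using subsetD[OF SI True] by simp
        qed simp
      qed
      finally show "(\<lambda>z. ennreal (fk k z * rho z) * indicator ?S z) \<in> borel_measurable lborel" by simp
    qed
    also have "\<dots> = (\<integral>\<^sup>+z. ennreal (f z * rho z) * indicator (I \<times> I) z \<partial>lborel)"
    proof (rule nn_integral_cong)
      fix z :: "real \<times> real"
      show "(SUP k. ennreal (fk k z * rho z) * indicator ?S z) = ennreal (f z * rho z) * indicator (I \<times> I) z"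
      proof (cases "z \<in> ?S")
        case True
        then have zI: "z \<in> I \<times> I" using SI by blast
        have "0 \<le> f z * rho z" using zI nn rho_nonneg by simp
        from SUP_offdiag_cutoff[OF this, of "fst z - snd z"]
        have "(SUP k. ennreal (fk k z * rho z)) = ennreal (f z * rho z)"
          by (simp add: fk_def mult.assoc mult.left_commute mult.commute rho_def)
        then show ?thesis using True zI by simp
      next
        case False
        then have "ennreal (f z * rho z) * indicator (I \<times> I) z = 0" using supp[of z] by (cases "z \<in> I \<times> I") simp_all
        then show ?thesis using False by simp
      qed
    qed
    finally show ?thesis using meas by blast
  qed
  then show "pair_sum f \<in> borel_measurable M"
    "(\<integral>\<^sup>+\<omega>. pair_sum f \<omega> \<partial>M) = (\<integral>\<^sup>+z. ennreal (f z * rho z) * indicator (I \<times> I) z \<partial>lborel)" by blast+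
qed

section \<open>Signed test functions and the correlation measure\<close>

lemma nn_integral_square:
  "(\<integral>\<^sup>+z. h z \<partial>lebesgue_on (I \<times> I)) = (\<integral>\<^sup>+z. h z * indicator (I \<times> I) z \<partial>lborel)"
  using I_borel by (subst nn_integral_restrict_space) (auto simp: nn_integral_completion)

lemma pair_sum_integral_square:
  assumes "test_function I f" "\<And>z. z \<in> I \<times> I \<Longrightarrow> 0 \<le> f z"
  shows "(\<integral>\<^sup>+\<omega>. pair_sum f \<omega> \<partial>M) = (\<integral>\<^sup>+z. ennreal (f z * rho z) \<partial>lebesgue_on (I \<times> I))"
  unfolding nn_integral_square using assms by (rule pair_sum_integral(2))

lemma rho_measurable_square: "rho \<in> borel_measurable (lebesgue_on (I \<times> I))"
proof -
  have "(\<lambda>z. indicator (I \<times> I) z * rho z) \<in> borel_measurable (lebesgue_on (I \<times> I))"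
    using rho_measurable by (intro measurable_restrict_space1 measurable_completion) simp
  then show ?thesis by (rule measurable_cong[THEN iffD1, rotated]) (simp add: space_restrict_space)
qed

text \<open>A real family is summable exactly if its positive and negative parts are. Otherwise
  \<open>infsum\<close> takes the default value 0, which accounts for the last branch. The formula
  holds for every \<omega> and so makes the random sum measurable.\<close>

lemma infsum_zero_pairs:
  fixes f :: "real \<times> real \<Rightarrow> real"
  defines "P \<equiv> \<lambda>z. max 0 (f z)" and "Q \<equiv> \<lambda>z. max 0 (- f z)"
  shows "(\<Sum>\<^sub>\<infinity>z\<in>zero_pairs I G \<omega>. f z) =
      (if pair_sum P \<omega> < \<top> \<and> pair_sum Q \<omega> < \<top> then enn2real (pair_sum P \<omega>) - enn2real (pair_sum Q \<omega>) else 0)"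
    and "pair_sum P \<omega> < \<top> \<Longrightarrow> pair_sum Q \<omega> < \<top> \<Longrightarrow> f summable_on zero_pairs I G \<omega>"
proof -
  let ?Z = "zero_pairs I G \<omega>"
  have PQ: "0 \<le> P z" "0 \<le> Q z" "f z = P z - Q z" for z by (auto simp: P_def Q_def)
  have fin: "P summable_on ?Z \<and> Q summable_on ?Z" if "pair_sum P \<omega> < \<top>" "pair_sum Q \<omega> < \<top>"
    using that PQ unfolding pair_sum_def by (auto intro: nn_integral_count_space_finiteD)
  have hs: "(f has_sum infsum P ?Z - infsum Q ?Z) ?Z" if "P summable_on ?Z" "Q summable_on ?Z"
  proof -
    have "((\<lambda>z. P z + - Q z) has_sum infsum P ?Z + - infsum Q ?Z) ?Z"
      using that by (intro has_sum_add has_sum_uminusI has_sum_infsum)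
    then show ?thesis unfolding PQ(3) by simp
  qed
  show "f summable_on ?Z" if "pair_sum P \<omega> < \<top>" "pair_sum Q \<omega> < \<top>"
    using fin[OF that] hs by (auto intro: has_sum_imp_summable)
  have val: "pair_sum F \<omega> = ennreal (infsum F ?Z)" if "F summable_on ?Z" "\<And>z. 0 \<le> F z" for F
    unfolding pair_sum_def using that by (intro nn_integral_count_space_summable) auto
  show "infsum f ?Z = (if pair_sum P \<omega> < \<top> \<and> pair_sum Q \<omega> < \<top> then enn2real (pair_sum P \<omega>) - enn2real (pair_sum Q \<omega>) else 0)"
  proof (cases "pair_sum P \<omega> < \<top> \<and> pair_sum Q \<omega> < \<top>")
    case True
    then have s: "P summable_on ?Z" "Q summable_on ?Z" using fin by auto
    have nn: "0 \<le> infsum P ?Z" "0 \<le> infsum Q ?Z" using PQ(1,2) by (auto intro: infsum_nonneg)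
    have "pair_sum P \<omega> = ennreal (infsum P ?Z)" "pair_sum Q \<omega> = ennreal (infsum Q ?Z)"
      using s PQ(1,2) by (auto intro: val)
    then show ?thesis using True infsumI[OF hs[OF s]] nn by simp
  next
    case False
    have "\<not> f summable_on ?Z"
    proof
      assume "f summable_on ?Z"
      then have a: "(\<lambda>z. norm (f z)) summable_on ?Z" by (rule summable_on_iff_abs_summable_on_real[THEN iffD1])
      have "P summable_on ?Z" by (rule summable_on_comparison_test[OF a]) (auto simp: P_def)
      moreover have "Q summable_on ?Z" by (rule summable_on_comparison_test[OF a]) (auto simp: Q_def)
      ultimately show False using False val[of P] val[of Q] PQ(1,2) by simp
    qed
    then show ?thesis unfolding if_not_P[OF False] by (rule infsum_not_exists)
  qed
qed

text \<open>For signed \<open>f\<close> the parts \<open>P\<close> and \<open>Q\<close> are again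
  test functions. Because \<open>rho\<close> is nonnegative on the square, their integrals against
  it are those of the positive and negative parts of \<open>f * rho\<close>, which are finite by the
  integrability assumption.\<close>

lemma two_point_density_rho: "two_point_density M I G (\<lambda>x y. rho (x, y))"
  unfolding two_point_density_def
proof (intro conjI allI impI)
  have [simp]: "(\<lambda>(x, y). rho (x, y)) = rho" by auto
  have sp: "(\<lambda>(x, y). ennreal (f (x, y) * rho (x, y))) = (\<lambda>z. ennreal (f z * rho z))"
    "(\<lambda>(x, y). f (x, y) * rho (x, y)) = (\<lambda>z. f z * rho z)" for f by auto
  have spc: "space (lebesgue_on (I \<times> I)) = I \<times> I" by (simp add: space_restrict_space)
  show "(\<lambda>(x, y). rho (x, y)) \<in> borel_measurable (lebesgue_on (I \<times> I))"
    using rho_measurable_square by simp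
  show "AE (x, y) in lebesgue_on (I \<times> I). 0 \<le> rho (x, y)"
    by (rule AE_I2) (auto simp: spc intro!: rho_nonneg)
  fix f :: "real \<times> real \<Rightarrow> real"
  { assume f: "test_function I f \<and> (\<forall>z\<in>I \<times> I. 0 \<le> f z)"
    show "(\<integral>\<^sup>+\<omega>. (\<integral>\<^sup>+z. ennreal (f z) \<partial>count_space (zero_pairs I G \<omega>)) \<partial>M) =
        (\<integral>\<^sup>+(x, y). ennreal (f (x, y) * rho (x, y)) \<partial>lebesgue_on (I \<times> I))"
      using pair_sum_integral_square[of f] f unfolding pair_sum_def sp by blast }
  assume "test_function I f \<and> integrable (lebesgue_on (I \<times> I)) (\<lambda>(x, y). f (x, y) * rho (x, y))"
  then have f: "test_function I f" and int: "integrable (lebesgue_on (I \<times> I)) (\<lambda>z. f z * rho z)"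
    unfolding sp by blast+
  define P Q where "P = (\<lambda>z. max 0 (f z))" and "Q = (\<lambda>z. max 0 (- f z))"
  have tP: "test_function I P" "test_function I Q"
    using f unfolding test_function_def P_def Q_def by (auto intro!: continuous_intros)
  have meas: "pair_sum P \<in> borel_measurable M" "pair_sum Q \<in> borel_measurable M"
    using tP by (auto intro!: pair_sum_integral(1) simp: P_def Q_def)
  have cP: "(\<integral>\<^sup>+\<omega>. pair_sum P \<omega> \<partial>M) = (\<integral>\<^sup>+z. ennreal (f z * rho z) \<partial>lebesgue_on (I \<times> I))"
  proof -
    have "(\<integral>\<^sup>+\<omega>. pair_sum P \<omega> \<partial>M) = (\<integral>\<^sup>+z. ennreal (P z * rho z) \<partial>lebesgue_on (I \<times> I))"
      by (rule pair_sum_integral_square[OF tP(1)]) (simp add: P_def)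
    also have "\<dots> = (\<integral>\<^sup>+z. ennreal (f z * rho z) \<partial>lebesgue_on (I \<times> I))"
    proof (rule nn_integral_cong)
      fix z assume "z \<in> space (lebesgue_on (I \<times> I))"
      then have "0 \<le> rho z" by (intro rho_nonneg) (simp add: spc)
      then show "ennreal (P z * rho z) = ennreal (f z * rho z)"
        by (cases "0 \<le> f z") (auto simp: P_def ennreal_neg mult_nonpos_nonneg)
    qed
    finally show ?thesis .
  qed
  have cQ: "(\<integral>\<^sup>+\<omega>. pair_sum Q \<omega> \<partial>M) = (\<integral>\<^sup>+z. ennreal (- (f z * rho z)) \<partial>lebesgue_on (I \<times> I))"
  proof -
    have "(\<integral>\<^sup>+\<omega>. pair_sum Q \<omega> \<partial>M) = (\<integral>\<^sup>+z. ennreal (Q z * rho z) \<partial>lebesgue_on (I \<times> I))"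
      by (rule pair_sum_integral_square[OF tP(2)]) (simp add: Q_def)
    also have "\<dots> = (\<integral>\<^sup>+z. ennreal (- (f z * rho z)) \<partial>lebesgue_on (I \<times> I))"
    proof (rule nn_integral_cong)
      fix z assume "z \<in> space (lebesgue_on (I \<times> I))"
      then have "0 \<le> rho z" by (intro rho_nonneg) (simp add: spc)
      then show "ennreal (Q z * rho z) = ennreal (- (f z * rho z))"
        by (cases "0 \<le> f z") (auto simp: Q_def ennreal_neg mult_nonneg_nonneg)
    qed
    finally show ?thesis .
  qed
  have fin: "(\<integral>\<^sup>+\<omega>. pair_sum P \<omega> \<partial>M) \<noteq> \<infinity>" "(\<integral>\<^sup>+\<omega>. pair_sum Q \<omega> \<partial>M) \<noteq> \<infinity>"
    using int unfolding cP cQ real_integrable_def by auto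
  have ae: "AE \<omega> in M. pair_sum P \<omega> < \<top> \<and> pair_sum Q \<omega> < \<top>"
    using nn_integral_PInf_AE[OF meas(1) fin(1)] nn_integral_PInf_AE[OF meas(2) fin(2)]
    by eventually_elim (simp add: less_top)
  then show "AE \<omega> in M. f summable_on zero_pairs I G \<omega>"
    by (rule eventually_mono) (auto intro!: infsum_zero_pairs(2) simp: P_def Q_def)
  let ?s = "\<lambda>\<omega>. infsum f (zero_pairs I G \<omega>)"
  let ?d = "\<lambda>\<omega>. enn2real (pair_sum P \<omega>) - enn2real (pair_sum Q \<omega>)"
  have s_eq: "?s = (\<lambda>\<omega>. if pair_sum P \<omega> < \<top> \<and> pair_sum Q \<omega> < \<top> then ?d \<omega> else 0)"
    unfolding P_def Q_def using infsum_zero_pairs(1) by blast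
  have sm: "?s \<in> borel_measurable M" unfolding s_eq using meas by measurable
  have sd: "AE \<omega> in M. ?s \<omega> = ?d \<omega>" using ae by (rule eventually_mono) (simp add: fun_cong[OF s_eq])
  have real_eq: "integrable M (\<lambda>\<omega>. enn2real (pair_sum F \<omega>)) \<and> (\<integral>\<omega>. enn2real (pair_sum F \<omega>) \<partial>M) = enn2real (\<integral>\<^sup>+\<omega>. pair_sum F \<omega> \<partial>M)"
    if "pair_sum F \<in> borel_measurable M" "(\<integral>\<^sup>+\<omega>. pair_sum F \<omega> \<partial>M) \<noteq> \<infinity>" for F
  proof -
    note [measurable] = that(1)
    have eq: "(\<integral>\<^sup>+\<omega>. ennreal (enn2real (pair_sum F \<omega>)) \<partial>M) = (\<integral>\<^sup>+\<omega>. pair_sum F \<omega> \<partial>M)"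
      using nn_integral_PInf_AE[OF that] by (intro nn_integral_cong_AE) (auto elim!: eventually_mono simp: less_top)
    have "(\<lambda>\<omega>. enn2real (pair_sum F \<omega>)) \<in> borel_measurable M" by measurable
    then show ?thesis using that(2) eq by (auto intro!: integrableI_nonneg simp: integral_eq_nn_integral less_top)
  qed
  note rP = real_eq[OF meas(1) fin(1)] and rQ = real_eq[OF meas(2) fin(2)]
  have di: "integrable M ?d" using rP rQ by (intro Bochner_Integration.integrable_diff) auto
  show "integrable M ?s"
    by (rule integrable_cong_AE_imp[OF di sm]) (use sd in auto)
  have "(\<integral>\<omega>. ?s \<omega> \<partial>M) = (\<integral>\<omega>. ?d \<omega> \<partial>M)"
    by (rule integral_cong_AE[OF sm _ sd]) (use di in auto)
  also have "\<dots> = enn2real (\<integral>\<^sup>+\<omega>. pair_sum P \<omega> \<partial>M) - enn2real (\<integral>\<^sup>+\<omega>. pair_sum Q \<omega> \<partial>M)"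
    using rP rQ by (subst Bochner_Integration.integral_diff) auto
  also have "\<dots> = (\<integral>z. f z * rho z \<partial>lebesgue_on (I \<times> I))"
    unfolding cP cQ by (rule real_lebesgue_integral_def[OF int, symmetric])
  finally show "(\<integral>\<omega>. ?s \<omega> \<partial>M) = (\<integral>(x, y). f (x, y) * rho (x, y) \<partial>lebesgue_on (I \<times> I))"
    unfolding sp .
qed

end

section \<open>The closed form\<close>

text \<open>The factor pi / 2 clears the 2 / pi of the centred expectations, and \<mu> = \<nu>
  \<sigma> turns the coefficients \<nu> of the expansion into those of the closed form once
  \<sigma>1 \<sigma>2 is distributed over it.\<close>

lemma corr_expectation_abs_shift_formula:
  fixes \<delta> \<sigma>1 \<sigma>2 \<mu>1 \<mu>2 \<nu>1 \<nu>2 :: real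
  assumes d: "\<bar>\<delta>\<bar> < 1" and s: "0 < \<sigma>1" "0 < \<sigma>2"
    and \<nu>1: "\<nu>1 = \<mu>1 / \<sigma>1" and \<nu>2: "\<nu>2 = \<mu>2 / \<sigma>2"
  shows "\<sigma>1 * \<sigma>2 * (pi / 2 * corr_expectation \<delta> (\<lambda>x. \<bar>\<nu>1 + x\<bar>) (\<lambda>y. \<bar>\<nu>2 + y\<bar>)) =
     \<sigma>1 * \<sigma>2 * (sqrt (1 - \<delta>\<^sup>2) + \<delta> * arcsin \<delta>) + \<mu>1 * \<mu>2 * arcsin \<delta> +
     (\<sigma>1 * \<sigma>2 * sqrt (1 - \<delta>\<^sup>2) *
                     (\<Sum>\<nu>\<leftarrow>[\<nu>1, \<nu>2]. (LBINT t=0..1.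
                        (1 - t) * \<nu>\<^sup>2 / exp (\<nu>\<^sup>2 * t\<^sup>2 / (2 - 2 * \<delta>\<^sup>2))))
                 + sqrt (pi / 2) * \<sigma>1 * \<sigma>2 * \<bar>\<delta>\<bar> *
                     (\<Sum>\<nu>\<leftarrow>[\<nu>1, \<nu>2]. \<nu>\<^sup>2 * (LBINT t=0..1.
                        (1 - t) * \<bar>\<nu> * t\<bar> / exp (\<nu>\<^sup>2 * t\<^sup>2 / 2)
                          * erf (\<bar>\<delta> * \<nu> * t\<bar> / sqrt (2 * (1 - \<delta>\<^sup>2)))))) +
     sqrt (pi / 2) * \<mu>1 * \<mu>2 *
                     (\<Sum>\<nu>\<leftarrow>[\<nu>1, \<nu>2]. (LBINT t=0..1.
                        (t - 1) * \<nu> / exp (\<nu>\<^sup>2 * t\<^sup>2 / 2)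
                          * erf (\<delta> * \<nu> * t / sqrt (2 * (1 - \<delta>\<^sup>2))))) +
     \<bar>\<mu>1 * \<mu>2 * \<nu>1 * \<nu>2\<bar> / sqrt (1 - \<delta>\<^sup>2) *
                     (LBINT s=0..1. (LBINT t=0..1. (1 - t) * (1 - s) *
                        exp (- ((\<nu>1\<^sup>2 * t\<^sup>2 - 2 * \<delta> * \<nu>1 * \<nu>2 * t * s + \<nu>2\<^sup>2 * s\<^sup>2)
                                / (2 * (1 - \<delta>\<^sup>2))))))"
proof -
  have m: "\<mu>1 = \<nu>1 * \<sigma>1" "\<mu>2 = \<nu>2 * \<sigma>2" using s \<nu>1 \<nu>2 by auto
  have ab: "\<bar>\<mu>1 * \<mu>2 * \<nu>1 * \<nu>2\<bar> = \<sigma>1 * \<sigma>2 * (\<nu>1\<^sup>2 * \<nu>2\<^sup>2)"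
  proof -
    have "\<mu>1 * \<mu>2 * \<nu>1 * \<nu>2 = \<sigma>1 * \<sigma>2 * (\<nu>1\<^sup>2 * \<nu>2\<^sup>2)" unfolding m by (simp add: power2_eq_square)
    then show ?thesis using s by simp
  qed
  have e1: "pi / 2 * corr_expectation \<delta> (\<lambda>x. \<bar>x\<bar>) (\<lambda>x. \<bar>x\<bar>) = sqrt (1 - \<delta>\<^sup>2) + \<delta> * arcsin \<delta>"
    "pi / 2 * corr_expectation \<delta> sgn sgn = arcsin \<delta>" unfolding corr_expectation_abs_abs[OF d] corr_expectation_sgn_sgn[OF d] by simp_all
  have "pi / 2 * corr_expectation \<delta> (\<lambda>x. \<bar>\<nu>1 + x\<bar>) (\<lambda>y. \<bar>\<nu>2 + y\<bar>) =
    pi / 2 * corr_expectation \<delta> (\<lambda>x. \<bar>x\<bar>) (\<lambda>x. \<bar>x\<bar>) + \<nu>1 * \<nu>2 * (pi / 2 * corr_expectation \<delta> sgn sgn) +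
    (pi / 2 * corr_expectation \<delta> (abs_remainder \<nu>1) (\<lambda>x. \<bar>x\<bar>) + pi / 2 * corr_expectation \<delta> (abs_remainder \<nu>2) (\<lambda>x. \<bar>x\<bar>))
    + (\<nu>2 * (pi / 2 * corr_expectation \<delta> (abs_remainder \<nu>1) sgn) + \<nu>1 * (pi / 2 * corr_expectation \<delta> (abs_remainder \<nu>2) sgn)) + pi / 2 * corr_expectation \<delta> (abs_remainder \<nu>1) (abs_remainder \<nu>2)"
    unfolding corr_expectation_abs_shift[OF d] by (simp only: distrib_left mult.assoc mult.left_commute)
  then show ?thesis
    unfolding e1 corr_expectation_abs_remainder_abs[OF d] corr_expectation_abs_remainder_sgn[OF d] corr_expectation_abs_remainder_abs_remainder[OF d] ab
    unfolding m
    by (simp only: sum_list.Cons sum_list.Nil list.map add_0_right distrib_left times_divide_eq_left times_divide_eq_right mult_ac add_ac)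
qed

context gauss_proc
begin

text \<open>Here \<mu>1, \<mu>2 and \<sigma>1, \<sigma>2 are the conditional means and standard
  deviations of G'(x) and G'(y) given that G(x) and G(y) vanish, and \<delta> is their conditional
  correlation. The proof checks that the Cholesky entries produce these expressions.\<close>

lemma rice_density_formula:
  assumes xy: "x \<in> I" "y \<in> I" "x \<noteq> y"
    and R: "R = r x y"
    and r10: "r10 = partial I 1 0 r x y"
    and r01: "r01 = partial I 0 1 r x y"
    and \<mu>1: "\<mu>1 = deriv_on I m x + R * r10 / (1 - R\<^sup>2) * m x - r10 / (1 - R\<^sup>2) * m y"
    and \<sigma>1: "\<sigma>1 = sqrt (partial I 1 1 r x x - r10\<^sup>2 / (1 - R\<^sup>2))"
    and \<mu>2: "\<mu>2 = deriv_on I m y + R * r01 / (1 - R\<^sup>2) * m y - r01 / (1 - R\<^sup>2) * m x"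
    and \<sigma>2: "\<sigma>2 = sqrt (partial I 1 1 r y y - r01\<^sup>2 / (1 - R\<^sup>2))"
    and \<delta>: "\<delta> = 1 / (\<sigma>1 * \<sigma>2) * (partial I 1 1 r x y + R * r10 * r01 / (1 - R\<^sup>2))"
  shows "\<bar>\<delta>\<bar> < 1" "0 < \<sigma>1" "0 < \<sigma>2"
    and "rice_density M I G x y = exp (- (((m x)\<^sup>2 - 2 * R * m x * m y + (m y)\<^sup>2) / (2 * (1 - R\<^sup>2)))) / (pi\<^sup>2 * sqrt (1 - R\<^sup>2)) *
      (\<sigma>1 * \<sigma>2 * (pi / 2 * corr_expectation \<delta> (\<lambda>z. \<bar>\<mu>1 / \<sigma>1 + z\<bar>) (\<lambda>z. \<bar>\<mu>2 / \<sigma>2 + z\<bar>)))"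
proof -
  have p: "partial I 1 0 r x y = dx I r x y" "partial I 0 1 r x y = dy I r x y"
    "partial I 1 1 r u v = dx I (dy I r) u v" for u v by (simp_all add: partial_def)
  define A B D where "A = partial I 1 1 r x x" and "B = partial I 1 1 r x y" and "D = partial I 1 1 r y y"
  define l32 l42 l43 l44 where "l32 = chol32 R 0 r10" and "l42 = chol32 R r01 0"
    and "l43 = chol43 R 0 r10 r01 0 A B" and "l44 = chol44 R 0 r10 r01 0 A B D"
  have pos: "0 < 1 - R\<^sup>2" "0 < A - 0\<^sup>2 - l32\<^sup>2" "0 < D - r01\<^sup>2 - l42\<^sup>2 - l43\<^sup>2"
    using jet_cholesky_pos[OF xy] unfolding l32_def l42_def l43_def A_def B_def D_def R r10 r01 p by blast+
  define v where "v = sqrt (1 - R\<^sup>2)"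
  have v: "0 < v" "v * v = 1 - R\<^sup>2" using pos(1) by (simp_all add: v_def)
  have l32: "l32 = r10 / v" and l42: "l42 = - R * r01 / v" by (simp_all add: l32_def l42_def chol32_def chol22_def v_def)
  have sq: "l32\<^sup>2 = r10\<^sup>2 / (1 - R\<^sup>2)" "r01\<^sup>2 + l42\<^sup>2 = r01\<^sup>2 / (1 - R\<^sup>2)"
    "l32 * l42 = - R * r10 * r01 / (1 - R\<^sup>2)"
  proof -
    show "l32\<^sup>2 = r10\<^sup>2 / (1 - R\<^sup>2)" "l32 * l42 = - R * r10 * r01 / (1 - R\<^sup>2)"
      unfolding l32 l42 v(2)[symmetric] by (simp_all add: power2_eq_square mult_ac)
    have "l42\<^sup>2 = R\<^sup>2 * r01\<^sup>2 / (1 - R\<^sup>2)" unfolding l42 v(2)[symmetric] by (simp add: power2_eq_square mult_ac)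
    then show "r01\<^sup>2 + l42\<^sup>2 = r01\<^sup>2 / (1 - R\<^sup>2)" using pos(1) by (simp add: divide_simps) (simp add: algebra_simps)
  qed
  have s1: "\<sigma>1 = chol33 R 0 r10 A" unfolding \<sigma>1 chol33_def l32_def[symmetric] sq(1) A_def by simp
  have s1p: "0 < \<sigma>1" using pos(2) unfolding s1 chol33_def l32_def[symmetric] by simp
  have l44: "0 < l44" "l44\<^sup>2 = D - r01\<^sup>2 - l42\<^sup>2 - l43\<^sup>2"
    using pos(3) unfolding l44_def chol44_def l42_def[symmetric] l43_def[symmetric] by simp_all
  have s2: "\<sigma>2 = sqrt (l43\<^sup>2 + l44\<^sup>2)" unfolding \<sigma>2 sq(2)[symmetric] l44(2) D_def by (simp add: algebra_simps)
  have s2p: "0 < \<sigma>2" unfolding s2 using l44(1) by (simp add: add_nonneg_pos)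
  have d: "\<delta> = l43 / \<sigma>2"
    unfolding \<delta> l43_def chol43_def s1[symmetric] l32_def[symmetric] l42_def[symmetric] sq(3) B_def by simp
  have R1: "R\<^sup>2 < 1" using pos(1) by simp
  note cl = cross_limit_corr_expectation[OF R1 s1p l44(1), where ?l43.0 = l43, folded s2 v_def, folded d]
  show "\<bar>\<delta>\<bar> < 1" by (rule cl(1))
  show "0 < \<sigma>1" "0 < \<sigma>2" by (rule s1p, rule s2p)
  let ?z = "cross_z2_0 (m x) (m y) R v"
  \<comment> \<open>The coefficient 0 is the covariance of G(x) and G'(x), so the mean of G'(x) is
    corrected only through the second standard normal variable.\<close>
  have m1: "deriv_on I m x - 0 * m x + l32 * ?z = \<mu>1"
  proof -
    have "l32 * ?z = r10 * (R * m x - m y) / (1 - R\<^sup>2)" unfolding l32 cross_z2_0_def v(2)[symmetric] by simp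
    then show ?thesis unfolding \<mu>1 by (simp add: right_diff_distrib diff_divide_distrib mult_ac)
  qed
  have m2: "deriv_on I m y - r01 * m x + l42 * ?z = \<mu>2"
  proof -
    have "l42 * ?z = - R * r01 * (R * m x - m y) / (1 - R\<^sup>2)" unfolding l42 cross_z2_0_def v(2)[symmetric] by simp
    also have "\<dots> = R * r01 / (1 - R\<^sup>2) * m y - R\<^sup>2 * r01 / (1 - R\<^sup>2) * m x"
      by (simp add: right_diff_distrib diff_divide_distrib power2_eq_square mult_ac)
    finally have a: "l42 * ?z = R * r01 / (1 - R\<^sup>2) * m y - R\<^sup>2 * r01 / (1 - R\<^sup>2) * m x" .
    \<comment> \<open>Unlike the first derivative, the second one is correlated with G(x) as well;
      the two corrections to its mean are merged here.\<close>
    have "r01 + R\<^sup>2 * r01 / (1 - R\<^sup>2) = r01 / (1 - R\<^sup>2)"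
      using pos(1) by (simp add: divide_simps) (simp add: algebra_simps)
    then have "r01 * m x + R\<^sup>2 * r01 / (1 - R\<^sup>2) * m x = r01 / (1 - R\<^sup>2) * m x"
      by (simp only: distrib_right[symmetric])
    then show ?thesis unfolding \<mu>2 a by linarith
  qed
  have cd: "corr_density R (m x) (m y) = exp (- (((m x)\<^sup>2 - 2 * R * m x * m y + (m y)\<^sup>2) / (2 * (1 - R\<^sup>2)))) / (2 * pi * v)"
    unfolding corr_density_def v_def ..
  let ?H = "corr_expectation \<delta> (\<lambda>z. \<bar>\<mu>1 / \<sigma>1 + z\<bar>) (\<lambda>z. \<bar>\<mu>2 / \<sigma>2 + z\<bar>)"
  have "rice_limit x y = cross_limit (m x) (m y) (deriv_on I m x) (deriv_on I m y) R v 0 l32 \<sigma>1 r01 l42 l43 l44"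
    unfolding rice_limit_def s1 l32_def l42_def l43_def l44_def v_def chol22_def A_def B_def D_def R r10 r01 p ..
  also have "\<dots> = ennreal (corr_density R (m x) (m y) * (\<sigma>1 * \<sigma>2 * ?H))"
    unfolding cl(2) m1 m2 ..
  finally have "rice_density M I G x y = enn2real (ennreal (corr_density R (m x) (m y) * (\<sigma>1 * \<sigma>2 * ?H)))"
    unfolding rice_density_limit(1)[OF xy] by simp
  moreover have "0 \<le> corr_density R (m x) (m y) * (\<sigma>1 * \<sigma>2 * ?H)"
  proof -
    have "0 \<le> ?H" unfolding corr_expectation_def corr_cond_def by (intro Bochner_Integration.integral_nonneg mult_nonneg_nonneg) auto
    then show ?thesis unfolding cd using v s1p s2p by simp
  qed
  ultimately show "rice_density M I G x y = exp (- (((m x)\<^sup>2 - 2 * R * m x * m y + (m y)\<^sup>2) / (2 * (1 - R\<^sup>2)))) / (pi\<^sup>2 * sqrt (1 - R\<^sup>2)) *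
      (\<sigma>1 * \<sigma>2 * (pi / 2 * ?H))"
    unfolding v_def[symmetric] by (simp add: cd power2_eq_square)
qed

end

theorem theorem7p2:
  fixes M :: "'w measure" and I :: "real set" and G :: "real \<Rightarrow> 'w \<Rightarrow> real"
    and m :: "real \<Rightarrow> real" and r :: "real \<Rightarrow> real \<Rightarrow> real"
  assumes "prob_space M"
    and "is_interval I"
    and "gaussian_process M I G"
    and mean: "\<And>x. x \<in> I \<Longrightarrow> m x = (\<integral>\<omega>. G x \<omega> \<partial>M)"
    and cov: "\<And>x y. x \<in> I \<Longrightarrow> y \<in> I \<Longrightarrow>
               r x y = (\<integral>\<omega>. (G x \<omega> - m x) * (G y \<omega> - m y) \<partial>M)"
    and unit_variance: "\<And>x. x \<in> I \<Longrightarrow> r x x = 1"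
    and G1_paths: "\<And>\<omega>. \<omega> \<in> space M \<Longrightarrow> C1_on I (\<lambda>t. G t \<omega>)"
    and G1_mean: "C1_on I m"
    and G1_cov: "C2_on_square I r"
    and G2: "\<And>x y. x \<in> I \<Longrightarrow> y \<in> I \<Longrightarrow> x \<noteq> y \<Longrightarrow>
               nondegenerate M (\<lambda>\<omega>. (G x \<omega>, G y \<omega>, path_deriv I G x \<omega>, path_deriv I G y \<omega>))"
    and G3: "\<And>x. x \<in> I \<Longrightarrow>
               gaussian_vector M (\<lambda>\<omega>. (G x \<omega>, path_deriv I G x \<omega>)) \<and>
               nondegenerate M (\<lambda>\<omega>. (G x \<omega>, path_deriv I G x \<omega>))"
  shows "(\<exists>\<rho>2. two_point_correlation_function M I G \<rho>2) \<and>
    (\<forall>\<rho>2. two_point_correlation_function M I G \<rho>2 \<longrightarrow>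
      (\<forall>x\<in>I. \<forall>y\<in>I. x \<noteq> y \<longrightarrow>
        (let R = r x y;
             r10 = partial I 1 0 r x y;
             r01 = partial I 0 1 r x y;
             \<mu>1 = deriv_on I m x + R * r10 / (1 - R\<^sup>2) * m x - r10 / (1 - R\<^sup>2) * m y;
             \<sigma>1 = sqrt (partial I 1 1 r x x - r10\<^sup>2 / (1 - R\<^sup>2));
             \<mu>2 = deriv_on I m y + R * r01 / (1 - R\<^sup>2) * m y - r01 / (1 - R\<^sup>2) * m x;
             \<sigma>2 = sqrt (partial I 1 1 r y y - r01\<^sup>2 / (1 - R\<^sup>2));
             \<delta> = 1 / (\<sigma>1 * \<sigma>2) * (partial I 1 1 r x y + R * r10 * r01 / (1 - R\<^sup>2));
             \<nu>1 = \<mu>1 / \<sigma>1;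
             \<nu>2 = \<mu>2 / \<sigma>2;
             E = exp (- (((m x)\<^sup>2 - 2 * R * m x * m y + (m y)\<^sup>2) / (2 * (1 - R\<^sup>2))));
             \<rho>21 = \<sigma>1 * \<sigma>2 * (sqrt (1 - \<delta>\<^sup>2) + \<delta> * arcsin \<delta>);
             \<rho>22 = \<mu>1 * \<mu>2 * arcsin \<delta>;
             \<rho>23 = \<sigma>1 * \<sigma>2 * sqrt (1 - \<delta>\<^sup>2) *
                     (\<Sum>\<nu>\<leftarrow>[\<nu>1, \<nu>2]. (LBINT t=0..1.
                        (1 - t) * \<nu>\<^sup>2 / exp (\<nu>\<^sup>2 * t\<^sup>2 / (2 - 2 * \<delta>\<^sup>2))))
                 + sqrt (pi / 2) * \<sigma>1 * \<sigma>2 * \<bar>\<delta>\<bar> *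
                     (\<Sum>\<nu>\<leftarrow>[\<nu>1, \<nu>2]. \<nu>\<^sup>2 * (LBINT t=0..1.
                        (1 - t) * \<bar>\<nu> * t\<bar> / exp (\<nu>\<^sup>2 * t\<^sup>2 / 2)
                          * erf (\<bar>\<delta> * \<nu> * t\<bar> / sqrt (2 * (1 - \<delta>\<^sup>2)))));
             \<rho>24 = sqrt (pi / 2) * \<mu>1 * \<mu>2 *
                     (\<Sum>\<nu>\<leftarrow>[\<nu>1, \<nu>2]. (LBINT t=0..1.
                        (t - 1) * \<nu> / exp (\<nu>\<^sup>2 * t\<^sup>2 / 2)
                          * erf (\<delta> * \<nu> * t / sqrt (2 * (1 - \<delta>\<^sup>2)))));
             \<rho>25 = \<bar>\<mu>1 * \<mu>2 * \<nu>1 * \<nu>2\<bar> / sqrt (1 - \<delta>\<^sup>2) *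
                     (LBINT s=0..1. (LBINT t=0..1. (1 - t) * (1 - s) *
                        exp (- ((\<nu>1\<^sup>2 * t\<^sup>2 - 2 * \<delta> * \<nu>1 * \<nu>2 * t * s + \<nu>2\<^sup>2 * s\<^sup>2)
                                / (2 * (1 - \<delta>\<^sup>2))))))
         in \<rho>2 x y = E / (pi\<^sup>2 * sqrt (1 - R\<^sup>2)) * (\<rho>21 + \<rho>22 + \<rho>23 + \<rho>24 + \<rho>25))))"
proof -
  interpret gauss_proc M I G m r
    unfolding gauss_proc_def gauss_proc_axioms_def using assms by blast
  have off: "rho (x, y) = rice_density M I G x y" if "x \<noteq> y" for x y
    using that by (simp add: rho_def)
  show ?thesis
    unfolding Let_def
  proof (intro conjI exI[of _ "\<lambda>x y. rho (x, y)"] allI ballI impI, goal_cases)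
    case 1
    show ?case
      unfolding two_point_correlation_function_def using two_point_density_rho off by blast
  next
    \<comment> \<open>Off the diagonal every correlation function has the values of the Rice density
      by definition, so only that density has to be evaluated.\<close>
    case (2 \<rho>2 x y)
    have "\<rho>2 x y = rice_density M I G x y"
      using 2 unfolding two_point_correlation_function_def by blast
    note this rice_density_formula[OF 2(2-4) refl refl refl refl refl refl refl refl]
    note this(1,5) corr_expectation_abs_shift_formula[OF this(2-4) refl refl]
    then show ?case by (simp only:)
  qed
qed

end
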